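(* Let $\alpha_0,\alpha_1>0$, let $n_K,n_L\ge 1$ and $\nu\in\mathbb{N}$, and let $K$ and $L$ be interpolation operators given by filter kernels $(\xi^{a,r}_{m,n})$ ($a=1,2,3$, $r=1,\dots,n_K$) and $(\eta^{a,l}_{m,n})$ ($a=1,2$, $l=1,\dots,n_L$) of local support $-\nu\le m,n\le\nu$, with bounded real coefficients, each kernel having coefficients summing to $1$. For $h=1/N$, $N\in\mathbb{N}$, let $\mathrm{TGV}^2_{\alpha,h}$ be the corresponding discrete second-order total generalized variation on discrete affine plus periodic images, and let $\mathrm{TGV}^2_\alpha$ be the continuous second-order total generalized variation on functions on $\mathbb{R}^2$ that are affine plus periodic with period $1$ (in both cases with periodic auxiliary field $w$), as defined in the context. Then $\mathrm{TGV}^2_{\alpha,h}$ $\Gamma$-converges to $\mathrm{TGV}^2_{\alpha}$ as $h=1/N\to 0$, with respect to $L^1$ convergence of discrete images viewed as piecewise constant functions. That is, for every affine plus periodic $u$: (i) for every sequence of discrete affine plus periodic images $u^h$ with $u^h\to u$, one has $\mathrm{TGV}^2_{\alpha}(u)\le\liminf_{h\to0}\mathrm{TGV}^2_{\alpha,h}(u^h)$; (ii) there exists a sequence of discrete affine plus periodic images $u^h$ with $u^h\to u$ and $\limsup_{h\to0}\mathrm{TGV}^2_{\alpha,h}(u^h)\le \mathrm{TGV}^2_{\alpha}(u)$.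
   Context: **Continuous setting.** Let $\Omega=(0,1)^2$. A function $u\in L^1_{\mathrm{loc}}(\mathbb{R}^2)$ is affine plus periodic (with period $1$) if there is $q\in\mathbb{R}^2$ such that $x\mapsto u(x)-q\cdot x$ is $\mathbb{Z}^2$-periodic. For such $u$, with $\alpha=(\alpha_0,\alpha_1)$, $$\mathrm{TGV}^2_\alpha(u)=\min_{w}\Big\{\alpha_1|Du-w|+\alpha_0|Ew|\Big\},$$ where the minimum is over $\mathbb{Z}^2$-periodic vector fields $w:\mathbb{R}^2\to\mathbb{R}^2$ of bounded deformation (i.e. $w\in L^1_{\mathrm{loc}}$ and $Ew=\tfrac12(Dw+Dw^T)$ is a locally finite measure). Here $Du$ is the distributional gradient, and $|Du-w|$, $|Ew|$ denote the total masses over one period cell $[0,1)^2$ of these periodic measures, with respect to the Euclidean norm on $\mathbb{R}^2$ and the Frobenius norm on symmetric $2\times2$ matrices. The value is $+\infty$ if $Du$ is not a locally finite measure. Equivalently, in dual form, it is the supremum of $\int_\Omega (u(x)-q\cdot x)\,\mathrm{div}^2p\,dx$ over smooth $\mathbb{Z}^2$-periodic fields $p$ of symmetric $2\times 2$ matrices with $\|p\|_\infty\le\alpha_0$ and $\|\mathrm{div}\,p\|_\infty\le\alpha_1$, where $\mathrm{div}\,p$ is the row-wise divergence, $\mathrm{div}^2p$ is the divergence of $\mathrm{div}\,p$, and pointwise norms are the Frobenius and Euclidean norms. **Discrete setting.** Let $h=1/N$. A discrete affine plus periodic image is $u^h:\mathbb{Z}^2\to\mathbb{R}$ such that for some $q^h\in\mathbb{R}^2$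 the array $u^h_{i,j}-q^h\cdot(ih,jh)$ is $N$-periodic in $i$ and in $j$. It is viewed as the function on $\mathbb{R}^2$ equal to $u^h_{i,j}$ on the pixel $\big((i-\tfrac12)h,(i+\tfrac12)h\big)\times\big((j-\tfrac12)h,(j+\tfrac12)h\big)$. Convergence $u^h\to u$ means convergence of these functions in $L^1_{\mathrm{loc}}(\mathbb{R}^2)$ (if the slopes $q^h$ all equal the slope $q$ of $u$, this is convergence in $L^1(\Omega)$ as $h\to0$). Let $\mathcal{M}$ be the space of real arrays on an $N\times N$ pixel grid extended $N$-periodically (the spatial position of the entries within a pixel may be staggered, as indicated by half-integer indices). Define $D_hu^h\in\mathcal{M}^2$ by $$(D_hu)^1_{i+\frac12,j}=\tfrac1h(u_{i+1,j}-u_{i,j}),\qquad (D_hu)^2_{i,j+\frac12}=\tfrac1h(u_{i,j+1}-u_{i,j}).$$ For $w=(w^1_{i+\frac12,j},w^2_{i,j+\frac12})\in\mathcal{M}^2$ define $E_hw\in\mathcal{M}^3$ by $$(E_hw)^1_{i+1,j}=\tfrac1h(w^1_{i+\frac32,j}-w^1_{i+\frac12,j}),\quad (E_hw)^3_{i,j+1}=\tfrac1h(w^2_{i,j+\frac32}-w^2_{i,j+\frac12}),$$ $$(E_hw)^2_{i+\frac12,j+\frac12}=\tfrac1{2h}\big(w^1_{i+\frac12,j+1}-w^1_{i+\frac12,j}+w^2_{i+1,j+\frac12}-w^2_{i,j+\frac12}\big).$$ An element $p=(p^1,p^2,p^3)\in\mathcal{M}^3$ represents the symmetric tensor field $\begin{pmatrix}p^1&p^2\\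 p^2&p^3\end{pmatrix}$. Accordingly, the pointwise inner product and $2$-norm of the three components are the Frobenius ones, $\langle p,p'\rangle=p^1p'^1+2p^2p'^2+p^3p'^3$ and $|p|=\sqrt{(p^1)^2+2(p^2)^2+(p^3)^2}$. On $\mathcal{M}^2$ the pointwise norm is Euclidean. **Interpolation operators.** $L_h:\mathcal{M}^2\to\mathcal{M}^{2\times n_L}$ and $K_h:\mathcal{M}^3\to\mathcal{M}^{3\times n_K}$ are given by periodic convolutions with fixed kernels (the kernels do not depend on $h$): $$(L_h^{1,l}w^1)_{i,j}=\sum_{m,n=-\nu}^{\nu}\eta^{1,l}_{m,n}w^1_{i+\frac12-m,j-n},\qquad (L_h^{2,l}w^2)_{i,j}=\sum_{m,n=-\nu}^{\nu}\eta^{2,l}_{m,n}w^2_{i-m,j+\frac12-n},$$ $$(K_h^{a,r}p^a)_{i,j}=\sum_{m,n=-\nu}^{\nu}\xi^{a,r}_{m,n}p^a_{i-m,j-n}\ \ (a=1,3),\qquad (K_h^{2,r}p^2)_{i,j}=\sum_{m,n=-\nu}^{\nu}\xi^{2,r}_{m,n}p^2_{i+\frac12-m,j+\frac12-n},$$ with $\sum_{m,n}\eta^{a,l}_{m,n}=1$ and $\sum_{m,n}\xi^{a,r}_{m,n}=1$ for all $a,l,r$. $L_h^*$ and $K_h^*$ are the adjoints. Explicitly, $(L_h^*v)^1_{i+\frac12,j}=\sum_{l=1}^{n_L}\sum_{m,n}\eta^{1,l}_{m,n}v^{1,l}_{i+m,j+n}$, $(L_h^*v)^2_{i,j+\frac12}=\sum_{l=1}^{n_L}\sum_{m,n}\eta^{2,l}_{m,n}v^{2,l}_{i+m,j+n}$,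 $(K_h^*v)^a_{i,j}=\sum_{r=1}^{n_K}\sum_{m,n}\xi^{a,r}_{m,n}v^{a,r}_{i+m,j+n}$ for $a=1,3$, and $(K_h^*v)^2_{i+\frac12,j+\frac12}=\sum_{r=1}^{n_K}\sum_{m,n}\xi^{2,r}_{m,n}v^{2,r}_{i+m,j+n}$. **Norm.** For $v\in\mathcal{M}^{J\times I}$ ($J=2$ or $3$), $\|v\|_Z=\sum_{i,j=1}^N\sum_{r=1}^I|v^{\cdot,r}_{i,j}|$, the sum over pixels and over the $I$ filters of the pointwise $2$-norm of the $J$ components. Its dual norm is $\|v\|_Z^*=\max_{i,j,r}|v^{\cdot,r}_{i,j}|$. **Discrete functional.** $$\mathrm{TGV}^2_{\alpha,h}(u^h)=\min_{w^h,v_K^h,v_L^h}\Big\{h^2\alpha_1\|v_L^h\|_Z+h^2\alpha_0\|v_K^h\|_Z:\ L_h^*v_L^h=D_hu^h-w^h,\ K_h^*v_K^h=E_hw^h\Big\},$$ over $w^h\in\mathcal{M}^2$, $v_K^h\in\mathcal{M}^{3\times n_K}$, $v_L^h\in\mathcal{M}^{2\times n_L}$ (equal to $+\infty$ if the constraints are infeasible). Equivalently, by duality, $$\mathrm{TGV}^2_{\alpha,h}(u^h)=\sup_{p^h\in\mathcal{M}^3}\Big\{h^2\langle E_hD_hu^h,p^h\rangle:\ \|L_h\mathrm{div}_hp^h\|_Z^*\le\alpha_1,\ \|K_hp^h\|_Z^*\le\alpha_0\Big\},$$ where $\mathrm{div}_h=-E_h^*$ is the discrete divergence and $\langle\cdot,\cdot\rangle$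 is the sum over pixels of the pointwise inner products. *)

theory Defs
  imports "HOL-Analysis.Analysis"
begin

section \<open>Continuous setting\<close>

definition locally_integrable :: "(real^2 \<Rightarrow> 'b::euclidean_space) \<Rightarrow> bool" where
  "locally_integrable f \<longleftrightarrow> (\<forall>K. compact K \<longrightarrow> f absolutely_integrable_on K)"

text \<open>Elements of \<open>L\<^sup>1\<close>-spaces are functions up to null sets, so periodicity is required almost
  everywhere.\<close>

definition periodic_ae :: "(real^2 \<Rightarrow> 'b) \<Rightarrow> bool" where
  "periodic_ae f \<longleftrightarrow> (\<forall>k. (\<forall>i. k $ i \<in> \<int>) \<longrightarrow> (AE x in lebesgue. f (x + k) = f x))"

definition affine_plus_periodic :: "(real^2 \<Rightarrow> real) \<Rightarrow> bool" where
  "affine_plus_periodic u \<longleftrightarrow>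
     locally_integrable u \<and> (\<exists>q. periodic_ae (\<lambda>x. u x - q \<bullet> x))"

definition pderiv_dir :: "2 \<Rightarrow> (real^2 \<Rightarrow> real) \<Rightarrow> real^2 \<Rightarrow> real" where
  "pderiv_dir i f x = frechet_derivative f (at x) (axis i 1)"

text \<open>All iterated partial derivatives are (totally) differentiable, hence also continuous: this
  is \<open>C\<^sup>\<infinity>\<close>.\<close>

definition smooth :: "(real^2 \<Rightarrow> real) \<Rightarrow> bool" where
  "smooth f \<longleftrightarrow> (\<forall>js x. fold pderiv_dir js f differentiable (at x))"

definition test_function :: "(real^2 \<Rightarrow> real) \<Rightarrow> bool" where
  "test_function \<phi> \<longleftrightarrow> smooth \<phi> \<and> compact (closure {x. \<phi> x \<noteq> 0})"

text \<open>Vector-valued distributions are represented by their action on scalar test functions.\<close>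

definition distr_of_fun :: "(real^2 \<Rightarrow> 'b::euclidean_space) \<Rightarrow> (real^2 \<Rightarrow> real) \<Rightarrow> 'b" where
  "distr_of_fun f \<phi> = (LINT x|lebesgue. \<phi> x *\<^sub>R f x)"

definition distr_grad :: "(real^2 \<Rightarrow> real) \<Rightarrow> (real^2 \<Rightarrow> real) \<Rightarrow> real^2" where
  "distr_grad u \<phi> = (\<chi> i. - (LINT x|lebesgue. u x * pderiv_dir i \<phi> x))"

definition distr_sym_grad :: "(real^2 \<Rightarrow> real^2) \<Rightarrow> (real^2 \<Rightarrow> real) \<Rightarrow> real^2^2" where
  "distr_sym_grad w \<phi> =
     (\<chi> i j. (distr_grad (\<lambda>x. w x $ i) \<phi> $ j + distr_grad (\<lambda>x. w x $ j) \<phi> $ i) / 2)"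

text \<open>The distribution \<open>T\<close> is a locally finite vector measure, written in its polar decomposition
  \<open>T = \<sigma> M\<close> with \<open>\<bar>\<sigma>\<bar> = 1\<close> \<open>M\<close>-almost everywhere; thus \<open>M\<close> is the total variation measure \<open>\<bar>T\<bar>\<close>,
  which is uniquely determined by \<open>T\<close>. The norm of \<open>real^2^2\<close> is the Frobenius norm.\<close>

definition is_measure_with_variation ::
  "((real^2 \<Rightarrow> real) \<Rightarrow> 'b::euclidean_space) \<Rightarrow> (real^2) measure \<Rightarrow> bool" where
  "is_measure_with_variation T M \<longleftrightarrow>
     sets M = sets borel \<and> (\<forall>K. compact K \<longrightarrow> emeasure M K < \<infinity>) \<and>
     (\<exists>\<sigma>. \<sigma> \<in> borel_measurable borel \<and> (AE x in M. norm (\<sigma> x) = 1) \<and>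
          (\<forall>\<phi>. test_function \<phi> \<longrightarrow> T \<phi> = (LINT x|M. \<phi> x *\<^sub>R \<sigma> x)))"

definition period_cell :: "(real^2) set" where
  "period_cell = {x. \<forall>i. 0 \<le> x $ i \<and> x $ i < 1}"

text \<open>The infimum of the empty set is \<open>\<infinity>\<close>, which is the value if \<open>Du\<close> is not a locally finite
  measure.\<close>

definition TGV :: "real \<Rightarrow> real \<Rightarrow> (real^2 \<Rightarrow> real) \<Rightarrow> ennreal" where
  "TGV \<alpha>\<^sub>0 \<alpha>\<^sub>1 u = Inf {ennreal \<alpha>\<^sub>1 * emeasure A period_cell + ennreal \<alpha>\<^sub>0 * emeasure B period_cell | A B w.
     locally_integrable w \<and> periodic_ae w \<and>
     is_measure_with_variation (\<lambda>\<phi>. distr_grad u \<phi> - distr_of_fun w \<phi>) A \<and>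
     is_measure_with_variation (distr_sym_grad w) B}"

section \<open>Discrete setting\<close>

text \<open>Staggered positions are encoded by rounding the indices down: \<open>w i j\<close> holds
  \<open>(w\<^sup>1\<^bsub>i+1/2,j\<^esub>, w\<^sup>2\<^bsub>i,j+1/2\<^esub>)\<close>, and \<open>p i j\<close> holds \<open>(p\<^sup>1\<^bsub>i,j\<^esub>, p\<^sup>2\<^bsub>i+1/2,j+1/2\<^esub>, p\<^sup>3\<^bsub>i,j\<^esub>)\<close>.\<close>

type_synonym 'b grid = "int \<Rightarrow> int \<Rightarrow> 'b"

definition periodic_grid :: "nat \<Rightarrow> 'b grid \<Rightarrow> bool" where
  "periodic_grid N v \<longleftrightarrow> (\<forall>i j. v (i + int N) j = v i j \<and> v i (j + int N) = v i j)"

definition discrete_affine_plus_periodic :: "nat \<Rightarrow> real grid \<Rightarrow> bool" where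
  "discrete_affine_plus_periodic N u \<longleftrightarrow>
     (\<exists>q::real^2. periodic_grid N (\<lambda>i j. u i j - q \<bullet> vector [of_int i / N, of_int j / N]))"

text \<open>\<open>round (N * t) = i\<close> for \<open>t\<close> strictly between \<open>(i - 1/2) / N\<close> and \<open>(i + 1/2) / N\<close>.\<close>

definition pixel_fun :: "nat \<Rightarrow> real grid \<Rightarrow> real^2 \<Rightarrow> real" where
  "pixel_fun N u x = u (round (N * x $ 1)) (round (N * x $ 2))"

definition images_converge :: "(nat \<Rightarrow> real grid) \<Rightarrow> (real^2 \<Rightarrow> real) \<Rightarrow> bool" where
  "images_converge uh u \<longleftrightarrow> (\<forall>K. compact K \<longrightarrow>
     (\<lambda>N. LINT x:K|lebesgue. \<bar>pixel_fun N (uh N) x - u x\<bar>) \<longlonglongrightarrow> 0)"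

definition discrete_grad :: "real \<Rightarrow> real grid \<Rightarrow> (real^2) grid" where
  "discrete_grad h u i j = vector [(u (i + 1) j - u i j) / h, (u i (j + 1) - u i j) / h]"

definition discrete_sym_grad :: "real \<Rightarrow> (real^2) grid \<Rightarrow> (real^3) grid" where
  "discrete_sym_grad h w i j = vector
     [(w i j $ 1 - w (i - 1) j $ 1) / h,
      (w i (j + 1) $ 1 - w i j $ 1 + w (i + 1) j $ 2 - w i j $ 2) / (2 * h),
      (w i j $ 2 - w i (j - 1) $ 2) / h]"

text \<open>Kernels are indexed by component, filter and the two offsets. With the index encoding above,
  the formulas for the adjoint interpolations \<open>L\<^sub>h\<^sup>*\<close> (\<open>'c = 2\<close>) and \<open>K\<^sub>h\<^sup>*\<close> (\<open>'c = 3\<close>) coincide.\<close>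

type_synonym 'c kernels = "'c \<Rightarrow> nat \<Rightarrow> int \<Rightarrow> int \<Rightarrow> real"

definition normalized_kernels :: "nat \<Rightarrow> nat \<Rightarrow> 'c kernels \<Rightarrow> bool" where
  "normalized_kernels \<nu> I \<kappa> \<longleftrightarrow>
     (\<forall>a. \<forall>r\<in>{1..I}. (\<Sum>m\<in>{- int \<nu>..int \<nu>}. \<Sum>n\<in>{- int \<nu>..int \<nu>}. \<kappa> a r m n) = 1)"

definition adjoint_interp ::
  "nat \<Rightarrow> nat \<Rightarrow> 'c kernels \<Rightarrow> (nat \<Rightarrow> (real^'c::finite) grid) \<Rightarrow> (real^'c) grid" where
  "adjoint_interp \<nu> I \<kappa> v i j =
     (\<chi> a. \<Sum>r=1..I. \<Sum>m\<in>{- int \<nu>..int \<nu>}. \<Sum>n\<in>{- int \<nu>..int \<nu>}.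
        \<kappa> a r m n * v r (i + m) (j + n) $ a)"

text \<open>Frobenius norm of the symmetric matrix with diagonal \<open>p\<^sup>1, p\<^sup>3\<close> and off-diagonal entry \<open>p\<^sup>2\<close>.\<close>

definition sym_norm :: "real^3 \<Rightarrow> real" where
  "sym_norm p = sqrt ((p $ 1)\<^sup>2 + 2 * (p $ 2)\<^sup>2 + (p $ 3)\<^sup>2)"

definition Z_norm :: "('b \<Rightarrow> real) \<Rightarrow> nat \<Rightarrow> nat \<Rightarrow> (nat \<Rightarrow> 'b grid) \<Rightarrow> real" where
  "Z_norm pointwise_norm N I v =
     (\<Sum>i=1..int N. \<Sum>j=1..int N. \<Sum>r=1..I. pointwise_norm (v r i j))"

definition discrete_TGV ::
  "real \<Rightarrow> real \<Rightarrow> nat \<Rightarrow> nat \<Rightarrow> 3 kernels \<Rightarrow> nat \<Rightarrow> 2 kernels \<Rightarrow> nat \<Rightarrow> real grid \<Rightarrow> ennreal" where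
  "discrete_TGV \<alpha>\<^sub>0 \<alpha>\<^sub>1 \<nu> n\<^sub>K \<xi> n\<^sub>L \<eta> N u = (let h = 1 / real N in
     Inf {ennreal (h\<^sup>2 * \<alpha>\<^sub>1 * Z_norm norm N n\<^sub>L v\<^sub>L + h\<^sup>2 * \<alpha>\<^sub>0 * Z_norm sym_norm N n\<^sub>K v\<^sub>K) | w v\<^sub>K v\<^sub>L.
       periodic_grid N w \<and>
       (\<forall>r\<in>{1..n\<^sub>K}. periodic_grid N (v\<^sub>K r)) \<and> (\<forall>l\<in>{1..n\<^sub>L}. periodic_grid N (v\<^sub>L l)) \<and>
       (\<forall>i j. adjoint_interp \<nu> n\<^sub>L \<eta> v\<^sub>L i j = discrete_grad h u i j - w i j) \<and>
       (\<forall>i j. adjoint_interp \<nu> n\<^sub>K \<xi> v\<^sub>K i j = discrete_sym_grad h w i j)})"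

end

(* Lower bound: near-optimal discrete w and v_L, v_K are bounded in mean by the energy. The means of w are controlled by the
   slopes of u^h and a kernel bound, so a discrete Korn inequality and the embedding of functions of bounded deformation
   into L^2 bound w in L^2 of the cell. Along a subsequence w converges weakly to a function and v_L, v_K to
   measures on the torus whose masses are at most the limits of the discrete norms. Testing the constraints with a smooth
   function moves differences and kernels onto it; the kernels have mass 1 and support of size O(h), so they disappear
   and the limits are Du - w and Ew.

   Upper bound: mollify u and a near-optimal w on a fixed scale, sample, and solve the constraints exactly by
   products of the kernels. As h -> 0 the discrete energy converges to the energy of the mollified pair, which
   is at most the original one: the variation measures are periodic because they are determined by their
   periodic distributions. Then remove the mollification by a diagonal argument. *)

theory Submission
  imports Defs "HOL-Probability.Probability"
begin

text \<open>The continuous functional asks for a field \<open>w\<close> that is a function, whereas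
  an L1 bound on discrete fields would only produce a measure in the limit; hence the L2 estimate.
  It has to come from the symmetrized gradient alone, which does not control the full gradient in
  L1. The substitute is a one-dimensional oscillation bound, used along rows, along columns and
  along one diagonal direction. The kernels may change sign and the interpolation operators are not
  inverted. Only two facts about them enter: each kernel has mass one, and the sum of the absolute
  coefficients does not depend on h. In the recovery sequence, commutativity of convolutions takes
  the place of an inverse. The variation measures in the definition of \<open>TGV\<close> live on
  the plane and carry no periodicity hypothesis, yet only their mass on one cell counts. Uniqueness
  of the polar decomposition makes this mass comparable with integrals over the torus. Torus
  measures are kept on the half-open cell and extended by lattice translates, so mass on the
  boundary is counted once.\<close>

abbreviation pair :: "(real^2 \<Rightarrow> real) \<Rightarrow> (real^2 \<Rightarrow> real) \<Rightarrow> real" where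
  "pair f g \<equiv> LINT x|lborel. f x * g x"

abbreviation lnorm :: "real \<Rightarrow> (real^2 \<Rightarrow> real) \<Rightarrow> real" where
  "lnorm R f \<equiv> LINT x|lborel. indicator (cball 0 R) x * \<bar>f x\<bar>"

section \<open>Smooth functions\<close>

text \<open>A chain of explicit derivatives instead of an iterated derivative operator: closure
  properties then follow by induction on the order, each step exhibiting the derivative.\<close>

primrec diffn :: "nat \<Rightarrow> (real \<Rightarrow> real) \<Rightarrow> bool" where
  "diffn 0 f = True"
| "diffn (Suc n) f = (\<exists>f'. (\<forall>x. (f has_real_derivative f' x) (at x)) \<and> diffn n f')"

definition smooth1 :: "(real \<Rightarrow> real) \<Rightarrow> bool" where
  "smooth1 f \<longleftrightarrow> (\<forall>n. diffn n f)"

lemma diffn_SucI: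
  "(\<And>x. (f has_real_derivative f' x) (at x)) \<Longrightarrow> diffn n f' \<Longrightarrow> diffn (Suc n) f"
  by auto

text \<open>The derivatives of products and exponentials keep an undifferentiated factor, which is
  known to order \<open>Suc n\<close> but is used to order \<open>n\<close>.\<close>

lemma diffn_Suc_imp: "diffn (Suc n) f \<Longrightarrow> diffn n f"
  by (induction n arbitrary: f) (simp, metis diffn.simps(2))

lemma diffn_const: "diffn n (\<lambda>x. c)"
proof (induction n arbitrary: c)
  case (Suc n)
  show ?case by (rule diffn_SucI[where f' = "\<lambda>x. 0"]) (auto intro!: derivative_eq_intros Suc)
qed simp

lemma diffn_add: "diffn n f \<Longrightarrow> diffn n g \<Longrightarrow> diffn n (\<lambda>x. f x + g x)"
proof (induction n arbitrary: f g)
  case (Suc n)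
  from Suc.prems obtain f' g' where
    "\<And>x. (f has_real_derivative f' x) (at x)" "diffn n f'"
    "\<And>x. (g has_real_derivative g' x) (at x)" "diffn n g'" by auto
  then show ?case
    by (intro diffn_SucI[where f' = "\<lambda>x. f' x + g' x"] Suc.IH) (auto intro!: derivative_eq_intros)
qed simp

lemma diffn_mult: "diffn n f \<Longrightarrow> diffn n g \<Longrightarrow> diffn n (\<lambda>x. f x * g x)"
proof (induction n arbitrary: f g)
  case (Suc n)
  from Suc.prems obtain f' g' where
    "\<And>x. (f has_real_derivative f' x) (at x)" "diffn n f'"
    "\<And>x. (g has_real_derivative g' x) (at x)" "diffn n g'" by auto
  with Suc.prems[THEN diffn_Suc_imp] show ?case
    by (intro diffn_SucI[where f' = "\<lambda>x. f' x * g x + g' x * f x"] Suc.IH diffn_add)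
       (auto intro!: derivative_eq_intros)
qed simp

lemma diffn_exp: "diffn n f \<Longrightarrow> diffn n (\<lambda>x. exp (f x))"
proof (induction n arbitrary: f)
  case (Suc n)
  from Suc.prems obtain f' where
    "\<And>x. (f has_real_derivative f' x) (at x)" "diffn n f'" by auto
  with Suc.prems[THEN diffn_Suc_imp] show ?case
    by (intro diffn_SucI[where f' = "\<lambda>x. f' x * exp (f x)"] Suc.IH diffn_mult)
       (auto intro!: derivative_eq_intros)
qed simp

lemma diffn_affine: "diffn n f \<Longrightarrow> diffn n (\<lambda>x. f (a * x + b))"
proof (induction n arbitrary: f)
  case (Suc n)
  from Suc.prems obtain f' where f':
    "\<And>x. (f has_real_derivative f' x) (at x)" "diffn n f'" by auto
  have "((\<lambda>x. f (a * x + b)) has_real_derivative f' (a * x + b) * a) (at x)" for x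
    by (rule DERIV_chain'[where f = "\<lambda>x. a * x + b" and g = f, THEN DERIV_cong])
       (auto intro!: derivative_eq_intros f')
  then show ?case
    by (rule diffn_SucI) (intro diffn_mult diffn_const Suc.IH f')
qed simp

lemma smooth1_const: "smooth1 (\<lambda>x. c)"
  by (simp add: smooth1_def diffn_const)

lemma smooth1_add: "smooth1 f \<Longrightarrow> smooth1 g \<Longrightarrow> smooth1 (\<lambda>x. f x + g x)"
  by (simp add: smooth1_def diffn_add)

lemma smooth1_mult: "smooth1 f \<Longrightarrow> smooth1 g \<Longrightarrow> smooth1 (\<lambda>x. f x * g x)"
  by (simp add: smooth1_def diffn_mult)

lemma smooth1_exp: "smooth1 f \<Longrightarrow> smooth1 (\<lambda>x. exp (f x))"
  by (simp add: smooth1_def diffn_exp)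

lemma smooth1_affine: "smooth1 f \<Longrightarrow> smooth1 (\<lambda>x. f (a * x + b))"
  by (simp add: smooth1_def diffn_affine)

lemma smooth1_derivE:
  assumes "smooth1 f"
  obtains f' where "\<And>x. (f has_real_derivative f' x) (at x)" "smooth1 f'"
proof -
  from assms have "diffn (Suc n) f" for n
    unfolding smooth1_def by blast
  then obtain F where F: "\<And>n x. (f has_real_derivative F n x) (at x)" "\<And>n. diffn n (F n)"
    unfolding diffn.simps by metis
  \<comment> \<open>Each order comes with its own derivative; uniqueness of derivatives identifies
    them, so that one function serves all orders.\<close>
  have "F n = F 0" for n
    by (rule ext) (use F DERIV_unique in blast)
  with F show thesis
    by (metis that smooth1_def)
qed

section \<open>Bump functions built from exp(-1/t)\<close>

definition flat :: "nat \<Rightarrow> real \<Rightarrow> real" where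
  "flat k t = (if t > 0 then (1 / t) ^ k * exp (- (1 / t)) else 0)"

text \<open>The substitution s = 1/t turns the right-hand limit into that of s^k / exp s at
  infinity; on the left the function is zero.\<close>

lemma flat_tendsto_0: "(flat k \<longlongrightarrow> 0) (at 0)"
proof -
  have "((\<lambda>x. x ^ k / exp x) \<longlongrightarrow> 0) (at_top :: real filter)"
    by (rule tendsto_power_div_exp_0)
  then have "((\<lambda>t. inverse t ^ k / exp (inverse t)) \<longlongrightarrow> 0) (at_right (0::real))"
    by (rule filterlim_compose) (rule filterlim_inverse_at_top_right)
  moreover have "\<forall>\<^sub>F t in at_right 0. inverse t ^ k / exp (inverse t) = flat k t"
    unfolding eventually_at_topological
    by (auto simp: flat_def exp_minus field_simps intro!: exI[of _ UNIV])
  ultimately have R: "(flat k \<longlongrightarrow> 0) (at_right 0)"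
    using tendsto_cong by force
  have "\<forall>\<^sub>F t in at_left 0. 0 = flat k t"
    unfolding eventually_at_topological by (auto simp: flat_def intro!: exI[of _ UNIV])
  then have L: "(flat k \<longlongrightarrow> 0) (at_left 0)"
    by (rule Lim_transform_eventually[OF tendsto_const])
  show ?thesis
    using L R by (rule filterlim_split_at)
qed

text \<open>The factors t^-k are carried along because the derivatives of exp(-1/t) produce them;
  with them the family is closed under differentiation up to linear combinations. At 0 the
  difference quotient of \<open>flat k\<close> is \<open>flat (k + 1)\<close>, which tends to
  0.\<close>

lemma flat_deriv:
  "(flat k has_real_derivative (flat (k + 2) t + (- real k) * flat (k + 1) t)) (at t)"
proof -
  consider "t > 0" | "t < 0" | "t = 0" by linarith
  then show ?thesis
  proof cases
    case 1
    have "((\<lambda>t. (1 / t) ^ k * exp (- (1 / t))) has_real_derivative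
        (flat (k + 2) t + (- real k) * flat (k + 1) t)) (at t)"
    proof -
      have i: "((\<lambda>t. 1 / t) has_real_derivative - ((1 / t) * (1 / t))) (at t)"
        using 1 by (auto intro!: derivative_eq_intros)
      have s: "real k * (- (s * s) * s ^ (k - Suc 0)) = - real k * s ^ (k + 1)" for s :: real
        by (cases k) (auto simp: algebra_simps)
      have p: "((\<lambda>t. (1 / t) ^ k) has_real_derivative - real k * (1 / t) ^ (k + 1)) (at t)"
        by (rule DERIV_cong[OF DERIV_power[OF i] s])
      have e: "((\<lambda>t. exp (- (1 / t))) has_real_derivative exp (- (1 / t)) * ((1 / t) * (1 / t))) (at t)"
        by (rule DERIV_cong[OF DERIV_fun_exp[OF DERIV_minus[OF i]]]) simp
      show ?thesis
        by (rule DERIV_cong[OF DERIV_mult[OF p e]]) (use 1 in \<open>simp add: flat_def algebra_simps\<close>)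
    qed
    then show ?thesis
      by (rule has_field_derivative_transform_within_open[where S = "{0<..}"])
         (use 1 in \<open>auto simp: flat_def\<close>)
  next
    case 2
    have "((\<lambda>t. 0) has_real_derivative
        (flat (k + 2) t + (- real k) * flat (k + 1) t)) (at t)"
      using 2 by (auto simp: flat_def)
    then show ?thesis
      by (rule has_field_derivative_transform_within_open[where S = "{..<0}"])
         (use 2 in \<open>auto simp: flat_def\<close>)
  next
    case 3
    have "\<forall>\<^sub>F s in at 0. flat (k + 1) s = (flat k (0 + s) - flat k 0) / s"
      unfolding eventually_at_topological by (auto simp: flat_def intro!: exI[of _ UNIV])
    from Lim_transform_eventually[OF flat_tendsto_0 this]
    show ?thesis using 3 by (simp add: DERIV_def flat_def)
  qed
qed

lemma smooth1_flat: "smooth1 (flat k)"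
proof -
  have "diffn n (flat k)" for n
  proof (induction n arbitrary: k)
    case (Suc n)
    show ?case
      by (rule diffn_SucI[OF flat_deriv]) (intro diffn_add diffn_mult diffn_const Suc)
  qed simp
  then show ?thesis by (simp add: smooth1_def)
qed

definition bump :: "real \<Rightarrow> real \<Rightarrow> real \<Rightarrow> real" where
  "bump a b t = flat 0 (t - a) * flat 0 (b - t)"

lemma smooth1_bump: "smooth1 (bump a b)"
proof -
  have "smooth1 (\<lambda>t. flat 0 (1 * t + (- a)) * flat 0 ((-1) * t + b))"
    by (intro smooth1_mult smooth1_affine smooth1_flat)
  then show ?thesis by (simp add: bump_def[abs_def])
qed

lemma bump_nonneg: "0 \<le> bump a b t"
  by (auto simp: bump_def flat_def)

lemma bump_pos_iff: "0 < bump a b t \<longleftrightarrow> a < t \<and> t < b"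
  by (auto simp: bump_def flat_def zero_less_mult_iff)

lemma bump_eq_0_iff: "bump a b t = 0 \<longleftrightarrow> \<not> (a < t \<and> t < b)"
  by (auto simp: bump_def flat_def)

lemma UNIV_2_cases: "i = (1::2) \<or> i = 2"
  using UNIV_2 by blast

lemma has_derivative_prod2:
  fixes x :: "real^2"
  assumes "(g has_real_derivative g') (at (x $ 1))" "(k has_real_derivative k') (at (x $ 2))"
  shows "((\<lambda>x. g (x $ 1) * k (x $ 2)) has_derivative
    (\<lambda>v. g (x $ 1) * (k' * v $ 2) + (g' * v $ 1) * k (x $ 2))) (at x)"
proof -
  have "((\<lambda>x. g (x $ 1)) has_derivative (\<lambda>v. g' * v $ 1)) (at x)"
    using has_derivative_compose[OF bounded_linear.has_derivative[OF bounded_linear_vec_nth has_derivative_ident, of 1]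
        assms(1)[unfolded has_field_derivative_def]] by simp
  moreover have "((\<lambda>x. k (x $ 2)) has_derivative (\<lambda>v. k' * v $ 2)) (at x)"
    using has_derivative_compose[OF bounded_linear.has_derivative[OF bounded_linear_vec_nth has_derivative_ident, of 2]
        assms(2)[unfolded has_field_derivative_def]] by simp
  ultimately show ?thesis by (rule has_derivative_mult)
qed

lemma pderiv_dir_eq:
  assumes "(f has_derivative f') (at x)"
  shows "pderiv_dir i f x = f' (axis i 1)"
  unfolding pderiv_dir_def by (metis assms frechet_derivative_at)

text \<open>Iterated partial derivatives of a product of one-variable functions are again such
  products, so differentiability of all orders reduces to one dimension.\<close>

lemma smooth_prod2:
  assumes "smooth1 g" "smooth1 k"
  shows "smooth (\<lambda>x. g (x $ 1) * k (x $ 2))"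
proof -
  have D: "(\<lambda>x::real^2. g (x $ 1) * k (x $ 2)) differentiable (at x)" if s: "smooth1 g" "smooth1 k" for g k x
  proof -
    obtain g' where "(g has_real_derivative g') (at (x $ 1))"
      using smooth1_derivE[OF s(1)] by metis
    moreover obtain k' where "(k has_real_derivative k') (at (x $ 2))"
      using smooth1_derivE[OF s(2)] by metis
    ultimately show ?thesis by (rule differentiableI[OF has_derivative_prod2])
  qed
  have "\<exists>g' k'. smooth1 g' \<and> smooth1 k' \<and>
      fold pderiv_dir js (\<lambda>x. g (x $ 1) * k (x $ 2)) = (\<lambda>x. g' (x $ 1) * k' (x $ 2))" for js
    using assms
  proof (induction js arbitrary: g k)
    case (Cons j js)
    obtain g' where g': "\<And>x. (g has_real_derivative g' x) (at x)" "smooth1 g'"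
      using Cons.prems smooth1_derivE by blast
    obtain k' where k': "\<And>x. (k has_real_derivative k' x) (at x)" "smooth1 k'"
      using Cons.prems smooth1_derivE by blast
    note eq = pderiv_dir_eq[OF has_derivative_prod2[OF g'(1) k'(1)]]
    show ?case
    proof (cases "j = 1")
      case True
      have "pderiv_dir j (\<lambda>x. g (x $ 1) * k (x $ 2)) = (\<lambda>x. g' (x $ 1) * k (x $ 2))"
        by (rule ext) (simp add: eq True axis_def)
      then show ?thesis using Cons g' by simp
    next
      case False
      then have "j = 2" using UNIV_2_cases by blast
      then have "pderiv_dir j (\<lambda>x. g (x $ 1) * k (x $ 2)) = (\<lambda>x. g (x $ 1) * k' (x $ 2))"
        by (intro ext) (simp add: eq axis_def)
      then show ?thesis using Cons k' by simp
    qed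
  qed auto
  then show ?thesis
    unfolding smooth_def by (metis D)
qed

section \<open>Supports, uniform continuity and difference quotients of test functions\<close>

lemma smooth_imp_differentiable: "smooth f \<Longrightarrow> f differentiable (at x)"
  unfolding smooth_def by (metis fold_Nil id_apply)

lemma smooth_imp_continuous: "smooth f \<Longrightarrow> continuous_on UNIV f"
  by (meson continuous_at_imp_continuous_on differentiable_imp_continuous_within smooth_imp_differentiable)

lemma smooth_pderiv: "smooth f \<Longrightarrow> smooth (pderiv_dir i f)"
  unfolding smooth_def by (metis comp_apply fold_Cons)

lemma test_function_prod2:
  assumes "smooth1 g" "smooth1 k"
    and "\<And>t. g t \<noteq> 0 \<Longrightarrow> a \<le> t \<and> t \<le> b" "\<And>t. k t \<noteq> 0 \<Longrightarrow> c \<le> t \<and> t \<le> d"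
  shows "test_function (\<lambda>x. g (x $ 1) * k (x $ 2))"
proof -
  have "{x::real^2. g (x $ 1) * k (x $ 2) \<noteq> 0} \<subseteq> cbox (vector [a, c]) (vector [b, d])"
    using assms(3,4) by (auto simp: mem_box_cart forall_2)
  then have "bounded {x::real^2. g (x $ 1) * k (x $ 2) \<noteq> 0}"
    using bounded_cbox bounded_subset by blast
  then show ?thesis
    using smooth_prod2[OF assms(1,2)] by (auto simp: test_function_def)
qed

lemma test_function_continuous: "test_function f \<Longrightarrow> continuous_on UNIV f"
  by (simp add: test_function_def smooth_imp_continuous)

lemma test_function_support:
  assumes "test_function f"
  obtains R where "R > 0" "\<And>x. norm x > R \<Longrightarrow> f x = 0"
proof -
  have "bounded {x. f x \<noteq> 0}"
    using assms unfolding test_function_def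
    by (meson bounded_subset closure_subset compact_imp_bounded)
  then obtain R where "R > 0" "\<forall>x\<in>{x. f x \<noteq> 0}. norm x \<le> R"
    using bounded_pos by blast
  then show thesis by (intro that[of R]) force+
qed

lemma test_function_pderiv_support:
  assumes "test_function f" "\<And>x. norm x > R \<Longrightarrow> f x = 0" "norm x > R"
  shows "pderiv_dir i f x = 0"
proof -
  have "((\<lambda>x. 0) has_derivative (\<lambda>v. 0)) (at x)" by simp
  moreover have "open {y. norm y > R}"
    by (intro open_Collect_less continuous_intros)
  ultimately have "(f has_derivative (\<lambda>v. 0)) (at x)"
    by (rule has_derivative_transform_within_open) (use assms in auto)
  then show ?thesis by (simp add: pderiv_dir_eq)
qed

lemma test_function_pderiv:
  assumes "test_function f"
  shows "test_function (pderiv_dir i f)"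
proof -
  obtain R where R: "R > 0" "\<And>x. norm x > R \<Longrightarrow> f x = 0"
    using test_function_support[OF assms] by metis
  have "{x. pderiv_dir i f x \<noteq> 0} \<subseteq> cball 0 R"
    using test_function_pderiv_support[OF assms R(2)] by (force simp: not_less[symmetric])
  then have "bounded {x. pderiv_dir i f x \<noteq> 0}"
    using bounded_cball bounded_subset by blast
  then show ?thesis
    using assms by (auto simp: test_function_def smooth_pderiv)
qed

text \<open>Two points at distance below 1 either both lie outside the ball of radius R, where
  \<open>f\<close> vanishes, or both lie in the compact ball of radius R + 1.\<close>

lemma compact_support_uniformly_continuous:
  fixes f :: "'a::euclidean_space \<Rightarrow> 'b::real_normed_vector"
  assumes c: "continuous_on UNIV f" and R: "\<And>x. norm x > R \<Longrightarrow> f x = 0"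
  shows "uniformly_continuous_on UNIV f"
  unfolding uniformly_continuous_on_def
proof (intro allI impI)
  fix e :: real assume "e > 0"
  have "uniformly_continuous_on (cball 0 (R + 1)) f"
    using c by (intro compact_uniformly_continuous continuous_on_subset[OF c]) auto
  then obtain d where d: "d > 0"
    "\<And>x y. \<lbrakk>x \<in> cball 0 (R + 1); y \<in> cball 0 (R + 1); dist y x < d\<rbrakk> \<Longrightarrow> dist (f y) (f x) < e"
    unfolding uniformly_continuous_on_def using \<open>e > 0\<close> by metis
  show "\<exists>d>0. \<forall>x\<in>UNIV. \<forall>x'\<in>UNIV. dist x' x < d \<longrightarrow> dist (f x') (f x) < e"
  proof (intro exI[of _ "min d 1"] conjI ballI impI)
    fix x y :: 'a assume xy: "dist y x < min d 1"
    show "dist (f y) (f x) < e"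
    proof (cases "norm x > R \<and> norm y > R")
      case True then show ?thesis using R \<open>e > 0\<close> by auto
    next
      case False
      have "norm y \<le> norm x + 1" "norm x \<le> norm y + 1"
        using xy norm_triangle_ineq2[of y x] norm_triangle_ineq2[of x y]
        by (auto simp: dist_norm norm_minus_commute)
      with False have "x \<in> cball 0 (R + 1)" "y \<in> cball 0 (R + 1)" by auto
      then show ?thesis using d xy by auto
    qed
  qed (use d in auto)
qed

lemma test_function_uc: "test_function f \<Longrightarrow> uniformly_continuous_on UNIV f"
  by (meson compact_support_uniformly_continuous test_function_continuous test_function_support)

text \<open>By the mean value theorem the quotient is a value of the derivative at distance at most
  |t|, and the derivative is uniformly continuous. Uniformity in \<open>x\<close> is what later
  allows integration against sequences that are merely bounded in L1.\<close>

lemma diff_quotient_uniform: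
  assumes f: "test_function f" and e: "e > 0"
  obtains d where "d > 0"
    "\<And>t x. t \<noteq> 0 \<Longrightarrow> \<bar>t\<bar> < d \<Longrightarrow> \<bar>(f (x + t *\<^sub>R axis i 1) - f x) / t - pderiv_dir i f x\<bar> \<le> e"
proof -
  have "uniformly_continuous_on UNIV (pderiv_dir i f)"
    using f test_function_pderiv test_function_uc by blast
  then obtain d where d: "d > 0"
    "\<And>x y. dist y x < d \<Longrightarrow> dist (pderiv_dir i f y) (pderiv_dir i f x) < e"
    unfolding uniformly_continuous_on_def using e by (metis UNIV_I)
  have D: "((\<lambda>s. f (x + s *\<^sub>R axis i 1)) has_real_derivative pderiv_dir i f (x + s *\<^sub>R axis i 1)) (at s)" for x s
  proof -
    define y where "y = x + s *\<^sub>R axis i 1"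
    have fd: "(f has_derivative frechet_derivative f (at y)) (at y)"
      using f frechet_derivative_works smooth_imp_differentiable test_function_def by blast
    then have lin: "linear (frechet_derivative f (at y))"
      by (rule has_derivative_linear)
    have "((\<lambda>s. x + s *\<^sub>R axis i 1) has_derivative (\<lambda>v. v *\<^sub>R axis i 1)) (at s)"
      by (auto intro!: derivative_eq_intros)
    from has_derivative_compose[OF this, of f "frechet_derivative f (at y)"] fd
    have "((\<lambda>s. f (x + s *\<^sub>R axis i 1)) has_derivative (\<lambda>v. frechet_derivative f (at y) (v *\<^sub>R axis i 1))) (at s)"
      by (simp add: y_def)
    moreover have "(\<lambda>v. frechet_derivative f (at y) (v *\<^sub>R axis i 1)) = (*) (pderiv_dir i f y)"
      using linear_cmul[OF lin] by (auto simp: pderiv_dir_def mult.commute)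
    ultimately show ?thesis
      by (simp add: has_field_derivative_def y_def)
  qed
  have "\<bar>(f (x + t *\<^sub>R axis i 1) - f x) / t - pderiv_dir i f x\<bar> \<le> e" if t: "t \<noteq> 0" "\<bar>t\<bar> < d" for t x
  proof -
    define g where "g s = f (x + s *\<^sub>R axis i 1)" for s
    have "\<exists>z. \<bar>z\<bar> \<le> \<bar>t\<bar> \<and> g t - g 0 = t * pderiv_dir i f (x + z *\<^sub>R axis i 1)"
    proof (cases "t > 0")
      case True
      then obtain z where "0 < z" "z < t" "g t - g 0 = (t - 0) * pderiv_dir i f (x + z *\<^sub>R axis i 1)"
        using MVT2[of 0 t g "\<lambda>z. pderiv_dir i f (x + z *\<^sub>R axis i 1)"] D unfolding g_def by blast
      then show ?thesis by (intro exI[of _ z]) auto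
    next
      case False
      then have "t < 0" using t by auto
      then obtain z where "t < z" "z < 0" "g 0 - g t = (0 - t) * pderiv_dir i f (x + z *\<^sub>R axis i 1)"
        using MVT2[of t 0 g "\<lambda>z. pderiv_dir i f (x + z *\<^sub>R axis i 1)"] D unfolding g_def by blast
      then show ?thesis by (intro exI[of _ z]) (auto simp: algebra_simps)
    qed
    then obtain z where z: "\<bar>z\<bar> \<le> \<bar>t\<bar>" "g t - g 0 = t * pderiv_dir i f (x + z *\<^sub>R axis i 1)" by blast
    have "dist (x + z *\<^sub>R axis i 1) x < d"
      using z t by (simp add: dist_norm norm_axis_1)
    then have "\<bar>pderiv_dir i f (x + z *\<^sub>R axis i 1) - pderiv_dir i f x\<bar> < e"
      using d(2) by (simp add: dist_real_def)
    moreover have "(f (x + t *\<^sub>R axis i 1) - f x) / t = pderiv_dir i f (x + z *\<^sub>R axis i 1)"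
      using z t by (simp add: g_def)
    ultimately show ?thesis by simp
  qed
  with d(1) show thesis using that by blast
qed

section \<open>Periodic functions and measures\<close>

definition lat :: "int \<times> int \<Rightarrow> real^2" where
  "lat k = vector [of_int (fst k), of_int (snd k)]"

definition fracs :: "real^2 \<Rightarrow> real^2" where
  "fracs x = (\<chi> i. frac (x $ i))"

definition floors :: "real^2 \<Rightarrow> int \<times> int" where
  "floors x = (\<lfloor>x $ 1\<rfloor>, \<lfloor>x $ 2\<rfloor>)"

definition periodic :: "(real^2 \<Rightarrow> 'b) \<Rightarrow> bool" where
  "periodic f \<longleftrightarrow> (\<forall>k x. f (x + lat k) = f x)"

abbreviation Z2 :: "(int \<times> int) measure" where
  "Z2 \<equiv> count_space UNIV"

text \<open>The torus is represented inside the plane by Lebesgue measure on the half-open cell;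
  functions on it are periodic functions on the plane, so no quotient space occurs.\<close>

definition torus :: "(real^2) measure" where
  "torus = density lborel (indicator period_cell)"

text \<open>The sum of all lattice translates of a measure, written as an image of a product with
  counting measure so that Tonelli and Fubini apply to the lattice sum.\<close>

definition periodize :: "(real^2) measure \<Rightarrow> (real^2) measure" where
  "periodize \<mu> = distr (Z2 \<Otimes>\<^sub>M \<mu>) borel (\<lambda>(k, x). x + lat k)"

definition lat_invariant :: "(real^2) measure \<Rightarrow> bool" where
  "lat_invariant M \<longleftrightarrow> (\<forall>k. distr M borel (\<lambda>x. x + lat k) = M)"

text \<open>The operation on test functions that is dual to \<open>periodize\<close>.\<close>

definition fold_sum :: "(real^2 \<Rightarrow> real) \<Rightarrow> real^2 \<Rightarrow> real" where
  "fold_sum \<phi> x = (LINT k|Z2. \<phi> (x + lat k))"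

declare split_paired_All [simp del] split_paired_Ex [simp del]

section \<open>Reduction modulo the lattice\<close>

lemma vec2_eq_iff: "(x::'a^2) = y \<longleftrightarrow> x $ 1 = y $ 1 \<and> x $ 2 = y $ 2"
  by (simp add: vec_eq_iff forall_2)

lemma lat_nth [simp]: "lat k $ 1 = of_int (fst k)" "lat k $ 2 = of_int (snd k)"
  by (simp_all add: lat_def)

lemma lat_add: "lat (a + b) = lat a + lat b"
  by (simp add: vec2_eq_iff)

lemma lat_uminus: "lat (- a) = - lat a"
  by (simp add: vec2_eq_iff)

lemma lat_0 [simp]: "lat 0 = 0" "lat (0, 0) = 0"
  by (simp_all add: vec2_eq_iff)

lemma fracs_nth [simp]: "fracs x $ i = frac (x $ i)"
  by (simp add: fracs_def)

lemma fracs_plus_floors: "fracs x + lat (floors x) = x"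
  by (simp add: vec2_eq_iff floors_def frac_def)

lemma fracs_eq: "fracs x = x + lat (- floors x)"
  by (simp add: vec2_eq_iff floors_def frac_def)

lemma fracs_in_cell [simp]: "fracs x \<in> period_cell"
  by (simp add: period_cell_def frac_lt_1)

lemma fracs_cell: "x \<in> period_cell \<Longrightarrow> fracs x = x"
  by (simp add: period_cell_def vec2_eq_iff frac_eq)

lemma fracs_add_lat [simp]: "fracs (x + lat k) = fracs x"
  by (simp add: vec2_eq_iff)

lemma periodicD: "periodic f \<Longrightarrow> f (x + lat k) = f x"
  by (simp add: periodic_def)

lemma periodic_fracs: "periodic f \<Longrightarrow> f (fracs x) = f x"
  by (metis fracs_plus_floors periodic_def)

lemma periodic_compose_fracs: "periodic (\<lambda>x. f (fracs x))"
  by (simp add: periodic_def)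

text \<open>The half-open cell is a fundamental domain: every lattice orbit meets it exactly
  once.\<close>

lemma in_cell_lat_iff: "x + lat k \<in> period_cell \<longleftrightarrow> k = - floors x"
proof
  assume "x + lat k \<in> period_cell"
  then have "0 \<le> x $ 1 + of_int (fst k)" "x $ 1 + of_int (fst k) < 1"
    "0 \<le> x $ 2 + of_int (snd k)" "x $ 2 + of_int (snd k) < 1"
    by (auto simp: period_cell_def forall_2)
  then have "\<lfloor>x $ 1\<rfloor> = - fst k" "\<lfloor>x $ 2\<rfloor> = - snd k" by linarith+
  then show "k = - floors x" by (cases k) (simp add: floors_def)
next
  assume "k = - floors x"
  then show "x + lat k \<in> period_cell" using fracs_eq fracs_in_cell by metis
qed

lemma lat_measurable [measurable]: "(\<lambda>x. x + lat k) \<in> borel_measurable borel"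
  by simp

lemma fracs_measurable [measurable]: "fracs \<in> borel_measurable borel"
proof -
  have "(\<lambda>x. fracs x \<bullet> b) \<in> borel_measurable borel" if "b \<in> Basis" for b
  proof -
    obtain i where "b = axis i 1" using \<open>b \<in> Basis\<close> by (auto simp: Basis_vec_def)
    then have "(\<lambda>x. fracs x \<bullet> b) = (\<lambda>x. x $ i - of_int \<lfloor>x $ i\<rfloor>)"
      by (auto simp: inner_axis frac_def)
    also have "\<dots> \<in> borel_measurable borel" by measurable
    finally show ?thesis .
  qed
  then show ?thesis by (subst borel_measurable_euclidean_space) auto
qed

lemma cell_borel [measurable]: "period_cell \<in> sets borel"
proof -
  have "period_cell = {x::real^2. 0 \<le> x $ 1 \<and> x $ 1 < 1 \<and> 0 \<le> x $ 2 \<and> x $ 2 < 1}"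
    by (auto simp: period_cell_def forall_2)
  also have "\<dots> \<in> sets borel" by measurable
  finally show ?thesis .
qed

section \<open>Periodization of measures and unfolding of integrals\<close>

lemma sigma_finite_Z2: "sigma_finite_measure Z2"
  by (rule sigma_finite_measure_count_space)

lemma shift_measurable2 [measurable]: "(\<lambda>(k, x). x + lat k) \<in> borel_measurable (Z2 \<Otimes>\<^sub>M borel)"
  by (rule measurable_pair_measure_countable1) (auto simp: split_beta')

lemma shift_measurable2':
  assumes "sets \<mu> = sets borel" "f \<in> measurable borel N"
  shows "(\<lambda>(k, x). f (x + lat k)) \<in> measurable (Z2 \<Otimes>\<^sub>M \<mu>) N"
  using measurable_compose[OF shift_measurable2 assms(2)]
  unfolding measurable_cong_sets[OF sets_pair_measure_cong[OF refl assms(1)] refl]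
  by (simp add: split_beta')

lemma nn_integral_periodize:
  assumes s: "sets \<mu> = sets borel" and sf: "sigma_finite_measure \<mu>"
    and f[measurable]: "f \<in> borel_measurable borel"
  shows "(\<integral>\<^sup>+x. f x \<partial>periodize \<mu>) = (\<integral>\<^sup>+x. (\<integral>\<^sup>+k. f (x + lat k) \<partial>Z2) \<partial>\<mu>)"
proof -
  interpret sigma_finite_measure \<mu> by fact
  interpret pair_sigma_finite Z2 \<mu>
    by (intro pair_sigma_finite.intro sigma_finite_Z2 sf)
  have m: "(\<lambda>(k, x). x + lat k) \<in> measurable (Z2 \<Otimes>\<^sub>M \<mu>) borel"
    using shift_measurable2'[OF s measurable_ident] by (simp add: id_def)
  have "(\<integral>\<^sup>+x. f x \<partial>periodize \<mu>) = (\<integral>\<^sup>+(k,x). f (x + lat k) \<partial>(Z2 \<Otimes>\<^sub>M \<mu>))"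
    unfolding periodize_def by (subst nn_integral_distr[OF m]) (auto simp: split_beta')
  also have "\<dots> = (\<integral>\<^sup>+x. (\<integral>\<^sup>+k. f (x + lat k) \<partial>Z2) \<partial>\<mu>)"
    using nn_integral_snd[OF shift_measurable2'[OF s f]] by simp
  finally show ?thesis .
qed

lemma sets_periodize [simp]: "sets (periodize \<mu>) = sets borel"
  and space_periodize [simp]: "space (periodize \<mu>) = UNIV"
  by (simp_all add: periodize_def)

lemma nn_integral_Z2_uminus: "(\<integral>\<^sup>+k. g (- k) \<partial>Z2) = (\<integral>\<^sup>+k. g k \<partial>Z2)"
proof -
  have "bij_betw (\<lambda>k::int\<times>int. - k) UNIV UNIV"
    by (rule bij_betwI[where g = "\<lambda>k. - k"]) auto
  then show ?thesis by (rule nn_integral_bij_count_space)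
qed

lemma nn_integral_Z2_indicator_cell:
  "(\<integral>\<^sup>+k. indicator period_cell (x + lat k) \<partial>Z2) = 1"
proof -
  have "(\<integral>\<^sup>+k. indicator period_cell (x + lat k) \<partial>Z2) = (\<integral>\<^sup>+k. indicator {- floors x} k \<partial>Z2)"
    by (intro nn_integral_cong) (auto simp: indicator_def in_cell_lat_iff)
  also have "\<dots> = 1" by simp
  finally show ?thesis .
qed

lemma nn_integral_Z2_indicator_cell':
  "(\<integral>\<^sup>+k. indicator period_cell (x - lat k) \<partial>Z2) = 1"
  using nn_integral_Z2_uminus[of "\<lambda>k. indicator period_cell (x + lat k)"]
  by (simp add: nn_integral_Z2_indicator_cell lat_uminus)

definition on_cell :: "(real^2) measure \<Rightarrow> (real^2) measure" where
  "on_cell M = density M (indicator period_cell)"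

lemma torus_on_cell: "torus = on_cell lborel"
  by (simp add: torus_def on_cell_def)

lemma sets_on_cell [simp, measurable_cong]: "sets (on_cell M) = sets M"
  and space_on_cell [simp]: "space (on_cell M) = space M"
  by (simp_all add: on_cell_def)

lemma sets_torus [simp, measurable_cong]: "sets torus = sets borel"
  and space_torus [simp]: "space torus = UNIV"
  by (simp_all add: torus_def)

lemma nn_integral_on_cell:
  assumes "sets M = sets borel" "f \<in> borel_measurable borel"
  shows "(\<integral>\<^sup>+x. f x \<partial>on_cell M) = (\<integral>\<^sup>+x. indicator period_cell x * f x \<partial>M)"
  unfolding on_cell_def
  by (subst nn_integral_density)
     (use assms cell_borel in \<open>auto cong: measurable_cong_sets\<close>)

lemma AE_on_cell:
  assumes "sets M = sets borel"
  shows "AE x in on_cell M. x \<in> period_cell"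
  unfolding on_cell_def
  by (subst AE_density) (use assms cell_borel in \<open>auto simp: indicator_def cong: measurable_cong_sets\<close>)

text \<open>The lattice translates of the cell form a partition of unity. Inserting it, exchanging
  sum and integral, and moving each translate back by invariance of \<open>M\<close> puts the whole
  lattice sum on one cell.\<close>

lemma nn_integral_unfold:
  assumes s: "sets M = sets borel" and sf: "sigma_finite_measure M" and inv: "lat_invariant M"
    and f[measurable]: "f \<in> borel_measurable borel"
  shows "(\<integral>\<^sup>+x. f x \<partial>M) = (\<integral>\<^sup>+x. (\<integral>\<^sup>+k. f (x + lat k) \<partial>Z2) \<partial>on_cell M)"
proof -
  interpret sigma_finite_measure M by fact
  interpret pair_sigma_finite Z2 M
    by (intro pair_sigma_finite.intro sigma_finite_Z2 sf)
  note [measurable_cong] = s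
  have m1: "(\<lambda>(k, x). f x * indicator period_cell (x - lat k)) \<in> borel_measurable (Z2 \<Otimes>\<^sub>M M)"
    by (rule measurable_pair_measure_countable1) auto
  have m2: "(\<lambda>(k, x). indicator period_cell x * f (x + lat k)) \<in> borel_measurable (Z2 \<Otimes>\<^sub>M M)"
    by (rule measurable_pair_measure_countable1) auto
  have "(\<integral>\<^sup>+x. f x \<partial>M) = (\<integral>\<^sup>+x. f x * (\<integral>\<^sup>+k. indicator period_cell (x - lat k) \<partial>Z2) \<partial>M)"
    by (simp add: nn_integral_Z2_indicator_cell')
  also have "\<dots> = (\<integral>\<^sup>+x. (\<integral>\<^sup>+k. f x * indicator period_cell (x - lat k) \<partial>Z2) \<partial>M)"
    by (intro nn_integral_cong, subst nn_integral_cmult) auto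
  also have "\<dots> = (\<integral>\<^sup>+k. (\<integral>\<^sup>+x. f x * indicator period_cell (x - lat k) \<partial>M) \<partial>Z2)"
    using Fubini'[OF m1] .
  also have "\<dots> = (\<integral>\<^sup>+k. (\<integral>\<^sup>+x. indicator period_cell x * f (x + lat k) \<partial>M) \<partial>Z2)"
  proof (rule nn_integral_cong)
    fix k
    have "(\<integral>\<^sup>+x. f x * indicator period_cell (x - lat k) \<partial>M) =
        (\<integral>\<^sup>+x. f x * indicator period_cell (x - lat k) \<partial>distr M borel (\<lambda>x. x + lat k))"
      using inv by (simp add: lat_invariant_def)
    also have "\<dots> = (\<integral>\<^sup>+x. indicator period_cell x * f (x + lat k) \<partial>M)"
      by (subst nn_integral_distr) (auto simp: mult.commute)
    finally show "(\<integral>\<^sup>+x. f x * indicator period_cell (x - lat k) \<partial>M) =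
      (\<integral>\<^sup>+x. indicator period_cell x * f (x + lat k) \<partial>M)" .
  qed
  also have "\<dots> = (\<integral>\<^sup>+x. (\<integral>\<^sup>+k. indicator period_cell x * f (x + lat k) \<partial>Z2) \<partial>M)"
    using Fubini'[OF m2] by simp
  also have "\<dots> = (\<integral>\<^sup>+x. indicator period_cell x * (\<integral>\<^sup>+k. f (x + lat k) \<partial>Z2) \<partial>M)"
    by (intro nn_integral_cong, subst nn_integral_cmult) auto
  also have "\<dots> = (\<integral>\<^sup>+x. (\<integral>\<^sup>+k. f (x + lat k) \<partial>Z2) \<partial>on_cell M)"
  proof (rule nn_integral_on_cell[symmetric, OF s])
    have "(\<lambda>(x, k). f (x + lat k)) \<in> borel_measurable (borel \<Otimes>\<^sub>M Z2)"
      using measurable_pair_swap[OF shift_measurable2'[OF refl f]] by simp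
    then show "(\<lambda>x. \<integral>\<^sup>+k. f (x + lat k) \<partial>Z2) \<in> borel_measurable borel"
      by (rule M1.borel_measurable_nn_integral)
  qed
  finally show ?thesis .
qed

lemma sigma_finite_on_cell:
  assumes s: "sets M = sets borel" and sf: "sigma_finite_measure M"
  shows "sigma_finite_measure (on_cell M)"
proof -
  have "on_cell M = density M (\<lambda>x. ennreal (indicator period_cell x))"
    by (simp add: on_cell_def ennreal_indicator)
  moreover have "sigma_finite_measure (density M (\<lambda>x. ennreal (indicator period_cell x)))"
    using sf by (subst sigma_finite_measure.sigma_finite_iff_density_finite)
      (use s cell_borel in \<open>auto cong: measurable_cong_sets\<close>)
  ultimately show ?thesis by simp
qed

text \<open>An invariant measure is recovered from its restriction to the cell, because
  \<open>nn_integral_periodize\<close> and \<open>nn_integral_unfold\<close> produce the same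
  iterated integral.\<close>

lemma periodize_on_cell:
  assumes s: "sets M = sets borel" and sf: "sigma_finite_measure M" and inv: "lat_invariant M"
  shows "periodize (on_cell M) = M"
proof (rule measure_eqI)
  show "sets (periodize (on_cell M)) = sets M" by (simp add: s)
  fix A assume "A \<in> sets (periodize (on_cell M))"
  then have A: "A \<in> sets borel" by simp
  have "emeasure (periodize (on_cell M)) A = (\<integral>\<^sup>+x. indicator A x \<partial>periodize (on_cell M))"
    using A by simp
  also have "\<dots> = (\<integral>\<^sup>+x. (\<integral>\<^sup>+k. indicator A (x + lat k) \<partial>Z2) \<partial>on_cell M)"
    using A s sf by (intro nn_integral_periodize sigma_finite_on_cell) auto
  also have "\<dots> = (\<integral>\<^sup>+x. indicator A x \<partial>M)"
    using A s sf inv by (intro nn_integral_unfold[symmetric]) auto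
  also have "\<dots> = emeasure M A" using A s by simp
  finally show "emeasure (periodize (on_cell M)) A = emeasure M A" .
qed

lemma lat_invariant_lborel: "lat_invariant lborel"
proof -
  have "(\<lambda>x. x + lat k) = (+) (lat k)" for k by auto
  then show ?thesis by (simp add: lat_invariant_def lborel_distr_plus)
qed

lemma periodize_torus: "periodize torus = lborel"
  unfolding torus_on_cell
  by (rule periodize_on_cell) (auto simp: lat_invariant_lborel lborel.sigma_finite_measure_axioms)

lemma nn_integral_torus:
  assumes "f \<in> borel_measurable borel"
  shows "(\<integral>\<^sup>+x. f x \<partial>torus) = (\<integral>\<^sup>+x. indicator period_cell x * f x \<partial>lborel)"
  unfolding torus_on_cell by (rule nn_integral_on_cell) (use assms in auto)

text \<open>After the substitution the integral extends over a shifted cell. Unfolding it produces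
  the lattice sum of the indicators of that shifted cell, which is again 1, while the integrand
  depends on the fractional part only.\<close>

lemma torus_translate:
  "distr torus borel (\<lambda>x. fracs (x + c)) = torus"
proof (rule measure_eqI)
  show "sets (distr torus borel (\<lambda>x. fracs (x + c))) = sets torus" by simp
  fix A assume "A \<in> sets (distr torus borel (\<lambda>x. fracs (x + c)))"
  then have A[measurable]: "A \<in> sets borel" by simp
  have m: "(\<lambda>x. fracs (x + c)) \<in> measurable torus borel" by measurable
  have p: "(\<integral>\<^sup>+k. indicator period_cell (x + lat k - c) * indicator A (fracs (x + lat k)) \<partial>Z2)
      = indicator A (fracs x)" for x
  proof -
    have "(\<integral>\<^sup>+k. indicator period_cell (x + lat k - c) * indicator A (fracs (x + lat k)) \<partial>Z2) =
       (\<integral>\<^sup>+k. indicator period_cell ((x - c) + lat k) \<partial>Z2) * indicator A (fracs x)"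
      by (subst nn_integral_multc[symmetric]) (auto simp: algebra_simps)
    then show ?thesis by (simp add: nn_integral_Z2_indicator_cell)
  qed
  have "emeasure (distr torus borel (\<lambda>x. fracs (x + c))) A =
     (\<integral>\<^sup>+x. indicator A x \<partial>distr torus borel (\<lambda>x. fracs (x + c)))" by simp
  also have "\<dots> = (\<integral>\<^sup>+x. indicator A (fracs (x + c)) \<partial>torus)"
    by (subst nn_integral_distr[OF m]) auto
  also have "\<dots> = (\<integral>\<^sup>+x. indicator period_cell x * indicator A (fracs (x + c)) \<partial>lborel)"
    by (subst nn_integral_torus) auto
  also have "\<dots> = (\<integral>\<^sup>+x. indicator period_cell x * indicator A (fracs (x + c)) \<partial>distr lborel borel ((+) (- c)))"
    by (simp add: lborel_distr_plus)
  also have "\<dots> = (\<integral>\<^sup>+x. indicator period_cell (x - c) * indicator A (fracs x) \<partial>lborel)"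
    by (subst nn_integral_distr) auto
  also have "\<dots> = (\<integral>\<^sup>+x. (\<integral>\<^sup>+k. indicator period_cell (x + lat k - c) * indicator A (fracs (x + lat k)) \<partial>Z2) \<partial>torus)"
    unfolding torus_on_cell
    by (rule nn_integral_unfold) (auto simp: lat_invariant_lborel lborel.sigma_finite_measure_axioms)
  also have "\<dots> = (\<integral>\<^sup>+x. indicator A (fracs x) \<partial>torus)" by (rule nn_integral_cong) (rule p)
  also have "\<dots> = (\<integral>\<^sup>+x. indicator A x \<partial>torus)"
  proof (rule nn_integral_cong_AE)
    have "AE x in torus. x \<in> period_cell" unfolding torus_on_cell by (rule AE_on_cell) simp
    then show "AE x in torus. (indicator A (fracs x) :: ennreal) = indicator A x"
      by eventually_elim (simp add: fracs_cell)
  qed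
  also have "\<dots> = emeasure torus A" by simp
  finally show "emeasure (distr torus borel (\<lambda>x. fracs (x + c))) A = emeasure torus A" .
qed

lemma integral_torus_translate:
  fixes f :: "real^2 \<Rightarrow> 'b::{banach, second_countable_topology}"
  assumes p: "periodic f" and [measurable]: "f \<in> borel_measurable borel"
  shows "(LINT x|torus. f (x + c)) = (LINT x|torus. f x)"
proof -
  have "(LINT x|torus. f x) = (\<integral>x. f x \<partial>distr torus borel (\<lambda>x. fracs (x + c)))"
    by (simp add: torus_translate)
  also have "\<dots> = (LINT x|torus. f (fracs (x + c)))"
    by (subst integral_distr) auto
  finally show ?thesis using p by (simp add: periodic_fracs)
qed

lemma AE_torus: "AE x in torus. x \<in> period_cell"
  unfolding torus_on_cell by (rule AE_on_cell) simp

lemma emeasure_torus_UNIV: "emeasure torus UNIV = 1"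
proof -
  have "emeasure torus UNIV = emeasure lborel period_cell"
    by (simp add: torus_def emeasure_density)
  also have "\<dots> = 1"
  proof (rule antisym)
    have "emeasure lborel period_cell \<le> emeasure lborel (cbox 0 (vector [1, 1] :: real^2))"
      by (intro emeasure_mono) (auto simp: period_cell_def mem_box_cart forall_2 less_imp_le)
    also have "\<dots> = 1"
      by (subst emeasure_lborel_cbox) (auto simp: Basis_vec_def UNIV_2 inner_axis axis_eq_axis)
    finally show "emeasure lborel period_cell \<le> 1" .
    have "1 = emeasure lborel (box 0 (vector [1, 1] :: real^2))"
      by (subst emeasure_lborel_box) (auto simp: Basis_vec_def UNIV_2 inner_axis axis_eq_axis)
    also have "\<dots> \<le> emeasure lborel period_cell"
      by (intro emeasure_mono) (auto simp: period_cell_def mem_box_cart forall_2 less_imp_le)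
    finally show "1 \<le> emeasure lborel period_cell" .
  qed
  finally show ?thesis .
qed

lemma prob_space_torus: "prob_space torus"
  by (rule prob_spaceI) (simp add: emeasure_torus_UNIV)

text \<open>Only lattice vectors of norm at most \<open>R + norm x\<close> contribute. The range of
  summation can thus be chosen uniformly for \<open>x\<close> in a bounded set.\<close>

lemma fold_sum_eq:
  assumes R: "\<And>x. norm x > R \<Longrightarrow> \<phi> x = 0" and n: "real_of_int n \<ge> R + norm x"
  shows "fold_sum \<phi> x = (\<Sum>k\<in>{-n..n} \<times> {-n..n}. \<phi> (x + lat k))"
    and "integrable Z2 (\<lambda>k. \<phi> (x + lat k))"
    and "\<And>k. k \<notin> {-n..n} \<times> {-n..n} \<Longrightarrow> \<phi> (x + lat k) = 0"
proof -
  show z: "\<phi> (x + lat k) = 0" if k: "k \<notin> {-n..n} \<times> {-n..n}" for k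
  proof (rule R, rule ccontr)
    assume "\<not> norm (x + lat k) > R"
    then have "norm (lat k) \<le> R + norm x"
      using norm_triangle_ineq4[of "x + lat k" x] by auto
    then have "\<bar>lat k $ 1\<bar> \<le> R + norm x" "\<bar>lat k $ 2\<bar> \<le> R + norm x"
      using component_le_norm_cart[of "lat k"] order_trans by blast+
    with n have "\<bar>real_of_int (fst k)\<bar> \<le> of_int n" "\<bar>real_of_int (snd k)\<bar> \<le> of_int n" by auto
    with k show False by (cases k) auto
  qed
  have fin: "finite {k. \<phi> (x + lat k) \<noteq> 0}"
    by (rule finite_subset[of _ "{-n..n} \<times> {-n..n}"]) (use z in auto)
  have "fold_sum \<phi> x = (\<Sum>k | k \<in> UNIV \<and> \<phi> (x + lat k) \<noteq> 0. \<phi> (x + lat k))"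
    unfolding fold_sum_def by (rule lebesgue_integral_count_space_finite_support) (use fin in auto)
  also have "\<dots> = (\<Sum>k\<in>{-n..n} \<times> {-n..n}. \<phi> (x + lat k))"
    by (rule sum.mono_neutral_left) (use z in auto)
  finally show "fold_sum \<phi> x = (\<Sum>k\<in>{-n..n} \<times> {-n..n}. \<phi> (x + lat k))" .
  have "integrable Z2 (\<lambda>k. \<Sum>l\<in>{-n..n} \<times> {-n..n}. indicator {l} k *\<^sub>R \<phi> (x + lat l))"
    by (intro Bochner_Integration.integrable_sum integrable_scaleR_left integrable_real_indicator) auto
  also have "(\<lambda>k. \<Sum>l\<in>{-n..n} \<times> {-n..n}. indicator {l} k *\<^sub>R \<phi> (x + lat l)) = (\<lambda>k. \<phi> (x + lat k))"
  proof
    fix k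
    have "(\<Sum>l\<in>{-n..n} \<times> {-n..n}. indicator {l} k *\<^sub>R \<phi> (x + lat l)) =
        (\<Sum>l\<in>{-n..n} \<times> {-n..n}. if l = k then \<phi> (x + lat l) else 0)"
      by (intro sum.cong) (auto simp: indicator_def)
    also have "\<dots> = \<phi> (x + lat k)"
      using z[of k] by (simp add: sum.delta)
    finally show "(\<Sum>l\<in>{-n..n} \<times> {-n..n}. indicator {l} k *\<^sub>R \<phi> (x + lat l)) = \<phi> (x + lat k)" .
  qed
  finally show "integrable Z2 (\<lambda>k. \<phi> (x + lat k))" .
qed

lemma periodic_fold_sum: "periodic (fold_sum \<phi>)"
proof -
  have "fold_sum \<phi> (x + lat l) = fold_sum \<phi> x" for l x
  proof -
    have "bij_betw (\<lambda>k::int\<times>int. k + l) UNIV UNIV"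
      by (rule bij_betwI[where g = "\<lambda>k. k - l"]) auto
    from integral_bij_count_space[OF this, of "\<lambda>k. \<phi> (x + lat k)"]
    show ?thesis by (simp add: fold_sum_def lat_add algebra_simps)
  qed
  then show ?thesis by (simp add: periodic_def)
qed

lemma continuous_fold_sum:
  assumes R: "\<And>x. norm x > R \<Longrightarrow> \<phi> x = 0" and c: "continuous_on UNIV \<phi>"
  shows "continuous_on UNIV (fold_sum \<phi>)"
proof -
  have "isCont (fold_sum \<phi>) x" for x
  proof -
    \<comment> \<open>One range of summation for the whole unit ball around \<open>x\<close>; there
      the lattice sum is a fixed finite sum of continuous functions.\<close>
    define n where "n = \<lceil>R + (norm x + 1)\<rceil>"
    have n: "real_of_int n \<ge> R + norm y" if "y \<in> ball x 1" for y
      using that norm_triangle_ineq2[of y x] unfolding n_def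
      by (simp add: dist_norm norm_minus_commute) linarith
    have "continuous_on (ball x 1) (\<lambda>y. \<Sum>k\<in>{-n..n} \<times> {-n..n}. \<phi> (y + lat k))"
      by (intro continuous_intros continuous_on_compose2[OF c]) auto
    moreover have "fold_sum \<phi> y = (\<Sum>k\<in>{-n..n} \<times> {-n..n}. \<phi> (y + lat k))" if "y \<in> ball x 1" for y
      using R n[OF that] by (rule fold_sum_eq(1))
    ultimately have "continuous_on (ball x 1) (fold_sum \<phi>)"
      by (subst continuous_on_cong[OF refl])
    then show ?thesis by (simp add: continuous_on_eq_continuous_at)
  qed
  then show ?thesis by (simp add: continuous_at_imp_continuous_on)
qed

lemma norm_cell: "x \<in> period_cell \<Longrightarrow> norm x \<le> 2"
proof -
  assume "x \<in> period_cell"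
  then have "\<bar>x $ 1\<bar> \<le> 1" "\<bar>x $ 2\<bar> \<le> 1" by (auto simp: period_cell_def less_imp_le)
  then show ?thesis using norm_le_l1_cart[of x] by (simp add: sum_2)
qed

text \<open>Periodicity pulls \<open>f\<close> out of the lattice sum, which then acts on the test
  function alone. This is the passage between test functions on the plane and periodic test
  functions on the cell.\<close>

lemma periodize_integral:
  fixes f :: "real^2 \<Rightarrow> 'b::euclidean_space"
  assumes s: "sets \<mu> = sets borel" and fin: "sigma_finite_measure \<mu>"
    and cell: "AE x in \<mu>. x \<in> period_cell"
    and R: "\<And>x. norm x > R \<Longrightarrow> \<phi> x = 0" and c: "continuous_on UNIV \<phi>"
    and f[measurable]: "f \<in> borel_measurable borel" and p: "periodic f" and i: "integrable \<mu> f"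
  shows "integrable (periodize \<mu>) (\<lambda>x. \<phi> x *\<^sub>R f x)"
    and "(\<integral>x. \<phi> x *\<^sub>R f x \<partial>periodize \<mu>) = (LINT x|\<mu>. fold_sum \<phi> x *\<^sub>R f x)"
proof -
  interpret sigma_finite_measure \<mu> by fact
  interpret Z: sigma_finite_measure Z2 by (rule sigma_finite_Z2)
  interpret pair_sigma_finite \<mu> Z2
    by (intro pair_sigma_finite.intro sigma_finite_Z2 fin)
  note [measurable_cong] = s
  have \<phi>[measurable]: "\<phi> \<in> borel_measurable borel"
    using c by (rule borel_measurable_continuous_onI)
  define g where "g = (\<lambda>x. \<phi> x *\<^sub>R f x)"
  have g[measurable]: "g \<in> borel_measurable borel" unfolding g_def by measurable
  have m: "(\<lambda>(k, x). x + lat k) \<in> measurable (Z2 \<Otimes>\<^sub>M \<mu>) borel"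
    using shift_measurable2'[OF s measurable_ident] by (simp add: id_def)
  have gm: "(\<lambda>(x, k). g (x + lat k)) \<in> borel_measurable (\<mu> \<Otimes>\<^sub>M Z2)"
    using measurable_pair_swap[OF shift_measurable2'[OF s g]] by simp
  obtain B where B: "\<And>x. \<bar>\<phi> x\<bar> \<le> B" "B \<ge> 0"
  proof -
    have "compact (\<phi> ` cball 0 R)"
      by (intro compact_continuous_image continuous_on_subset[OF c]) auto
    then obtain B where "\<And>y. y \<in> \<phi> ` cball 0 R \<Longrightarrow> norm y \<le> B" "B > 0"
      using compact_imp_bounded bounded_pos by metis
    then have "\<bar>\<phi> x\<bar> \<le> B" for x
      using R[of x] by (cases "norm x > R") auto
    then show thesis using \<open>B > 0\<close> by (intro that[of B]) auto
  qed
  \<comment> \<open>Points of the cell have norm at most 2, so these lattice vectors suffice on the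
    whole cell. Their number bounds the terms of each lattice sum and gives the dominating function
    for Fubini.\<close>
  define n where "n = \<lceil>R + 2\<rceil>"
  define K where "K = {-n..n} \<times> {-n..n}"
  have n: "real_of_int n \<ge> R + norm x" if "x \<in> period_cell" for x
    using norm_cell[OF that] unfolding n_def by linarith
  note fs = fold_sum_eq[OF R n]
  have gk: "g (x + lat k) = \<phi> (x + lat k) *\<^sub>R f x" for x k
    by (simp add: g_def periodicD[OF p])
  have int: "integrable (\<mu> \<Otimes>\<^sub>M Z2) (\<lambda>(x, k). g (x + lat k))"
  proof (rule Fubini_integrable[OF gm])
    show "AE x in \<mu>. integrable Z2 (\<lambda>y. case (x, y) of (x, k) \<Rightarrow> g (x + lat k))"
      using cell
    proof eventually_elim
      case (elim x)
      show ?case using fs(2)[OF _ elim] by (auto simp: gk intro!: integrable_scaleR_left)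
    qed
    show "integrable \<mu> (\<lambda>x. LINT y|Z2. norm (case (x, y) of (x, k) \<Rightarrow> g (x + lat k)))"
    proof (rule Bochner_Integration.integrable_bound[where f = "\<lambda>x. (B * card K) *\<^sub>R f x"])
      show "integrable \<mu> (\<lambda>x. (B * card K) *\<^sub>R f x)" using i by simp
      show "(\<lambda>x. LINT y|Z2. norm (case (x, y) of (x, k) \<Rightarrow> g (x + lat k))) \<in> borel_measurable \<mu>"
        using gm by (intro Z.borel_measurable_lebesgue_integral) (simp add: split_beta')
      show "AE x in \<mu>. norm (LINT y|Z2. norm (case (x, y) of (x, k) \<Rightarrow> g (x + lat k)))
          \<le> norm ((B * card K) *\<^sub>R f x)"
        using cell
      proof eventually_elim
        case (elim x)
        have "(LINT k|Z2. norm (g (x + lat k))) = fold_sum (\<lambda>x. \<bar>\<phi> x\<bar>) x * norm (f x)"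
          by (simp add: gk fold_sum_def)
        also have "fold_sum (\<lambda>x. \<bar>\<phi> x\<bar>) x = (\<Sum>k\<in>K. \<bar>\<phi> (x + lat k)\<bar>)"
          unfolding K_def by (rule fold_sum_eq(1)[OF _ n[OF elim]]) (use R in auto)
        also have "\<dots> \<le> real (card K) * B"
          by (rule sum_bounded_above) (rule B)
        finally have "(LINT k|Z2. norm (g (x + lat k))) \<le> real (card K) * B * norm (f x)"
          by (simp add: mult_right_mono)
        moreover have "0 \<le> (LINT k|Z2. norm (g (x + lat k)))" by simp
        ultimately show ?case using B by (simp add: mult_ac)
      qed
    qed
  qed
  have int': "integrable (Z2 \<Otimes>\<^sub>M \<mu>) (\<lambda>(k, x). g (x + lat k))"
    using integrable_product_swap[OF int] by (simp add: split_beta')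
  show "integrable (periodize \<mu>) (\<lambda>x. \<phi> x *\<^sub>R f x)"
    using int' unfolding periodize_def g_def
    by (subst integrable_distr_eq[OF m]) (auto simp: split_beta')
  have "(\<integral>x. \<phi> x *\<^sub>R f x \<partial>periodize \<mu>) = (\<integral>(k, x). g (x + lat k) \<partial>(Z2 \<Otimes>\<^sub>M \<mu>))"
    unfolding periodize_def g_def
    by (subst integral_distr[OF m]) (auto simp: split_beta')
  also have "\<dots> = (\<integral>(x, k). g (x + lat k) \<partial>(\<mu> \<Otimes>\<^sub>M Z2))"
    using integral_product_swap[of "\<lambda>(x, k). g (x + lat k)"] gm by (simp add: split_beta')
  also have "\<dots> = (\<integral>x. \<integral>k. g (x + lat k) \<partial>Z2 \<partial>\<mu>)"
    using integral_fst'[OF int] by simp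
  also have "\<dots> = (LINT x|\<mu>. fold_sum \<phi> x *\<^sub>R f x)"
  proof (rule integral_cong_AE)
    show "(\<lambda>x. LINT k|Z2. g (x + lat k)) \<in> borel_measurable \<mu>"
      using gm by (intro Z.borel_measurable_lebesgue_integral) (simp add: split_beta')
    have "fold_sum \<phi> \<in> borel_measurable borel"
      using continuous_fold_sum[OF R c] by (rule borel_measurable_continuous_onI)
    then show "(\<lambda>x. fold_sum \<phi> x *\<^sub>R f x) \<in> borel_measurable \<mu>" by measurable
    show "AE x in \<mu>. (LINT k|Z2. g (x + lat k)) = fold_sum \<phi> x *\<^sub>R f x"
      using cell
    proof eventually_elim
      case (elim x)
      have "integrable Z2 (\<lambda>k. \<phi> (x + lat k))"
        using R n[OF elim] by (rule fold_sum_eq(2))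
      then show ?case by (simp add: gk fold_sum_def)
    qed
  qed
  finally show "(\<integral>x. \<phi> x *\<^sub>R f x \<partial>periodize \<mu>) = (LINT x|\<mu>. fold_sum \<phi> x *\<^sub>R f x)" .
qed

section \<open>Weak compactness on the torus\<close>

text \<open>Interleaving the binary digits of the two coordinates into base-8 digits from \<open>{0..3}\<close> embeds the cell
  into the line with uniformly continuous inverse. This transports Helly's selection theorem to the torus.\<close>

definition digit :: "nat \<Rightarrow> real^2 \<Rightarrow> int" where
  "digit k x = \<lfloor>2 ^ Suc k * x $ 1\<rfloor> mod 2 + 2 * (\<lfloor>2 ^ Suc k * x $ 2\<rfloor> mod 2)"

definition code :: "real^2 \<Rightarrow> real" where
  "code x = (\<Sum>k. real_of_int (digit k x) / 8 ^ k)"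

lemma digit_range: "0 \<le> digit k x" "digit k x \<le> 3"
  unfolding digit_def
  using pos_mod_bound[of 2 "\<lfloor>2 ^ Suc k * x $ 1\<rfloor>"] pos_mod_bound[of 2 "\<lfloor>2 ^ Suc k * x $ 2\<rfloor>"]
    pos_mod_sign[of 2 "\<lfloor>2 ^ Suc k * x $ 1\<rfloor>"] pos_mod_sign[of 2 "\<lfloor>2 ^ Suc k * x $ 2\<rfloor>"]
  by linarith+

lemma summable_geom8: "summable (\<lambda>k. c * (1 / 8 :: real) ^ k)"
  by (intro summable_mult summable_geometric) auto

lemma suminf_geom8: "(\<Sum>k. c * (1 / 8 :: real) ^ k) = c * 8 / 7"
  by (subst suminf_mult) (auto simp: suminf_geometric intro!: summable_geometric)

lemma summable_digit: "summable (\<lambda>k. real_of_int (digit k x) / 8 ^ k)"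
  by (rule summable_comparison_test[OF _ summable_geom8[of 3]])
     (use digit_range[of _ x] in \<open>auto simp: power_one_over field_simps\<close>)

lemma code_range: "0 \<le> code x" "code x \<le> 4"
proof -
  show "0 \<le> code x"
    unfolding code_def by (intro suminf_nonneg summable_digit) (simp add: digit_range)
  have "code x \<le> (\<Sum>k. 3 * (1 / 8 :: real) ^ k)"
    unfolding code_def
    by (intro suminf_le summable_digit summable_geom8)
       (use digit_range[of _ x] in \<open>auto simp: power_one_over field_simps\<close>)
  then show "code x \<le> 4" by (simp add: suminf_geom8)
qed

lemma code_measurable [measurable]: "code \<in> borel_measurable borel"
  unfolding code_def[abs_def] digit_def by measurable

text \<open>The first different digit contributes at least 8^-m, while all later ones together
  contribute at most the sum of 3 * 8^-k over k > m, which is 3/7 * 8^-m; a gap of 4/7 * 8^-m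
  remains. In base 4 the same digits would leave no gap.\<close>

lemma code_separates:
  assumes "digit m x \<noteq> digit m y" "\<And>j. j < m \<Longrightarrow> digit j x = digit j y"
  shows "4 / 7 / 8 ^ m \<le> \<bar>code x - code y\<bar>"
proof -
  define f where "f k = real_of_int (digit k x - digit k y) / 8 ^ k" for k
  have f_bound: "\<bar>f k\<bar> \<le> 3 * (1 / 8) ^ k" for k
  proof -
    have "\<bar>real_of_int (digit k x - digit k y)\<bar> \<le> 3"
      using digit_range[of k x] digit_range[of k y] by linarith
    then have "\<bar>real_of_int (digit k x - digit k y)\<bar> / 8 ^ k \<le> 3 / 8 ^ k"
      by (rule divide_right_mono) simp
    then show ?thesis by (simp add: f_def abs_divide power_one_over)
  qed
  have sf: "summable f"
    by (rule summable_comparison_test[OF _ summable_geom8[of 3]]) (use f_bound in auto)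
  have "code x - code y = (\<Sum>k. f k)"
    unfolding code_def f_def
    by (subst suminf_diff) (auto simp: summable_digit diff_divide_distrib)
  also have "\<dots> = (\<Sum>k. f (k + Suc m)) + (\<Sum>k<Suc m. f k)"
    by (rule suminf_split_initial_segment[OF sf])
  also have "(\<Sum>k<Suc m. f k) = f m"
    using assms(2) by (simp add: f_def)
  finally have *: "code x - code y = (\<Sum>k. f (k + Suc m)) + f m" .
  have b: "\<bar>f (k + Suc m)\<bar> \<le> (3 * (1 / 8) ^ Suc m) * (1 / 8) ^ k" for k
    using f_bound[of "k + Suc m"] by (simp add: power_add mult_ac)
  have sfa: "summable (\<lambda>k. \<bar>f (k + Suc m)\<bar>)"
    by (rule summable_comparison_test[OF _ summable_geom8[of "3 * (1 / 8) ^ Suc m"]]) (use b in auto)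
  have "\<bar>\<Sum>k. f (k + Suc m)\<bar> \<le> (\<Sum>k. \<bar>f (k + Suc m)\<bar>)"
    by (rule summable_rabs[OF sfa])
  also have "\<dots> \<le> (\<Sum>k. (3 * (1 / 8) ^ Suc m) * (1 / 8) ^ k)"
    by (intro suminf_le sfa summable_geom8 b)
  also have "\<dots> = 3 / 7 / 8 ^ m"
    by (subst suminf_geom8) (simp add: power_one_over)
  finally have t: "\<bar>\<Sum>k. f (k + Suc m)\<bar> \<le> 3 / 7 / 8 ^ m" .
  have "1 \<le> \<bar>real_of_int (digit m x - digit m y)\<bar>"
    using assms(1) by linarith
  then have "1 / 8 ^ m \<le> \<bar>f m\<bar>"
    by (simp add: f_def abs_divide divide_right_mono)
  moreover have "1 / 8 ^ m = 3 / 7 / 8 ^ m + 4 / 7 / (8::real) ^ m"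
    by (simp add: field_simps)
  ultimately show ?thesis using t * by linarith
qed

lemma floor_double: "\<lfloor>2 * (y::real)\<rfloor> = 2 * \<lfloor>y\<rfloor> + \<lfloor>2 * y\<rfloor> mod 2"
proof -
  have "\<lfloor>2 * y\<rfloor> div 2 = \<lfloor>y\<rfloor>"
    using floor_divide_real_eq_div[of 2 "2 * y"] by simp
  then show ?thesis by presburger
qed

text \<open>On the cell all integer parts vanish, which starts the induction; each further digit
  records the parities of the next pair of dyadic floors. Equal digits up to \<open>m\<close> thus
  mean the same dyadic square of side 2^-m.\<close>

lemma digits_floor:
  assumes "\<And>j. j < m \<Longrightarrow> digit j x = digit j y" "x \<in> period_cell" "y \<in> period_cell"
  shows "\<lfloor>2 ^ m * x $ 1\<rfloor> = \<lfloor>2 ^ m * y $ 1\<rfloor> \<and> \<lfloor>2 ^ m * x $ 2\<rfloor> = \<lfloor>2 ^ m * y $ 2\<rfloor>"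
  using assms(1)
proof (induction m)
  case 0
  have "\<lfloor>x $ 1\<rfloor> = 0" "\<lfloor>y $ 1\<rfloor> = 0" "\<lfloor>x $ 2\<rfloor> = 0" "\<lfloor>y $ 2\<rfloor> = 0"
    using assms(2,3) by (auto simp: period_cell_def floor_eq_iff)
  then show ?case by simp
next
  case (Suc m)
  have IH: "\<lfloor>2 ^ m * x $ 1\<rfloor> = \<lfloor>2 ^ m * y $ 1\<rfloor>" "\<lfloor>2 ^ m * x $ 2\<rfloor> = \<lfloor>2 ^ m * y $ 2\<rfloor>"
    using Suc by auto
  have aux: "a mod 2 + 2 * (b mod 2) = c mod 2 + 2 * (d mod 2) \<Longrightarrow> a mod 2 = c mod 2 \<and> b mod 2 = d mod 2"
    for a b c d :: int by presburger
  have "digit m x = digit m y" using Suc.prems by simp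
  then have "\<lfloor>2 ^ Suc m * x $ 1\<rfloor> mod 2 = \<lfloor>2 ^ Suc m * y $ 1\<rfloor> mod 2"
     "\<lfloor>2 ^ Suc m * x $ 2\<rfloor> mod 2 = \<lfloor>2 ^ Suc m * y $ 2\<rfloor> mod 2"
    unfolding digit_def using aux by blast+
  moreover have "\<lfloor>2 ^ Suc m * z\<rfloor> = 2 * \<lfloor>2 ^ m * z\<rfloor> + \<lfloor>2 ^ Suc m * z\<rfloor> mod 2" for z :: real
    using floor_double[of "2 ^ m * z"] by (simp add: mult.assoc)
  ultimately show ?case using IH by metis
qed

lemma floor_eq_dist:
  assumes "\<lfloor>2 ^ m * a\<rfloor> = \<lfloor>2 ^ m * (b::real)\<rfloor>" shows "\<bar>a - b\<bar> \<le> 1 / 2 ^ m"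
proof -
  have "\<bar>2 ^ m * a - 2 ^ m * b\<bar> \<le> 1"
    using assms by linarith
  then have "2 ^ m * \<bar>a - b\<bar> \<le> 1"
    by (simp add: abs_mult flip: right_diff_distrib)
  then show ?thesis by (simp add: field_simps)
qed

text \<open>Codes closer than the gap at level \<open>m\<close> share their first \<open>m\<close>
  digits, hence the points share a dyadic square. The estimate is quantitative so that it gives
  uniform continuity of the inverse.\<close>

lemma code_inverse:
  assumes xy: "x \<in> period_cell" "y \<in> period_cell" and c: "\<bar>code x - code y\<bar> < 4 / 7 / 8 ^ m"
  shows "dist x y \<le> 2 / 2 ^ m"
proof -
  have "digit j x = digit j y" if "j < m" for j
    using that
  proof (induction j rule: less_induct)
    case (less j)
    show ?case
    proof (rule ccontr)
      assume "digit j x \<noteq> digit j y"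
      then have "4 / 7 / 8 ^ j \<le> \<bar>code x - code y\<bar>"
        by (rule code_separates) (use less in auto)
      moreover have "4 / 7 / 8 ^ m \<le> 4 / 7 / (8::real) ^ j"
        using less.prems by (intro divide_left_mono power_increasing) auto
      ultimately show False using c by linarith
    qed
  qed
  from digits_floor[OF this xy] have "\<bar>x $ 1 - y $ 1\<bar> \<le> 1 / 2 ^ m" "\<bar>x $ 2 - y $ 2\<bar> \<le> 1 / 2 ^ m"
    by (auto intro: floor_eq_dist)
  moreover have "dist x y \<le> \<bar>x $ 1 - y $ 1\<bar> + \<bar>x $ 2 - y $ 2\<bar>"
    using norm_le_l1_cart[of "x - y"] by (simp add: dist_norm sum_2)
  ultimately show ?thesis by simp
qed

text \<open>The inverse of \<open>code\<close> is uniformly continuous on its range, so it extends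
  to the closure of the range, and from this closed set to the line by Tietze's theorem.\<close>

lemma decode_exists:
  obtains \<psi> :: "real \<Rightarrow> real^2" where "continuous_on UNIV \<psi>" "\<And>x. x \<in> period_cell \<Longrightarrow> \<psi> (code x) = x"
proof -
  define s where "s = inv_into period_cell code"
  have inj: "inj_on code period_cell"
  proof (rule inj_onI)
    fix x y assume xy: "x \<in> period_cell" "y \<in> period_cell" "code x = code y"
    then have "dist x y \<le> 2 / 2 ^ m" for m by (intro code_inverse) auto
    then have "dist x y \<le> 2 * (1/2) ^ m" for m by (simp add: power_one_over)
    moreover have "(\<lambda>m. 2 * (1/2::real) ^ m) \<longlonglongrightarrow> 2 * 0"
      by (intro tendsto_intros LIMSEQ_realpow_zero) auto
    ultimately have "dist x y \<le> 2 * 0" by (metis LIMSEQ_le_const)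
    then show "x = y" by simp
  qed
  have s: "s (code x) = x" if "x \<in> period_cell" for x
    unfolding s_def using inj that by simp
  have uc: "uniformly_continuous_on (code ` period_cell) s"
    unfolding uniformly_continuous_on_def
  proof (intro allI impI)
    fix e :: real assume "e > 0"
    then obtain m where m: "(1/2::real) ^ m < e / 2"
      using real_arch_pow_inv[of "e/2" "1/2"] by auto
    show "\<exists>d>0. \<forall>x\<in>code ` period_cell. \<forall>x'\<in>code ` period_cell. dist x' x < d \<longrightarrow> dist (s x') (s x) < e"
    proof (intro exI[of _ "4 / 7 / 8 ^ m"] conjI ballI impI)
      fix a b assume "a \<in> code ` period_cell" "b \<in> code ` period_cell" "dist b a < 4 / 7 / 8 ^ m"
      then obtain x y where xy: "x \<in> period_cell" "y \<in> period_cell" "a = code x" "b = code y"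
        "\<bar>code y - code x\<bar> < 4 / 7 / 8 ^ m" by (auto simp: dist_real_def)
      have "dist y x \<le> 2 / 2 ^ m" by (rule code_inverse) (use xy in auto)
      also have "\<dots> < e" using m by (simp add: power_one_over)
      finally show "dist (s b) (s a) < e" by (simp add: xy s)
    qed auto
  qed
  obtain g where g: "uniformly_continuous_on (closure (code ` period_cell)) g"
      "\<And>x. x \<in> code ` period_cell \<Longrightarrow> s x = g x"
    using uniformly_continuous_on_extension_on_closure[OF uc] by metis
  have "continuous_on (closure (code ` period_cell)) g"
    using g(1) by (rule uniformly_continuous_imp_continuous)
  then obtain \<psi> where "continuous_on UNIV \<psi>" "\<And>x. x \<in> closure (code ` period_cell) \<Longrightarrow> \<psi> x = g x"
    using Tietze_unbounded[of "closure (code ` period_cell)" g UNIV] closedin_closed_Int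
    by (metis closed_closedin closed_closure subtopology_UNIV)
  moreover have "\<psi> (code x) = x" if "x \<in> period_cell" for x
  proof -
    have "code x \<in> closure (code ` period_cell)" using closure_subset that by fast
    then show ?thesis using calculation(2) g(2) s that by force
  qed
  ultimately show thesis using that by blast
qed

section \<open>Periodic test functions and weak compactness of densities\<close>

definition cper :: "(real^2 \<Rightarrow> real) \<Rightarrow> bool" where
  "cper \<phi> \<longleftrightarrow> continuous_on UNIV \<phi> \<and> periodic \<phi>"

lemma cper_measurable: "cper \<phi> \<Longrightarrow> \<phi> \<in> borel_measurable borel"
  by (simp add: cper_def borel_measurable_continuous_onI)

lemma cper_bounded:
  assumes "cper \<phi>" obtains B where "B > 0" "\<And>x. \<bar>\<phi> x\<bar> \<le> B"
proof -
  have "compact (\<phi> ` cball 0 2)"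
    using assms by (intro compact_continuous_image) (auto simp: cper_def intro: continuous_on_subset)
  then obtain B where B: "B > 0" "\<And>y. y \<in> \<phi> ` cball 0 2 \<Longrightarrow> norm y \<le> B"
    using compact_imp_bounded bounded_pos by metis
  have "\<bar>\<phi> x\<bar> \<le> B" for x
    using B(2)[of "\<phi> (fracs x)"] norm_cell[OF fracs_in_cell] assms
    by (auto simp: cper_def periodic_fracs)
  with B(1) show thesis using that by blast
qed

text \<open>Finite Borel measures on the torus, represented by their copies on the half-open
  cell.\<close>

definition cell_measure :: "(real^2) measure \<Rightarrow> bool" where
  "cell_measure \<mu> \<longleftrightarrow> finite_measure \<mu> \<and> sets \<mu> = sets borel \<and> (AE x in \<mu>. x \<in> period_cell)"

lemma cell_measure_torus: "cell_measure torus"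
  using prob_space_torus AE_torus by (simp add: cell_measure_def prob_space.finite_measure)

lemma integrable_cper:
  fixes f :: "real^2 \<Rightarrow> 'b::{banach, second_countable_topology}"
  assumes "cper \<phi>" "integrable M f" "sets M = sets borel"
  shows "integrable M (\<lambda>x. \<phi> x *\<^sub>R f x)"
proof -
  obtain B where B: "B > 0" "\<And>x. \<bar>\<phi> x\<bar> \<le> B" using cper_bounded[OF assms(1)] by metis
  have [measurable]: "\<phi> \<in> borel_measurable M" "f \<in> borel_measurable M"
    using cper_measurable[OF assms(1)] assms by (auto cong: measurable_cong_sets)
  show ?thesis
    by (rule Bochner_Integration.integrable_bound[where f = "\<lambda>x. B *\<^sub>R f x"])
       (use assms B in \<open>auto intro!: mult_right_mono\<close>)
qed

text \<open>The missing mass is put at the point 10, outside the range of \<open>code\<close>.\<close>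

lemma torus_density_tight:
  fixes g :: "real^2 \<Rightarrow> real"
  assumes [measurable]: "g \<in> borel_measurable borel" and pos: "\<And>x. 0 \<le> g x"
    and i: "integrable torus g" and le: "(LINT x|torus. g x) \<le> C" and "C > 0"
  obtains P where "real_distribution P" "measure P {-1<..11} = 1"
    "\<And>f. f \<in> borel_measurable borel \<Longrightarrow> f 10 = (0::real) \<Longrightarrow>
      (LINT t|P. f t) = (LINT x|torus. f (code x) * g x) / C"
proof -
  define m where "m = (LINT x|torus. g x)"
  \<comment> \<open>A translate of the cell, disjoint from it, carries the missing mass, so that a
    single density on the plane gives a probability measure; \<open>T\<close> sends everything
    outside the cell to 10.\<close>
  define c :: "real^2" where "c = vector [5, 0]"
  define T where "T x = (if x \<in> period_cell then code x else 10)" for x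
  define d where "d x = indicator period_cell x * (g x / C) + indicator period_cell (x - c) * (1 - m / C)" for x
  have m: "0 \<le> m" "m / C \<le> 1" using le pos \<open>C > 0\<close> by (auto simp: m_def)
  have [measurable]: "T \<in> borel_measurable borel" "d \<in> borel_measurable borel"
    unfolding T_def[abs_def] d_def[abs_def] by measurable
  have d0: "0 \<le> d x" for x using pos \<open>C > 0\<close> m by (simp add: d_def)
  have em: "(\<integral>\<^sup>+x. indicator period_cell (x - c) \<partial>lborel) = (1::ennreal)"
  proof -
    have "(\<integral>\<^sup>+x. indicator period_cell (x - c) \<partial>lborel) =
        (\<integral>\<^sup>+x. indicator period_cell (x - c) \<partial>distr lborel borel ((+) c) :: ennreal)"
      by (simp add: lborel_distr_plus)
    also have "\<dots> = (\<integral>\<^sup>+x. indicator period_cell x \<partial>lborel)"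
      by (subst nn_integral_distr) auto
    also have "\<dots> = emeasure torus UNIV"
      by (simp add: torus_def emeasure_density)
    finally show ?thesis by (simp add: emeasure_torus_UNIV)
  qed
  have "(\<integral>\<^sup>+x. d x \<partial>lborel) = (\<integral>\<^sup>+x. indicator period_cell x * ennreal (g x / C) +
      ennreal (1 - m / C) * indicator period_cell (x - c) \<partial>lborel)"
    unfolding d_def using pos \<open>C > 0\<close> m
    by (intro nn_integral_cong) (auto simp: indicator_def ennreal_plus[symmetric] simp del: ennreal_plus)
  also have "\<dots> = (\<integral>\<^sup>+x. indicator period_cell x * ennreal (g x / C) \<partial>lborel) + ennreal (1 - m / C)"
    by (subst nn_integral_add) (auto simp: nn_integral_cmult em)
  also have "(\<integral>\<^sup>+x. indicator period_cell x * ennreal (g x / C) \<partial>lborel) = (\<integral>\<^sup>+x. ennreal (g x / C) \<partial>torus)"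
    by (rule nn_integral_torus[symmetric]) measurable
  also have "\<dots> = ennreal (m / C)"
    using i pos \<open>C > 0\<close> by (subst nn_integral_eq_integral) (auto simp: m_def)
  finally have mass: "(\<integral>\<^sup>+x. d x \<partial>lborel) = 1"
    using m \<open>C > 0\<close> by (simp flip: ennreal_plus)
  define D where "D = density lborel (\<lambda>x. ennreal (d x))"
  have sD[measurable_cong]: "sets D = sets borel" by (simp add: D_def)
  have spD: "space D = UNIV" by (simp add: D_def)
  interpret D: prob_space D
    by (rule prob_spaceI) (simp add: D_def emeasure_density mass)
  define P where "P = distr D borel T"
  interpret P: prob_space P
    unfolding P_def by (rule D.prob_space_distr) measurable
  show thesis
  proof (rule that[of P])
    show "real_distribution P"
      by (intro real_distribution.intro real_distribution_axioms.intro P.prob_space_axioms) (simp add: P_def)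
    have "measure P {-1<..11} = measure D (T -` {-1<..11} \<inter> space D)"
      unfolding P_def by (rule measure_distr) auto
    also have "T -` {-1<..11} \<inter> space D = space D"
    proof -
      have "-1 < T x \<and> T x \<le> 11" for x
        using code_range[of x] by (auto simp: T_def)
      then show ?thesis by auto
    qed
    finally show "measure P {-1<..11} = 1" by (simp add: D.prob_space)
  next
    fix f :: "real \<Rightarrow> real"
    assume f[measurable]: "f \<in> borel_measurable borel" and f10: "f 10 = 0"
    have "(LINT t|P. f t) = (LINT x|D. f (T x))"
      unfolding P_def by (rule integral_distr) auto
    also have "\<dots> = (LINT x|lborel. d x *\<^sub>R f (T x))"
      unfolding D_def by (rule integral_density) (auto simp: d0)
    also have "\<dots> = (LINT x|lborel. indicator period_cell x *\<^sub>R (f (code x) * g x / C))"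
    proof (rule Bochner_Integration.integral_cong[OF refl])
      fix x
      have "x \<in> period_cell \<Longrightarrow> x - c \<notin> period_cell"
        by (auto simp: period_cell_def c_def forall_2)
      then show "d x *\<^sub>R f (T x) = indicator period_cell x *\<^sub>R (f (code x) * g x / C)"
        by (auto simp: d_def T_def f10 indicator_def)
    qed
    also have "\<dots> = (\<integral>x. f (code x) * g x / C \<partial>density lborel (\<lambda>x. ennreal (indicator period_cell x)))"
      by (rule integral_density[symmetric]) auto
    also have "\<dots> = (LINT x|torus. f (code x) * g x) / C"
      by (simp add: torus_def ennreal_indicator)
    finally show "(LINT t|P. f t) = (LINT x|torus. f (code x) * g x) / C" .
  qed
qed

text \<open>The densities, normalised and transported by \<open>code\<close>, become probability
  laws on one bounded interval. These are tight, so a subsequence converges weakly on the line, and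
  decoding carries the limit back to the cell.\<close>

lemma torus_weak_compact:
  fixes g :: "nat \<Rightarrow> real^2 \<Rightarrow> real"
  assumes m[measurable]: "\<And>k. g k \<in> borel_measurable borel" and pos: "\<And>k x. 0 \<le> g k x"
    and i: "\<And>k. integrable torus (g k)" and le: "\<And>k. (LINT x|torus. g k x) \<le> C"
  obtains r \<mu> where "strict_mono (r :: nat \<Rightarrow> nat)" "cell_measure \<mu>"
    "\<And>\<phi>. cper \<phi> \<Longrightarrow> (\<lambda>k. LINT x|torus. \<phi> x * g (r k) x) \<longlonglongrightarrow> (LINT x|\<mu>. \<phi> x)"
proof -
  define D where "D = max C 1"
  have D: "D > 0" "\<And>k. (LINT x|torus. g k x) \<le> D"
    using le by (auto simp: D_def le_max_iff_disj)
  obtain \<psi> :: "real \<Rightarrow> real^2" where \<psi>: "continuous_on UNIV \<psi>" "\<And>x. x \<in> period_cell \<Longrightarrow> \<psi> (code x) = x"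
    using decode_exists by metis
  have [measurable]: "\<psi> \<in> borel_measurable borel" using \<psi>(1) by (rule borel_measurable_continuous_onI)
  have "\<exists>P. real_distribution P \<and> measure P {-1<..11} = 1 \<and>
      (\<forall>f. f \<in> borel_measurable borel \<longrightarrow> f 10 = (0::real) \<longrightarrow>
      (LINT t|P. f t) = (LINT x|torus. f (code x) * g k x) / D)" for k
    by (rule torus_density_tight[OF m[of k] pos[of k] i[of k] D(2)[of k] D(1)]) blast
  then obtain P where P: "\<And>k. real_distribution (P k)" "\<And>k. measure (P k) {-1<..11} = 1"
    "\<And>k f. \<lbrakk>f \<in> borel_measurable borel; f 10 = (0::real)\<rbrakk> \<Longrightarrow>
      (\<integral>t. f t \<partial>P k) = (LINT x|torus. f (code x) * g k x) / D" by metis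
  have "tight P"
    unfolding tight_def using P(1,2) by (intro conjI allI impI exI[of _ "-1"] exI[of _ 11]) auto
  then obtain r \<nu> where r: "strict_mono r" "real_distribution \<nu>" "weak_conv_m (P \<circ> id \<circ> r) \<nu>"
    using tight_imp_convergent_subsubsequence[of P id] by (auto simp: strict_mono_def)
  interpret \<nu>: real_distribution \<nu> by fact
  \<comment> \<open>Continuous, equal to 1 on the range of \<open>code\<close> and equal to 0 at 10:
    it removes the auxiliary mass without destroying weak convergence.\<close>
  define cut :: "real \<Rightarrow> real" where "cut t = max 0 (min 1 (5 - t))" for t
  have cutc: "continuous_on UNIV cut" unfolding cut_def[abs_def] by (intro continuous_intros)
  have [measurable]: "cut \<in> borel_measurable borel" using cutc by (rule borel_measurable_continuous_onI)
  \<comment> \<open>Limits of codes may decode to points outside the half-open cell;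
    \<open>fracs\<close> wraps them back, which periodic test functions do not see.\<close>
  define \<mu> where "\<mu> = distr (density \<nu> (\<lambda>t. ennreal (D * cut t))) borel (\<lambda>t. fracs (\<psi> t))"
  have cut01: "0 \<le> cut t" "cut t \<le> 1" for t by (auto simp: cut_def)
  have fin: "finite_measure (density \<nu> (\<lambda>t. ennreal (D * cut t)))"
  proof (rule finite_measureI)
    have "emeasure (density \<nu> (\<lambda>t. ennreal (D * cut t))) (space \<nu>) = (\<integral>\<^sup>+t. ennreal (D * cut t) \<partial>\<nu>)"
      by (simp add: emeasure_density)
    also have "\<dots> \<le> (\<integral>\<^sup>+t. ennreal D \<partial>\<nu>)"
      using D cut01 by (intro nn_integral_mono ennreal_leI) (simp add: mult_left_le)
    also have "\<dots> < \<infinity>" using \<nu>.emeasure_space_1 by (simp add: ennreal_mult_less_top)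
    finally show "emeasure (density \<nu> (\<lambda>t. ennreal (D * cut t))) (space (density \<nu> (\<lambda>t. ennreal (D * cut t)))) \<noteq> \<infinity>"
      by simp
  qed
  have cm: "cell_measure \<mu>"
    unfolding cell_measure_def \<mu>_def
    using fin by (auto intro!: finite_measure.finite_measure_distr simp: AE_distr_iff)
  have "(\<lambda>k. LINT x|torus. \<phi> x * g (r k) x) \<longlonglongrightarrow> (LINT x|\<mu>. \<phi> x)" if \<phi>: "cper \<phi>" for \<phi>
  proof -
    obtain B where B: "B > 0" "\<And>x. \<bar>\<phi> x\<bar> \<le> B" using cper_bounded[OF \<phi>] by metis
    have \<phi>c: "continuous_on UNIV \<phi>" "periodic \<phi>" using \<phi> by (auto simp: cper_def)
    have [measurable]: "\<phi> \<in> borel_measurable borel" using \<phi> by (rule cper_measurable)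
    define f where "f t = cut t * \<phi> (\<psi> t)" for t
    have fc: "continuous_on UNIV f"
      unfolding f_def[abs_def]
      by (intro continuous_intros cutc continuous_on_compose2[OF \<phi>c(1)] \<psi>(1)) auto
    have fB: "\<bar>f t\<bar> \<le> B" for t
      using B cut01[of t] by (auto simp: f_def abs_mult intro: mult_mono[of _ 1 _ B, simplified])
    have "(\<lambda>n. integral\<^sup>L ((P \<circ> id \<circ> r) n) f) \<longlonglongrightarrow> integral\<^sup>L \<nu> f"
    proof (rule weak_conv_imp_integral_bdd_continuous_conv)
      show "\<And>n. real_distribution ((P \<circ> id \<circ> r) n)" using P by simp
      show "isCont f x" for x using fc by (simp add: continuous_on_eq_continuous_at)
      show "norm (f x) \<le> B" for x using fB by simp
      show "weak_conv_m (P \<circ> id \<circ> r) \<nu>" "real_distribution \<nu>" by fact+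
    qed
    moreover have "integral\<^sup>L ((P \<circ> id \<circ> r) n) f = (LINT x|torus. \<phi> x * g (r n) x) / D" for n
    proof -
      have "integral\<^sup>L ((P \<circ> id \<circ> r) n) f = (LINT x|torus. f (code x) * g (r n) x) / D"
        unfolding comp_def id_def
        by (rule P(3)) (use fc in \<open>auto simp: f_def cut_def borel_measurable_continuous_onI\<close>)
      also have "(LINT x|torus. f (code x) * g (r n) x) = (LINT x|torus. \<phi> x * g (r n) x)"
      proof (rule integral_cong_AE)
        have [measurable]: "f \<in> borel_measurable borel" using fc by (rule borel_measurable_continuous_onI)
        show "(\<lambda>x. f (code x) * g (r n) x) \<in> borel_measurable torus" by measurable
        show "(\<lambda>x. \<phi> x * g (r n) x) \<in> borel_measurable torus" by measurable
        show "AE x in torus. f (code x) * g (r n) x = \<phi> x * g (r n) x"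
          using AE_torus
        proof eventually_elim
          case (elim x)
          then show ?case using \<psi>(2)[OF elim] code_range(2)[of x] by (simp add: f_def cut_def)
        qed
      qed
      finally show ?thesis .
    qed
    ultimately have "(\<lambda>n. D * ((LINT x|torus. \<phi> x * g (r n) x) / D)) \<longlonglongrightarrow> D * integral\<^sup>L \<nu> f"
      by (intro tendsto_intros) simp
    moreover have "(LINT x|\<mu>. \<phi> x) = D * integral\<^sup>L \<nu> f"
    proof -
      have "(LINT x|\<mu>. \<phi> x) = (\<integral>t. \<phi> (fracs (\<psi> t)) \<partial>density \<nu> (\<lambda>t. ennreal (D * cut t)))"
        unfolding \<mu>_def by (rule integral_distr) auto
      also have "\<dots> = (LINT t|\<nu>. (D * cut t) *\<^sub>R \<phi> (fracs (\<psi> t)))"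
        by (rule integral_density) (use D cut01 in auto)
      also have "\<dots> = D * integral\<^sup>L \<nu> f"
        by (simp add: f_def[abs_def] periodic_fracs[OF \<phi>c(2)] mult.assoc)
      finally show ?thesis .
    qed
    ultimately show ?thesis using D by simp
  qed
  with r(1) cm show thesis using that by blast
qed

section \<open>Comparison of measures through periodic test functions\<close>

lemma cell_measureD:
  assumes "cell_measure \<mu>"
  shows "finite_measure \<mu>" "sets \<mu> = sets borel" "space \<mu> = UNIV" "AE x in \<mu>. x \<in> period_cell"
    "sigma_finite_measure \<mu>"
proof -
  show "finite_measure \<mu>" "sets \<mu> = sets borel" "AE x in \<mu>. x \<in> period_cell"
    using assms by (auto simp: cell_measure_def)
  then show "space \<mu> = UNIV" by (metis sets_eq_imp_space_eq space_borel)
  show "sigma_finite_measure \<mu>"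
    using \<open>finite_measure \<mu>\<close> by (simp add: finite_measure_def)
qed

lemma integrable_cper_const:
  assumes "cper \<phi>" "finite_measure M" "sets M = sets borel"
  shows "integrable M \<phi>"
proof -
  interpret finite_measure M by fact
  show ?thesis
    using integrable_cper[OF assms(1) integrable_const[of "1::real"] assms(3)] by simp
qed

text \<open>Distance cut-offs that shrink to \<open>K\<close> are made periodic by summing over the
  lattice; as \<open>K\<close> lies in the half-open cell, only the term k = 0 survives at points of
  the cell. The bound 169 = 13^2 counts the lattice vectors with entries in {-6..6}, among which are
  all that contribute for supports of radius 3 and points of norm at most 2.\<close>

lemma compact_cper_approx:
  assumes K: "compact K" "K \<subseteq> period_cell" "K \<noteq> {}"
  obtains \<Phi> :: "nat \<Rightarrow> real^2 \<Rightarrow> real" where "\<And>n. cper (\<Phi> n)" "\<And>n x. 0 \<le> \<Phi> n x"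
    "\<And>n x. x \<in> period_cell \<Longrightarrow> \<Phi> n x \<le> 169" "\<And>x. x \<in> period_cell \<Longrightarrow> (\<lambda>n. \<Phi> n x) \<longlonglongrightarrow> indicator K x"
proof -
  define \<psi> where "\<psi> n x = max 0 (1 - real (Suc n) * infdist x K)" for n x
  have c: "continuous_on UNIV (\<psi> n)" for n
    unfolding \<psi>_def[abs_def] by (intro continuous_intros)
  have R: "\<psi> n x = 0" if "norm x > 3" for n x
  proof -
    obtain y where y: "y \<in> K" "infdist x K = dist x y"
      using infdist_attains_inf[of K x] K compact_imp_closed by metis
    have "norm y \<le> 2" using y K norm_cell by blast
    then have "1 \<le> dist x y"
      using that norm_triangle_ineq2[of x y] by (simp add: dist_norm)
    then have "1 \<le> real (Suc n) * infdist x K"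
      using y by (simp add: mult_ge1_I)
    then show ?thesis by (simp add: \<psi>_def)
  qed
  have b: "0 \<le> \<psi> n x" "\<psi> n x \<le> 1" for n x
    by (auto simp: \<psi>_def infdist_nonneg)
  have lim: "(\<lambda>n. \<psi> n x) \<longlonglongrightarrow> indicator K x" for x
  proof (cases "x \<in> K")
    case True
    then show ?thesis by (simp add: \<psi>_def)
  next
    case False
    then have pos: "0 < infdist x K"
      using K compact_imp_closed infdist_pos_not_in_closed by blast
    obtain N :: nat where N: "1 / infdist x K < real N" using reals_Archimedean2 by blast
    have "\<psi> n x = 0" if "n \<ge> N" for n
    proof -
      have "1 < real N * infdist x K" using N pos by (simp add: divide_less_eq)
      also have "\<dots> \<le> real (Suc n) * infdist x K" using that pos by (intro mult_right_mono) auto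
      finally show ?thesis by (simp add: \<psi>_def)
    qed
    then have "\<forall>\<^sub>F n in sequentially. \<psi> n x = indicator K x"
      using False by (auto simp: eventually_sequentially)
    then show ?thesis by (rule tendsto_eventually)
  qed
  have fs: "fold_sum (\<psi> n) x = (\<Sum>k\<in>{-6..6} \<times> {-6..6}. \<psi> n (x + lat k))"
    if "x \<in> period_cell" for n x
    by (rule fold_sum_eq(1)[of 3]) (use R norm_cell[OF that] in auto)
  show thesis
  proof (rule that[of "\<lambda>n. fold_sum (\<psi> n)"])
    show "cper (fold_sum (\<psi> n))" for n
      unfolding cper_def using R c by (auto intro!: periodic_fold_sum continuous_fold_sum[of 3])
    show "0 \<le> fold_sum (\<psi> n) x" for n x
      unfolding fold_sum_def using b by simp
    fix x assume x: "x \<in> period_cell"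
    show "fold_sum (\<psi> n) x \<le> 169" for n
      unfolding fs[OF x] using sum_bounded_above[of "{-6..6} \<times> {-6..6}" "\<lambda>k. \<psi> n (x + lat k)" 1] b by simp
    have "(\<lambda>n. fold_sum (\<psi> n) x) \<longlonglongrightarrow> (\<Sum>k\<in>{-6..6} \<times> {-6..6}. indicator K (x + lat k))"
      unfolding fs[OF x] by (intro tendsto_intros lim)
    also have "(\<Sum>k\<in>{-6..6} \<times> {-6..6}. indicator K (x + lat k)) =
        (\<Sum>k\<in>{-6..6::int} \<times> {-6..6::int}. if k = 0 then indicator K x else (0::real))"
    proof (intro sum.cong refl)
      fix k :: "int \<times> int"
      have "x + lat k \<in> K \<Longrightarrow> k = 0"
        using K(2) x in_cell_lat_iff[of x k] in_cell_lat_iff[of x 0] by auto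
      then show "indicator K (x + lat k) = (if k = 0 then indicator K x else (0::real))"
        by (auto simp: indicator_def)
    qed
    also have "\<dots> = indicator K x"
      by (subst sum.delta) (auto simp: zero_prod_def)
    finally show "(\<lambda>n. fold_sum (\<psi> n) x) \<longlonglongrightarrow> indicator K x" .
  qed
qed

lemma cper_approx_integral:
  assumes \<mu>: "cell_measure \<mu>" and K: "K \<in> sets borel"
    and m: "\<And>n. \<Phi> n \<in> borel_measurable borel"
    and "\<And>n x. 0 \<le> \<Phi> n x"
    "\<And>n x. x \<in> period_cell \<Longrightarrow> \<Phi> n x \<le> B" "\<And>x. x \<in> period_cell \<Longrightarrow> (\<lambda>n. \<Phi> n x) \<longlonglongrightarrow> indicator K x"
  shows "(\<lambda>n. LINT x|\<mu>. \<Phi> n x) \<longlonglongrightarrow> measure \<mu> K"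
proof -
  note \<mu>' = cell_measureD[OF \<mu>]
  interpret finite_measure \<mu> by fact
  note [measurable_cong] = \<mu>'(2)
  note [measurable] = m K
  have "(\<lambda>n. LINT x|\<mu>. \<Phi> n x) \<longlonglongrightarrow> (LINT x|\<mu>. indicator K x)"
  proof (rule integral_dominated_convergence[where w = "\<lambda>x. B"])
    show "AE x in \<mu>. (\<lambda>n. \<Phi> n x) \<longlonglongrightarrow> indicator K x"
      using \<mu>'(4) by eventually_elim (rule assms(6))
    show "AE x in \<mu>. norm (\<Phi> n x) \<le> B" for n
      using \<mu>'(4) by eventually_elim (use assms in auto)
  qed auto
  then show ?thesis using \<mu>'(3) by simp
qed

text \<open>The inequality passes from test functions to compact subsets of the cell by
  approximation, and from there to Borel sets by inner regularity of the smaller measure.\<close>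

lemma cell_measure_dominated:
  assumes \<mu>1: "cell_measure \<mu>1" and \<mu>2: "cell_measure \<mu>2"
    and le: "\<And>\<phi>. cper \<phi> \<Longrightarrow> (\<And>x. 0 \<le> \<phi> x) \<Longrightarrow> (LINT x|\<mu>1. \<phi> x) \<le> (LINT x|\<mu>2. \<phi> x)"
    and B: "B \<in> sets borel"
  shows "emeasure \<mu>1 B \<le> emeasure \<mu>2 B"
proof -
  note \<mu>1' = cell_measureD[OF \<mu>1] and \<mu>2' = cell_measureD[OF \<mu>2]
  interpret \<mu>1: finite_measure \<mu>1 by fact
  interpret \<mu>2: finite_measure \<mu>2 by fact
  have Kle: "emeasure \<mu>1 K \<le> emeasure \<mu>2 K" if K: "compact K" "K \<subseteq> period_cell" for K
  proof (cases "K = {}")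
    case False
    have Kb: "K \<in> sets borel" using K by (simp add: borel_compact)
    obtain \<Phi> :: "nat \<Rightarrow> real^2 \<Rightarrow> real" where \<Phi>: "\<And>n. cper (\<Phi> n)" "\<And>n x. 0 \<le> \<Phi> n x"
    "\<And>n x. x \<in> period_cell \<Longrightarrow> \<Phi> n x \<le> 169" "\<And>x. x \<in> period_cell \<Longrightarrow> (\<lambda>n. \<Phi> n x) \<longlonglongrightarrow> indicator K x"
      using compact_cper_approx[OF K False] by blast
    note a = cper_approx_integral[OF _ Kb cper_measurable[OF \<Phi>(1)] \<Phi>(2,3,4)]
    have "measure \<mu>1 K \<le> measure \<mu>2 K"
      by (rule LIMSEQ_le[OF a[OF \<mu>1] a[OF \<mu>2]]) (use le \<Phi> in auto)
    then show ?thesis by (simp add: \<mu>1.emeasure_eq_measure \<mu>2.emeasure_eq_measure)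
  qed simp
  define A where "A = B \<inter> period_cell"
  have A: "A \<in> sets borel" using B cell_borel by (auto simp: A_def)
  have "emeasure \<mu>1 B = emeasure \<mu>1 A"
    by (rule emeasure_eq_AE) (use \<mu>1' A B in \<open>auto simp: A_def\<close>)
  also have "\<dots> = (SUP K \<in> {K. K \<subseteq> A \<and> compact K}. emeasure \<mu>1 K)"
    by (rule inner_regular[OF \<mu>1'(2) _ A]) simp
  also have "\<dots> \<le> emeasure \<mu>2 A"
  proof (rule SUP_least)
    fix K assume K: "K \<in> {K. K \<subseteq> A \<and> compact K}"
    then have "emeasure \<mu>1 K \<le> emeasure \<mu>2 K" by (intro Kle) (auto simp: A_def)
    also have "\<dots> \<le> emeasure \<mu>2 A" using K A \<mu>2' by (intro emeasure_mono) auto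
    finally show "emeasure \<mu>1 K \<le> emeasure \<mu>2 A" .
  qed
  also have "\<dots> \<le> emeasure \<mu>2 B"
    using B \<mu>2' by (intro emeasure_mono) (auto simp: A_def)
  finally show ?thesis .
qed

text \<open>The Radon-Nikodym density is finite almost everywhere because \<open>M\<close> is
  sigma-finite, so it can be taken real-valued and Borel, the form that
  \<open>integral_density\<close> and Bochner integrals require.\<close>

lemma borel_RN_density:
  assumes P: "sigma_finite_measure P" "sets P = sets borel" and M: "sigma_finite_measure M" "sets M = sets borel"
    and null: "\<And>A. A \<in> sets borel \<Longrightarrow> emeasure P A = 0 \<Longrightarrow> emeasure M A = 0"
  obtains m where "m \<in> borel_measurable borel" "\<And>x. 0 \<le> (m x :: real)" "M = density P (\<lambda>x. ennreal (m x))"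
proof -
  interpret P: sigma_finite_measure P by fact
  have s: "sets M = sets P" using P M by simp
  have ac: "absolutely_continuous P M"
    using null P(2) M(2) by (auto simp: absolutely_continuous_def null_sets_def)
  define m where "m x = enn2real (RN_deriv P M x)" for x
  have mP: "m \<in> borel_measurable P" unfolding m_def[abs_def] by measurable
  have "AE x in P. RN_deriv P M x = ennreal (m x)"
    using P.RN_deriv_finite[OF M(1) ac s] by eventually_elim (auto simp: m_def less_top)
  then have "M = density P (\<lambda>x. ennreal (m x))"
    by (subst P.density_RN_deriv[OF ac s, symmetric], intro density_cong) (use mP in auto)
  moreover have "m \<in> borel_measurable borel" using mP by (simp cong: measurable_cong_sets[OF P(2)])
  ultimately show thesis using that by (simp add: m_def)
qed

lemma cell_measure_RN:
  assumes \<mu>: "cell_measure \<mu>" and \<nu>: "cell_measure \<nu>"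
    and null: "\<And>A. A \<in> sets borel \<Longrightarrow> emeasure \<mu> A = 0 \<Longrightarrow> emeasure \<nu> A = 0"
  obtains D where "D \<in> borel_measurable borel" "\<And>x. 0 \<le> (D x :: real)" "integrable \<mu> D" "\<nu> = density \<mu> (\<lambda>x. ennreal (D x))"
proof -
  note \<mu>' = cell_measureD[OF \<mu>] and \<nu>' = cell_measureD[OF \<nu>]
  obtain D where D: "D \<in> borel_measurable borel" "\<And>x. 0 \<le> (D x :: real)" "\<nu> = density \<mu> (\<lambda>x. ennreal (D x))"
    using borel_RN_density[OF \<mu>'(5,2) \<nu>'(5,2) null] by metis
  have [measurable]: "D \<in> borel_measurable \<mu>" using D(1) \<mu>'(2) by (simp cong: measurable_cong_sets)
  have "emeasure \<nu> UNIV < \<infinity>" using finite_measure.emeasure_finite[OF \<nu>'(1)] by (simp add: less_top[symmetric])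
  then have "(\<integral>\<^sup>+x. ennreal (D x) \<partial>\<mu>) < \<infinity>"
    using \<mu>'(2,3) by (simp add: D(3) emeasure_density)
  then have "integrable \<mu> D" using D(2) by (simp add: integrable_iff_bounded)
  then show thesis using that D by blast
qed

lemma cell_measure_density:
  assumes \<mu>: "cell_measure \<mu>" and p: "integrable \<mu> p"
  shows "cell_measure (density \<mu> (\<lambda>x. ennreal (p x)))"
  unfolding cell_measure_def
proof (intro conjI)
  note \<mu>' = cell_measureD[OF \<mu>]
  note [measurable_cong] = \<mu>'(2)
  have [measurable]: "p \<in> borel_measurable \<mu>" using p by auto
  show "finite_measure (density \<mu> (\<lambda>x. ennreal (p x)))"
  proof (rule finite_measureI)
    have "emeasure (density \<mu> (\<lambda>x. ennreal (p x))) (space \<mu>) = (\<integral>\<^sup>+x. ennreal (p x) \<partial>\<mu>)"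
      by (simp add: emeasure_density cong: nn_integral_cong)
    also have "\<dots> \<le> (\<integral>\<^sup>+x. ennreal (norm (p x)) \<partial>\<mu>)"
      by (intro nn_integral_mono ennreal_leI) auto
    also have "\<dots> < \<infinity>" using p by (simp add: integrable_iff_bounded)
    finally show "emeasure (density \<mu> (\<lambda>x. ennreal (p x))) (space (density \<mu> (\<lambda>x. ennreal (p x)))) \<noteq> \<infinity>"
      by simp
  qed
  show "sets (density \<mu> (\<lambda>x. ennreal (p x))) = sets borel" using \<mu>' by simp
  show "AE x in density \<mu> (\<lambda>x. ennreal (p x)). x \<in> period_cell"
    by (subst AE_density) (use \<mu>'(4) in auto)
qed

text \<open>On test functions the measure with density \<open>pn\<close> is at most the one with
  density \<open>pp\<close>, hence also on the set {p < 0}, where the latter vanishes.\<close>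

lemma AE_nonneg_of_cper:
  fixes p :: "real^2 \<Rightarrow> real"
  assumes \<mu>: "cell_measure \<mu>" and p: "integrable \<mu> p"
    and nn: "\<And>\<phi>. cper \<phi> \<Longrightarrow> (\<And>x. 0 \<le> \<phi> x) \<Longrightarrow> 0 \<le> (LINT x|\<mu>. \<phi> x * p x)"
  shows "AE x in \<mu>. 0 \<le> p x"
proof -
  note \<mu>' = cell_measureD[OF \<mu>]
  note [measurable_cong] = \<mu>'(2)
  have [measurable]: "p \<in> borel_measurable borel" using p by (auto cong: measurable_cong_sets)
  define pp where "pp x = max 0 (p x)" for x
  define pn where "pn x = max 0 (- p x)" for x
  have [measurable]: "pp \<in> borel_measurable borel" "pn \<in> borel_measurable borel"
    unfolding pp_def[abs_def] pn_def[abs_def] by measurable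
  have ipp: "integrable \<mu> pp"
    by (rule Bochner_Integration.integrable_bound[OF p]) (auto simp: pp_def)
  have ipn: "integrable \<mu> pn"
    by (rule Bochner_Integration.integrable_bound[OF p]) (auto simp: pn_def)
  have eq: "(\<integral>x. \<phi> x \<partial>density \<mu> (\<lambda>x. ennreal (q x))) = (LINT x|\<mu>. \<phi> x * q x)"
    if "cper \<phi>" "q \<in> borel_measurable borel" "\<And>x. 0 \<le> q x" for q \<phi>
    using cper_measurable[OF that(1)] that(2,3) by (subst integral_density) (auto simp: mult.commute)
  define A where "A = {x. p x < 0}"
  have A[measurable]: "A \<in> sets borel" unfolding A_def by measurable
  have "emeasure (density \<mu> (\<lambda>x. ennreal (pn x))) A \<le> emeasure (density \<mu> (\<lambda>x. ennreal (pp x))) A"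
  proof (rule cell_measure_dominated)
    show "cell_measure (density \<mu> (\<lambda>x. ennreal (pn x)))" "cell_measure (density \<mu> (\<lambda>x. ennreal (pp x)))"
      using \<mu> ipn ipp by (auto intro: cell_measure_density)
    fix \<phi> assume \<phi>: "cper \<phi>" "\<And>x. 0 \<le> \<phi> x"
    have "0 \<le> (LINT x|\<mu>. \<phi> x * p x)" using \<phi> by (rule nn)
    also have "\<dots> = (LINT x|\<mu>. \<phi> x * pp x - \<phi> x * pn x)"
      by (intro Bochner_Integration.integral_cong) (auto simp: pp_def pn_def max_def algebra_simps)
    also have "\<dots> = (LINT x|\<mu>. \<phi> x * pp x) - (LINT x|\<mu>. \<phi> x * pn x)"
      using integrable_cper[OF \<phi>(1) ipp \<mu>'(2)] integrable_cper[OF \<phi>(1) ipn \<mu>'(2)] by simp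
    finally show "(\<integral>x. \<phi> x \<partial>density \<mu> (\<lambda>x. ennreal (pn x))) \<le> (\<integral>x. \<phi> x \<partial>density \<mu> (\<lambda>x. ennreal (pp x)))"
      using \<phi> by (subst (1 2) eq) (auto simp: pp_def pn_def)
  qed measurable
  also have "\<dots> = (\<integral>\<^sup>+x. ennreal (pp x) * indicator A x \<partial>\<mu>)"
    by (rule emeasure_density) auto
  also have "\<dots> = (\<integral>\<^sup>+x. 0 \<partial>\<mu>)"
    by (intro nn_integral_cong) (auto simp: pp_def A_def indicator_def max_def)
  finally have "emeasure (density \<mu> (\<lambda>x. ennreal (pn x))) A = 0" by simp
  then have "(\<integral>\<^sup>+x. ennreal (pn x) * indicator A x \<partial>\<mu>) = 0"
    by (subst (asm) emeasure_density) auto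
  then have "AE x in \<mu>. ennreal (pn x) * indicator A x = 0"
    by (subst (asm) nn_integral_0_iff_AE) auto
  then show ?thesis
    by eventually_elim (auto simp: pn_def A_def indicator_def ennreal_eq_0_iff split: if_splits)
qed

text \<open>By continuity the inequality extends to all directions, in particular to
  \<open>e = x\<close>. A countable set of directions suffices, so that the exceptional null sets of
  an almost everywhere statement can be united.\<close>

lemma norm_le_1_of_dense:
  fixes x :: "'b::euclidean_space"
  assumes D: "closure D = UNIV" and le: "\<And>e. e \<in> D \<Longrightarrow> x \<bullet> e \<le> norm e"
  shows "norm x \<le> 1"
proof -
  have "closed {e. x \<bullet> e \<le> norm e}"
    by (intro closed_Collect_le continuous_intros)
  then have "closure D \<subseteq> {e. x \<bullet> e \<le> norm e}"
    using le by (intro closure_minimal) auto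
  then have "x \<bullet> x \<le> norm x" using D by auto
  then show ?thesis
    by (cases "x = 0") (auto simp: dot_square_norm power2_eq_square)
qed

section \<open>Weak compactness for vector fields with a dominating density\<close>

lemma torus_weak_compact_family:
  fixes g :: "'i \<Rightarrow> nat \<Rightarrow> real^2 \<Rightarrow> real"
  assumes "finite I"
    and m: "\<And>b k. b \<in> I \<Longrightarrow> g b k \<in> borel_measurable borel" and pos: "\<And>b k x. b \<in> I \<Longrightarrow> 0 \<le> g b k x"
    and i: "\<And>b k. b \<in> I \<Longrightarrow> integrable torus (g b k)" and le: "\<And>b k. b \<in> I \<Longrightarrow> (LINT x|torus. g b k x) \<le> C"
  shows "\<exists>r \<mu>. strict_mono (r :: nat \<Rightarrow> nat) \<and> (\<forall>b\<in>I. cell_measure (\<mu> b) \<and>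
    (\<forall>\<phi>. cper \<phi> \<longrightarrow> (\<lambda>k. LINT x|torus. \<phi> x * g b (r k) x) \<longlonglongrightarrow> (\<integral>x. \<phi> x \<partial>\<mu> b)))"
  using assms
proof (induction I rule: finite_induct)
  case empty
  show ?case by (intro exI[of _ id]) (auto simp: strict_mono_def)
next
  case (insert a I)
  have "\<exists>r \<mu>. strict_mono (r :: nat \<Rightarrow> nat) \<and> (\<forall>b\<in>I. cell_measure (\<mu> b) \<and>
    (\<forall>\<phi>. cper \<phi> \<longrightarrow> (\<lambda>k. LINT x|torus. \<phi> x * g b (r k) x) \<longlonglongrightarrow> (\<integral>x. \<phi> x \<partial>\<mu> b)))"
    by (rule insert.IH) (use insert.prems in auto)
  then obtain r \<mu> where r: "strict_mono (r :: nat \<Rightarrow> nat)" "\<And>b. b \<in> I \<Longrightarrow> cell_measure (\<mu> b)"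
    "\<And>b \<phi>. b \<in> I \<Longrightarrow> cper \<phi> \<Longrightarrow> (\<lambda>k. LINT x|torus. \<phi> x * g b (r k) x) \<longlonglongrightarrow> (\<integral>x. \<phi> x \<partial>\<mu> b)"
    by blast
  obtain s \<nu> where s: "strict_mono (s :: nat \<Rightarrow> nat)" "cell_measure \<nu>"
    "\<And>\<phi>. cper \<phi> \<Longrightarrow> (\<lambda>k. LINT x|torus. \<phi> x * g a (r (s k)) x) \<longlonglongrightarrow> (LINT x|\<nu>. \<phi> x)"
    by (rule torus_weak_compact[of "\<lambda>k. g a (r k)" C]) (use insert.prems in auto)
  show ?case
  proof (intro exI[of _ "r \<circ> s"] exI[of _ "\<mu>(a := \<nu>)"] conjI ballI allI impI)
    show "strict_mono (r \<circ> s)" using r s by (simp add: strict_mono_o)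
    fix b assume b: "b \<in> insert a I"
    then show "cell_measure ((\<mu>(a := \<nu>)) b)" using r s by auto
    fix \<phi> assume \<phi>: "cper \<phi>"
    show "(\<lambda>k. LINT x|torus. \<phi> x * g b ((r \<circ> s) k) x) \<longlonglongrightarrow> (\<integral>x. \<phi> x \<partial>(\<mu>(a := \<nu>)) b)"
    proof (cases "b = a")
      case True then show ?thesis using s(3)[OF \<phi>] by simp
    next
      case False
      then have "b \<in> I" using b by simp
      from LIMSEQ_subseq_LIMSEQ[OF r(3)[OF this \<phi>] s(1)] False show ?thesis
        by (simp add: o_def)
    qed
  qed
qed

text \<open>The components of \<open>F\<close> have no sign, so scalar compactness is applied to
  \<open>G\<close> plus each component. The limits are absolutely continuous with respect to the
  limit of \<open>G\<close>, and their densities give the limit of \<open>F\<close>. That its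
  modulus is at most 1 follows from testing the inequality F . e \<le> |e| G for a countable dense
  set of directions \<open>e\<close>.\<close>

lemma torus_weak_compact_vector:
  fixes F :: "nat \<Rightarrow> real^2 \<Rightarrow> 'b::euclidean_space" and G :: "nat \<Rightarrow> real^2 \<Rightarrow> real"
  assumes mF[measurable]: "\<And>k. F k \<in> borel_measurable borel" and mG[measurable]: "\<And>k. G k \<in> borel_measurable borel"
    and FG: "\<And>k x. norm (F k x) \<le> G k x"
    and i: "\<And>k. integrable torus (G k)" and le: "\<And>k. (LINT x|torus. G k x) \<le> C"
  obtains r \<mu> \<sigma> where "strict_mono (r :: nat \<Rightarrow> nat)" "cell_measure \<mu>" "\<sigma> \<in> borel_measurable borel"
    "periodic \<sigma>" "\<And>x. norm (\<sigma> x) \<le> 1"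
    "\<And>\<phi>. cper \<phi> \<Longrightarrow> (\<lambda>k. LINT x|torus. \<phi> x * G (r k) x) \<longlonglongrightarrow> (LINT x|\<mu>. \<phi> x)"
    "\<And>\<phi>. cper \<phi> \<Longrightarrow> (\<lambda>k. LINT x|torus. \<phi> x *\<^sub>R F (r k) x) \<longlonglongrightarrow> (LINT x|\<mu>. \<phi> x *\<^sub>R \<sigma> x)"
proof -
  have G0: "0 \<le> G k x" for k x using FG[of k x] norm_ge_zero order_trans by blast
  have iF: "integrable torus (F k)" for k
    by (rule Bochner_Integration.integrable_bound[OF i[of k]]) (use FG G0 in auto)
  \<comment> \<open>The index \<open>b = 0\<close> stands for \<open>G\<close> itself; adding
    \<open>G\<close> makes the other members of the family nonnegative.\<close>
  define g where "g b k x = G k x + F k x \<bullet> b" for b k x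
  have in_b: "\<bar>F k x \<bullet> b\<bar> \<le> G k x" if "b \<in> insert 0 Basis" for b k x
    using that FG[of k x] Basis_le_norm[of b "F k x"] G0[of k x] by auto
  have ig: "integrable torus (g b k)" for b k
    unfolding g_def[abs_def] using i iF by (intro Bochner_Integration.integrable_add integrable_inner_left) auto
  have g0: "0 \<le> g b k x" if "b \<in> insert 0 Basis" for b k x
    using in_b[OF that, of k x] by (simp add: g_def)
  have g2: "g b k x \<le> 2 * G k x" if "b \<in> insert 0 Basis" for b k x
    using in_b[OF that, of k x] by (simp add: g_def)
  have gle: "(LINT x|torus. g b k x) \<le> 2 * C" if "b \<in> insert 0 Basis" for b k
  proof -
    have "(LINT x|torus. g b k x) \<le> (LINT x|torus. 2 * G k x)"
      using ig i g2[OF that] by (intro integral_mono) auto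
    also have "\<dots> = 2 * (LINT x|torus. G k x)" by simp
    also have "\<dots> \<le> 2 * C" using le by simp
    finally show ?thesis .
  qed
  have "\<exists>r \<mu>. strict_mono (r :: nat \<Rightarrow> nat) \<and> (\<forall>b\<in>insert 0 Basis. cell_measure (\<mu> b) \<and>
    (\<forall>\<phi>. cper \<phi> \<longrightarrow> (\<lambda>k. LINT x|torus. \<phi> x * g b (r k) x) \<longlonglongrightarrow> (\<integral>x. \<phi> x \<partial>\<mu> b)))"
    by (rule torus_weak_compact_family[of _ _ "2 * C"]) (use g0 ig gle in \<open>auto simp: g_def[abs_def]\<close>)
  then obtain r \<mu>' where r: "strict_mono (r :: nat \<Rightarrow> nat)"
    and \<mu>': "\<And>b. b \<in> insert 0 Basis \<Longrightarrow> cell_measure (\<mu>' b)"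
    and lim': "\<And>b \<phi>. b \<in> insert 0 Basis \<Longrightarrow> cper \<phi> \<Longrightarrow>
      (\<lambda>k. LINT x|torus. \<phi> x * g b (r k) x) \<longlonglongrightarrow> (\<integral>x. \<phi> x \<partial>\<mu>' b)" by blast
  define \<mu> where "\<mu> = \<mu>' 0"
  have \<mu>: "cell_measure \<mu>" using \<mu>' by (simp add: \<mu>_def)
  note \<mu>c = cell_measureD[OF \<mu>]
  note [measurable_cong] = \<mu>c(2)
  interpret \<mu>: finite_measure \<mu> by fact
  have limG: "(\<lambda>k. LINT x|torus. \<phi> x * G (r k) x) \<longlonglongrightarrow> (LINT x|\<mu>. \<phi> x)" if "cper \<phi>" for \<phi>
    using lim'[of 0 \<phi>] that by (simp add: g_def \<mu>_def)
  have ic: "integrable torus (\<lambda>x. \<phi> x * f x)" if "cper \<phi>" "integrable torus f" for \<phi> f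
    using integrable_cper[OF that] by simp
  have dens2: "cell_measure (density \<mu> (\<lambda>x. ennreal 2))"
    by (rule cell_measure_density[OF \<mu>]) simp
  have "\<exists>D. D \<in> borel_measurable borel \<and> integrable \<mu> D \<and>
      (\<forall>\<phi>. cper \<phi> \<longrightarrow> (\<integral>x. \<phi> x \<partial>\<mu>' b) = (LINT x|\<mu>. \<phi> x * D x))" if b: "b \<in> Basis" for b
  proof -
    have b': "b \<in> insert 0 Basis" using b by simp
    \<comment> \<open>Each integrand is at most \<open>2 * G\<close>. In the limit this becomes
      domination by twice the measure \<mu>, hence absolute continuity.\<close>
    have dom: "emeasure (\<mu>' b) A \<le> emeasure (density \<mu> (\<lambda>x. ennreal 2)) A" if "A \<in> sets borel" for A
    proof (rule cell_measure_dominated[OF \<mu>'[OF b'] dens2 _ that])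
      fix \<phi> :: "real^2 \<Rightarrow> real" assume \<phi>: "cper \<phi>" "\<And>x. 0 \<le> \<phi> x"
      have [measurable]: "\<phi> \<in> borel_measurable borel" using \<phi>(1) by (rule cper_measurable)
      have "(\<lambda>k. 2 * (LINT x|torus. \<phi> x * G (r k) x)) \<longlonglongrightarrow> 2 * (LINT x|\<mu>. \<phi> x)"
        by (intro tendsto_intros limG \<phi>)
      moreover have "(LINT x|torus. \<phi> x * g b (r k) x) \<le> 2 * (LINT x|torus. \<phi> x * G (r k) x)" for k
      proof -
        have "(LINT x|torus. \<phi> x * g b (r k) x) \<le> (LINT x|torus. 2 * (\<phi> x * G (r k) x))"
          by (intro integral_mono integrable_mult_right ic ig i \<phi>)
             (auto intro!: mult_left_mono[OF g2[OF b']] \<phi>(2) simp: mult.left_commute[of 2])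
        then show ?thesis by simp
      qed
      ultimately have "(\<integral>x. \<phi> x \<partial>\<mu>' b) \<le> 2 * (LINT x|\<mu>. \<phi> x)"
        using LIMSEQ_le[OF lim'[OF b' \<phi>(1)]] by blast
      then show "(\<integral>x. \<phi> x \<partial>\<mu>' b) \<le> (\<integral>x. \<phi> x \<partial>density \<mu> (\<lambda>x. ennreal 2))"
        by (subst integral_density) auto
    qed
    have "emeasure (\<mu>' b) A = 0" if "A \<in> sets borel" "emeasure \<mu> A = 0" for A
      using dom[OF that(1)] that \<mu>c by (simp add: emeasure_density_const)
    then obtain D where D: "D \<in> borel_measurable borel" "\<And>x. 0 \<le> (D x :: real)" "integrable \<mu> D"
      and eq: "\<mu>' b = density \<mu> (\<lambda>x. ennreal (D x))"
      using cell_measure_RN[OF \<mu> \<mu>'[OF b']] by metis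
    note [measurable] = D(1)
    have "(\<integral>x. \<phi> x \<partial>\<mu>' b) = (LINT x|\<mu>. \<phi> x * D x)" if "cper \<phi>" for \<phi>
      using cper_measurable[OF that] D(2) unfolding eq
      by (subst integral_density) (auto simp: mult.commute)
    then show ?thesis using D by blast
  qed
  then obtain D where D: "\<And>b. b \<in> Basis \<Longrightarrow> D b \<in> borel_measurable borel"
    "\<And>b. b \<in> Basis \<Longrightarrow> integrable \<mu> (D b)"
    "\<And>b \<phi>. b \<in> Basis \<Longrightarrow> cper \<phi> \<Longrightarrow> (\<integral>x. \<phi> x \<partial>\<mu>' b) = (LINT x|\<mu>. \<phi> x * D b x)"
    by metis
  \<comment> \<open>Subtracting 1 takes away the copy of \<open>G\<close> that was added to each
    component.\<close>
  define \<sigma>0 :: "real^2 \<Rightarrow> 'b" where "\<sigma>0 x = (\<Sum>b\<in>Basis. (D b x - 1) *\<^sub>R b)" for x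
  have \<sigma>0m[measurable]: "\<sigma>0 \<in> borel_measurable borel"
    unfolding \<sigma>0_def[abs_def] using D(1) by (intro borel_measurable_sum borel_measurable_scaleR) auto
  have i\<sigma>0: "integrable \<mu> \<sigma>0"
    unfolding \<sigma>0_def[abs_def] using D(2)
    by (intro Bochner_Integration.integrable_sum integrable_scaleR_left Bochner_Integration.integrable_diff) auto
  have limb: "(\<lambda>k. LINT x|torus. \<phi> x *\<^sub>R F (r k) x) \<longlonglongrightarrow> (LINT x|\<mu>. \<phi> x *\<^sub>R \<sigma>0 x)" if \<phi>: "cper \<phi>" for \<phi>
  proof -
    have iphi: "integrable \<mu> \<phi>" by (rule integrable_cper_const[OF \<phi> \<mu>c(1,2)])
    have comp: "(\<lambda>k. (LINT x|torus. \<phi> x *\<^sub>R F (r k) x) \<bullet> b) \<longlonglongrightarrow> (LINT x|\<mu>. \<phi> x *\<^sub>R \<sigma>0 x) \<bullet> b"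
      if b: "b \<in> Basis" for b
    proof -
      have b': "b \<in> insert 0 Basis" using b by simp
      have "(LINT x|torus. \<phi> x *\<^sub>R F (r k) x) \<bullet> b =
          (LINT x|torus. \<phi> x * g b (r k) x) - (LINT x|torus. \<phi> x * G (r k) x)" for k
      proof -
        have "(LINT x|torus. \<phi> x * g b (r k) x) - (LINT x|torus. \<phi> x * G (r k) x) =
            (LINT x|torus. \<phi> x * g b (r k) x - \<phi> x * G (r k) x)"
          by (rule Bochner_Integration.integral_diff[symmetric]) (intro ic ig i \<phi>)+
        also have "\<dots> = (LINT x|torus. (\<phi> x *\<^sub>R F (r k) x) \<bullet> b)"
          by (intro Bochner_Integration.integral_cong) (auto simp: g_def algebra_simps)
        also have "\<dots> = (LINT x|torus. \<phi> x *\<^sub>R F (r k) x) \<bullet> b"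
          using integrable_cper[OF \<phi> iF] by (subst integral_inner_left) auto
        finally show ?thesis by simp
      qed
      moreover have "(\<lambda>k. (LINT x|torus. \<phi> x * g b (r k) x) - (LINT x|torus. \<phi> x * G (r k) x))
         \<longlonglongrightarrow> (LINT x|\<mu>. \<phi> x * D b x) - (LINT x|\<mu>. \<phi> x)"
        using lim'[OF b' \<phi>] limG[OF \<phi>] D(3)[OF b \<phi>] by (intro tendsto_intros) auto
      moreover have "(LINT x|\<mu>. \<phi> x * D b x) - (LINT x|\<mu>. \<phi> x) = (LINT x|\<mu>. \<phi> x *\<^sub>R \<sigma>0 x) \<bullet> b"
      proof -
        have "(LINT x|\<mu>. \<phi> x *\<^sub>R \<sigma>0 x) \<bullet> b = (LINT x|\<mu>. (\<phi> x *\<^sub>R \<sigma>0 x) \<bullet> b)"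
          using integrable_cper[OF \<phi> i\<sigma>0 \<mu>c(2)] by (subst integral_inner_left) auto
        also have "\<dots> = (LINT x|\<mu>. \<phi> x * D b x - \<phi> x)"
          using b by (intro Bochner_Integration.integral_cong)
            (auto simp: \<sigma>0_def inner_sum_left inner_Basis algebra_simps if_distrib cong: if_cong)
        also have "\<dots> = (LINT x|\<mu>. \<phi> x * D b x) - (LINT x|\<mu>. \<phi> x)"
          using integrable_cper[OF \<phi> D(2)[OF b] \<mu>c(2)] iphi
          by (intro Bochner_Integration.integral_diff) auto
        finally show ?thesis by simp
      qed
      ultimately show ?thesis by simp
    qed
    show ?thesis
      by (subst tendsto_componentwise_iff) (use comp in auto)
  qed
  have AEe: "AE x in \<mu>. \<sigma>0 x \<bullet> e \<le> norm e" for e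
  proof -
    have "AE x in \<mu>. 0 \<le> norm e - \<sigma>0 x \<bullet> e"
    proof (rule AE_nonneg_of_cper[OF \<mu>])
      show "integrable \<mu> (\<lambda>x. norm e - \<sigma>0 x \<bullet> e)" using i\<sigma>0 by simp
      fix \<phi> :: "real^2 \<Rightarrow> real" assume \<phi>: "cper \<phi>" "\<And>x. 0 \<le> \<phi> x"
      have iphi: "integrable \<mu> \<phi>" by (rule integrable_cper_const[OF \<phi>(1) \<mu>c(1,2)])
      have "(\<lambda>k. norm e * (LINT x|torus. \<phi> x * G (r k) x) - (LINT x|torus. \<phi> x *\<^sub>R F (r k) x) \<bullet> e)
         \<longlonglongrightarrow> norm e * (LINT x|\<mu>. \<phi> x) - (LINT x|\<mu>. \<phi> x *\<^sub>R \<sigma>0 x) \<bullet> e"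
        by (intro tendsto_intros limG limb \<phi>)
      moreover have "0 \<le> norm e * (LINT x|torus. \<phi> x * G (r k) x) - (LINT x|torus. \<phi> x *\<^sub>R F (r k) x) \<bullet> e" for k
      proof -
        have "(LINT x|torus. \<phi> x *\<^sub>R F (r k) x) \<bullet> e \<le> norm (LINT x|torus. \<phi> x *\<^sub>R F (r k) x) * norm e"
          by (rule norm_cauchy_schwarz)
        also have "norm (LINT x|torus. \<phi> x *\<^sub>R F (r k) x) \<le> (LINT x|torus. \<phi> x * G (r k) x)"
          by (rule Bochner_Integration.integral_norm_bound_integral)
             (use integrable_cper[OF \<phi>(1) iF] ic[OF \<phi>(1) i] \<phi>(2) FG in \<open>auto intro!: mult_left_mono\<close>)
        finally show ?thesis by (simp add: mult.commute mult_right_mono)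
      qed
      ultimately have "0 \<le> norm e * (LINT x|\<mu>. \<phi> x) - (LINT x|\<mu>. \<phi> x *\<^sub>R \<sigma>0 x) \<bullet> e"
        by (intro LIMSEQ_le_const) auto
      also have "\<dots> = (LINT x|\<mu>. norm e * \<phi> x) - (LINT x|\<mu>. (\<phi> x *\<^sub>R \<sigma>0 x) \<bullet> e)"
        using integrable_cper[OF \<phi>(1) i\<sigma>0 \<mu>c(2)] by (subst integral_inner_left) auto
      also have "\<dots> = (LINT x|\<mu>. norm e * \<phi> x - (\<phi> x *\<^sub>R \<sigma>0 x) \<bullet> e)"
        using integrable_cper[OF \<phi>(1) i\<sigma>0 \<mu>c(2)] iphi
        by (intro Bochner_Integration.integral_diff[symmetric] integrable_inner_left) auto
      also have "\<dots> = (LINT x|\<mu>. \<phi> x * (norm e - \<sigma>0 x \<bullet> e))"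
        by (intro Bochner_Integration.integral_cong) (auto simp: algebra_simps)
      finally show "0 \<le> (LINT x|\<mu>. \<phi> x * (norm e - \<sigma>0 x \<bullet> e))" .
    qed
    then show ?thesis by eventually_elim simp
  qed
  obtain E :: "'b set" where E: "countable E" "\<And>X. open X \<Longrightarrow> X \<noteq> {} \<Longrightarrow> \<exists>d\<in>E. d \<in> X"
    using countable_dense_exists by blast
  have Ec: "closure E = UNIV"
  proof -
    have "\<exists>y\<in>E. dist y x < e" if "e > 0" for x e
      using E(2)[of "ball x e"] that by (auto simp: dist_commute)
    then show ?thesis by (auto simp: closure_approachable)
  qed
  have "AE x in \<mu>. \<forall>e\<in>E. \<sigma>0 x \<bullet> e \<le> norm e"
    using E(1) AEe by (simp add: AE_ball_countable)
  then have AE1: "AE x in \<mu>. norm (\<sigma>0 x) \<le> 1"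
    by eventually_elim (rule norm_le_1_of_dense[OF Ec], auto)
  \<comment> \<open>A modification on a null set makes the bound hold everywhere, and composition
    with \<open>fracs\<close> makes the density periodic everywhere.\<close>
  define \<sigma>1 where "\<sigma>1 x = (if norm (\<sigma>0 x) \<le> 1 then \<sigma>0 x else 0)" for x
  define \<sigma> where "\<sigma> x = \<sigma>1 (fracs x)" for x
  have [measurable]: "\<sigma>1 \<in> borel_measurable borel" unfolding \<sigma>1_def[abs_def] by measurable
  have [measurable]: "\<sigma> \<in> borel_measurable borel" unfolding \<sigma>_def[abs_def] by measurable
  have \<sigma>eq: "AE x in \<mu>. \<sigma> x = \<sigma>0 x"
    using AE1 \<mu>c(4) by eventually_elim (simp add: \<sigma>_def fracs_cell \<sigma>1_def)
  show thesis
  proof (rule that[OF r \<mu>])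
    show "\<sigma> \<in> borel_measurable borel" by simp
    show "periodic \<sigma>" unfolding \<sigma>_def[abs_def] by (rule periodic_compose_fracs)
    show "norm (\<sigma> x) \<le> 1" for x by (simp add: \<sigma>_def \<sigma>1_def)
    fix \<phi> :: "real^2 \<Rightarrow> real" assume \<phi>: "cper \<phi>"
    have [measurable]: "\<phi> \<in> borel_measurable borel" using \<phi> by (rule cper_measurable)
    show "(\<lambda>k. LINT x|torus. \<phi> x * G (r k) x) \<longlonglongrightarrow> (LINT x|\<mu>. \<phi> x)" using \<phi> by (rule limG)
    have "(LINT x|\<mu>. \<phi> x *\<^sub>R \<sigma> x) = (LINT x|\<mu>. \<phi> x *\<^sub>R \<sigma>0 x)"
      using \<sigma>eq by (intro integral_cong_AE) auto
    then show "(\<lambda>k. LINT x|torus. \<phi> x *\<^sub>R F (r k) x) \<longlonglongrightarrow> (LINT x|\<mu>. \<phi> x *\<^sub>R \<sigma> x)"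
      using limb[OF \<phi>] by simp
  qed
qed

section \<open>From measures on the cell to measures on the plane\<close>

lemma test_function_cper:
  assumes "test_function \<phi>" shows "cper (fold_sum \<phi>)"
proof -
  obtain R where "R > 0" "\<And>x. norm x > R \<Longrightarrow> \<phi> x = 0"
    using test_function_support[OF assms] by metis
  then show ?thesis
    unfolding cper_def using continuous_fold_sum[of R \<phi>] test_function_continuous[OF assms]
      periodic_fold_sum by auto
qed

text \<open>The indicator of a compact set is dominated by a continuous cut-off of bounded support,
  which is integrable by \<open>periodize_integral\<close>.\<close>

lemma periodize_locally_finite:
  assumes \<mu>: "cell_measure \<mu>" and K: "compact K"
  shows "emeasure (periodize \<mu>) K < \<infinity>"
proof (cases "K = {}")
  case False
  note \<mu>' = cell_measureD[OF \<mu>]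
  interpret finite_measure \<mu> by fact
  obtain R where R: "R > 0" "\<And>x. x \<in> K \<Longrightarrow> norm x \<le> R"
    using K compact_imp_bounded bounded_pos by metis
  define \<phi> :: "real^2 \<Rightarrow> real" where "\<phi> x = max 0 (1 - infdist x K)" for x
  have c: "continuous_on UNIV \<phi>" unfolding \<phi>_def[abs_def] by (intro continuous_intros)
  have z: "\<phi> x = 0" if "norm x > R + 1" for x
  proof -
    obtain y where y: "y \<in> K" "infdist x K = dist x y"
      using infdist_attains_inf[of K x] K False compact_imp_closed by metis
    have "1 \<le> dist x y"
      using that R(2)[OF y(1)] norm_triangle_ineq2[of x y] by (simp add: dist_norm)
    then show ?thesis using y by (simp add: \<phi>_def)
  qed
  have [measurable]: "\<phi> \<in> borel_measurable borel" using c by (rule borel_measurable_continuous_onI)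
  have "integrable (periodize \<mu>) (\<lambda>x. \<phi> x *\<^sub>R (1::real))"
    by (rule periodize_integral(1)[OF \<mu>'(2,5,4) z c]) (auto simp: periodic_def)
  then have "(\<integral>\<^sup>+x. ennreal (norm (\<phi> x)) \<partial>periodize \<mu>) < \<infinity>"
    by (simp add: integrable_iff_bounded)
  moreover have "emeasure (periodize \<mu>) K \<le> (\<integral>\<^sup>+x. ennreal (norm (\<phi> x)) \<partial>periodize \<mu>)"
  proof -
    have "emeasure (periodize \<mu>) K = (\<integral>\<^sup>+x. indicator K x \<partial>periodize \<mu>)"
      using borel_compact[OF K] by simp
    also have "\<dots> \<le> (\<integral>\<^sup>+x. ennreal (norm (\<phi> x)) \<partial>periodize \<mu>)"
      by (intro nn_integral_mono) (auto simp: indicator_def \<phi>_def)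
    finally show ?thesis .
  qed
  ultimately show ?thesis by (rule order_le_less_trans[rotated])
qed simp

lemma emeasure_periodize_cell:
  assumes \<mu>: "cell_measure \<mu>"
  shows "emeasure (periodize \<mu>) period_cell = emeasure \<mu> UNIV"
proof -
  note \<mu>' = cell_measureD[OF \<mu>]
  have "emeasure (periodize \<mu>) period_cell = (\<integral>\<^sup>+x. indicator period_cell x \<partial>periodize \<mu>)" by simp
  also have "\<dots> = (\<integral>\<^sup>+x. 1 \<partial>\<mu>)"
    using \<mu>' by (subst nn_integral_periodize) (auto simp: nn_integral_Z2_indicator_cell)
  finally show ?thesis using \<mu>' by simp
qed

text \<open>A weak limit only provides a density of modulus at most 1, since oscillations may
  cancel. The polar form demands modulus 1, so the factor \<open>norm (\<sigma> x)\<close> is moved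
  into the measure, which can only decrease its mass.\<close>

lemma polar_periodize:
  fixes T :: "(real^2 \<Rightarrow> real) \<Rightarrow> 'b::euclidean_space"
  assumes \<mu>: "cell_measure \<mu>" and \<sigma>[measurable]: "\<sigma> \<in> borel_measurable borel" and p: "periodic \<sigma>"
    and n1: "\<And>x. norm (\<sigma> x) \<le> 1"
    and T: "\<And>\<phi>. test_function \<phi> \<Longrightarrow> T \<phi> = (LINT x|\<mu>. fold_sum \<phi> x *\<^sub>R \<sigma> x)"
  obtains M where "is_measure_with_variation T M" "emeasure M period_cell \<le> emeasure \<mu> UNIV"
proof -
  note \<mu>' = cell_measureD[OF \<mu>]
  note [measurable_cong] = \<mu>'(2)
  interpret finite_measure \<mu> by fact
  define \<nu> where "\<nu> = density \<mu> (\<lambda>x. ennreal (norm (\<sigma> x)))"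
  have i1: "integrable \<mu> (\<lambda>x. norm (\<sigma> x))"
    by (rule integrable_const_bound[where B = 1]) (use n1 in auto)
  have \<nu>: "cell_measure \<nu>" unfolding \<nu>_def using \<mu> i1 by (rule cell_measure_density)
  note \<nu>' = cell_measureD[OF \<nu>]
  interpret N: finite_measure \<nu> by fact
  \<comment> \<open>Where \<sigma> vanishes the direction is arbitrary, because the new measure has
    density zero there; a fixed unit vector keeps the modulus equal to 1 everywhere.\<close>
  obtain e0 :: 'b where e0: "e0 \<in> Basis" using nonempty_Basis by blast
  define \<tau> where "\<tau> x = (if \<sigma> x = 0 then e0 else \<sigma> x /\<^sub>R norm (\<sigma> x))" for x
  have [measurable]: "\<tau> \<in> borel_measurable borel" unfolding \<tau>_def[abs_def] by measurable
  have \<tau>p: "periodic \<tau>" using p by (simp add: periodic_def \<tau>_def)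
  have \<tau>1: "norm (\<tau> x) = 1" for x using e0 by (simp add: \<tau>_def)
  have \<tau>\<sigma>: "norm (\<sigma> x) *\<^sub>R \<tau> x = \<sigma> x" for x by (simp add: \<tau>_def)
  have i\<tau>: "integrable \<nu> \<tau>"
    by (rule N.integrable_const_bound[where B = 1]) (use \<tau>1 in \<open>auto simp: \<nu>_def\<close>)
  have "is_measure_with_variation T (periodize \<nu>)"
    unfolding is_measure_with_variation_def
  proof (intro conjI allI impI exI[of _ \<tau>])
    show "emeasure (periodize \<nu>) K < \<infinity>" if "compact K" for K
      using \<nu> that by (rule periodize_locally_finite)
    show "AE x in periodize \<nu>. norm (\<tau> x) = 1" using \<tau>1 by simp
    fix \<phi> :: "real^2 \<Rightarrow> real" assume \<phi>: "test_function \<phi>"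
    obtain R where R: "R > 0" "\<And>x. norm x > R \<Longrightarrow> \<phi> x = 0"
      using test_function_support[OF \<phi>] by metis
    have [measurable]: "fold_sum \<phi> \<in> borel_measurable borel"
      using \<phi> by (intro cper_measurable test_function_cper)
    have "(\<integral>x. \<phi> x *\<^sub>R \<tau> x \<partial>periodize \<nu>) = (LINT x|\<nu>. fold_sum \<phi> x *\<^sub>R \<tau> x)"
      by (rule periodize_integral(2)[OF \<nu>'(2,5,4) R(2) test_function_continuous[OF \<phi>] _ \<tau>p i\<tau>]) auto
    also have "\<dots> = (LINT x|\<mu>. norm (\<sigma> x) *\<^sub>R (fold_sum \<phi> x *\<^sub>R \<tau> x))"
      unfolding \<nu>_def by (rule integral_density) auto
    also have "\<dots> = (LINT x|\<mu>. fold_sum \<phi> x *\<^sub>R \<sigma> x)"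
      by (intro Bochner_Integration.integral_cong refl) (metis \<tau>\<sigma> scaleR_left_commute)
    also have "\<dots> = T \<phi>" using T[OF \<phi>] by simp
    finally show "T \<phi> = (\<integral>x. \<phi> x *\<^sub>R \<tau> x \<partial>periodize \<nu>)" by simp
  qed auto
  moreover have "emeasure (periodize \<nu>) period_cell \<le> emeasure \<mu> UNIV"
  proof -
    have "emeasure (periodize \<nu>) period_cell = (\<integral>\<^sup>+x. ennreal (norm (\<sigma> x)) \<partial>\<mu>)"
      using \<mu>' by (subst emeasure_periodize_cell[OF \<nu>]) (simp add: \<nu>_def emeasure_density)
    also have "\<dots> \<le> (\<integral>\<^sup>+x. 1 \<partial>\<mu>)" by (intro nn_integral_mono) (use n1 in simp)
    finally show ?thesis using \<mu>' by simp
  qed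
  ultimately show thesis by (rule that)
qed

text \<open>Approximating the indicator of a Lebesgue-null compact set sends the quadratic term to 0
  for fixed \<open>t\<close>; then \<open>t\<close> tends to 0. Inner regularity extends this to all
  null sets. The hypothesis is the Young form of a Cauchy-Schwarz bound and passes to weak
  limits.\<close>

lemma cell_measure_ac_density:
  assumes \<mu>: "cell_measure \<mu>"
    and le: "\<And>\<phi> t. cper \<phi> \<Longrightarrow> (\<And>x. 0 \<le> \<phi> x) \<Longrightarrow> t > 0 \<Longrightarrow>
       (LINT x|\<mu>. \<phi> x) \<le> (LINT x|torus. (\<phi> x)\<^sup>2) / t + t * C"
  obtains D where "D \<in> borel_measurable borel" "\<And>x. 0 \<le> D x" "integrable torus D"
    "\<mu> = density torus (\<lambda>x. ennreal (D x))"
proof -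
  note \<mu>' = cell_measureD[OF \<mu>]
  note [measurable_cong] = \<mu>'(2)
  interpret finite_measure \<mu> by fact
  interpret T: prob_space torus by (rule prob_space_torus)
  have K0: "emeasure \<mu> K = 0" if K: "compact K" "K \<subseteq> period_cell" "emeasure torus K = 0" for K
  proof (cases "K = {}")
    case False
    have Kb: "K \<in> sets borel" using K by (simp add: borel_compact)
    obtain \<Phi> :: "nat \<Rightarrow> real^2 \<Rightarrow> real" where \<Phi>: "\<And>n. cper (\<Phi> n)" "\<And>n x. 0 \<le> \<Phi> n x"
    "\<And>n x. x \<in> period_cell \<Longrightarrow> \<Phi> n x \<le> 169" "\<And>x. x \<in> period_cell \<Longrightarrow> (\<lambda>n. \<Phi> n x) \<longlonglongrightarrow> indicator K x"
      using compact_cper_approx[OF K(1,2) False] by blast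
    note [measurable] = cper_measurable[OF \<Phi>(1)]
    have a: "(\<lambda>n. LINT x|\<mu>. \<Phi> n x) \<longlonglongrightarrow> measure \<mu> K"
      by (rule cper_approx_integral[OF \<mu> Kb _ \<Phi>(2,3,4)]) auto
    have "(\<lambda>n. LINT x|torus. (\<Phi> n x)\<^sup>2) \<longlonglongrightarrow> measure torus K"
    proof (rule cper_approx_integral[OF cell_measure_torus Kb])
      show "(\<Phi> n x)\<^sup>2 \<le> 169\<^sup>2" if "x \<in> period_cell" for n x
        using \<Phi>(2,3) that by (intro power_mono) auto
      show "(\<lambda>n. (\<Phi> n x)\<^sup>2) \<longlonglongrightarrow> indicator K x" if "x \<in> period_cell" for x
      proof -
        have e: "(indicator K x :: real)\<^sup>2 = indicator K x" by (simp add: indicator_def)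
        show ?thesis by (rule tendsto_power[OF \<Phi>(4)[OF that], of 2, unfolded e])
      qed
    qed auto
    then have b: "(\<lambda>n. LINT x|torus. (\<Phi> n x)\<^sup>2) \<longlonglongrightarrow> 0"
      using K(3) by (simp add: measure_def)
    have "measure \<mu> K \<le> t * C" if t: "t > 0" for t
    proof -
      have "(\<lambda>n. (LINT x|torus. (\<Phi> n x)\<^sup>2) / t + t * C) \<longlonglongrightarrow> 0 / t + t * C"
        using t by (intro tendsto_intros b) auto
      then have "measure \<mu> K \<le> 0 / t + t * C"
        by (rule LIMSEQ_le[OF a]) (use le[OF \<Phi>(1,2) t] in auto)
      then show ?thesis by simp
    qed
    note tC = this
    have "measure \<mu> K \<le> 0"
    proof (rule field_le_epsilon)
      fix e :: real assume e: "e > 0"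
      have "measure \<mu> K \<le> e / (\<bar>C\<bar> + 1) * C" using e by (intro tC) auto
      also have "\<dots> \<le> e / (\<bar>C\<bar> + 1) * (\<bar>C\<bar> + 1)" using e by (intro mult_left_mono) auto
      also have "\<dots> = e" by simp
      finally show "measure \<mu> K \<le> 0 + e" by simp
    qed
    then show ?thesis by (simp add: emeasure_eq_measure ennreal_neg)
  qed simp
  have "emeasure \<mu> A = 0" if A: "A \<in> sets borel" "emeasure torus A = 0" for A
  proof -
    define A' where "A' = A \<inter> period_cell"
    have A': "A' \<in> sets borel" using A cell_borel by (auto simp: A'_def)
    have "emeasure \<mu> A = emeasure \<mu> A'"
      by (rule emeasure_eq_AE) (use \<mu>' A A' in \<open>auto simp: A'_def\<close>)
    also have "\<dots> = (SUP K \<in> {K. K \<subseteq> A' \<and> compact K}. emeasure \<mu> K)"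
      by (rule inner_regular[OF \<mu>'(2) _ A']) simp
    also have "\<dots> \<le> 0"
    proof (rule SUP_least)
      fix K assume K: "K \<in> {K. K \<subseteq> A' \<and> compact K}"
      have "emeasure torus K \<le> emeasure torus A"
        using K A by (intro emeasure_mono) (auto simp: A'_def)
      then have "emeasure \<mu> K = 0" using K A by (intro K0) (auto simp: A'_def)
      then show "emeasure \<mu> K \<le> 0" by simp
    qed
    finally show ?thesis by simp
  qed
  then show thesis using cell_measure_RN[OF cell_measure_torus \<mu>] that by metis
qed

section \<open>Pixel functions\<close>

text \<open>\<open>pixel_fun\<close> for values in an arbitrary type, since vector and matrix grids
  occur as well.\<close>

definition pix :: "nat \<Rightarrow> 'b grid \<Rightarrow> real^2 \<Rightarrow> 'b" where
  "pix N v x = v (round (N * x $ 1)) (round (N * x $ 2))"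

lemma pixel_fun_pix: "pixel_fun = pix"
  by (simp add: fun_eq_iff pixel_fun_def pix_def)

definition hvec :: "nat \<Rightarrow> int \<Rightarrow> int \<Rightarrow> real^2" where
  "hvec N m n = vector [of_int m / N, of_int n / N]"

lemma hvec_nth [simp]: "hvec N m n $ 1 = of_int m / N" "hvec N m n $ 2 = of_int n / N"
  by (simp_all add: hvec_def)

lemma round_add_int: "round (x + of_int m) = round (x::real) + m"
  unfolding round_def by linarith

lemma pix_shift:
  assumes "N \<ge> 1"
  shows "pix N (\<lambda>i j. v (i + m) (j + n)) x = pix N v (x + hvec N m n)"
  using assms by (simp add: pix_def distrib_left round_add_int)

lemma periodic_grid_mult:
  assumes "periodic_grid N v"
  shows "v (i + int N * a) (j + int N * b) = v i j"
proof -
  have p1: "v (i + int N * a) j = v i j" for i j a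
  proof (induction a rule: int_induct[where k = 0])
    case (step1 a)
    then show ?case using assms by (simp add: periodic_grid_def distrib_left flip: add.assoc)
  next
    case (step2 a)
    have "v (i + int N * (a - 1)) j = v (i + int N * (a - 1) + int N) j"
      using assms unfolding periodic_grid_def by metis
    also have "\<dots> = v i j" using step2 by (simp add: right_diff_distrib)
    finally show ?case .
  qed simp
  have p2: "v i (j + int N * a) = v i j" for i j a
  proof (induction a rule: int_induct[where k = 0])
    case (step1 a)
    then show ?case using assms by (simp add: periodic_grid_def distrib_left flip: add.assoc)
  next
    case (step2 a)
    have "v i (j + int N * (a - 1)) = v i (j + int N * (a - 1) + int N)"
      using assms unfolding periodic_grid_def by metis
    also have "\<dots> = v i j" using step2 by (simp add: right_diff_distrib)
    finally show ?case .
  qed simp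
  show ?thesis by (simp add: p1 p2)
qed

lemma periodic_pix:
  assumes "periodic_grid N v" shows "periodic (pix N v)"
  unfolding periodic_def
proof (intro allI)
  fix k x
  have "round (N * (x + lat k) $ 1) = round (N * x $ 1) + int N * fst k"
    "round (N * (x + lat k) $ 2) = round (N * x $ 2) + int N * snd k"
    using round_add_int[of "N * x $ 1" "int N * fst k"] round_add_int[of "N * x $ 2" "int N * snd k"]
    by (simp_all add: distrib_left)
  then show "pix N v (x + lat k) = pix N v x"
    by (simp add: pix_def periodic_grid_mult[OF assms])
qed

lemma pix_measurable [measurable]: "pix N v \<in> measurable borel M" if "\<And>i j. v i j \<in> space M"
proof -
  have r[measurable]: "(\<lambda>x::real^2. round (N * x $ a)) \<in> measurable borel (count_space UNIV)" for a
    unfolding round_def by measurable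
  have "(\<lambda>x::real^2. v i (round (N * x $ 2))) \<in> measurable borel M" for i
    by (rule measurable_compose_countable[OF _ r[of 2]]) (simp add: that)
  then show ?thesis
    unfolding pix_def[abs_def] by (rule measurable_compose_countable[OF _ r[of 1]])
qed

lemma pix_borel_measurable [measurable]: "pix N v \<in> borel_measurable borel"
  by (rule pix_measurable) simp

lemma pixel_measure:
  assumes N: "N \<ge> 1" and i: "1 \<le> i" "i \<le> int N" and j: "1 \<le> j" "j \<le> int N"
  shows "measure torus {x. \<lfloor>N * x $ 1\<rfloor> = i - 1 \<and> \<lfloor>N * x $ 2\<rfloor> = j - 1} = 1 / N\<^sup>2"
proof -
  define B where "B = {x::real^2. \<lfloor>N * x $ 1\<rfloor> = i - 1 \<and> \<lfloor>N * x $ 2\<rfloor> = j - 1}"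
  define a :: "real^2" where "a = vector [(of_int i - 1) / N, (of_int j - 1) / N]"
  define b :: "real^2" where "b = vector [of_int i / N, of_int j / N]"
  have B[measurable]: "B \<in> sets borel" unfolding B_def by measurable
  have Beq: "x \<in> B \<longleftrightarrow> a $ 1 \<le> x $ 1 \<and> x $ 1 < b $ 1 \<and> a $ 2 \<le> x $ 2 \<and> x $ 2 < b $ 2" for x
  proof -
    have "\<lfloor>N * y\<rfloor> = i - 1 \<longleftrightarrow> (of_int i - 1) / N \<le> y \<and> y < of_int i / N" for y :: real and i
      using N unfolding floor_eq_iff
      by (auto simp: pos_divide_le_eq pos_less_divide_eq mult.commute)
    then show ?thesis by (auto simp: B_def a_def b_def)
  qed
  have cell: "B \<subseteq> period_cell"
  proof
    fix x assume "x \<in> B"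
    moreover have "0 \<le> a $ 1" "0 \<le> a $ 2" "b $ 1 \<le> 1" "b $ 2 \<le> 1"
      using N i j by (auto simp: a_def b_def)
    ultimately show "x \<in> period_cell" by (auto simp: Beq period_cell_def forall_2)
  qed
  have ba: "b $ 1 - a $ 1 = 1 / N" "b $ 2 - a $ 2 = 1 / N"
    using N by (auto simp: a_def b_def field_simps)
  have "0 \<le> 1 / real N" by simp
  with ba have ab: "a $ 1 \<le> b $ 1" "a $ 2 \<le> b $ 2" by linarith+
  have vol: "(\<Prod>e\<in>Basis. (b - a) \<bullet> e) = 1 / N\<^sup>2"
    using ba by (auto simp: Basis_vec_def UNIV_2 inner_axis axis_eq_axis power2_eq_square)
  have abe: "\<And>e. e \<in> Basis \<Longrightarrow> a \<bullet> e \<le> b \<bullet> e"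
    using ab by (auto simp: Basis_vec_def UNIV_2 inner_axis)
  have "emeasure torus B = emeasure lborel B"
    using cell by (simp add: torus_def emeasure_density indicator_inter_arith[symmetric] Int_absorb1)
  also have "\<dots> = ennreal (1 / N\<^sup>2)"
  proof (rule antisym)
    have "emeasure lborel B \<le> emeasure lborel (cbox a b)"
      by (intro emeasure_mono) (auto simp: Beq mem_box_cart forall_2)
    then show "emeasure lborel B \<le> ennreal (1 / N\<^sup>2)"
      using emeasure_lborel_cbox[OF abe] vol by simp
    have "emeasure lborel (box a b) \<le> emeasure lborel B"
      by (intro emeasure_mono) (auto simp: Beq mem_box_cart forall_2)
    then show "ennreal (1 / N\<^sup>2) \<le> emeasure lborel B"
      using emeasure_lborel_box[OF abe] vol by simp
  qed
  finally show ?thesis unfolding B_def[symmetric] by (simp add: measure_def)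
qed

text \<open>Pixels centred at grid points straddle the boundary of the cell. A shift by half a
  pixel, which leaves torus integrals of periodic functions unchanged, turns rounding into a floor
  and aligns the pixels with the cell.\<close>

lemma integral_pix:
  fixes v :: "'b::euclidean_space grid"
  assumes N: "N \<ge> 1" and p: "periodic_grid N v"
  shows "integrable torus (pix N v)"
    and "(LINT x|torus. pix N v x) = (\<Sum>i=1..int N. \<Sum>j=1..int N. v i j) /\<^sub>R N\<^sup>2"
proof -
  interpret prob_space torus by (rule prob_space_torus)
  define c :: "real^2" where "c = vector [1 / (2 * N), 1 / (2 * N)]"
  define B where "B i j = {x::real^2. \<lfloor>N * x $ 1\<rfloor> = i - 1 \<and> \<lfloor>N * x $ 2\<rfloor> = j - 1}" for i j
  have [measurable]: "B i j \<in> sets borel" for i j unfolding B_def by measurable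
  have AEeq: "AE x in torus. pix N v (x + c) = (\<Sum>i=1..int N. \<Sum>j=1..int N. indicator (B i j) x *\<^sub>R v i j)"
    using AE_torus
  proof eventually_elim
    case (elim x)
    define a b where "a = \<lfloor>N * x $ 1\<rfloor> + 1" and "b = \<lfloor>N * x $ 2\<rfloor> + 1"
    have r: "round (N * (x + c) $ 1) = a" "round (N * (x + c) $ 2) = b"
      using N by (simp_all add: round_def c_def a_def b_def distrib_left)
    have x01: "0 \<le> x $ 1" "x $ 1 < 1" "0 \<le> x $ 2" "x $ 2 < 1"
      using elim by (auto simp: period_cell_def)
    have "0 \<le> \<lfloor>N * x $ 1\<rfloor>" "0 \<le> \<lfloor>N * x $ 2\<rfloor>" using x01 by auto
    moreover have "\<lfloor>N * x $ 1\<rfloor> < int N" "\<lfloor>N * x $ 2\<rfloor> < int N"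
      using x01 N by (auto simp: floor_less_iff)
    ultimately have ab: "a \<in> {1..int N}" "b \<in> {1..int N}" by (auto simp: a_def b_def)
    have "(\<Sum>i=1..int N. \<Sum>j=1..int N. indicator (B i j) x *\<^sub>R v i j) =
        (\<Sum>i=1..int N. if i = a then v a b else 0)"
    proof (intro sum.cong refl)
      fix i
      have "(\<Sum>j=1..int N. indicator (B i j) x *\<^sub>R v i j) = (\<Sum>j=1..int N. if j = b then (if i = a then v a b else 0) else 0)"
        by (intro sum.cong refl) (auto simp: B_def a_def b_def)
      also have "\<dots> = (if i = a then v a b else 0)"
        using ab by (subst sum.delta) auto
      finally show "(\<Sum>j=1..int N. indicator (B i j) x *\<^sub>R v i j) = (if i = a then v a b else 0)" .
    qed
    also have "\<dots> = v a b"
      using ab by (simp add: sum.delta)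
    finally show ?case unfolding pix_def r by (rule sym)
  qed
  have int1: "integrable torus (\<lambda>x. \<Sum>i=1..int N. \<Sum>j=1..int N. indicator (B i j) x *\<^sub>R v i j)"
    by (intro Bochner_Integration.integrable_sum integrable_scaleR_left integrable_real_indicator) (auto simp: less_top[symmetric])
  have ii: "integrable torus (\<lambda>x. indicator (B i j) x *\<^sub>R v i j)" for i j
    by (intro integrable_scaleR_left integrable_real_indicator) (auto simp: less_top[symmetric])
  have mc: "(\<lambda>x. pix N v (x + c)) \<in> borel_measurable borel" by measurable
  have int2: "integrable torus (\<lambda>x. pix N v (x + c))"
    by (rule iffD2[OF integrable_cong_AE[OF _ borel_measurable_integrable[OF int1] AEeq] int1]) (use mc in simp)
  have "integrable (distr torus borel (\<lambda>x. fracs (x + c))) (pix N v)"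
    by (subst integrable_distr_eq) (use int2 in \<open>auto simp: periodic_fracs[OF periodic_pix[OF p]]\<close>)
  then show "integrable torus (pix N v)" by (simp add: torus_translate)
  have "(LINT x|torus. pix N v x) = (LINT x|torus. pix N v (x + c))"
    by (rule integral_torus_translate[symmetric]) (auto simp: periodic_pix[OF p])
  also have "\<dots> = (LINT x|torus. (\<Sum>i=1..int N. \<Sum>j=1..int N. indicator (B i j) x *\<^sub>R v i j))"
    by (rule integral_cong_AE[OF _ borel_measurable_integrable[OF int1] AEeq]) (use mc in simp)
  also have "\<dots> = (\<Sum>i=1..int N. (LINT x|torus. (\<Sum>j=1..int N. indicator (B i j) x *\<^sub>R v i j)))"
    by (rule Bochner_Integration.integral_sum) (intro Bochner_Integration.integrable_sum ii)
  also have "\<dots> = (\<Sum>i=1..int N. \<Sum>j=1..int N. (LINT x|torus. indicator (B i j) x *\<^sub>R v i j))"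
    by (intro sum.cong refl Bochner_Integration.integral_sum ii)
  also have "\<dots> = (\<Sum>i=1..int N. \<Sum>j=1..int N. measure torus (B i j) *\<^sub>R v i j)"
    by (intro sum.cong refl) (simp add: less_top[symmetric])
  also have "\<dots> = (\<Sum>i=1..int N. \<Sum>j=1..int N. (1 / N\<^sup>2) *\<^sub>R v i j)"
    using pixel_measure[OF N] by (intro sum.cong refl) (auto simp: B_def)
  finally show "(LINT x|torus. pix N v x) = (\<Sum>i=1..int N. \<Sum>j=1..int N. v i j) /\<^sub>R N\<^sup>2"
    by (simp add: scaleR_sum_right inverse_eq_divide)
qed

section \<open>Discrete Korn and embedding estimates\<close>

text \<open>Means over one period instead of sums: as integrals of pixel functions they allow
  estimates whose constants do not depend on \<open>N\<close>.\<close>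

definition av :: "nat \<Rightarrow> (int \<Rightarrow> real) \<Rightarrow> real" where
  "av N f = (\<Sum>i=1..int N. f i) / N"

abbreviation av2 :: "nat \<Rightarrow> (int \<Rightarrow> int \<Rightarrow> real) \<Rightarrow> real" where
  "av2 N f \<equiv> av N (\<lambda>i. av N (\<lambda>j. f i j))"

definition per1 :: "nat \<Rightarrow> (int \<Rightarrow> 'a) \<Rightarrow> bool" where
  "per1 N f \<longleftrightarrow> (\<forall>i. f (i + int N) = f i)"

lemma per1_shift:
  assumes "per1 N f" shows "per1 N (\<lambda>i. f (i + m))"
  unfolding per1_def
proof
  fix i
  show "f (i + int N + m) = f (i + m)"
    using assms[unfolded per1_def, rule_format, of "i + m"] by (simp add: ac_simps)
qed

lemma periodic_grid_shift:
  assumes "periodic_grid N v" shows "periodic_grid N (\<lambda>i j. v (i + m) (j + n))"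
  unfolding periodic_grid_def
proof (intro allI conjI)
  fix i j
  show "v (i + int N + m) (j + n) = v (i + m) (j + n)"
    using assms[unfolded periodic_grid_def, rule_format, of "i + m" "j + n"] by (simp add: ac_simps)
  show "v (i + m) (j + int N + n) = v (i + m) (j + n)"
    using assms[unfolded periodic_grid_def, rule_format, of "i + m" "j + n"] by (simp add: ac_simps)
qed

lemma periodic_grid_simps:
  assumes "periodic_grid N v"
  shows "v (i + int N) j = v i j" "v i (j + int N) = v i j"
    "v (i + int N + 1) j = v (i + 1) j" "v i (j + int N + 1) = v i (j + 1)"
    "v (i + int N - 1) j = v (i - 1) j" "v i (j + int N - 1) = v i (j - 1)"
  using assms[unfolded periodic_grid_def, rule_format, of i j]
    periodic_grid_shift[OF assms, of 1 0, unfolded periodic_grid_def, rule_format, of i j]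
    periodic_grid_shift[OF assms, of 0 1, unfolded periodic_grid_def, rule_format, of i j]
    periodic_grid_shift[OF assms, of "-1" 0, unfolded periodic_grid_def, rule_format, of i j]
    periodic_grid_shift[OF assms, of 0 "-1", unfolded periodic_grid_def, rule_format, of i j]
  by simp_all

lemma sum_shift_per1:
  fixes f :: "int \<Rightarrow> 'a::ab_group_add"
  assumes "per1 N f" shows "(\<Sum>i=1..int N. f (i + m)) = (\<Sum>i=1..int N. f i)"
proof -
  have 1: "(\<Sum>i=1..int N. g (i + 1)) = (\<Sum>i=1..int N. g i)" if "per1 N g" for g :: "int \<Rightarrow> 'a"
  proof (cases "N = 0")
    case False
    have "(\<Sum>i=1..int N. g (i + 1)) = (\<Sum>i=2..int N + 1. g i)"
      by (rule sum.reindex_bij_witness[where i = "\<lambda>i. i - 1" and j = "\<lambda>i. i + 1"]) auto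
    also have "{2..int N + 1} = insert (int N + 1) {2..int N}" using False by auto
    also have "sum g (insert (int N + 1) {2..int N}) = g (int N + 1) + sum g {2..int N}" by simp
    also have "g (int N + 1) = g 1" using that by (simp add: per1_def add.commute)
    also have "g 1 + sum g {2..int N} = sum g (insert 1 {2..int N})" by simp
    also have "insert 1 {2..int N} = {1..int N}" using False by auto
    finally show ?thesis .
  qed simp
  show ?thesis
  proof (induction m rule: int_induct[where k = 0])
    case (step1 m)
    from 1[OF per1_shift[OF assms, of m]] step1 show ?case by (simp add: algebra_simps)
  next
    case (step2 m)
    from 1[OF per1_shift[OF assms, of "m - 1"]] step2 show ?case by (simp add: algebra_simps)
  qed simp
qed

lemma av_shift: "per1 N f \<Longrightarrow> av N (\<lambda>i. f (i + m)) = av N f"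
  by (simp add: av_def sum_shift_per1)

lemma av_mono: "(\<And>i. f i \<le> g i) \<Longrightarrow> av N f \<le> av N g"
  by (simp add: av_def divide_right_mono sum_mono)

lemma av_add: "av N (\<lambda>i. f i + g i) = av N f + av N g"
  by (simp add: av_def sum.distrib add_divide_distrib)

lemma av_diff: "av N (\<lambda>i. f i - g i) = av N f - av N g"
  by (simp add: av_def sum_subtractf diff_divide_distrib)

lemma av_cmult: "av N (\<lambda>i. c * f i) = c * av N f"
  by (simp add: av_def sum_distrib_left)

lemma av_multc: "av N (\<lambda>i. f i * c) = av N f * c"
  by (simp add: av_def sum_distrib_right)

lemma av_const: "N \<ge> 1 \<Longrightarrow> av N (\<lambda>i. c) = c"
  by (simp add: av_def)

lemma av_nonneg: "(\<And>i. 0 \<le> f i) \<Longrightarrow> 0 \<le> av N f"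
  by (simp add: av_def sum_nonneg)

lemma av_abs: "\<bar>av N f\<bar> \<le> av N (\<lambda>i. \<bar>f i\<bar>)"
  by (simp add: av_def abs_divide divide_right_mono sum_abs)

lemma av_swap: "av N (\<lambda>i. av N (\<lambda>j. f i j)) = av N (\<lambda>j. av N (\<lambda>i. f i j))"
  unfolding av_def by (simp add: sum_divide_distrib[symmetric]) (rule disjI2, rule sum.swap)

lemma av_sum: "av N (\<lambda>i. \<Sum>k\<in>K. f k i) = (\<Sum>k\<in>K. av N (f k))"
  unfolding av_def by (subst sum.swap) (simp add: sum_divide_distrib)

text \<open>Any two values of a periodic sequence differ by at most its variation over one period,
  so each value is that close to the mean. The factor \<open>N\<close> of the difference quotient
  cancels the normalisation of the mean.\<close>

lemma oscillation_av:
  assumes N: "N \<ge> 1" and p: "per1 N f"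
  shows "\<bar>f i - av N f\<bar> \<le> av N (\<lambda>k. \<bar>N * (f k - f (k - 1))\<bar>)"
proof -
  define D where "D = (\<Sum>k=1..int N. \<bar>f k - f (k - 1)\<bar>)"
  have tel: "\<bar>f (i + int n) - f i\<bar> \<le> (\<Sum>k=1..int n. \<bar>f (i + k) - f (i + k - 1)\<bar>)" for n
  proof (induction n)
    case (Suc n)
    have "{1..int (Suc n)} = insert (int n + 1) {1..int n}" by auto
    then have "(\<Sum>k=1..int (Suc n). \<bar>f (i + k) - f (i + k - 1)\<bar>) =
      \<bar>f (i + (int n + 1)) - f (i + int n)\<bar> + (\<Sum>k=1..int n. \<bar>f (i + k) - f (i + k - 1)\<bar>)"
      by (simp add: algebra_simps)
    with Suc show ?case by (simp add: algebra_simps)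
  qed simp
  have dist: "\<bar>f j - f i\<bar> \<le> D" for j
  proof -
    define n where "n = nat ((j - i) mod int N)"
    have n: "int n = (j - i) mod int N" "n \<le> N" using N by (auto simp: n_def nat_le_iff less_imp_le)
    have "periodic_grid N (\<lambda>i j. f i)" using p by (simp add: periodic_grid_def per1_def)
    from periodic_grid_mult[OF this, of "i + int n" "(j - i) div int N"]
    have "f j = f (i + int n)" using n(1) by (simp add: algebra_simps)
    then have "\<bar>f j - f i\<bar> \<le> (\<Sum>k=1..int n. \<bar>f (i + k) - f (i + k - 1)\<bar>)" using tel by simp
    also have "\<dots> \<le> (\<Sum>k=1..int N. \<bar>f (i + k) - f (i + k - 1)\<bar>)"
      using n by (intro sum_mono2) auto
    also have "\<dots> = (\<Sum>k=1..int N. \<bar>f (k + i) - f (k + i - 1)\<bar>)" by (simp add: add.commute)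
    also have "\<dots> = D"
      unfolding D_def
      by (rule sum_shift_per1[where f = "\<lambda>k. \<bar>f k - f (k - 1)\<bar>"])
         (use p in \<open>simp add: per1_def\<close>, metis add_diff_eq diff_add_eq)
    finally show ?thesis .
  qed
  have "f i - av N f = av N (\<lambda>k. f i - f k)"
    using N by (simp add: av_diff av_const)
  also have "\<bar>\<dots>\<bar> \<le> av N (\<lambda>k. \<bar>f i - f k\<bar>)" by (rule av_abs)
  also have "\<dots> \<le> av N (\<lambda>k. D)" by (rule av_mono) (use dist in \<open>simp add: abs_minus_commute\<close>)
  also have "\<dots> = D" using N by (rule av_const)
  also have "D = av N (\<lambda>k. \<bar>N * (f k - f (k - 1))\<bar>)"
    using N by (simp add: av_def D_def abs_mult sum_distrib_left[symmetric])
  finally show ?thesis .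
qed

text \<open>\<open>dif1\<close>, \<open>difm\<close> and \<open>dif2\<close> are the three
  components of the discrete symmetrized gradient for h = 1/N, written for two scalar grids so that
  exchanging the axes can be expressed.\<close>

definition dif1 :: "nat \<Rightarrow> real grid \<Rightarrow> real grid" where
  "dif1 N a i j = N * (a i j - a (i - 1) j)"

definition dif2 :: "nat \<Rightarrow> real grid \<Rightarrow> real grid" where
  "dif2 N b i j = N * (b i j - b i (j - 1))"

definition difm :: "nat \<Rightarrow> real grid \<Rightarrow> real grid \<Rightarrow> real grid" where
  "difm N a b i j = N * (a i (j + 1) - a i j + b (i + 1) j - b i j) / 2"

lemma periodic_gridD: "periodic_grid N v \<Longrightarrow> v (i + int N) j = v i j" "periodic_grid N v \<Longrightarrow> v i (j + int N) = v i j"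
  by (simp_all add: periodic_grid_def)

lemma periodic_grid_per1:
  assumes "periodic_grid N v"
  shows "per1 N (\<lambda>i. v (i + m) n)" "per1 N (\<lambda>j. v m (j + n))" "per1 N (\<lambda>i. v i n)" "per1 N (\<lambda>j. v m j)"
  using assms periodic_grid_shift[OF assms, of m 0] periodic_grid_shift[OF assms, of 0 n]
  by (simp_all add: per1_def periodic_grid_def)

text \<open>Averaging in the first direction removes the first-direction derivative of the other component
  from the mixed difference, so the row means are controlled by it alone.\<close>

lemma korn_row:
  assumes N: "N \<ge> 1" and pa: "periodic_grid N a" and pb: "periodic_grid N b"
    and S: "av2 N (\<lambda>i j. 2 * \<bar>difm N a b i j\<bar>) \<le> S" and m: "\<bar>av2 N a\<bar> \<le> m"
  shows "\<bar>a i j\<bar> \<le> m + S + av N (\<lambda>i. \<bar>dif1 N a i j\<bar>)"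
proof -
  define A where "A j = av N (\<lambda>i. a i j)" for j
  have pA: "per1 N A" using pa by (simp add: per1_def A_def periodic_gridD)
  have a1: "\<bar>a i j - A j\<bar> \<le> av N (\<lambda>i. \<bar>dif1 N a i j\<bar>)"
    unfolding A_def dif1_def by (rule oscillation_av[OF N]) (rule periodic_grid_per1[OF pa])
  have dA: "N * (A j - A (j - 1)) = av N (\<lambda>i. 2 * difm N a b i (j - 1))" for j
  proof -
    have "av N (\<lambda>i. N * (b (i + 1) (j - 1) - b i (j - 1))) = 0"
      using av_shift[OF periodic_grid_per1(3)[OF pb], of 1 "j - 1"] by (simp add: av_cmult av_diff)
    moreover have "2 * difm N a b i (j - 1) = N * (a i j - a i (j - 1)) + N * (b (i + 1) (j - 1) - b i (j - 1))" for i
      by (simp add: difm_def field_simps)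
    ultimately show ?thesis by (simp add: av_add) (simp add: av_cmult av_diff A_def)
  qed
  have "\<bar>A j - av N A\<bar> \<le> av N (\<lambda>j. \<bar>N * (A j - A (j - 1))\<bar>)"
    by (rule oscillation_av[OF N pA])
  also have "\<dots> \<le> av N (\<lambda>j. av N (\<lambda>i. 2 * \<bar>difm N a b i (j + (-1))\<bar>))"
  proof (rule av_mono)
    fix j
    have "\<bar>N * (A j - A (j - 1))\<bar> \<le> av N (\<lambda>i. \<bar>2 * difm N a b i (j - 1)\<bar>)"
      unfolding dA by (rule av_abs)
    then show "\<bar>N * (A j - A (j - 1))\<bar> \<le> av N (\<lambda>i. 2 * \<bar>difm N a b i (j + (-1))\<bar>)"
      by (simp add: abs_mult)
  qed
  also have "\<dots> = av N (\<lambda>j. av N (\<lambda>i. 2 * \<bar>difm N a b i j\<bar>))"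
    by (rule av_shift[where f = "\<lambda>j. av N (\<lambda>i. 2 * \<bar>difm N a b i j\<bar>)"])
       (simp add: per1_def difm_def periodic_grid_simps[OF pa] periodic_grid_simps[OF pb])
  also have "\<dots> = av2 N (\<lambda>i j. 2 * \<bar>difm N a b i j\<bar>)" by (rule av_swap)
  also have "\<dots> \<le> S" by (rule S)
  finally have "\<bar>A j - av N A\<bar> \<le> S" .
  moreover have "av N A = av2 N a" unfolding A_def by (rule av_swap)
  ultimately show ?thesis using a1 m by linarith
qed

text \<open>The shear (d, t) -> (d + t, t) permutes the discrete torus, so the diagonals exhaust it
  exactly once.\<close>

lemma av2_diagonal:
  assumes "\<And>t. per1 N (\<lambda>d. F d t)"
  shows "av N (\<lambda>d. av N (\<lambda>t. F (d + t) t)) = av2 N F"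
proof -
  have "av N (\<lambda>d. av N (\<lambda>t. F (d + t) t)) = av N (\<lambda>t. av N (\<lambda>d. F (d + t) t))" by (rule av_swap)
  also have "\<dots> = av N (\<lambda>t. av N (\<lambda>d. F d t))" by (simp add: av_shift[OF assms])
  also have "\<dots> = av2 N F" by (rule av_swap)
  finally show ?thesis .
qed

lemma av2_prod_cross: "av2 N (\<lambda>i j. H i * G j) = av N H * av N G"
  by (simp add: av_cmult av_multc)

text \<open>The coordinates \<open>j\<close> and \<open>i - j\<close> are independent on the
  discrete torus, so the mean of the product factorises just as for \<open>i\<close> and
  \<open>j\<close>.\<close>

lemma av2_prod_diagonal:
  assumes "per1 N T"
  shows "av2 N (\<lambda>i j. G j * T (i - j)) = av N G * av N T"
proof -
  have "av2 N (\<lambda>i j. G j * T (i - j)) = av N (\<lambda>j. av N (\<lambda>i. G j * T (i - j)))" by (rule av_swap)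
  also have "\<dots> = av N (\<lambda>j. G j * av N T)"
    using av_shift[OF assms, of "- _"] by (simp add: av_cmult)
  finally show ?thesis by (simp add: av_multc)
qed

lemma av2_mono: "(\<And>i j. f i j \<le> g i j) \<Longrightarrow> av2 N f \<le> av2 N g"
  by (intro av_mono)

lemma av2_add: "av2 N (\<lambda>i j. f i j + g i j) = av2 N f + av2 N g"
  by (simp add: av_add)

lemma av2_shift:
  assumes "periodic_grid N f" shows "av2 N (\<lambda>i j. f (i + m) (j + n)) = av2 N f"
proof -
  have "av2 N (\<lambda>i j. f (i + m) (j + n)) = av N (\<lambda>i. av N (f (i + m)))"
    by (intro arg_cong[where f = "av N"] ext av_shift) (rule periodic_grid_per1[OF assms])
  also have "\<dots> = av2 N f"
  proof (rule av_shift[where f = "\<lambda>i. av N (f i)"])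
    have "f (i + int N) = f i" for i using assms by (auto simp: periodic_grid_def)
    then show "per1 N (\<lambda>i. av N (f i))" by (simp add: per1_def)
  qed
  finally show ?thesis .
qed

text \<open>The diagonal combination has its diagonal derivative controlled by the symmetrized gradient;
  with the bounds along rows and columns this gives the two-dimensional \<open>L\<^sup>2\<close> bound, because
  functions of two transversal variables multiply to an integrable function.\<close>

lemma discrete_strauss:
  assumes N: "N \<ge> 1" and pa: "periodic_grid N a" and pb: "periodic_grid N b"
    and S: "av2 N (\<lambda>i j. \<bar>dif1 N a i j\<bar> + 2 * \<bar>difm N a b i j\<bar> + \<bar>dif2 N b i j\<bar>) \<le> S"
    and ma: "\<bar>av2 N a\<bar> \<le> m" and mb: "\<bar>av2 N b\<bar> \<le> m"
  shows "av2 N (\<lambda>i j. \<bar>a i j\<bar> + \<bar>b i j\<bar>) \<le> 2 * (m + 2 * S)"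
    and "av2 N (\<lambda>i j. (a i j)\<^sup>2 + (b i j)\<^sup>2) \<le> 2 * (m + 2 * S) * (3 * m + 7 * S)"
proof -
  have S1: "av2 N (\<lambda>i j. \<bar>dif1 N a i j\<bar>) \<le> S"
    by (rule order_trans[OF av2_mono S]) auto
  have S2: "av2 N (\<lambda>i j. 2 * \<bar>difm N a b i j\<bar>) \<le> S"
    by (rule order_trans[OF av2_mono S]) auto
  have S3: "av2 N (\<lambda>i j. \<bar>dif2 N b i j\<bar>) \<le> S"
    by (rule order_trans[OF av2_mono S]) auto
  have m0: "0 \<le> m" using ma by linarith
  have S0: "0 \<le> S" by (rule order_trans[OF _ S1]) (intro av_nonneg, simp)
  \<comment> \<open>Pointwise majorants of \<open>a\<close> and \<open>b\<close> that depend on one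
    variable only: \<open>G\<close> on the row \<open>j\<close>, \<open>H\<close> on the column
    \<open>i\<close>. Their means are at most m + 2 S.\<close>
  define G where "G j = m + S + av N (\<lambda>i. \<bar>dif1 N a i j\<bar>)" for j
  define H where "H i = m + S + av N (\<lambda>j. \<bar>dif2 N b i j\<bar>)" for i
  have aG: "\<bar>a i j\<bar> \<le> G j" for i j
    unfolding G_def by (rule korn_row[OF N pa pb S2 ma])
  have bH: "\<bar>b i j\<bar> \<le> H i" for i j
  proof -
    \<comment> \<open>Transposing the grid exchanges the roles of the two components and turns the
      row estimate into a column estimate.\<close>
    let ?a = "\<lambda>i j. b j i" and ?b = "\<lambda>i j. a j i"
    have m1: "difm N ?a ?b i j = difm N a b j i" for i j by (simp add: difm_def)
    have d1: "dif1 N ?a i j = dif2 N b j i" for i j by (simp add: dif1_def dif2_def)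
    have "\<bar>?a j i\<bar> \<le> m + S + av N (\<lambda>i'. \<bar>dif1 N ?a i' i\<bar>)"
    proof (rule korn_row[OF N])
      show "periodic_grid N ?a" "periodic_grid N ?b" using pa pb by (auto simp: periodic_grid_def)
      show "av2 N (\<lambda>i j. 2 * \<bar>difm N ?a ?b i j\<bar>) \<le> S" unfolding m1 using S2 by (subst av_swap)
      show "\<bar>av2 N ?a\<bar> \<le> m" using mb by (subst av_swap)
    qed
    then show ?thesis by (simp add: H_def d1)
  qed
  have G0: "0 \<le> G j" for j using aG[of 0 j] by linarith
  have H0: "0 \<le> H i" for i using bH[of i 0] by linarith
  have "av N G = m + S + av N (\<lambda>j. av N (\<lambda>i. \<bar>dif1 N a i j\<bar>))"
    unfolding G_def using N by (simp add: av_add av_const)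
  also have "\<dots> \<le> m + 2 * S" using S1 by (subst av_swap) simp
  finally have Gav: "av N G \<le> m + 2 * S" .
  have "av N H = m + S + av2 N (\<lambda>i j. \<bar>dif2 N b i j\<bar>)"
    unfolding H_def using N by (simp add: av_add av_const)
  also have "\<dots> \<le> m + 2 * S" using S3 by simp
  finally have Hav: "av N H \<le> m + 2 * S" .
  have avG0: "0 \<le> av N G" "0 \<le> av N H" using G0 H0 by (auto intro: av_nonneg)
  have "av2 N (\<lambda>i j. \<bar>a i j\<bar> + \<bar>b i j\<bar>) \<le> av2 N (\<lambda>i j. G j + H i)"
    using aG bH by (intro av2_mono add_mono)
  also have "\<dots> = av N G + av N H" using N by (simp add: av_add av_const)
  also have "\<dots> \<le> 2 * (m + 2 * S)" using Gav Hav by simp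
  finally show L1: "av2 N (\<lambda>i j. \<bar>a i j\<bar> + \<bar>b i j\<bar>) \<le> 2 * (m + 2 * S)" .
  \<comment> \<open>The offset (+1, -1) respects the staggering: with it the diagonal difference of
    \<open>s\<close> is exactly a sum of \<open>dif1\<close>, twice \<open>difm\<close> and
    \<open>dif2\<close> at (i + 1, j), so the antisymmetric part of the gradient does not
    occur.\<close>
  define s where "s i j = a i j + b (i + 1) (j - 1)" for i j
  define \<delta> where "\<delta> i j = \<bar>dif1 N a (i + 1) j\<bar> + 2 * \<bar>difm N a b (i + 1) j\<bar> + \<bar>dif2 N b (i + 1) j\<bar>" for i j
  have ps: "periodic_grid N s"
    using periodic_grid_simps[OF pa] periodic_grid_shift[OF pb, of 1 "-1"]
    by (simp add: periodic_grid_def s_def)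
  have pE: "periodic_grid N (\<lambda>i j. \<bar>dif1 N a i j\<bar> + 2 * \<bar>difm N a b i j\<bar> + \<bar>dif2 N b i j\<bar>)"
    unfolding periodic_grid_def
    by (simp add: dif1_def dif2_def difm_def periodic_grid_simps[OF pa] periodic_grid_simps[OF pb])
  have s\<delta>: "\<bar>N * (s (i + 1) (j + 1) - s i j)\<bar> \<le> \<delta> i j" for i j
  proof -
    have "N * (s (i + 1) (j + 1) - s i j) = dif1 N a (i + 1) j + 2 * difm N a b (i + 1) j + dif2 N b (i + 1) j"
      by (simp add: s_def dif1_def dif2_def difm_def field_simps)
    then show ?thesis by (simp add: \<delta>_def)
  qed
  \<comment> \<open>A majorant of \<open>s\<close> depending on \<open>i - j\<close> only: along a
    diagonal, the mean of |s| plus its variation, the latter bounded through \<delta>.\<close>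
  define T where "T d = av N (\<lambda>t. \<bar>s (d + t) t\<bar>) + av N (\<lambda>t. \<delta> (d + t) t)" for d
  have p\<delta>: "periodic_grid N \<delta>"
    unfolding \<delta>_def[abs_def] using periodic_grid_shift[OF pE, of 1 0] by simp
  have sT: "\<bar>s i j\<bar> \<le> T (i - j)" for i j
  proof -
    define f where "f t = s (i - j + t) t" for t
    have pf: "per1 N f"
      using periodic_grid_mult[OF ps, of _ 1 _ 1] by (simp add: per1_def f_def flip: add.assoc)
    have "\<bar>f j - av N f\<bar> \<le> av N (\<lambda>k. \<bar>N * (f k - f (k - 1))\<bar>)"
      by (rule oscillation_av[OF N pf])
    also have "\<dots> \<le> av N (\<lambda>k. \<delta> (i - j + (k + (-1))) (k + (-1)))"
    proof (rule av_mono)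
      fix k
      show "\<bar>N * (f k - f (k - 1))\<bar> \<le> \<delta> (i - j + (k + (-1))) (k + (-1))"
        using s\<delta>[of "i - j + (k - 1)" "k - 1"] by (simp add: f_def algebra_simps)
    qed
    also have "\<dots> = av N (\<lambda>k. \<delta> (i - j + k) k)"
      by (rule av_shift[where f = "\<lambda>k. \<delta> (i - j + k) k"])
         (use periodic_grid_mult[OF p\<delta>, of _ 1 _ 1] in \<open>simp add: per1_def flip: add.assoc\<close>)
    finally have "\<bar>f j - av N f\<bar> \<le> av N (\<lambda>k. \<delta> (i - j + k) k)" .
    moreover have "\<bar>av N f\<bar> \<le> av N (\<lambda>t. \<bar>s (i - j + t) t\<bar>)"
      unfolding f_def by (rule av_abs)
    moreover have "f j = s i j" by (simp add: f_def)
    ultimately show ?thesis by (simp add: T_def)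
  qed
  have pT: "per1 N T"
  proof -
    have "s (i + int N + t) t = s (i + t) t" "\<delta> (i + int N + t) t = \<delta> (i + t) t" for i t
      using periodic_grid_simps(1)[OF ps, of "i + t" t] periodic_grid_simps(1)[OF p\<delta>, of "i + t" t]
      by (simp_all add: ac_simps)
    then show ?thesis by (simp add: per1_def T_def)
  qed
  have "av N T = av2 N (\<lambda>i j. \<bar>s i j\<bar>) + av2 N \<delta>"
    unfolding T_def using av2_diagonal[of N "\<lambda>i j. \<bar>s i j\<bar>"] av2_diagonal[of N \<delta>] ps p\<delta>
    by (simp add: av_add per1_def periodic_grid_def)
  also have "av2 N (\<lambda>i j. \<bar>s i j\<bar>) \<le> av2 N (\<lambda>i j. \<bar>a i j\<bar> + \<bar>b (i + 1) (j + (-1))\<bar>)"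
    by (rule av2_mono) (simp add: s_def)
  also have "\<dots> = av2 N (\<lambda>i j. \<bar>a i j\<bar> + \<bar>b i j\<bar>)"
    using av2_shift[of N "\<lambda>i j. \<bar>b i j\<bar>" 1 "-1"] pb
    by (simp add: av_add periodic_grid_def)
  also have "av2 N \<delta> = av2 N (\<lambda>i j. \<bar>dif1 N a i j\<bar> + 2 * \<bar>difm N a b i j\<bar> + \<bar>dif2 N b i j\<bar>)"
    unfolding \<delta>_def using av2_shift[OF pE, of 1 0] by simp
  \<comment> \<open>The L1 bound 2 (m + 2 S) for the mean of |s|, plus S for the mean of
    \<delta>.\<close>
  finally have Tav: "av N T \<le> 2 * m + 5 * S" using L1 S by simp
  have T0: "0 \<le> T d" for d using sT[of d 0] by simp
  have avT0: "0 \<le> av N T" using T0 by (auto intro: av_nonneg)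
  have GT: "av2 N (\<lambda>i j. G j * T (i - j)) \<le> (m + 2 * S) * (2 * m + 5 * S)"
    unfolding av2_prod_diagonal[OF pT] using Gav Tav avG0 avT0 m0 S0 by (intro mult_mono) auto
  have HG: "av2 N (\<lambda>i j. H (i + 1) * G j) \<le> (m + 2 * S) * (m + 2 * S)"
  proof -
    have "per1 N H" using pb by (simp add: per1_def H_def dif2_def periodic_gridD)
    then have "av2 N (\<lambda>i j. H (i + 1) * G j) = av N H * av N G"
      unfolding av2_prod_cross by (simp add: av_shift)
    then show ?thesis using Gav Hav avG0 m0 S0 by (simp add: mult_mono)
  qed
  have HT: "av2 N (\<lambda>i j. H (i + 1) * T (i - j)) \<le> (m + 2 * S) * (2 * m + 5 * S)"
  proof -
    have "per1 N H" using pb by (simp add: per1_def H_def dif2_def periodic_gridD)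
    have "per1 N (\<lambda>d. T (- d))"
      unfolding per1_def
    proof
      fix d
      show "T (- (d + int N)) = T (- d)"
        using pT[unfolded per1_def, rule_format, of "- (d + int N)"] by simp
    qed
    from av_shift[OF this, of "- _"] have sh: "av N (\<lambda>j. T (i - j)) = av N (\<lambda>d. T (- d))" for i by simp
    have neg: "av N (\<lambda>d. T (- d)) = av N T"
    proof -
      have "(\<Sum>d=1..int N. T (- d)) = (\<Sum>d=1..int N. T (d + (- int N - 1)))"
        by (rule sum.reindex_bij_witness[where i = "\<lambda>d. int N + 1 - d" and j = "\<lambda>d. int N + 1 - d"]) auto
      then show ?thesis using sum_shift_per1[OF pT] by (simp add: av_def)
    qed
    have "av2 N (\<lambda>i j. H (i + 1) * T (i - j)) = av N H * av N T"
      using av_shift[OF \<open>per1 N H\<close>, of 1] by (simp add: av_cmult av_multc sh neg)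
    then show ?thesis using Hav Tav avG0 avT0 m0 S0 by (simp add: mult_mono)
  qed
  have "av2 N (\<lambda>i j. (a i j)\<^sup>2 + (b i j)\<^sup>2) = av2 N (\<lambda>i j. (a i j)\<^sup>2 + (b (i + 1) (j + (-1)))\<^sup>2)"
    using av2_shift[of N "\<lambda>i j. (b i j)\<^sup>2" 1 "-1"] pb by (simp add: av_add periodic_grid_def)
  also have "\<dots> \<le> av2 N (\<lambda>i j. (G j * T (i - j) + H (i + 1) * G j) + (H (i + 1) * T (i - j) + H (i + 1) * G j))"
  proof (rule av2_mono, rule add_mono)
    fix i j
    \<comment> \<open>Since a = s - b at the shifted index, a^2 = a s - a b. Each factor has a
      majorant in one of the variables \<open>j\<close>, \<open>i\<close> and \<open>i - j\<close>,
      and any two of these are independent, so products of majorants have factorising means.\<close>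
    have "(a i j)\<^sup>2 = a i j * s i j - a i j * b (i + 1) (j - 1)"
      by (simp add: s_def power2_eq_square algebra_simps)
    also have "\<dots> \<le> \<bar>a i j\<bar> * \<bar>s i j\<bar> + \<bar>b (i + 1) (j - 1)\<bar> * \<bar>a i j\<bar>"
      using abs_ge_self[of "a i j * s i j"] abs_ge_minus_self[of "a i j * b (i + 1) (j - 1)"]
      by (simp add: abs_mult mult.commute)
    also have "\<dots> \<le> G j * T (i - j) + H (i + 1) * G j"
      using aG bH sT G0 T0 H0 by (intro add_mono mult_mono) auto
    finally show "(a i j)\<^sup>2 \<le> G j * T (i - j) + H (i + 1) * G j" .
    have "(b (i + 1) (j + (-1)))\<^sup>2 = b (i + 1) (j - 1) * s i j - a i j * b (i + 1) (j - 1)"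
      by (simp add: s_def power2_eq_square algebra_simps)
    also have "\<dots> \<le> \<bar>b (i + 1) (j - 1)\<bar> * \<bar>s i j\<bar> + \<bar>b (i + 1) (j - 1)\<bar> * \<bar>a i j\<bar>"
      using abs_ge_self[of "b (i + 1) (j - 1) * s i j"] abs_ge_minus_self[of "a i j * b (i + 1) (j - 1)"]
      by (simp add: abs_mult mult.commute)
    also have "\<dots> \<le> H (i + 1) * T (i - j) + H (i + 1) * G j"
      using aG bH sT G0 T0 H0 by (intro add_mono mult_mono) auto
    finally show "(b (i + 1) (j + (-1)))\<^sup>2 \<le> H (i + 1) * T (i - j) + H (i + 1) * G j" .
  qed
  also have "\<dots> = (av2 N (\<lambda>i j. G j * T (i - j)) + av2 N (\<lambda>i j. H (i + 1) * G j)) +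
      (av2 N (\<lambda>i j. H (i + 1) * T (i - j)) + av2 N (\<lambda>i j. H (i + 1) * G j))"
    by (simp only: av_add)
  also have "\<dots> \<le> ((m + 2 * S) * (2 * m + 5 * S) + (m + 2 * S) * (m + 2 * S)) +
      ((m + 2 * S) * (2 * m + 5 * S) + (m + 2 * S) * (m + 2 * S))"
    by (intro add_mono GT HG HT)
  \<comment> \<open>The factor 3 m + 7 S is the sum of 2 m + 5 S, from \<open>T\<close>, and m + 2
    S, from the product of \<open>H\<close> and \<open>G\<close>; the factor 2 accounts for the two
    components.\<close>
  also have "\<dots> = 2 * (m + 2 * S) * (3 * m + 7 * S)" by (simp add: algebra_simps)
  finally show "av2 N (\<lambda>i j. (a i j)\<^sup>2 + (b i j)\<^sup>2) \<le> 2 * (m + 2 * S) * (3 * m + 7 * S)" .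
qed

section \<open>Means of discrete gradients and of interpolated fields\<close>

lemma av2_sum: "av2 N (\<lambda>i j. \<Sum>k\<in>K. f k i j) = (\<Sum>k\<in>K. av2 N (f k))"
  by (simp add: av_sum)

lemma av2_abs: "\<bar>av2 N f\<bar> \<le> av2 N (\<lambda>i j. \<bar>f i j\<bar>)"
  by (rule order_trans[OF av_abs]) (intro av_mono av_abs)

lemma integral_pix_av2:
  assumes "N \<ge> 1" "periodic_grid N v"
  shows "(LINT x|torus. pix N v x) = av2 N v"
  using integral_pix(2)[OF assms] by (simp add: av_def sum_divide_distrib[symmetric] power2_eq_square field_simps)

text \<open>Differences of the periodic part have mean zero, so only the slope is left.\<close>

lemma mean_discrete_grad:
  assumes N: "N \<ge> 1" and p: "periodic_grid N (\<lambda>i j. u i j - q \<bullet> vector [of_int i / N, of_int j / N])"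
  shows "av2 N (\<lambda>i j. discrete_grad (1 / real N) u i j $ a) = q $ a"
proof -
  define v where "v i j = u i j - q \<bullet> vector [of_int i / N, of_int j / N]" for i j
  have pv: "periodic_grid N v" using p by (simp add: v_def[abs_def])
  have ueq: "u i j = v i j + q $ 1 * (of_int i / N) + q $ 2 * (of_int j / N)" for i j
    by (simp add: v_def inner_vec_def sum_2)
  show ?thesis
  proof (cases "a = 1")
    case True
    have "discrete_grad (1 / real N) u i j $ 1 = N * (v (i + 1) j - v i j) + q $ 1" for i j
      using N by (simp add: discrete_grad_def ueq field_simps)
    moreover have "av2 N (\<lambda>i j. N * (v (i + 1) j - v i j) + q $ 1) = q $ 1"
      using av2_shift[OF pv, of 1 0] N by (simp add: av_add av_const av_cmult av_diff)
    ultimately show ?thesis using True by simp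
  next
    case False
    then have a: "a = 2" using UNIV_2_cases by blast
    have "discrete_grad (1 / real N) u i j $ 2 = N * (v i (j + 1) - v i j) + q $ 2" for i j
      using N by (simp add: discrete_grad_def ueq field_simps)
    moreover have "av2 N (\<lambda>i j. N * (v i (j + 1) - v i j) + q $ 2) = q $ 2"
      using av2_shift[OF pv, of 0 1] N by (simp add: av_add av_const av_cmult av_diff)
    ultimately show ?thesis using a by simp
  qed
qed

text \<open>Since the kernels may change sign, the sum of absolute coefficients is the constant that
  bounds the adjoint interpolation in the mean norm, independently of h.\<close>

definition kernel_mass :: "nat \<Rightarrow> nat \<Rightarrow> 'c::finite kernels \<Rightarrow> real" where
  "kernel_mass \<nu> I \<kappa> = (\<Sum>a\<in>UNIV. \<Sum>r=1..I. \<Sum>m\<in>{- int \<nu>..int \<nu>}. \<Sum>n\<in>{- int \<nu>..int \<nu>}. \<bar>\<kappa> a r m n\<bar>)"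

lemma kernel_mass_nonneg: "0 \<le> kernel_mass \<nu> I \<kappa>"
  unfolding kernel_mass_def by (intro sum_nonneg) auto

text \<open>Young's inequality for a finite convolution: each shift of a periodic grid has the same
  mean, so the absolute coefficients simply add up.\<close>

lemma mean_adjoint_interp:
  fixes v :: "nat \<Rightarrow> (real^'c::finite) grid"
  assumes N: "N \<ge> 1" and p: "\<And>r. r \<in> {1..I} \<Longrightarrow> periodic_grid N (v r)"
  shows "av2 N (\<lambda>i j. \<bar>adjoint_interp \<nu> I \<kappa> v i j $ a\<bar>) \<le> kernel_mass \<nu> I \<kappa> * av2 N (\<lambda>i j. \<Sum>r=1..I. norm (v r i j))"
proof -
  let ?V = "{- int \<nu>..int \<nu>}"
  have "av2 N (\<lambda>i j. \<bar>adjoint_interp \<nu> I \<kappa> v i j $ a\<bar>) \<le>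
     av2 N (\<lambda>i j. \<Sum>r=1..I. \<Sum>m\<in>?V. \<Sum>n\<in>?V. \<bar>\<kappa> a r m n\<bar> * norm (v r (i + m) (j + n)))"
  proof (rule av2_mono)
    fix i j
    have "\<bar>adjoint_interp \<nu> I \<kappa> v i j $ a\<bar> \<le> (\<Sum>r=1..I. \<Sum>m\<in>?V. \<Sum>n\<in>?V. \<bar>\<kappa> a r m n * v r (i + m) (j + n) $ a\<bar>)"
      unfolding adjoint_interp_def vec_lambda_beta
      by (intro order_trans[OF sum_abs] sum_mono order_refl)
    also have "\<dots> \<le> (\<Sum>r=1..I. \<Sum>m\<in>?V. \<Sum>n\<in>?V. \<bar>\<kappa> a r m n\<bar> * norm (v r (i + m) (j + n)))"
      by (intro sum_mono) (auto simp: abs_mult intro!: mult_left_mono component_le_norm_cart)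
    finally show "\<bar>adjoint_interp \<nu> I \<kappa> v i j $ a\<bar> \<le> \<dots>" .
  qed
  also have "\<dots> = (\<Sum>r=1..I. \<Sum>m\<in>?V. \<Sum>n\<in>?V. \<bar>\<kappa> a r m n\<bar> * av2 N (\<lambda>i j. norm (v r (i + m) (j + n))))"
    by (simp add: av2_sum av_cmult av_sum)
  also have "\<dots> = (\<Sum>r=1..I. \<Sum>m\<in>?V. \<Sum>n\<in>?V. \<bar>\<kappa> a r m n\<bar> * av2 N (\<lambda>i j. norm (v r i j)))"
  proof (intro sum.cong refl)
    fix r m n assume r: "r \<in> {1..I}"
    have "periodic_grid N (\<lambda>i j. norm (v r i j))" using p[OF r] by (simp add: periodic_grid_def)
    then show "\<bar>\<kappa> a r m n\<bar> * av2 N (\<lambda>i j. norm (v r (i + m) (j + n))) = \<bar>\<kappa> a r m n\<bar> * av2 N (\<lambda>i j. norm (v r i j))"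
      using av2_shift[where f = "\<lambda>i j. norm (v r i j)" and m = m and n = n] by simp
  qed
  also have "\<dots> \<le> (\<Sum>r=1..I. \<Sum>m\<in>?V. \<Sum>n\<in>?V. \<bar>\<kappa> a r m n\<bar> * av2 N (\<lambda>i j. \<Sum>r=1..I. norm (v r i j)))"
    by (intro sum_mono mult_left_mono av2_mono member_le_sum) auto
  also have "\<dots> = (\<Sum>r=1..I. \<Sum>m\<in>?V. \<Sum>n\<in>?V. \<bar>\<kappa> a r m n\<bar>) * av2 N (\<lambda>i j. \<Sum>r=1..I. norm (v r i j))"
    by (simp only: sum_distrib_right)
  also have "\<dots> \<le> kernel_mass \<nu> I \<kappa> * av2 N (\<lambda>i j. \<Sum>r=1..I. norm (v r i j))"
    unfolding kernel_mass_def
    by (intro mult_right_mono av_nonneg sum_nonneg member_le_sum[of a UNIV "\<lambda>a. \<Sum>r=1..I. \<Sum>m\<in>?V. \<Sum>n\<in>?V. \<bar>\<kappa> a r m n\<bar>"])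
       (auto intro!: sum_nonneg)
  finally show ?thesis .
qed

section \<open>Locally integrable functions and testing\<close>

text \<open>A Borel counterpart of \<open>locally_integrable\<close>. With Borel representatives and
  \<open>lborel\<close>, products, translations and Fubini arguments raise no question about
  completed sigma-algebras.\<close>

definition loc_int :: "(real^2 \<Rightarrow> 'b::euclidean_space) \<Rightarrow> bool" where
  "loc_int f \<longleftrightarrow> f \<in> borel_measurable borel \<and> (\<forall>R. integrable lborel (\<lambda>x. indicator (cball 0 R) x *\<^sub>R f x))"

lemma loc_int_measurable: "loc_int f \<Longrightarrow> f \<in> borel_measurable borel"
  by (simp add: loc_int_def)

lemma locally_integrable_lebesgue_measurable:
  assumes "locally_integrable f" shows "f \<in> borel_measurable lebesgue"
proof (rule borel_measurable_LIMSEQ_metric)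
  fix n :: nat
  have "integrable lebesgue (\<lambda>x. indicator (cball 0 (real n)) x *\<^sub>R f x)"
    using assms unfolding locally_integrable_def set_integrable_def by (metis compact_cball)
  then show "(\<lambda>x. indicator (cball 0 (real n)) x *\<^sub>R f x) \<in> borel_measurable lebesgue" by auto
next
  fix x :: "real^2"
  obtain m :: nat where m: "norm x \<le> real m" using real_arch_simple by blast
  have "\<forall>\<^sub>F n in sequentially. indicator (cball 0 (real n)) x *\<^sub>R f x = f x"
    using eventually_ge_at_top[of m] by eventually_elim (use m in auto)
  then show "(\<lambda>n. indicator (cball 0 (real n)) x *\<^sub>R f x) \<longlonglongrightarrow> f x"
    by (rule tendsto_eventually)
qed

text \<open>The representative is built coordinate by coordinate; the basis is finite, so the
  exceptional sets unite to a null set.\<close>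

lemma borel_representative:
  fixes f :: "real^2 \<Rightarrow> 'b::euclidean_space"
  assumes "locally_integrable f"
  obtains f' where "loc_int f'" "AE x in lebesgue. f x = f' x"
proof -
  have m: "f \<in> borel_measurable lebesgue" using assms by (rule locally_integrable_lebesgue_measurable)
  have "\<exists>g. g \<in> borel_measurable lborel \<and> (AE x in lborel. f x \<bullet> b = g x)" for b
    using completion_ex_borel_measurable_real[of "\<lambda>x. f x \<bullet> b" lborel] m by auto
  then obtain g where g: "\<And>b. g b \<in> borel_measurable lborel" "\<And>b. AE x in lborel. f x \<bullet> b = g b x" by metis
  define f' where "f' x = (\<Sum>b\<in>Basis. g b x *\<^sub>R b)" for x
  have [measurable]: "g b \<in> borel_measurable borel" for b using g(1) by simp
  have mf': "f' \<in> borel_measurable borel" unfolding f'_def[abs_def] by measurable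
  have "AE x in lborel. \<forall>b\<in>Basis. f x \<bullet> b = g b x" using g(2) by (intro AE_finite_allI) auto
  then have "AE x in lborel. f x = f' x"
    by eventually_elim (rule euclidean_eqI, simp add: f'_def inner_sum_left inner_Basis if_distrib cong: if_cong)
  then have AE: "AE x in lebesgue. f x = f' x" by (rule AE_completion)
  have "integrable lborel (\<lambda>x. indicator (cball 0 R) x *\<^sub>R f' x)" for R
  proof -
    have "integrable lebesgue (\<lambda>x. indicator (cball 0 R) x *\<^sub>R f x)"
      using assms unfolding locally_integrable_def set_integrable_def by (metis compact_cball)
    then have "integrable lebesgue (\<lambda>x. indicator (cball 0 R) x *\<^sub>R f' x)"
    proof (rule integrable_cong_AE_imp)
      have [measurable]: "f' \<in> borel_measurable borel" by (rule mf')
      have "(\<lambda>x. indicator (cball 0 R) x *\<^sub>R f' x) \<in> borel_measurable lborel"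
        by (intro borel_measurable_scaleR borel_measurable_indicator) auto
      then show "(\<lambda>x. indicator (cball 0 R) x *\<^sub>R f' x) \<in> borel_measurable lebesgue"
        by (rule measurable_completion)
    qed (use AE in auto)
    then show ?thesis
      using mf' by (subst (asm) integrable_completion)
        (auto intro!: borel_measurable_scaleR borel_measurable_indicator)
  qed
  then have "loc_int f'" using mf' by (simp add: loc_int_def)
  then show thesis using AE that by blast
qed

lemma loc_int_locally_integrable:
  assumes "loc_int f" shows "locally_integrable f"
  unfolding locally_integrable_def set_integrable_def
proof (intro allI impI)
  fix K :: "(real^2) set" assume K: "compact K"
  have [measurable]: "f \<in> borel_measurable borel" using assms by (rule loc_int_measurable)
  have [measurable]: "K \<in> sets borel" using K by (simp add: borel_compact)
  obtain R where R: "\<And>x. x \<in> K \<Longrightarrow> norm x \<le> R" using K compact_imp_bounded bounded_iff by metis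
  have "integrable lborel (\<lambda>x. indicator K x *\<^sub>R f x)"
  proof (rule Bochner_Integration.integrable_bound)
    show "integrable lborel (\<lambda>x. indicator (cball 0 R) x *\<^sub>R f x)" using assms by (simp add: loc_int_def)
    show "AE x in lborel. norm (indicator K x *\<^sub>R f x) \<le> norm (indicator (cball 0 R) x *\<^sub>R f x)"
      using R by (auto simp: indicator_def)
  qed measurable
  then show "integrable lebesgue (\<lambda>x. indicator K x *\<^sub>R f x)"
    by (subst integrable_completion) auto
qed

text \<open>The support radius is part of the notion, because sequences of test functions need one
  ball that contains all their supports.\<close>

definition ctest :: "real \<Rightarrow> (real^2 \<Rightarrow> real) \<Rightarrow> bool" where
  "ctest R \<phi> \<longleftrightarrow> continuous_on UNIV \<phi> \<and> (\<forall>x. norm x > R \<longrightarrow> \<phi> x = 0)"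

lemma ctest_measurable: "ctest R \<phi> \<Longrightarrow> \<phi> \<in> borel_measurable borel"
  by (simp add: ctest_def borel_measurable_continuous_onI)

lemma test_function_ctest:
  assumes "test_function \<phi>" obtains R where "R > 0" "ctest R \<phi>"
proof -
  obtain R where "R > 0" "\<And>x. norm x > R \<Longrightarrow> \<phi> x = 0"
    using test_function_support[OF assms] by metis
  then show thesis using that[of R] test_function_continuous[OF assms] by (auto simp: ctest_def)
qed

lemma ctest_bounded:
  assumes "ctest R \<phi>" obtains B where "B > 0" "\<And>x. \<bar>\<phi> x\<bar> \<le> B"
proof -
  have "compact (\<phi> ` cball 0 R)"
    using assms by (intro compact_continuous_image) (auto simp: ctest_def intro: continuous_on_subset)
  then obtain B where B: "B > 0" "\<And>y. y \<in> \<phi> ` cball 0 R \<Longrightarrow> norm y \<le> B"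
    using compact_imp_bounded bounded_pos by metis
  have "\<bar>\<phi> x\<bar> \<le> B" for x
    using B assms by (cases "norm x > R") (auto simp: ctest_def)
  with B(1) show thesis using that by blast
qed

lemma integrable_ctest:
  fixes f :: "real^2 \<Rightarrow> 'b::euclidean_space"
  assumes \<phi>: "ctest R \<phi>" and f: "loc_int f"
  shows "integrable lborel (\<lambda>x. \<phi> x *\<^sub>R f x)"
proof -
  obtain B where B: "B > 0" "\<And>x. \<bar>\<phi> x\<bar> \<le> B" using ctest_bounded[OF \<phi>] by metis
  note [measurable] = ctest_measurable[OF \<phi>] loc_int_measurable[OF f]
  show ?thesis
  proof (rule Bochner_Integration.integrable_bound)
    show "integrable lborel (\<lambda>x. B *\<^sub>R (indicator (cball 0 R) x *\<^sub>R f x))"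
      using f by (intro integrable_scaleR_right) (simp add: loc_int_def)
    show "AE x in lborel. norm (\<phi> x *\<^sub>R f x) \<le> norm (B *\<^sub>R (indicator (cball 0 R) x *\<^sub>R f x))"
    proof (rule AE_I2)
      fix x
      show "norm (\<phi> x *\<^sub>R f x) \<le> norm (B *\<^sub>R (indicator (cball 0 R) x *\<^sub>R f x))"
        using B(1) B(2)[of x] \<phi> by (cases "norm x > R") (auto simp: ctest_def mult_right_mono)
    qed
  qed measurable
qed

lemma integrable_cball_abs:
  assumes "loc_int f" shows "integrable lborel (\<lambda>x. indicator (cball 0 R) x * \<bar>f x :: real\<bar>)"
proof -
  have "integrable lborel (\<lambda>x. norm (indicator (cball 0 R) x *\<^sub>R f x))"
    using assms unfolding loc_int_def by (intro integrable_norm) blast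
  then show ?thesis by (simp add: abs_mult)
qed

lemma ctest_integral_bound:
  fixes f :: "real^2 \<Rightarrow> real"
  assumes \<phi>: "ctest R \<phi>" and f: "loc_int f" and e: "\<And>x. \<bar>\<phi> x\<bar> \<le> e"
  shows "\<bar>\<integral>x. \<phi> x * f x \<partial>lborel\<bar> \<le> e * lnorm R f"
proof -
  have e0: "0 \<le> e" using e[of 0] by linarith
  have "\<bar>\<integral>x. \<phi> x * f x \<partial>lborel\<bar> \<le> (LINT x|lborel. \<bar>\<phi> x * f x\<bar>)" by (rule integral_abs_bound)
  also have "\<dots> \<le> (LINT x|lborel. e * (indicator (cball 0 R) x * \<bar>f x\<bar>))"
  proof (rule integral_mono)
    show "integrable lborel (\<lambda>x. \<bar>\<phi> x * f x\<bar>)"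
      using integrable_ctest[OF \<phi> f] by (intro integrable_abs) simp
    show "integrable lborel (\<lambda>x. e * (indicator (cball 0 R) x * \<bar>f x\<bar>))"
      using integrable_cball_abs[OF f] by simp
    show "\<bar>\<phi> x * f x\<bar> \<le> e * (indicator (cball 0 R) x * \<bar>f x\<bar>)" for x
      using e[of x] \<phi> e0 by (cases "norm x > R") (auto simp: ctest_def abs_mult mult_right_mono)
  qed
  finally show ?thesis by simp
qed

text \<open>Distributional convergence together with local L1 bounds. The bounds are what allows
  test functions to vary along the sequence, provided they converge uniformly with supports in a
  fixed ball.\<close>

definition wconv :: "(nat \<Rightarrow> real^2 \<Rightarrow> real) \<Rightarrow> (real^2 \<Rightarrow> real) \<Rightarrow> bool" where
  "wconv V v \<longleftrightarrow> (\<forall>k. loc_int (V k)) \<and> loc_int v \<and>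
    (\<forall>R. \<exists>C. \<forall>k. (lnorm R (V k)) \<le> C) \<and>
    (\<forall>\<phi>. test_function \<phi> \<longrightarrow> (\<lambda>k. pair \<phi> (V k)) \<longlonglongrightarrow> pair \<phi> v)"

lemma wconv_perturb:
  assumes V: "\<And>k. loc_int (V k)" "\<And>k. (lnorm R (V k)) \<le> C"
    and c: "\<And>k. ctest R (f k)" and e: "\<And>e. e > 0 \<Longrightarrow> \<forall>\<^sub>F k in sequentially. \<forall>x. \<bar>f k x\<bar> \<le> e"
  shows "(\<lambda>k. LINT x|lborel. f k x * V k x) \<longlonglongrightarrow> 0"
proof (rule tendstoI)
  fix e :: real assume e0: "e > 0"
  define d where "d = e / (\<bar>C\<bar> + 1) / 2"
  have d: "d > 0" using e0 by (simp add: d_def)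
  show "\<forall>\<^sub>F k in sequentially. dist (LINT x|lborel. f k x * V k x) 0 < e"
    using e[OF d]
  proof eventually_elim
    case (elim k)
    have "\<bar>\<integral>x. f k x * V k x \<partial>lborel\<bar> \<le> d * lnorm R (V k)"
      by (rule ctest_integral_bound) (use c V elim in auto)
    also have "\<dots> \<le> d * (\<bar>C\<bar> + 1)" using V(2)[of k] d by (intro mult_left_mono) auto
    also have "\<dots> = e / 2"
    proof -
      have "\<bar>C\<bar> + 1 \<noteq> 0" by linarith
      then show ?thesis unfolding d_def by (metis (no_types) divide_divide_eq_left mult.commute nonzero_mult_div_cancel_left times_divide_eq_right)
    qed
    finally show ?case using e0 by (simp add: dist_real_def)
  qed
qed

lemma ctest_diff_quotient:
  assumes \<phi>: "test_function \<phi>" and R: "ctest R \<phi>" and t: "\<bar>t\<bar> \<le> 1"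
  shows "ctest (R + 1) (\<lambda>x. (\<phi> (x + t *\<^sub>R axis i 1) - \<phi> x) / t - pderiv_dir i \<phi> x)"
    "ctest (R + 1) (\<lambda>x. (\<phi> (x + t *\<^sub>R axis i 1) - \<phi> x) / t)"
    "ctest (R + 1) (pderiv_dir i \<phi>)"
proof -
  have c: "continuous_on UNIV \<phi>" "\<And>x. norm x > R \<Longrightarrow> \<phi> x = 0" using R by (auto simp: ctest_def)
  have d: "continuous_on UNIV (pderiv_dir i \<phi>)" using \<phi> test_function_continuous test_function_pderiv by blast
  have z: "\<phi> (x + t *\<^sub>R axis i 1) = 0 \<and> \<phi> x = 0 \<and> pderiv_dir i \<phi> x = 0" if "norm x > R + 1" for x
  proof -
    have "norm x \<le> norm (x + t *\<^sub>R axis i 1) + norm (t *\<^sub>R axis i (1::real) :: real^2)"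
      using norm_triangle_ineq4[of "x + t *\<^sub>R axis i 1" "t *\<^sub>R axis i 1"] by simp
    then have "norm (x + t *\<^sub>R axis i 1) > R" using that t by simp
    then show ?thesis using that c test_function_pderiv_support[OF \<phi> c(2)] by simp
  qed
  have c': "continuous_on UNIV (\<lambda>x. \<phi> (x + t *\<^sub>R axis i 1))"
    by (intro continuous_on_compose2[OF c(1)] continuous_intros) auto
  have q: "continuous_on UNIV (\<lambda>x. (\<phi> (x + t *\<^sub>R axis i 1) - \<phi> x) / t)"
    unfolding divide_inverse by (intro continuous_intros c' c(1))
  then show "ctest (R + 1) (\<lambda>x. (\<phi> (x + t *\<^sub>R axis i 1) - \<phi> x) / t)"
    "ctest (R + 1) (\<lambda>x. (\<phi> (x + t *\<^sub>R axis i 1) - \<phi> x) / t - pderiv_dir i \<phi> x)"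
    "ctest (R + 1) (pderiv_dir i \<phi>)"
    using z d by (auto simp: ctest_def intro!: continuous_intros)
qed

text \<open>The difference quotients converge uniformly to the derivative with supports in one ball,
  so replacing them by the derivative costs nothing against a sequence that is bounded in
  L1.\<close>

lemma wconv_diff_quotient:
  assumes V: "wconv V v" and \<phi>: "test_function \<phi>"
    and s: "s \<longlonglongrightarrow> 0" "\<And>k. s k \<noteq> 0" "\<And>k. \<bar>s k\<bar> \<le> 1"
  shows "(\<lambda>k. LINT x|lborel. (\<phi> (x + s k *\<^sub>R axis i 1) - \<phi> x) / s k * V k x)
    \<longlonglongrightarrow> pair (pderiv_dir i \<phi>) v"
proof -
  obtain R where R: "R > 0" "ctest R \<phi>" using test_function_ctest[OF \<phi>] by metis
  obtain C where C: "\<And>k. (lnorm (R + 1) (V k)) \<le> C"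
    using V unfolding wconv_def by metis
  have l: "\<And>k. loc_int (V k)" using V by (simp add: wconv_def)
  define f where "f k x = (\<phi> (x + s k *\<^sub>R axis i 1) - \<phi> x) / s k - pderiv_dir i \<phi> x" for k x
  have cf: "ctest (R + 1) (f k)" for k
    unfolding f_def[abs_def] by (rule ctest_diff_quotient(1)[OF \<phi> R(2) s(3)])
  have "(\<lambda>k. LINT x|lborel. f k x * V k x) \<longlonglongrightarrow> 0"
  proof (rule wconv_perturb[OF l C cf])
    fix e :: real assume "e > 0"
    then obtain d where d: "d > 0"
      "\<And>t x. t \<noteq> 0 \<Longrightarrow> \<bar>t\<bar> < d \<Longrightarrow> \<bar>(\<phi> (x + t *\<^sub>R axis i 1) - \<phi> x) / t - pderiv_dir i \<phi> x\<bar> \<le> e"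
      using diff_quotient_uniform[OF \<phi>] by metis
    have "\<forall>\<^sub>F k in sequentially. dist (s k) 0 < d" using s(1) d(1) by (rule tendstoD)
    then show "\<forall>\<^sub>F k in sequentially. \<forall>x. \<bar>f k x\<bar> \<le> e"
      by eventually_elim (use d(2) s(2) in \<open>auto simp: f_def dist_real_def\<close>)
  qed
  moreover have "(\<lambda>k. pair (pderiv_dir i \<phi>) (V k)) \<longlonglongrightarrow> pair (pderiv_dir i \<phi>) v"
    using V test_function_pderiv[OF \<phi>] by (simp add: wconv_def)
  ultimately have "(\<lambda>k. (LINT x|lborel. f k x * V k x) + pair (pderiv_dir i \<phi>) (V k))
     \<longlonglongrightarrow> 0 + pair (pderiv_dir i \<phi>) v" by (rule tendsto_add)
  moreover have "(LINT x|lborel. f k x * V k x) + pair (pderiv_dir i \<phi>) (V k) =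
      (LINT x|lborel. (\<phi> (x + s k *\<^sub>R axis i 1) - \<phi> x) / s k * V k x)" for k
  proof -
    have "(LINT x|lborel. f k x * V k x) + pair (pderiv_dir i \<phi>) (V k) =
      (LINT x|lborel. f k x * V k x + pderiv_dir i \<phi> x * V k x)"
      using integrable_ctest[OF cf[of k] l] integrable_ctest[OF ctest_diff_quotient(3)[OF \<phi> R(2) s(3)] l]
      by (intro Bochner_Integration.integral_add[symmetric]) auto
    then show ?thesis by (simp add: f_def algebra_simps)
  qed
  ultimately show ?thesis by simp
qed

section \<open>Translations and local bounds for periodic functions\<close>

lemma lborel_shift:
  fixes f :: "real^2 \<Rightarrow> 'b::euclidean_space"
  assumes "f \<in> borel_measurable borel"
  shows "(LINT x|lborel. f (x + c)) = (LINT x|lborel. f x)"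
proof -
  have "(LINT x|lborel. f x) = (\<integral>x. f x \<partial>distr lborel borel ((+) c))" by (simp add: lborel_distr_plus)
  also have "\<dots> = (LINT x|lborel. f (c + x))" by (rule integral_distr) (use assms in auto)
  finally show ?thesis by (simp add: add.commute)
qed

lemma integrable_shift:
  fixes f :: "real^2 \<Rightarrow> real"
  assumes "integrable lborel f" shows "integrable lborel (\<lambda>x. f (x + c))"
proof -
  have "integrable (distr lborel borel ((+) c)) f" using assms by (simp add: lborel_distr_plus)
  then have "integrable lborel (\<lambda>x. f (c + x))"
    by (subst (asm) integrable_distr_eq) (use borel_measurable_integrable[OF assms] in auto)
  then show ?thesis by (simp add: add.commute)
qed

lemma lborel_shift_product:
  fixes f g :: "real^2 \<Rightarrow> real"
  assumes [measurable]: "f \<in> borel_measurable borel" "g \<in> borel_measurable borel"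
  shows "pair f (\<lambda>x. g (x + c)) = (LINT x|lborel. f (x - c) * g x)"
  using lborel_shift[of "\<lambda>x. f (x - c) * g x" c] by simp

lemma loc_int_pix: "loc_int (pix N (v :: 'b::euclidean_space grid))"
  unfolding loc_int_def
proof (intro conjI allI)
  show "pix N v \<in> borel_measurable borel" by measurable
  fix R :: real
  define K where "K = \<lceil>N * \<bar>R\<bar>\<rceil> + 1"
  define B where "B = (\<Sum>i\<in>{-K..K}. \<Sum>j\<in>{-K..K}. norm (v i j))"
  have b: "norm (pix N v x) \<le> B" if "norm x \<le> R" for x
  proof -
    have r: "round (N * x $ a) \<in> {-K..K}" for a
    proof -
      have "\<bar>x $ a\<bar> \<le> \<bar>R\<bar>" using component_le_norm_cart[of x a] that by linarith
      then have "\<bar>N * x $ a\<bar> \<le> N * \<bar>R\<bar>" by (simp add: abs_mult mult_left_mono)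
      then show ?thesis unfolding K_def round_def by (simp; linarith)
    qed
    have "norm (pix N v x) \<le> (\<Sum>j\<in>{-K..K}. norm (v (round (N * x $ 1)) j))"
      unfolding pix_def using r[of 2] by (intro member_le_sum[of _ _ "\<lambda>j. norm (v (round (N * x $ 1)) j)"]) auto
    also have "\<dots> \<le> B"
      unfolding B_def using r[of 1] by (intro member_le_sum[of _ _ "\<lambda>i. \<Sum>j\<in>{-K..K}. norm (v i j)"]) (auto intro: sum_nonneg)
    finally show ?thesis .
  qed
  show "integrable lborel (\<lambda>x. indicator (cball 0 R) x *\<^sub>R pix N v x)"
  proof (rule integrableI_bounded_set[where A = "cball 0 R" and B = B])
    show "emeasure lborel (cball 0 R) < \<infinity>"
      using emeasure_lborel_cball_finite less_top by blast
    show "AE x in lborel. x \<in> cball 0 R \<longrightarrow> norm (indicator (cball 0 R) x *\<^sub>R pix N v x) \<le> B"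
      using b by auto
    have [measurable]: "pix N v \<in> borel_measurable borel" by measurable
    show "(\<lambda>x. indicator (cball 0 R) x *\<^sub>R pix N v x) \<in> borel_measurable lborel"
      by (intro borel_measurable_scaleR borel_measurable_indicator) auto
  qed auto
qed

text \<open>The indicator of the ball lies below a continuous cut-off whose lattice sum is bounded;
  integrating over the torus gives a constant that depends on \<open>R\<close> and not on
  \<open>V\<close>.\<close>

lemma periodic_loc_bound:
  obtains B where "B \<ge> 0" "\<And>V :: real^2 \<Rightarrow> 'b::euclidean_space.
    periodic V \<Longrightarrow> V \<in> borel_measurable borel \<Longrightarrow> integrable torus V \<Longrightarrow>
     integrable lborel (\<lambda>x. indicator (cball 0 R) x *\<^sub>R V x) \<and>
     (LINT x|lborel. indicator (cball 0 R) x * norm (V x)) \<le> B * (LINT x|torus. norm (V x))"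
proof -
  note t = cell_measureD[OF cell_measure_torus]
  define \<psi> :: "real^2 \<Rightarrow> real" where "\<psi> x = max 0 (min 1 (R + 1 - norm x))" for x
  have c: "continuous_on UNIV \<psi>" unfolding \<psi>_def[abs_def] by (intro continuous_intros)
  have z: "\<psi> x = 0" if "norm x > R + 1" for x using that by (simp add: \<psi>_def)
  have [measurable]: "\<psi> \<in> borel_measurable borel" using c by (rule borel_measurable_continuous_onI)
  have cp: "cper (fold_sum \<psi>)"
    unfolding cper_def using continuous_fold_sum[OF z c] periodic_fold_sum by auto
  then obtain B where B: "B > 0" "\<And>x. \<bar>fold_sum \<psi> x\<bar> \<le> B" using cper_bounded by metis
  show thesis
  proof (rule that[of B], goal_cases)
    case 1 then show ?case using B by simp
  next
    case (2 V)
    note [measurable] = 2(2)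
    have ib: "integrable lborel (\<lambda>x. \<psi> x *\<^sub>R V x)"
      using periodize_integral(1)[OF t(2,5,4) z c 2(2,1,3)] by (simp add: periodize_torus)
    have pn: "periodic (\<lambda>x. norm (V x))" using 2(1) by (simp add: periodic_def)
    have iV: "integrable torus (\<lambda>x. norm (V x))" using 2(3) by simp
    have ibn: "integrable lborel (\<lambda>x. \<psi> x *\<^sub>R norm (V x))"
      using periodize_integral(1)[OF t(2,5,4) z c _ pn iV] by (simp add: periodize_torus)
    have ii: "integrable lborel (\<lambda>x. indicator (cball 0 R) x *\<^sub>R V x)"
      by (rule Bochner_Integration.integrable_bound[OF ib]) (auto simp: indicator_def \<psi>_def)
    have "integrable lborel (\<lambda>x. norm (indicator (cball 0 R) x *\<^sub>R V x))" using ii by (rule integrable_norm)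
    then have iin: "integrable lborel (\<lambda>x. indicator (cball 0 R) x * norm (V x))" by simp
    have "(LINT x|lborel. indicator (cball 0 R) x * norm (V x)) \<le> (LINT x|lborel. \<psi> x *\<^sub>R norm (V x))"
      by (rule integral_mono[OF iin ibn]) (auto simp: indicator_def \<psi>_def)
    also have "\<dots> = (LINT x|torus. fold_sum \<psi> x *\<^sub>R norm (V x))"
      using periodize_integral(2)[OF t(2,5,4) z c _ pn iV] by (simp add: periodize_torus)
    also have "\<dots> \<le> (LINT x|torus. B * norm (V x))"
    proof (rule integral_mono)
      show "integrable torus (\<lambda>x. fold_sum \<psi> x *\<^sub>R norm (V x))"
        by (rule integrable_cper[OF cp iV]) simp
      show "fold_sum \<psi> x *\<^sub>R norm (V x) \<le> B * norm (V x)" for x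
        using B(2)[of x] by (simp add: mult_right_mono)
    qed (use iV in simp)
    finally show ?case using ii by simp
  qed
qed

lemma loc_int_periodic:
  fixes V :: "real^2 \<Rightarrow> 'b::euclidean_space"
  assumes "periodic V" "V \<in> borel_measurable borel" "integrable torus V"
  shows "loc_int V"
  unfolding loc_int_def
proof (intro conjI allI)
  fix R :: real
  obtain B where "\<And>V :: real^2 \<Rightarrow> 'b.
    periodic V \<Longrightarrow> V \<in> borel_measurable borel \<Longrightarrow> integrable torus V \<Longrightarrow>
     integrable lborel (\<lambda>x. indicator (cball 0 R) x *\<^sub>R V x)"
    by (rule periodic_loc_bound[of R]) blast
  then show "integrable lborel (\<lambda>x. indicator (cball 0 R) x *\<^sub>R V x)" using assms by blast
qed (use assms in auto)

text \<open>Lebesgue measure is the periodization of the torus measure. This links distributions,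
  tested on the plane, with weak limits, taken on the torus.\<close>

lemma test_integral_torus:
  fixes V :: "real^2 \<Rightarrow> 'b::euclidean_space"
  assumes V: "periodic V" "V \<in> borel_measurable borel" "integrable torus V" and \<phi>: "ctest R \<phi>"
  shows "(LINT x|lborel. \<phi> x *\<^sub>R V x) = (LINT x|torus. fold_sum \<phi> x *\<^sub>R V x)"
proof -
  note t = cell_measureD[OF cell_measure_torus]
  show ?thesis
    using periodize_integral(2)[OF t(2,5,4) _ _ V(2,1,3), of R \<phi>] \<phi> by (auto simp: ctest_def periodize_torus)
qed

lemma hvec_axis:
  "hvec N 1 0 = (1 / N) *\<^sub>R axis 1 1" "hvec N 0 1 = (1 / N) *\<^sub>R axis 2 1"
  "hvec N (-1) 0 = - ((1 / N) *\<^sub>R axis 1 1)" "hvec N 0 (-1) = - ((1 / N) *\<^sub>R axis 2 1)"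
  by (simp_all add: vec2_eq_iff axis_def)

lemma norm_hvec: "norm (hvec N m n) \<le> (\<bar>of_int m\<bar> + \<bar>of_int n\<bar>) / N"
  using norm_le_l1_cart[of "hvec N m n"] by (simp add: sum_2 add_divide_distrib abs_divide)

section \<open>The lower bound\<close>

lemma pderiv_ctest:
  assumes "test_function \<phi>" "ctest R \<phi>" shows "ctest R (pderiv_dir i \<phi>)"
  using assms test_function_continuous[OF test_function_pderiv[OF assms(1)]]
    test_function_pderiv_support[OF assms(1)] by (auto simp: ctest_def)

text \<open>The distributions are defined with \<open>lebesgue\<close>; from here on they are
  computed with Borel representatives and \<open>lborel\<close>.\<close>

lemma lebesgue_test_integral:
  fixes w :: "real^2 \<Rightarrow> 'b::euclidean_space"
  assumes w: "locally_integrable w" and w': "loc_int w'" and eq: "AE x in lebesgue. w x = w' x"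
    and \<phi>: "test_function \<phi>"
  shows "(LINT x|lebesgue. \<phi> x *\<^sub>R w x) = (LINT x|lborel. \<phi> x *\<^sub>R w' x)"
proof -
  have \<phi>m: "\<phi> \<in> borel_measurable borel"
    using test_function_continuous[OF \<phi>] by (rule borel_measurable_continuous_onI)
  have m: "(\<lambda>x. \<phi> x *\<^sub>R w' x) \<in> borel_measurable lborel"
    using \<phi>m loc_int_measurable[OF w'] by measurable
  have "(LINT x|lebesgue. \<phi> x *\<^sub>R w x) = (LINT x|lebesgue. \<phi> x *\<^sub>R w' x)"
  proof (rule integral_cong_AE)
    have "\<phi> \<in> borel_measurable lebesgue" using \<phi>m by (intro measurable_completion) simp
    then show "(\<lambda>x. \<phi> x *\<^sub>R w x) \<in> borel_measurable lebesgue"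
      using locally_integrable_lebesgue_measurable[OF w] by (rule borel_measurable_scaleR)
    show "(\<lambda>x. \<phi> x *\<^sub>R w' x) \<in> borel_measurable lebesgue"
      using m by (rule measurable_completion)
    show "AE x in lebesgue. \<phi> x *\<^sub>R w x = \<phi> x *\<^sub>R w' x"
      using eq by eventually_elim simp
  qed
  also have "\<dots> = (LINT x|lborel. \<phi> x *\<^sub>R w' x)" using m by (rule integral_completion)
  finally show ?thesis .
qed

lemma distr_grad_borel:
  assumes u: "locally_integrable u" and u': "loc_int u'" and eq: "AE x in lebesgue. u x = u' x"
    and \<phi>: "test_function \<phi>"
  shows "distr_grad u \<phi> $ i = - pair (pderiv_dir i \<phi>) u'"
  using lebesgue_test_integral[OF u u' eq test_function_pderiv[OF \<phi>, of i]]
  by (simp add: distr_grad_def mult.commute)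

lemma loc_int_diff:
  fixes f g :: "real^2 \<Rightarrow> 'b::euclidean_space"
  assumes "loc_int f" "loc_int g" shows "loc_int (\<lambda>x. f x - g x)"
  using assms by (auto simp: loc_int_def scaleR_diff_right)

lemma loc_int_nth:
  fixes f :: "real^2 \<Rightarrow> real^'n"
  assumes "loc_int f" shows "loc_int (\<lambda>x. f x $ a)"
  unfolding loc_int_def
proof (intro conjI allI)
  have [measurable]: "f \<in> borel_measurable borel" using assms by (rule loc_int_measurable)
  have "(\<lambda>x. f x \<bullet> axis a 1) \<in> borel_measurable borel" by measurable
  then show "(\<lambda>x. f x $ a) \<in> borel_measurable borel" by (simp add: inner_axis)
  fix R
  have "integrable lborel (\<lambda>x. (indicator (cball 0 R) x *\<^sub>R f x) \<bullet> axis a 1)"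
    using assms by (intro integrable_inner_left) (simp add: loc_int_def)
  then show "integrable lborel (\<lambda>x. indicator (cball 0 R) x *\<^sub>R f x $ a)"
    by (simp add: inner_axis)
qed

lemma ctest_nth_integral:
  fixes f :: "real^2 \<Rightarrow> real^'n"
  assumes \<phi>: "ctest R \<phi>" and f: "loc_int f"
  shows "(LINT x|lborel. \<phi> x *\<^sub>R f x) $ a = pair \<phi> (\<lambda>x. f x $ a)"
proof -
  have "(LINT x|lborel. \<phi> x *\<^sub>R f x) \<bullet> axis a 1 = (LINT x|lborel. (\<phi> x *\<^sub>R f x) \<bullet> axis a 1)"
    using integrable_ctest[OF \<phi> f] by (subst integral_inner_left) auto
  then show ?thesis by (simp add: inner_axis)
qed

lemma set_integral_abs_diff:
  assumes f: "loc_int f" and u: "locally_integrable u" and u': "loc_int u'" and eq: "AE x in lebesgue. u x = u' x"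
  shows "(LINT x:cball 0 R|lebesgue. \<bar>f x - u x\<bar>) = lnorm R (\<lambda>x. f x - u' x)"
proof -
  have m: "(\<lambda>x. indicator (cball 0 R) x * \<bar>f x - u' x\<bar>) \<in> borel_measurable lborel"
    by (rule borel_measurable_integrable[OF integrable_cball_abs[OF loc_int_diff[OF f u']]])
  have "(LINT x:cball 0 R|lebesgue. \<bar>f x - u x\<bar>) = (LINT x|lebesgue. indicator (cball 0 R) x * \<bar>f x - u' x\<bar>)"
    unfolding set_lebesgue_integral_def
  proof (rule integral_cong_AE)
    have "f \<in> borel_measurable lebesgue"
      using loc_int_measurable[OF f] by (intro measurable_completion) simp
    moreover have "indicator (cball 0 R) \<in> borel_measurable (lebesgue :: (real^2) measure)"
      by (intro measurable_completion borel_measurable_indicator) simp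
    ultimately show "(\<lambda>x. indicator (cball 0 R) x *\<^sub>R \<bar>f x - u x\<bar>) \<in> borel_measurable lebesgue"
      using locally_integrable_lebesgue_measurable[OF u]
      by (intro borel_measurable_scaleR borel_measurable_abs borel_measurable_diff) auto
    show "(\<lambda>x. indicator (cball 0 R) x * \<bar>f x - u' x\<bar>) \<in> borel_measurable lebesgue"
      using m by (rule measurable_completion)
    show "AE x in lebesgue. indicator (cball 0 R) x *\<^sub>R \<bar>f x - u x\<bar> = indicator (cball 0 R) x * \<bar>f x - u' x\<bar>"
      using eq by eventually_elim simp
  qed
  then show ?thesis using m by (simp add: integral_completion)
qed

text \<open>Strong local convergence supplies the L1 bounds as well as the weak limits. The
  subsequence \<open>r\<close> is built in because the compactness argument extracts one.\<close>

lemma images_converge_wconv: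
  assumes conv: "images_converge uh u" and u: "locally_integrable u" and u': "loc_int u'"
    and eq: "AE x in lebesgue. u x = u' x" and r: "strict_mono r"
  shows "wconv (\<lambda>k. pix (r k) (uh (r k))) u'"
proof -
  define U where "U k = pix (r k) (uh (r k))" for k
  have lU: "loc_int (U k)" for k by (simp add: U_def loc_int_pix)
  have lim: "(\<lambda>k. lnorm R (\<lambda>x. U k x - u' x)) \<longlonglongrightarrow> 0" for R
  proof -
    have "(\<lambda>N. LINT x:cball 0 R|lebesgue. \<bar>pixel_fun N (uh N) x - u x\<bar>) \<longlonglongrightarrow> 0"
      by (rule conv[unfolded images_converge_def, rule_format, OF compact_cball])
    from LIMSEQ_subseq_LIMSEQ[OF this r]
    have "(\<lambda>k. LINT x:cball 0 R|lebesgue. \<bar>U k x - u x\<bar>) \<longlonglongrightarrow> 0"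
      by (simp add: o_def U_def pixel_fun_pix)
    then show ?thesis by (simp add: set_integral_abs_diff[OF lU u u' eq])
  qed
  note ii = integrable_cball_abs
  have "wconv U u'"
    unfolding wconv_def
  proof (intro conjI allI impI lU u')
    fix R
    obtain B where B: "\<And>k. \<bar>\<integral>x. indicator (cball 0 R) x * \<bar>U k x - u' x\<bar> \<partial>lborel\<bar> \<le> B"
      using convergent_imp_Bseq[OF convergentI[OF lim[of R]]] unfolding Bseq_def by auto
    show "\<exists>C. \<forall>k. (lnorm R (U k)) \<le> C"
    proof (intro exI allI)
      fix k
      have "lnorm R (U k) \<le>
          (LINT x|lborel. indicator (cball 0 R) x * \<bar>U k x - u' x\<bar> + indicator (cball 0 R) x * \<bar>u' x\<bar>)"
        by (intro integral_mono Bochner_Integration.integrable_add ii lU u' loc_int_diff)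
           (auto simp: indicator_def)
      also have "\<dots> = lnorm R (\<lambda>x. U k x - u' x) + lnorm R u'"
        by (intro Bochner_Integration.integral_add ii lU u' loc_int_diff)
      also have "\<dots> \<le> B + lnorm R u'"
        using B[of k] by simp
      finally show "lnorm R (U k) \<le> \<dots>" .
    qed
  next
    fix \<phi> assume "test_function \<phi>"
    then obtain R where R: "ctest R \<phi>" using test_function_ctest by metis
    obtain B where B: "B > 0" "\<And>x. \<bar>\<phi> x\<bar> \<le> B" using ctest_bounded[OF R] by metis
    have "(\<lambda>k. (pair \<phi> (U k)) - pair \<phi> u') \<longlonglongrightarrow> 0"
    proof (rule Lim_null_comparison)
      show "(\<lambda>k. B * lnorm R (\<lambda>x. U k x - u' x)) \<longlonglongrightarrow> 0"
        using tendsto_mult_left[OF lim[of R], of B] by simp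
      show "\<forall>\<^sub>F k in sequentially. norm (pair \<phi> (U k) - pair \<phi> u') \<le>
          B * lnorm R (\<lambda>x. U k x - u' x)"
      proof (rule always_eventually, rule allI)
        fix k
        have "pair \<phi> (U k) - pair \<phi> u' = pair \<phi> (\<lambda>x. U k x - u' x)"
          using integrable_ctest[OF R lU[of k]] integrable_ctest[OF R u']
          by (simp add: right_diff_distrib)
        then show "norm (pair \<phi> (U k) - pair \<phi> u') \<le>
          B * lnorm R (\<lambda>x. U k x - u' x)"
          using ctest_integral_bound[OF R loc_int_diff[OF lU u'] B(2)] by simp
      qed
    qed
    then show "(\<lambda>k. pair \<phi> (U k)) \<longlonglongrightarrow> pair \<phi> u'"
      by (simp add: LIM_zero_iff)
  qed
  then show ?thesis by (simp add: U_def[abs_def])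
qed

text \<open>The slopes are not prescribed, but translating by a unit vector adds exactly one
  component of the slope. Hence that component is at most |P(x + e)| + |P(x)|, and integrating over
  the unit ball, whose translate stays inside radius 2, bounds it by the local L1 norm.\<close>

lemma slopes_bounded:
  fixes q :: "nat \<Rightarrow> real^2"
  assumes V: "\<And>k. (lnorm 2 (pix (N k) (U k))) \<le> C" and N: "\<And>k. N k \<ge> 1"
    and p: "\<And>k. periodic_grid (N k) (\<lambda>i j. U k i j - q k \<bullet> vector [of_int i / N k, of_int j / N k])"
  obtains B where "\<And>k a. \<bar>q k $ a\<bar> \<le> B"
proof -
  define c where "c = measure lborel (cball (0::real^2) 1)"
  have c: "c > 0" unfolding c_def by (rule content_cball_pos) simp
  have "\<bar>q k $ a\<bar> \<le> 2 * C / c" for k a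
  proof -
    define e :: "real^2" where "e = axis a 1"
    define P where "P = pix (N k) (U k)"
    have lP: "loc_int P" by (simp add: P_def loc_int_pix)
    have mP[measurable]: "P \<in> borel_measurable borel" using lP by (rule loc_int_measurable)
    note ii = integrable_cball_abs[OF lP]
    have mI: "(\<lambda>x. indicator (cball 0 R) x * \<bar>P x\<bar>) \<in> borel_measurable borel" for R
      by (intro borel_measurable_times borel_measurable_indicator borel_measurable_abs mP) simp
    have sh: "P (x + e) = P x + q k $ a" for x
    proof -
      have e1: "U k (i + int (N k)) j = U k i j + q k $ 1" "U k i (j + int (N k)) = U k i j + q k $ 2" for i j
      proof -
        have "U k (i + int (N k)) j - q k \<bullet> vector [of_int (i + int (N k)) / N k, of_int j / N k] =
           U k i j - q k \<bullet> vector [of_int i / N k, of_int j / N k]"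
          using p[of k] unfolding periodic_grid_def by blast
        then show "U k (i + int (N k)) j = U k i j + q k $ 1"
          using N[of k] by (simp add: inner_vec_def sum_2 add_divide_distrib distrib_left)
        have "U k i (j + int (N k)) - q k \<bullet> vector [of_int i / N k, of_int (j + int (N k)) / N k] =
           U k i j - q k \<bullet> vector [of_int i / N k, of_int j / N k]"
          using p[of k] unfolding periodic_grid_def by blast
        then show "U k i (j + int (N k)) = U k i j + q k $ 2"
          using N[of k] by (simp add: inner_vec_def sum_2 add_divide_distrib distrib_left)
      qed
      have "a = 1 \<or> a = 2" by (rule UNIV_2_cases)
      then show ?thesis
        using e1 round_add_int[of "N k * x $ 1" "int (N k)"] round_add_int[of "N k * x $ 2" "int (N k)"]
        by (auto simp: P_def pix_def e_def axis_def distrib_left)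
    qed
    have "\<bar>q k $ a\<bar> * c = (LINT x|lborel. indicator (cball (0::real^2) 1) x * \<bar>q k $ a\<bar>)"
      by (simp add: c_def)
    also have "\<dots> \<le> (LINT x|lborel. indicator (cball 0 2) (x + e) * \<bar>P (x + e)\<bar> + indicator (cball 0 2) x * \<bar>P x\<bar>)"
    proof (rule integral_mono)
      show "integrable lborel (\<lambda>x. indicator (cball (0::real^2) 1) x * \<bar>q k $ a\<bar>)"
        using emeasure_lborel_cball_finite[of "0::real^2" 1]
        by (intro integrable_mult_left integrable_real_indicator) (auto simp: less_top[symmetric])
      show "integrable lborel (\<lambda>x. indicator (cball 0 2) (x + e) * \<bar>P (x + e)\<bar> + indicator (cball 0 2) x * \<bar>P x\<bar>)"
        by (intro Bochner_Integration.integrable_add integrable_shift[OF ii] ii)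
      fix x
      show "indicator (cball 0 1) x * \<bar>q k $ a\<bar> \<le> indicator (cball 0 2) (x + e) * \<bar>P (x + e)\<bar> + indicator (cball 0 2) x * \<bar>P x\<bar>"
      proof (cases "x \<in> cball 0 1")
        case True
        then have "norm (x + e) \<le> 2" using norm_triangle_ineq[of x e] by (simp add: e_def)
        moreover have "\<bar>q k $ a\<bar> \<le> \<bar>P (x + e)\<bar> + \<bar>P x\<bar>" using sh[of x] by linarith
        ultimately show ?thesis using True by simp
      qed (simp add: indicator_def)
    qed
    also have "\<dots> = (LINT x|lborel. indicator (cball 0 2) (x + e) * \<bar>P (x + e)\<bar>) + lnorm 2 P"
      by (intro Bochner_Integration.integral_add integrable_shift[OF ii] ii)
    also have "(LINT x|lborel. indicator (cball 0 2) (x + e) * \<bar>P (x + e)\<bar>) = lnorm 2 P"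
      by (rule lborel_shift[OF mI])
    finally have "\<bar>q k $ a\<bar> * c \<le> 2 * C" using V[of k] by (simp add: P_def)
    then show ?thesis using c by (simp add: pos_le_divide_eq)
  qed
  then show thesis using that by blast
qed

section \<open>Limits of shifted and differenced pixel functions\<close>

lemma shifted_test_null:
  assumes \<phi>: "test_function \<phi>" and R: "ctest R \<phi>" and c: "c \<longlonglongrightarrow> 0" "\<And>k. norm (c k) \<le> d"
    and V: "\<And>k. loc_int (V k)" "\<And>k. (lnorm (R + d) (V k)) \<le> C"
  shows "(\<lambda>k. LINT x|lborel. (\<phi> (x - c k) - \<phi> x) * V k x) \<longlonglongrightarrow> 0"
proof (rule wconv_perturb[OF V])
  have \<phi>c: "continuous_on UNIV \<phi>" using R by (simp add: ctest_def)
  fix k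
  have "continuous_on UNIV (\<lambda>x. \<phi> (x - c k))"
    by (intro continuous_on_compose2[OF \<phi>c] continuous_intros) auto
  moreover have "\<phi> (x - c k) - \<phi> x = 0" if "norm x > R + d" for x
  proof -
    have "norm x \<le> norm (x - c k) + norm (c k)" using norm_triangle_ineq[of "x - c k" "c k"] by simp
    then have "norm (x - c k) > R" using that c(2)[of k] by linarith
    moreover have "norm x > R" using that norm_ge_zero[of "c k"] c(2)[of k] by linarith
    ultimately show ?thesis using R by (simp add: ctest_def)
  qed
  ultimately show "ctest (R + d) (\<lambda>x. \<phi> (x - c k) - \<phi> x)"
    using \<phi>c by (auto simp: ctest_def intro!: continuous_intros)
next
  fix e :: real assume "e > 0"
  then obtain \<delta> where \<delta>: "\<delta> > 0" "\<And>x y. dist y x < \<delta> \<Longrightarrow> dist (\<phi> y) (\<phi> x) < e"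
    using test_function_uc[OF \<phi>] unfolding uniformly_continuous_on_def by (metis UNIV_I)
  have "\<forall>\<^sub>F k in sequentially. dist (c k) 0 < \<delta>" using c(1) \<delta>(1) by (rule tendstoD)
  then show "\<forall>\<^sub>F k in sequentially. \<forall>x. \<bar>\<phi> (x - c k) - \<phi> x\<bar> \<le> e"
  proof eventually_elim
    case (elim k)
    show ?case
    proof
      fix x
      have "dist (x - c k) x < \<delta>" using elim by (simp add: dist_norm)
      from \<delta>(2)[OF this] show "\<bar>\<phi> (x - c k) - \<phi> x\<bar> \<le> e" by (simp add: dist_real_def)
    qed
  qed
qed

lemma hvec_tendsto_0:
  assumes "(\<lambda>k. 1 / real (N k)) \<longlonglongrightarrow> 0" shows "(\<lambda>k. hvec (N k) m n) \<longlonglongrightarrow> 0"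
proof (rule Lim_null_comparison)
  show "(\<lambda>k. (\<bar>of_int m\<bar> + \<bar>of_int n\<bar>) * (1 / real (N k))) \<longlonglongrightarrow> 0"
    using tendsto_mult_left[OF assms] by simp
  show "\<forall>\<^sub>F k in sequentially. norm (hvec (N k) m n) \<le> (\<bar>of_int m\<bar> + \<bar>of_int n\<bar>) * (1 / real (N k))"
    using norm_hvec by (intro always_eventually) auto
qed

lemma ctest_translate:
  assumes "ctest R \<psi>" "norm x \<le> r" shows "ctest (R + r) (\<lambda>y. \<psi> (y - x))"
proof -
  have c: "continuous_on UNIV \<psi>" using assms by (simp add: ctest_def)
  have "continuous_on UNIV (\<lambda>y. \<psi> (y - x))"
    by (intro continuous_on_compose2[OF c] continuous_intros) auto
  moreover have "\<psi> (y - x) = 0" if "norm y > R + r" for y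
    using that assms norm_triangle_ineq[of "y - x" x] by (simp add: ctest_def)
  ultimately show ?thesis by (simp add: ctest_def)
qed

lemma ctest_shift_integrable:
  fixes V :: "real^2 \<Rightarrow> real"
  assumes "ctest R \<phi>" "loc_int V"
  shows "integrable lborel (\<lambda>x. \<phi> (x - c) * V x)"
  using integrable_ctest[OF ctest_translate[OF assms(1) order_refl] assms(2)] by simp

text \<open>Mass one lets each kernel be written as its action minus the identity, so every term
  contains a difference of the test function at two points O(h) apart. The filters themselves do not
  disappear: what remains is the sum of their fields, whose norm is at most the sum of the norms in
  the energy.\<close>

lemma adjoint_interp_limit:
  fixes v :: "nat \<Rightarrow> nat \<Rightarrow> (real^'c::finite) grid"
  assumes N: "\<And>k. N k \<ge> 1" and h0: "(\<lambda>k. 1 / real (N k)) \<longlonglongrightarrow> 0"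
    and p: "\<And>k r. r \<in> {1..I} \<Longrightarrow> periodic_grid (N k) (v k r)"
    and C: "\<And>k. av2 (N k) (\<lambda>i j. \<Sum>r=1..I. norm (v k r i j)) \<le> C"
    and \<kappa>: "normalized_kernels \<nu> I \<kappa>" and \<phi>: "test_function \<phi>"
  shows "(\<lambda>k. (pair \<phi> (pix (N k) (\<lambda>i j. adjoint_interp \<nu> I \<kappa> (v k) i j $ a)))
     - pair \<phi> (pix (N k) (\<lambda>i j. (\<Sum>r=1..I. v k r i j) $ a))) \<longlonglongrightarrow> 0"
proof -
  let ?V = "{- int \<nu>..int \<nu>}"
  obtain R where R: "R > 0" "ctest R \<phi>" using test_function_ctest[OF \<phi>] by metis
  have m\<phi>[measurable]: "\<phi> \<in> borel_measurable borel" using R(2) by (rule ctest_measurable)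
  define W where "W k r = pix (N k) (\<lambda>i j. v k r i j $ a)" for k r
  have lW: "loc_int (W k r)" for k r by (simp add: W_def loc_int_pix)
  have mW[measurable]: "W k r \<in> borel_measurable borel" for k r using lW by (rule loc_int_measurable)
  have iW: "integrable lborel (\<lambda>x. \<phi> (x - c) * W k r x)" for c k r
    using R(2) lW by (rule ctest_shift_integrable)
  have iW0: "integrable lborel (\<lambda>x. \<phi> x * W k r x)" for k r
    using iW[of 0] by simp
  have bW: "\<exists>B. \<forall>k. \<forall>r\<in>{1..I}. (lnorm R' (W k r)) \<le> B" for R'
  proof -
    obtain B where B: "B \<ge> 0" "\<And>V :: real^2 \<Rightarrow> real.
      periodic V \<Longrightarrow> V \<in> borel_measurable borel \<Longrightarrow> integrable torus V \<Longrightarrow>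
        (LINT x|lborel. indicator (cball 0 R') x * norm (V x)) \<le> B * (LINT x|torus. norm (V x))"
      by (rule periodic_loc_bound[of R']) blast
    have "lnorm R' (W k r) \<le> B * C" if r: "r \<in> {1..I}" for k r
    proof -
      have pg: "periodic_grid (N k) (\<lambda>i j. v k r i j $ a)" "periodic_grid (N k) (\<lambda>i j. \<bar>v k r i j $ a\<bar>)"
        using p[OF r, of k] by (auto simp: periodic_grid_def)
      have "(LINT x|lborel. indicator (cball 0 R') x * norm (W k r x)) \<le> B * (LINT x|torus. norm (W k r x))"
        using N[of k] by (intro B(2)) (auto simp: W_def periodic_pix[OF pg(1)] integral_pix(1)[OF _ pg(1)])
      also have "(LINT x|torus. norm (W k r x)) = (LINT x|torus. pix (N k) (\<lambda>i j. \<bar>v k r i j $ a\<bar>) x)"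
        by (simp add: W_def pix_def)
      also have "\<dots> = av2 (N k) (\<lambda>i j. \<bar>v k r i j $ a\<bar>)" using N pg(2) by (rule integral_pix_av2)
      also have "\<dots> \<le> av2 (N k) (\<lambda>i j. \<Sum>r=1..I. norm (v k r i j))"
      proof (rule av2_mono)
        fix i j
        have "\<bar>v k r i j $ a\<bar> \<le> norm (v k r i j)" by (rule component_le_norm_cart)
        also have "\<dots> \<le> (\<Sum>r=1..I. norm (v k r i j))"
          using r by (intro member_le_sum[of _ _ "\<lambda>r. norm (v k r i j)"]) auto
        finally show "\<bar>v k r i j $ a\<bar> \<le> (\<Sum>r=1..I. norm (v k r i j))" .
      qed
      also have "\<dots> \<le> C" by (rule C)
      finally show ?thesis using B(1) by (simp add: mult_left_mono)
    qed
    then show ?thesis by blast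
  qed
  have eq: "pair \<phi> (pix (N k) (\<lambda>i j. adjoint_interp \<nu> I \<kappa> (v k) i j $ a))
     - pair \<phi> (pix (N k) (\<lambda>i j. (\<Sum>r=1..I. v k r i j) $ a)) =
     (\<Sum>r=1..I. \<Sum>m\<in>?V. \<Sum>n\<in>?V. \<kappa> a r m n * (LINT x|lborel. (\<phi> (x - hvec (N k) m n) - \<phi> x) * W k r x))" for k
  proof -
    have 1: "pix (N k) (\<lambda>i j. adjoint_interp \<nu> I \<kappa> (v k) i j $ a) x =
        (\<Sum>r=1..I. \<Sum>m\<in>?V. \<Sum>n\<in>?V. \<kappa> a r m n * W k r (x + hvec (N k) m n))" for x
      unfolding W_def pix_shift[OF N, symmetric] by (simp add: pix_def adjoint_interp_def)
    have sint: "integrable lborel (\<lambda>x. \<phi> x * W k r (x + hvec (N k) m n))" for r m n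
      using integrable_shift[OF iW[of "hvec (N k) m n" k r], of "hvec (N k) m n"] by simp
    have "pair \<phi> (pix (N k) (\<lambda>i j. adjoint_interp \<nu> I \<kappa> (v k) i j $ a)) =
        (LINT x|lborel. (\<Sum>r=1..I. \<Sum>m\<in>?V. \<Sum>n\<in>?V. \<kappa> a r m n * (\<phi> x * W k r (x + hvec (N k) m n))))"
      unfolding 1 by (simp add: sum_distrib_left mult_ac)
    also have "\<dots> = (\<Sum>r=1..I. \<Sum>m\<in>?V. \<Sum>n\<in>?V. \<kappa> a r m n * pair \<phi> (\<lambda>x. W k r (x + hvec (N k) m n)))"
      using sint by (simp add: Bochner_Integration.integral_sum)
    also have "\<dots> = (\<Sum>r=1..I. \<Sum>m\<in>?V. \<Sum>n\<in>?V. \<kappa> a r m n * (LINT x|lborel. \<phi> (x - hvec (N k) m n) * W k r x))"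
      by (simp add: lborel_shift_product)
    finally have A: "pair \<phi> (pix (N k) (\<lambda>i j. adjoint_interp \<nu> I \<kappa> (v k) i j $ a)) = \<dots>" .
    have "pair \<phi> (pix (N k) (\<lambda>i j. (\<Sum>r=1..I. v k r i j) $ a)) =
        (LINT x|lborel. (\<Sum>r=1..I. \<phi> x * W k r x))"
      by (simp add: pix_def W_def sum_distrib_left)
    also have "\<dots> = (\<Sum>r=1..I. (pair \<phi> (W k r)))"
      using iW0 by (simp add: Bochner_Integration.integral_sum)
    also have "\<dots> = (\<Sum>r=1..I. (\<Sum>m\<in>?V. \<Sum>n\<in>?V. \<kappa> a r m n) * pair \<phi> (W k r))"
      using \<kappa> by (intro sum.cong refl) (simp add: normalized_kernels_def)
    also have "\<dots> = (\<Sum>r=1..I. \<Sum>m\<in>?V. \<Sum>n\<in>?V. \<kappa> a r m n * pair \<phi> (W k r))"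
      by (simp add: sum_distrib_right)
    finally have B: "pair \<phi> (pix (N k) (\<lambda>i j. (\<Sum>r=1..I. v k r i j) $ a)) = \<dots>" .
    show ?thesis
      unfolding A B by (simp add: sum_subtractf[symmetric] left_diff_distrib iW iW0 right_diff_distrib)
  qed
  have "(\<lambda>k. \<Sum>r=1..I. \<Sum>m\<in>?V. \<Sum>n\<in>?V. \<kappa> a r m n * (LINT x|lborel. (\<phi> (x - hvec (N k) m n) - \<phi> x) * W k r x))
     \<longlonglongrightarrow> (\<Sum>r=1..I. \<Sum>m\<in>?V. \<Sum>n\<in>?V. \<kappa> a r m n * 0)"
  proof (intro tendsto_sum tendsto_mult tendsto_const)
    fix r m n assume r: "r \<in> {1..I}"
    define d where "d = \<bar>real_of_int m\<bar> + \<bar>real_of_int n\<bar>"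
    obtain B where B: "\<And>k. (lnorm (R + d) (W k r)) \<le> B"
      using bW[of "R + d"] r by blast
    have "norm (hvec (N k) m n) \<le> d" for k
    proof -
      have "norm (hvec (N k) m n) \<le> d / N k" using norm_hvec unfolding d_def .
      also have "\<dots> \<le> d / 1" using N[of k] by (intro divide_left_mono) (auto simp: d_def)
      finally show ?thesis by simp
    qed
    then show "(\<lambda>k. LINT x|lborel. (\<phi> (x - hvec (N k) m n) - \<phi> x) * W k r x) \<longlonglongrightarrow> 0"
      by (rule shifted_test_null[OF \<phi> R(2) hvec_tendsto_0[OF h0] _ lW B])
  qed
  then show ?thesis unfolding eq by simp
qed

text \<open>Translation invariance moves the quotient to the test function with the opposite step. A
  backward difference is a quotient with negative step, so \<open>main\<close> covers all four
  cases; both kinds occur because the entries of the symmetrized gradient are staggered.\<close>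

lemma wconv_pix_difference:
  assumes V: "wconv (\<lambda>k. pix (N k) (U k)) v" and N: "\<And>k. N k \<ge> 1" and h0: "(\<lambda>k. 1 / real (N k)) \<longlonglongrightarrow> 0"
    and \<phi>: "test_function \<phi>"
  shows "(\<lambda>k. pair \<phi> (pix (N k) (\<lambda>i j. (U k (i + 1) j - U k i j) / (1 / N k))))
      \<longlonglongrightarrow> - pair (pderiv_dir 1 \<phi>) v"
    and "(\<lambda>k. pair \<phi> (pix (N k) (\<lambda>i j. (U k i (j + 1) - U k i j) / (1 / N k))))
      \<longlonglongrightarrow> - pair (pderiv_dir 2 \<phi>) v"
    and "(\<lambda>k. pair \<phi> (pix (N k) (\<lambda>i j. (U k i j - U k (i - 1) j) / (1 / N k))))
      \<longlonglongrightarrow> - pair (pderiv_dir 1 \<phi>) v"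
    and "(\<lambda>k. pair \<phi> (pix (N k) (\<lambda>i j. (U k i j - U k i (j - 1)) / (1 / N k))))
      \<longlonglongrightarrow> - pair (pderiv_dir 2 \<phi>) v"
proof -
  obtain R where R: "R > 0" "ctest R \<phi>" using test_function_ctest[OF \<phi>] by metis
  define P where "P k = pix (N k) (U k)" for k
  have m\<phi>[measurable]: "\<phi> \<in> borel_measurable borel" using R(2) by (rule ctest_measurable)
  have lP: "loc_int (P k)" for k by (simp add: P_def loc_int_pix)
  have mP[measurable]: "P k \<in> borel_measurable borel" for k using lP by (rule loc_int_measurable)
  have h: "\<bar>1 / real (N k)\<bar> \<le> 1" "1 / real (N k) \<noteq> 0" for k using N[of k] by auto
  have i: "integrable lborel (\<lambda>x. \<phi> (x - c) * P k x)" for c k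
    using R(2) lP by (rule ctest_shift_integrable)
  have i0: "integrable lborel (\<lambda>x. \<phi> x * P k x)" for k using i[of 0] by simp
  have isf: "integrable lborel (\<lambda>x. \<phi> x * P k (x + c))" for k c
    using integrable_shift[OF i[of c k], of c] by simp
  have main: "(\<lambda>k. pair \<phi> (\<lambda>x. (P k (x + s k *\<^sub>R axis a 1) - P k x) / s k))
      \<longlonglongrightarrow> - pair (pderiv_dir a \<phi>) v"
    if s: "s \<longlonglongrightarrow> 0" "\<And>k. s k \<noteq> 0" "\<And>k. \<bar>s k\<bar> \<le> 1" for s a
  proof -
    have "(\<lambda>k. - (LINT x|lborel. (\<phi> (x + (- s k) *\<^sub>R axis a 1) - \<phi> x) / (- s k) * P k x))
      \<longlonglongrightarrow> - pair (pderiv_dir a \<phi>) v"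
      using tendsto_minus[OF s(1)] s(2,3)
      by (intro tendsto_minus wconv_diff_quotient[where s = "\<lambda>k. - s k"] \<phi>) (use V in \<open>auto simp: P_def[abs_def]\<close>)
    moreover have "pair \<phi> (\<lambda>x. (P k (x + s k *\<^sub>R axis a 1) - P k x) / s k) =
       - (LINT x|lborel. (\<phi> (x + (- s k) *\<^sub>R axis a 1) - \<phi> x) / (- s k) * P k x)" for k
    proof -
      have "pair \<phi> (\<lambda>x. (P k (x + s k *\<^sub>R axis a 1) - P k x) / s k) =
        (LINT x|lborel. (1 / s k) * (\<phi> x * P k (x + s k *\<^sub>R axis a 1) - \<phi> x * P k x))"
        by (intro Bochner_Integration.integral_cong) (auto simp: field_simps)
      also have "\<dots> = (1 / s k) * (pair \<phi> (\<lambda>x. P k (x + s k *\<^sub>R axis a 1)) - pair \<phi> (P k))"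
        using isf i0 by simp
      also have "\<dots> = (1 / s k) * ((LINT x|lborel. \<phi> (x - s k *\<^sub>R axis a 1) * P k x) - pair \<phi> (P k))"
        by (simp add: lborel_shift_product)
      also have "\<dots> = (LINT x|lborel. (1 / s k) * (\<phi> (x - s k *\<^sub>R axis a 1) * P k x - \<phi> x * P k x))"
        using i i0 by simp
      also have "\<dots> = (LINT x|lborel. - ((\<phi> (x + (- s k) *\<^sub>R axis a 1) - \<phi> x) / (- s k) * P k x))"
        by (intro Bochner_Integration.integral_cong) (auto simp: field_simps)
      also have "\<dots> = - (LINT x|lborel. (\<phi> (x + (- s k) *\<^sub>R axis a 1) - \<phi> x) / (- s k) * P k x)" by simp
      finally show ?thesis .
    qed
    ultimately show ?thesis by (simp only:)
  qed
  have sh: "pix (N k) (\<lambda>i j. U k (i + m) (j + n)) x = P k (x + hvec (N k) m n)" for k m n x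
    unfolding P_def by (rule pix_shift[OF N])
  have mp: "(\<lambda>k. 1 / real (N k)) \<longlonglongrightarrow> 0" "(\<lambda>k. - (1 / real (N k))) \<longlonglongrightarrow> 0"
    using h0 tendsto_minus[OF h0] by auto
  have e1: "pix (N k) (\<lambda>i j. (U k (i + 1) j - U k i j) / (1 / N k)) x = (P k (x + (1 / real (N k)) *\<^sub>R axis 1 1) - P k x) / (1 / N k)" for k x
    using sh[of k 1 0 x] by (simp add: hvec_axis) (simp add: pix_def P_def)
  have e2: "pix (N k) (\<lambda>i j. (U k i (j + 1) - U k i j) / (1 / N k)) x = (P k (x + (1 / real (N k)) *\<^sub>R axis 2 1) - P k x) / (1 / N k)" for k x
    using sh[of k 0 1 x] by (simp add: hvec_axis) (simp add: pix_def P_def)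
  have e3: "pix (N k) (\<lambda>i j. (U k i j - U k (i - 1) j) / (1 / N k)) x = (P k (x + (- (1 / real (N k))) *\<^sub>R axis 1 1) - P k x) / (- (1 / N k))" for k x
    using sh[of k "-1" 0 x] by (simp add: hvec_axis) (simp add: pix_def P_def algebra_simps)
  have e4: "pix (N k) (\<lambda>i j. (U k i j - U k i (j - 1)) / (1 / N k)) x = (P k (x + (- (1 / real (N k))) *\<^sub>R axis 2 1) - P k x) / (- (1 / N k))" for k x
    using sh[of k 0 "-1" x] by (simp add: hvec_axis) (simp add: pix_def P_def algebra_simps)
  show "(\<lambda>k. pair \<phi> (pix (N k) (\<lambda>i j. (U k (i + 1) j - U k i j) / (1 / N k))))
      \<longlonglongrightarrow> - pair (pderiv_dir 1 \<phi>) v"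
    unfolding e1 by (rule main[OF mp(1)]) (use h in auto)
  show "(\<lambda>k. pair \<phi> (pix (N k) (\<lambda>i j. (U k i (j + 1) - U k i j) / (1 / N k))))
      \<longlonglongrightarrow> - pair (pderiv_dir 2 \<phi>) v"
    unfolding e2 by (rule main[OF mp(1)]) (use h in auto)
  show "(\<lambda>k. pair \<phi> (pix (N k) (\<lambda>i j. (U k i j - U k (i - 1) j) / (1 / N k))))
      \<longlonglongrightarrow> - pair (pderiv_dir 1 \<phi>) v"
    unfolding e3 by (rule main[OF mp(2)]) (use h in auto)
  show "(\<lambda>k. pair \<phi> (pix (N k) (\<lambda>i j. (U k i j - U k i (j - 1)) / (1 / N k))))
      \<longlonglongrightarrow> - pair (pderiv_dir 2 \<phi>) v"
    unfolding e4 by (rule main[OF mp(2)]) (use h in auto)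
qed

text \<open>Turns the three-component encoding into a matrix, so that \<open>sym_norm\<close>
  becomes the norm of a Euclidean space and the vector compactness theorem applies.\<close>

definition symm3 :: "real^3 \<Rightarrow> real^2^2" where
  "symm3 p = vector [vector [p $ 1, p $ 2], vector [p $ 2, p $ 3]]"

lemma symm3_nth [simp]:
  "symm3 p $ 1 $ 1 = p $ 1" "symm3 p $ 1 $ 2 = p $ 2" "symm3 p $ 2 $ 1 = p $ 2" "symm3 p $ 2 $ 2 = p $ 3"
  by (simp_all add: symm3_def)

lemma norm_symm3: "norm (symm3 p) = sym_norm p"
  by (simp add: norm_vec_def L2_set_def sum_2 sym_norm_def algebra_simps)

lemma symm3_sum: "symm3 (sum f A) = (\<Sum>x\<in>A. symm3 (f x))"
  by (simp add: vec_eq_iff forall_2)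

lemma norm_le_sym_norm: "norm p \<le> sym_norm (p :: real^3)"
  by (simp add: norm_vec_def L2_set_def sum_3 sym_norm_def)

lemma Z_norm_av2: "(1 / real N)\<^sup>2 * Z_norm f N I v = av2 N (\<lambda>i j. \<Sum>r=1..I. f (v r i j))"
  by (simp add: Z_norm_def av_def sum_divide_distrib[symmetric] power2_eq_square)

lemma periodic_imp_ae:
  assumes "periodic f" shows "periodic_ae f"
  unfolding periodic_ae_def
proof (intro allI impI AE_I2)
  fix k x :: "real^2" assume k: "\<forall>i. k $ i \<in> \<int>"
  obtain a b where "k $ 1 = of_int a" "k $ 2 = of_int b"
    using k Ints_cases by metis
  then have "k = lat (a, b)" by (simp add: vec2_eq_iff)
  then show "f (x + k) = f x" using assms by (simp add: periodic_def)
qed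

text \<open>Reads off a scalar component, tested on the plane, from a vector integral on the
  torus.\<close>

lemma fold_sum_pix_linear:
  fixes g :: "'b::euclidean_space grid" and L :: "'b \<Rightarrow> real"
  assumes N: "N \<ge> 1" and p: "periodic_grid N g" and R: "ctest R \<phi>" and L: "bounded_linear L"
  shows "L (LINT x|torus. fold_sum \<phi> x *\<^sub>R pix N g x) = pair \<phi> (pix N (\<lambda>i j. L (g i j)))"
proof -
  have "(LINT x|torus. fold_sum \<phi> x *\<^sub>R pix N g x) = (LINT x|lborel. \<phi> x *\<^sub>R pix N g x)"
    by (rule test_integral_torus[symmetric, OF _ _ _ R]) (use N p in \<open>auto simp: periodic_pix intro: integral_pix(1)\<close>)
  then show ?thesis
    using integral_bounded_linear[OF L integrable_ctest[OF R loc_int_pix[of N g]]]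
    by (simp add: linear_cmul[OF bounded_linear.linear[OF L]] pix_def)
qed

lemma wconv_components:
  fixes w :: "nat \<Rightarrow> (real^2) grid" and W :: "real^2 \<Rightarrow> real^2"
  assumes N: "\<And>k. N k \<ge> 1" and p: "\<And>k. periodic_grid (N k) (w k)"
    and C: "\<And>k. (LINT x|torus. norm (pix (N k) (w k) x)) \<le> C"
    and W: "periodic W" "W \<in> borel_measurable borel" "integrable torus W"
    and lim: "\<And>\<phi>. cper \<phi> \<Longrightarrow> (\<lambda>k. LINT x|torus. \<phi> x *\<^sub>R pix (N k) (w k) x) \<longlonglongrightarrow> (LINT x|torus. \<phi> x *\<^sub>R W x)"
  shows "wconv (\<lambda>k. pix (N k) (\<lambda>i j. w k i j $ a)) (\<lambda>x. W x $ a)"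
  unfolding wconv_def
proof (intro conjI allI impI)
  have lW: "loc_int W" using W by (rule loc_int_periodic)
  show "loc_int (pix (N k) (\<lambda>i j. w k i j $ a))" for k by (rule loc_int_pix)
  show "loc_int (\<lambda>x. W x $ a)" using lW by (rule loc_int_nth)
  have pa: "periodic_grid (N k) (\<lambda>i j. w k i j $ a)" for k
    using p[of k] by (simp add: periodic_grid_def)
  show "\<exists>C. \<forall>k. (lnorm R (pix (N k) (\<lambda>i j. w k i j $ a))) \<le> C" for R
  proof -
    obtain B where B: "B \<ge> 0" "\<And>V :: real^2 \<Rightarrow> real.
      periodic V \<Longrightarrow> V \<in> borel_measurable borel \<Longrightarrow> integrable torus V \<Longrightarrow>
        (LINT x|lborel. indicator (cball 0 R) x * norm (V x)) \<le> B * (LINT x|torus. norm (V x))"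
      by (rule periodic_loc_bound[of R]) blast
    have "(LINT x|lborel. indicator (cball 0 R) x * norm (pix (N k) (\<lambda>i j. w k i j $ a) x)) \<le> B * C" for k
    proof -
      have "(LINT x|lborel. indicator (cball 0 R) x * norm (pix (N k) (\<lambda>i j. w k i j $ a) x)) \<le>
         B * (LINT x|torus. norm (pix (N k) (\<lambda>i j. w k i j $ a) x))"
        using N[of k] by (intro B(2)) (auto simp: periodic_pix[OF pa] integral_pix(1)[OF _ pa])
      also have "(LINT x|torus. norm (pix (N k) (\<lambda>i j. w k i j $ a) x)) \<le> (LINT x|torus. norm (pix (N k) (w k) x))"
        using N[of k] by (intro integral_mono integrable_norm integral_pix(1) pa p)
          (auto simp: pix_def component_le_norm_cart)
      also have "\<dots> \<le> C" by (rule C)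
      finally show ?thesis using B(1) by (simp add: mult_left_mono)
    qed
    then show ?thesis by auto
  qed
  fix \<phi> assume "test_function \<phi>"
  then obtain R where R: "ctest R \<phi>" and cp: "cper (fold_sum \<phi>)" using test_function_ctest test_function_cper by metis
  have "(\<lambda>k. (LINT x|torus. fold_sum \<phi> x *\<^sub>R pix (N k) (w k) x) $ a) \<longlonglongrightarrow> (LINT x|torus. fold_sum \<phi> x *\<^sub>R W x) $ a"
    by (intro tendsto_vec_nth lim cp)
  moreover have "(LINT x|torus. fold_sum \<phi> x *\<^sub>R W x) $ a = pair \<phi> (\<lambda>x. W x $ a)"
    using ctest_nth_integral[OF R lW] test_integral_torus[OF W R] by simp
  moreover note fold_sum_pix_linear[OF N p R bounded_linear_vec_nth[of a]]
  ultimately show "(\<lambda>k. pair \<phi> (pix (N k) (\<lambda>i j. w k i j $ a))) \<longlonglongrightarrow> pair \<phi> (\<lambda>x. W x $ a)" by simp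
qed

text \<open>Young's inequality \<phi>|F| \<le> \<phi>^2 / t + t |F|^2 passes to the limit with the
  L2 bound \<open>C\<close>, so \<mu> is absolutely continuous. The weak limit is its density times
  the direction field \<sigma>, a function rather than a measure.\<close>

lemma l2_weak_limit_density:
  fixes F :: "nat \<Rightarrow> real^2 \<Rightarrow> 'b::euclidean_space"
  assumes \<mu>: "cell_measure \<mu>" and \<sigma>[measurable]: "\<sigma> \<in> borel_measurable borel" and p: "periodic \<sigma>"
    and \<sigma>1: "\<And>x. norm (\<sigma> x) \<le> (1::real)"
    and mF[measurable]: "\<And>k. F k \<in> borel_measurable borel"
    and i2: "\<And>k. integrable torus (\<lambda>x. (norm (F k x))\<^sup>2)" and i1: "\<And>k. integrable torus (F k)"
    and C: "\<And>k. (LINT x|torus. (norm (F k x))\<^sup>2) \<le> C"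
    and limG: "\<And>\<phi>. cper \<phi> \<Longrightarrow> (\<lambda>k. LINT x|torus. \<phi> x * norm (F k x)) \<longlonglongrightarrow> (LINT x|\<mu>. \<phi> x)"
  obtains W :: "real^2 \<Rightarrow> 'b" where "periodic W" "W \<in> borel_measurable borel" "integrable torus W"
    "\<And>\<phi>. cper \<phi> \<Longrightarrow> (LINT x|\<mu>. \<phi> x *\<^sub>R \<sigma> x) = (LINT x|torus. \<phi> x *\<^sub>R W x)"
proof -
  have le: "(LINT x|\<mu>. \<phi> x) \<le> (LINT x|torus. (\<phi> x)\<^sup>2) / t + t * C"
    if \<phi>: "cper \<phi>" "\<And>x. 0 \<le> \<phi> x" and t: "t > 0" for \<phi> t
  proof (rule LIMSEQ_le_const2[OF limG[OF \<phi>(1)]], intro exI allI impI)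
    fix k
    have cp2: "cper (\<lambda>x. (\<phi> x)\<^sup>2)" using \<phi>(1) by (auto simp: cper_def periodic_def intro!: continuous_intros)
    have i\<phi>: "integrable torus (\<lambda>x. (\<phi> x)\<^sup>2)"
      using integrable_cper_const[OF cp2] cell_measureD[OF cell_measure_torus] by blast
    have "(LINT x|torus. \<phi> x * norm (F k x)) \<le> (LINT x|torus. (\<phi> x)\<^sup>2 / t + t * (norm (F k x))\<^sup>2)"
    proof (rule integral_mono)
      show "integrable torus (\<lambda>x. \<phi> x * norm (F k x))"
        using integrable_cper[OF \<phi>(1) integrable_norm[OF i1[of k]]] by simp
      show "integrable torus (\<lambda>x. (\<phi> x)\<^sup>2 / t + t * (norm (F k x))\<^sup>2)"
        using i\<phi> i2[of k] by simp
      fix x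
      \<comment> \<open>Completing the square controls twice the product; the factor 2 is dropped
        because both factors are nonnegative.\<close>
      have "0 \<le> (\<phi> x - t * norm (F k x))\<^sup>2 / t" using t by simp
      also have "\<dots> = (\<phi> x)\<^sup>2 / t + t * (norm (F k x))\<^sup>2 - 2 * (\<phi> x * norm (F k x))"
        using t by (simp add: power2_diff field_simps power2_eq_square)
      finally show "\<phi> x * norm (F k x) \<le> (\<phi> x)\<^sup>2 / t + t * (norm (F k x))\<^sup>2"
        using \<phi>(2)[of x] mult_nonneg_nonneg[OF \<phi>(2)[of x] norm_ge_zero[of "F k x"]] by linarith
    qed
    also have "\<dots> = (LINT x|torus. (\<phi> x)\<^sup>2) / t + t * (LINT x|torus. (norm (F k x))\<^sup>2)"
      using i\<phi> i2[of k] by simp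
    also have "\<dots> \<le> (LINT x|torus. (\<phi> x)\<^sup>2) / t + t * C"
      using C[of k] t by simp
    finally show "(LINT x|torus. \<phi> x * norm (F k x)) \<le> (LINT x|torus. (\<phi> x)\<^sup>2) / t + t * C" .
  qed
  obtain D where D: "D \<in> borel_measurable borel" "\<And>x. 0 \<le> D x" "integrable torus D"
    "\<mu> = density torus (\<lambda>x. ennreal (D x))"
    by (rule cell_measure_ac_density[OF \<mu>]) (rule le that; (assumption | blast))+
  note [measurable] = D(1)
  define W where "W x = D (fracs x) *\<^sub>R \<sigma> x" for x
  have mW[measurable]: "W \<in> borel_measurable borel" unfolding W_def[abs_def] by measurable
  have AEW: "AE x in torus. W x = D x *\<^sub>R \<sigma> x"
    using AE_torus by eventually_elim (simp add: W_def fracs_cell)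
  show thesis
  proof (rule that[of W])
    show "periodic W" using p by (simp add: periodic_def W_def)
    show "W \<in> borel_measurable borel" by (rule mW)
    show "integrable torus W"
    proof (rule Bochner_Integration.integrable_bound[OF D(3)])
      show "AE x in torus. norm (W x) \<le> norm (D x)"
        using AEW
      proof eventually_elim
        case (elim x)
        then show ?case using D(2)[of x] \<sigma>1[of x] by (simp add: mult_left_le)
      qed
    qed auto
    fix \<phi> :: "real^2 \<Rightarrow> real" assume \<phi>: "cper \<phi>"
    note [measurable] = cper_measurable[OF \<phi>]
    have "(LINT x|\<mu>. \<phi> x *\<^sub>R \<sigma> x) = (LINT x|torus. D x *\<^sub>R (\<phi> x *\<^sub>R \<sigma> x))"
      unfolding D(4) by (rule integral_density) (use D(2) in auto)
    also have "\<dots> = (LINT x|torus. \<phi> x *\<^sub>R W x)"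
      by (rule integral_cong_AE) (use AEW in \<open>auto simp: mult.commute\<close>)
    finally show "(LINT x|\<mu>. \<phi> x *\<^sub>R \<sigma> x) = (LINT x|torus. \<phi> x *\<^sub>R W x)" .
  qed
qed

lemma adjoint_weak_limit:
  fixes v :: "nat \<Rightarrow> nat \<Rightarrow> (real^'c::finite) grid"
  assumes N: "\<And>k. N k \<ge> 1" and h0: "(\<lambda>k. 1 / real (N k)) \<longlonglongrightarrow> 0"
    and p: "\<And>k r. r \<in> {1..I} \<Longrightarrow> periodic_grid (N k) (v k r)"
    and C: "\<And>k. av2 (N k) (\<lambda>i j. \<Sum>r=1..I. norm (v k r i j)) \<le> C"
    and \<kappa>: "normalized_kernels \<nu> I \<kappa>" and \<phi>: "test_function \<phi>"
    and adj: "(\<lambda>k. pair \<phi> (pix (N k) (\<lambda>i j. adjoint_interp \<nu> I \<kappa> (v k) i j $ a))) \<longlonglongrightarrow> X"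
    and lim: "(\<lambda>k. pair \<phi> (pix (N k) (\<lambda>i j. (\<Sum>r=1..I. v k r i j) $ a))) \<longlonglongrightarrow> Y"
  shows "X = Y"
proof -
  from tendsto_diff[OF adj lim] adjoint_interp_limit[OF N h0 p C \<kappa> \<phi>, of a] have "X - Y = 0"
    by (rule LIMSEQ_unique)
  then show ?thesis by simp
qed

section \<open>Assembling the lower bound\<close>

lemma norm_le_abs2: "norm (x :: real^2) \<le> \<bar>x $ 1\<bar> + \<bar>x $ 2\<bar>"
  using norm_le_l1_cart[of x] by (simp add: sum_2)

definition feasible ::
  "nat \<Rightarrow> nat \<Rightarrow> 3 kernels \<Rightarrow> nat \<Rightarrow> 2 kernels \<Rightarrow> nat \<Rightarrow> real grid \<Rightarrow> (real^2) grid \<Rightarrow>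
    (nat \<Rightarrow> (real^3) grid) \<Rightarrow> (nat \<Rightarrow> (real^2) grid) \<Rightarrow> bool" where
  "feasible \<nu> nK \<xi> nL \<eta> N u w vK vL \<longleftrightarrow> periodic_grid N w \<and>
     (\<forall>r\<in>{1..nK}. periodic_grid N (vK r)) \<and> (\<forall>l\<in>{1..nL}. periodic_grid N (vL l)) \<and>
     (\<forall>i j. adjoint_interp \<nu> nL \<eta> vL i j = discrete_grad (1 / real N) u i j - w i j) \<and>
     (\<forall>i j. adjoint_interp \<nu> nK \<xi> vK i j = discrete_sym_grad (1 / real N) w i j)"

definition energy ::
  "real \<Rightarrow> real \<Rightarrow> nat \<Rightarrow> nat \<Rightarrow> nat \<Rightarrow> (nat \<Rightarrow> (real^3) grid) \<Rightarrow> (nat \<Rightarrow> (real^2) grid) \<Rightarrow> real" where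
  "energy \<alpha>0 \<alpha>1 N nK nL vK vL =
     (1 / real N)\<^sup>2 * \<alpha>1 * Z_norm norm N nL vL + (1 / real N)\<^sup>2 * \<alpha>0 * Z_norm sym_norm N nK vK"

lemma discrete_TGV_altdef:
  "discrete_TGV \<alpha>0 \<alpha>1 \<nu> nK \<xi> nL \<eta> N u =
     Inf {ennreal (energy \<alpha>0 \<alpha>1 N nK nL vK vL) | w vK vL. feasible \<nu> nK \<xi> nL \<eta> N u w vK vL}"
  by (simp add: discrete_TGV_def Let_def feasible_def energy_def)

text \<open>Formulated for feasible triples of energy at most \<open>c\<close> along a subsequence,
  so that neither attainment of the discrete minima nor convergence of the energies is
  involved.\<close>

lemma lower_bound_core:
  fixes c \<alpha>0 \<alpha>1 :: real and N :: "nat \<Rightarrow> nat" and w :: "nat \<Rightarrow> (real^2) grid"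
  assumes \<alpha>: "\<alpha>0 > 0" "\<alpha>1 > 0"
    and \<xi>: "normalized_kernels \<nu> nK \<xi>" and \<eta>: "normalized_kernels \<nu> nL \<eta>"
    and u: "locally_integrable u" and conv: "images_converge uh u"
    and Nm: "strict_mono N" and N: "\<And>k. N k \<ge> 1"
    and app: "\<And>k. discrete_affine_plus_periodic (N k) (uh (N k))"
    and feas: "\<And>k. feasible \<nu> nK \<xi> nL \<eta> (N k) (uh (N k)) (w k) (vK k) (vL k)"
    and val: "\<And>k. energy \<alpha>0 \<alpha>1 (N k) nK nL (vK k) (vL k) \<le> c"
  shows "TGV \<alpha>0 \<alpha>1 u \<le> ennreal c"
proof -
  have pw: "periodic_grid (N k) (w k)"
    and pK: "r \<in> {1..nK} \<Longrightarrow> periodic_grid (N k) (vK k r)"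
    and pL: "r \<in> {1..nL} \<Longrightarrow> periodic_grid (N k) (vL k r)"
    and eL: "adjoint_interp \<nu> nL \<eta> (vL k) i j = discrete_grad (1 / real (N k)) (uh (N k)) i j - w k i j"
    and eK: "adjoint_interp \<nu> nK \<xi> (vK k) i j = discrete_sym_grad (1 / real (N k)) (w k) i j" for k r i j
    using feas[of k] by (simp_all add: feasible_def)
  obtain u' where u': "loc_int u'" "AE x in lebesgue. u x = u' x"
    using borel_representative[OF u] by metis
  define mL where "mL k = av2 (N k) (\<lambda>i j. \<Sum>r=1..nL. norm (vL k r i j))" for k
  define mK where "mK k = av2 (N k) (\<lambda>i j. \<Sum>r=1..nK. sym_norm (vK k r i j))" for k
  have sn0: "0 \<le> sym_norm p" for p by (simp add: sym_norm_def)
  have mL0: "0 \<le> mL k" and mK0: "0 \<le> mK k" for k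
    unfolding mL_def mK_def using sn0 by (auto intro!: av_nonneg sum_nonneg)
  have mval: "\<alpha>1 * mL k + \<alpha>0 * mK k \<le> c" for k
    using val[of k] unfolding mL_def mK_def energy_def Z_norm_av2[symmetric] by (simp only: mult_ac)
  define CL where "CL = c / \<alpha>1"
  define CK where "CK = c / \<alpha>0"
  have mLC: "mL k \<le> CL" and mKC: "mK k \<le> CK" for k
  proof -
    have "0 \<le> \<alpha>1 * mL k" "0 \<le> \<alpha>0 * mK k" using mL0 mK0 \<alpha> by auto
    then have "\<alpha>1 * mL k \<le> c" "\<alpha>0 * mK k \<le> c" using mval[of k] by linarith+
    then show "mL k \<le> CL" "mK k \<le> CK"
      using \<alpha> by (simp_all add: CL_def CK_def pos_le_divide_eq mult.commute)
  qed
  have mK': "av2 (N k) (\<lambda>i j. \<Sum>r=1..nK. norm (vK k r i j)) \<le> CK" for k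
    by (rule order_trans[OF av2_mono mKC[of k, unfolded mK_def]]) (intro sum_mono norm_le_sym_norm)
  have mL': "av2 (N k) (\<lambda>i j. \<Sum>r=1..nL. norm (vL k r i j)) \<le> CL" for k
    using mLC by (simp add: mL_def)
  have h0: "(\<lambda>k. 1 / real (N k)) \<longlonglongrightarrow> 0"
    using LIMSEQ_subseq_LIMSEQ[OF lim_1_over_n Nm] by (simp add: o_def)
  have wu: "wconv (\<lambda>k. pix (N k) (uh (N k))) u'"
    using conv u u' Nm by (rule images_converge_wconv)
  have "\<forall>k. \<exists>q::real^2. periodic_grid (N k) (\<lambda>i j. uh (N k) i j - q \<bullet> vector [of_int i / N k, of_int j / N k])"
    using app unfolding discrete_affine_plus_periodic_def by simp
  from choice[OF this] obtain q :: "nat \<Rightarrow> real^2"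
    where q: "\<And>k. periodic_grid (N k) (\<lambda>i j. uh (N k) i j - q k \<bullet> vector [of_int i / N k, of_int j / N k])"
    by auto
  from wu have "\<exists>C. \<forall>k. (lnorm 2 (pix (N k) (uh (N k)))) \<le> C"
    unfolding wconv_def by (elim conjE) (erule allE)
  then obtain Cu where Cu: "\<And>k. (lnorm 2 (pix (N k) (uh (N k)))) \<le> Cu"
    by blast
  obtain Bq where Bq: "\<And>k a. \<bar>q k $ a\<bar> \<le> Bq"
    by (rule slopes_bounded[OF Cu N q]) (rule that)
  \<comment> \<open>The constraint expresses \<open>w\<close> as gradient minus interpolated field:
    the mean of the gradient is the slope, and the mean of the interpolated field is at most the
    kernel mass times the bound on \<open>mL\<close>.\<close>
  define m where "m = Bq + kernel_mass \<nu> nL \<eta> * CL"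
  have mean: "\<bar>av2 (N k) (\<lambda>i j. w k i j $ a)\<bar> \<le> m" for k a
  proof -
    have weq: "w k i j $ a = discrete_grad (1 / real (N k)) (uh (N k)) i j $ a - adjoint_interp \<nu> nL \<eta> (vL k) i j $ a" for i j
      using eL[of k i j] by simp
    have "av2 (N k) (\<lambda>i j. w k i j $ a) = q k $ a - av2 (N k) (\<lambda>i j. adjoint_interp \<nu> nL \<eta> (vL k) i j $ a)"
      unfolding weq by (simp only: av_diff mean_discrete_grad[OF N q])
    moreover have "\<bar>av2 (N k) (\<lambda>i j. adjoint_interp \<nu> nL \<eta> (vL k) i j $ a)\<bar> \<le> kernel_mass \<nu> nL \<eta> * CL"
      by (rule order_trans[OF av2_abs order_trans[OF mean_adjoint_interp[OF N pL] mult_left_mono[OF mL' kernel_mass_nonneg]]])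
    ultimately show ?thesis using Bq[of k a] by (simp add: m_def)
  qed
  \<comment> \<open>The factor 4 = 1 + 2 + 1 counts the three strain components with the weights
    they have in \<open>discrete_strauss\<close>.\<close>
  define S where "S = 4 * (kernel_mass \<nu> nK \<xi> * CK)"
  have aS: "av2 (N k) (\<lambda>i j. \<bar>discrete_sym_grad (1 / real (N k)) (w k) i j $ a\<bar>) \<le> kernel_mass \<nu> nK \<xi> * CK" for k a
    unfolding eK[symmetric]
    by (rule order_trans[OF mean_adjoint_interp[OF N pK] mult_left_mono[OF mK' kernel_mass_nonneg]])
  have pwa: "periodic_grid (N k) (\<lambda>i j. w k i j $ a)" for k a
    using pw[of k] by (simp add: periodic_grid_def)
  have dS: "av2 (N k) (\<lambda>i j. \<bar>dif1 (N k) (\<lambda>i j. w k i j $ 1) i j\<bar> +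
      2 * \<bar>difm (N k) (\<lambda>i j. w k i j $ 1) (\<lambda>i j. w k i j $ 2) i j\<bar> + \<bar>dif2 (N k) (\<lambda>i j. w k i j $ 2) i j\<bar>) \<le> S" for k
  proof -
    have e: "dif1 (N k) (\<lambda>i j. w k i j $ 1) i j = discrete_sym_grad (1 / real (N k)) (w k) i j $ 1"
      "difm (N k) (\<lambda>i j. w k i j $ 1) (\<lambda>i j. w k i j $ 2) i j = discrete_sym_grad (1 / real (N k)) (w k) i j $ 2"
      "dif2 (N k) (\<lambda>i j. w k i j $ 2) i j = discrete_sym_grad (1 / real (N k)) (w k) i j $ 3" for i j
      by (simp_all add: dif1_def difm_def dif2_def discrete_sym_grad_def mult.commute)
    show ?thesis
      unfolding e av2_add using aS[of k 1] aS[of k 2] aS[of k 3] by (simp add: S_def av_cmult)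
  qed
  define C1 where "C1 = 2 * (m + 2 * S)"
  define C2 where "C2 = 2 * (m + 2 * S) * (3 * m + 7 * S)"
  have strauss1: "av2 (N k) (\<lambda>i j. \<bar>w k i j $ 1\<bar> + \<bar>w k i j $ 2\<bar>) \<le> C1" for k
    unfolding C1_def by (rule discrete_strauss(1)[OF N pwa pwa dS mean mean])
  have strauss2: "av2 (N k) (\<lambda>i j. (w k i j $ 1)\<^sup>2 + (w k i j $ 2)\<^sup>2) \<le> C2" for k
    unfolding C2_def by (rule discrete_strauss(2)[OF N pwa pwa dS mean mean])
  define Fw where "Fw k = pix (N k) (w k)" for k
  define FL where "FL k = pix (N k) (\<lambda>i j. \<Sum>r=1..nL. vL k r i j)" for k
  define GL where "GL k = pix (N k) (\<lambda>i j. \<Sum>r=1..nL. norm (vL k r i j))" for k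
  define FK where "FK k = pix (N k) (\<lambda>i j. symm3 (\<Sum>r=1..nK. vK k r i j))" for k
  define GK where "GK k = pix (N k) (\<lambda>i j. \<Sum>r=1..nK. sym_norm (vK k r i j))" for k
  have pgL: "periodic_grid (N k) (\<lambda>i j. \<Sum>r=1..nL. vL k r i j)" "periodic_grid (N k) (\<lambda>i j. \<Sum>r=1..nL. norm (vL k r i j))" for k
    using pL[of _ k] by (auto simp: periodic_grid_def)
  have pgK: "periodic_grid (N k) (\<lambda>i j. symm3 (\<Sum>r=1..nK. vK k r i j))" "periodic_grid (N k) (\<lambda>i j. \<Sum>r=1..nK. sym_norm (vK k r i j))" for k
    using pK[of _ k] by (auto simp: periodic_grid_def)
  have pgw: "periodic_grid (N k) (\<lambda>i j. norm (w k i j))" "periodic_grid (N k) (\<lambda>i j. (norm (w k i j))\<^sup>2)" for k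
    using pw[of k] by (auto simp: periodic_grid_def)
  have iw: "integrable torus (Fw k)" and iL: "integrable torus (GL k)" and iK: "integrable torus (GK k)"
    and iFL: "integrable torus (FL k)" and iFK: "integrable torus (FK k)" for k
    unfolding Fw_def GL_def GK_def FL_def FK_def using N pw pgL pgK by (auto intro: integral_pix(1))
  have nw: "norm (Fw k x) = pix (N k) (\<lambda>i j. norm (w k i j)) x" "(norm (Fw k x))\<^sup>2 = pix (N k) (\<lambda>i j. (norm (w k i j))\<^sup>2) x" for k x
    by (simp_all add: Fw_def pix_def)
  have bw: "(LINT x|torus. norm (Fw k x)) \<le> C1" for k
    unfolding nw integral_pix_av2[OF N pgw(1)]
    by (rule order_trans[OF av2_mono strauss1]) (rule norm_le_abs2)
  have iw2: "integrable torus (\<lambda>x. (norm (Fw k x))\<^sup>2)" for k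
    unfolding nw(2) by (rule integral_pix(1)[OF N pgw(2)])
  have bw2: "(LINT x|torus. (norm (Fw k x))\<^sup>2) \<le> C2" for k
    unfolding nw(2) integral_pix_av2[OF N pgw(2)]
    by (rule order_trans[OF av2_mono strauss2]) (simp add: norm_vec_def L2_set_def sum_2)
  have bL: "(LINT x|torus. GL k x) = mL k" for k
    unfolding GL_def mL_def by (rule integral_pix_av2[OF N pgL(2)])
  have bK: "(LINT x|torus. GK k x) = mK k" for k
    unfolding GK_def mK_def by (rule integral_pix_av2[OF N pgK(2)])
  have mF[measurable]: "Fw k \<in> borel_measurable borel" "FL k \<in> borel_measurable borel" "GL k \<in> borel_measurable borel"
    "FK k \<in> borel_measurable borel" "GK k \<in> borel_measurable borel" for k
    unfolding Fw_def FL_def GL_def FK_def GK_def by (rule pix_borel_measurable)+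
  have FGL: "norm (FL k x) \<le> GL k x" for k x
    by (simp add: FL_def GL_def pix_def norm_sum)
  have FGK: "norm (FK k x) \<le> GK k x" for k x
    unfolding FK_def GK_def pix_def symm3_sum by (rule order_trans[OF norm_sum]) (simp add: norm_symm3)
  \<comment> \<open>Three nested extractions, for \<open>w\<close> and for the summed fields
    \<open>FL\<close> and \<open>FK\<close>. The last two are dominated by the sums
    \<open>GL\<close> and \<open>GK\<close> of pointwise norms, whose integrals are the
    energies.\<close>
  obtain r1 \<mu>w \<sigma>w where r1: "strict_mono (r1 :: nat \<Rightarrow> nat)" and \<mu>w: "cell_measure \<mu>w"
    and \<sigma>w: "\<sigma>w \<in> borel_measurable borel" "periodic \<sigma>w" "\<And>x. norm (\<sigma>w x) \<le> 1"
    and limGw: "\<And>\<phi>. cper \<phi> \<Longrightarrow> (\<lambda>k. LINT x|torus. \<phi> x * norm (Fw (r1 k) x)) \<longlonglongrightarrow> (\<integral>x. \<phi> x \<partial>\<mu>w)"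
    and limFw: "\<And>\<phi>. cper \<phi> \<Longrightarrow> (\<lambda>k. LINT x|torus. \<phi> x *\<^sub>R Fw (r1 k) x) \<longlonglongrightarrow> (\<integral>x. \<phi> x *\<^sub>R \<sigma>w x \<partial>\<mu>w)"
    by (rule torus_weak_compact_vector[of Fw "\<lambda>k x. norm (Fw k x)" C1]) (use iw bw in auto)
  obtain r2 \<mu>L \<sigma>L where r2: "strict_mono (r2 :: nat \<Rightarrow> nat)" and \<mu>L: "cell_measure \<mu>L"
    and \<sigma>L: "\<sigma>L \<in> borel_measurable borel" "periodic \<sigma>L" "\<And>x. norm (\<sigma>L x) \<le> 1"
    and limGL: "\<And>\<phi>. cper \<phi> \<Longrightarrow> (\<lambda>k. LINT x|torus. \<phi> x * GL (r1 (r2 k)) x) \<longlonglongrightarrow> (LINT x|\<mu>L. \<phi> x)"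
    and limFL: "\<And>\<phi>. cper \<phi> \<Longrightarrow> (\<lambda>k. LINT x|torus. \<phi> x *\<^sub>R FL (r1 (r2 k)) x) \<longlonglongrightarrow> (LINT x|\<mu>L. \<phi> x *\<^sub>R \<sigma>L x)"
    by (rule torus_weak_compact_vector[of "\<lambda>k. FL (r1 k)" "\<lambda>k. GL (r1 k)" CL]) (use FGL iL bL mLC in auto)
  obtain r3 \<mu>K \<sigma>K where r3: "strict_mono (r3 :: nat \<Rightarrow> nat)" and \<mu>K: "cell_measure \<mu>K"
    and \<sigma>K: "\<sigma>K \<in> borel_measurable borel" "periodic \<sigma>K" "\<And>x. norm (\<sigma>K x) \<le> 1"
    and limGK: "\<And>\<phi>. cper \<phi> \<Longrightarrow> (\<lambda>k. LINT x|torus. \<phi> x * GK (r1 (r2 (r3 k))) x) \<longlonglongrightarrow> (LINT x|\<mu>K. \<phi> x)"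
    and limFK: "\<And>\<phi>. cper \<phi> \<Longrightarrow> (\<lambda>k. LINT x|torus. \<phi> x *\<^sub>R FK (r1 (r2 (r3 k))) x) \<longlonglongrightarrow> (LINT x|\<mu>K. \<phi> x *\<^sub>R \<sigma>K x)"
    by (rule torus_weak_compact_vector[of "\<lambda>k. FK (r1 (r2 k))" "\<lambda>k. GK (r1 (r2 k))" CK]) (use FGK iK bK mKC in auto)
  define s where "s k = r1 (r2 (r3 k))" for k
  have sm: "strict_mono (N \<circ> s)" using Nm r1 r2 r3 by (simp add: strict_mono_def s_def)
  have limFws: "(\<lambda>k. LINT x|torus. \<phi> x *\<^sub>R Fw (s k) x) \<longlonglongrightarrow> (\<integral>x. \<phi> x *\<^sub>R \<sigma>w x \<partial>\<mu>w)" if "cper \<phi>" for \<phi>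
    using LIMSEQ_subseq_LIMSEQ[OF limFw[OF that] strict_mono_o[OF r2 r3]] by (simp add: o_def s_def)
  have limFLs: "(\<lambda>k. LINT x|torus. \<phi> x *\<^sub>R FL (s k) x) \<longlonglongrightarrow> (LINT x|\<mu>L. \<phi> x *\<^sub>R \<sigma>L x)" if "cper \<phi>" for \<phi>
    using LIMSEQ_subseq_LIMSEQ[OF limFL[OF that] r3] by (simp add: o_def s_def)
  have limGLs: "(\<lambda>k. LINT x|torus. \<phi> x * GL (s k) x) \<longlonglongrightarrow> (LINT x|\<mu>L. \<phi> x)" if "cper \<phi>" for \<phi>
    using LIMSEQ_subseq_LIMSEQ[OF limGL[OF that] r3] by (simp add: o_def s_def)
  note limFKs = limFK[folded s_def] and limGKs = limGK[folded s_def]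
  \<comment> \<open>Here the L2 bound is used: it makes the weak limit of the discrete fields a
    function.\<close>
  obtain W where W: "periodic W" "W \<in> borel_measurable borel" "integrable torus W"
    and \<sigma>W: "\<And>\<phi>. cper \<phi> \<Longrightarrow> (\<integral>x. \<phi> x *\<^sub>R \<sigma>w x \<partial>\<mu>w) = (LINT x|torus. \<phi> x *\<^sub>R W x)"
    by (rule l2_weak_limit_density[OF \<mu>w \<sigma>w mF(1) iw2 iw bw2]) (rule limGw that; (assumption | blast))+
  have lW: "loc_int W" using W by (rule loc_int_periodic)
  have lWa: "loc_int (\<lambda>x. W x $ a)" for a using lW by (rule loc_int_nth)
  have Ns: "\<And>k. N (s k) \<ge> 1" by (rule N)
  have h0s: "(\<lambda>k. 1 / real (N (s k))) \<longlonglongrightarrow> 0"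
    using LIMSEQ_subseq_LIMSEQ[OF lim_1_over_n sm] by (simp add: o_def)
  have wus: "wconv (\<lambda>k. pix (N (s k)) (uh (N (s k)))) u'"
    using images_converge_wconv[OF conv u u' sm] by simp
  have ww: "wconv (\<lambda>k. pix (N (s k)) (\<lambda>i j. w (s k) i j $ a)) (\<lambda>x. W x $ a)" for a
  proof (rule wconv_components[OF Ns pw _ W])
    show "(LINT x|torus. norm (pix (N (s k)) (w (s k)) x)) \<le> C1" for k
      using bw[of "s k"] by (simp add: Fw_def)
    show "(\<lambda>k. LINT x|torus. \<phi> x *\<^sub>R pix (N (s k)) (w (s k)) x) \<longlonglongrightarrow> (LINT x|torus. \<phi> x *\<^sub>R W x)" if "cper \<phi>" for \<phi>
      using limFws[OF that] \<sigma>W[OF that] by (simp add: Fw_def)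
  qed
  let ?G = "\<lambda>k. discrete_grad (1 / real (N (s k))) (uh (N (s k)))" and ?E = "\<lambda>k. discrete_sym_grad (1 / real (N (s k))) (w (s k))"
  have TA: "distr_grad u \<phi> - distr_of_fun W \<phi> = (LINT x|\<mu>L. fold_sum \<phi> x *\<^sub>R \<sigma>L x)" if \<phi>: "test_function \<phi>" for \<phi>
  proof -
    obtain R where R: "ctest R \<phi>" using test_function_ctest[OF \<phi>] by metis
    note d = wconv_pix_difference[OF wus Ns h0s \<phi>]
    have comp: "distr_grad u \<phi> $ a - distr_of_fun W \<phi> $ a = (LINT x|\<mu>L. fold_sum \<phi> x *\<^sub>R \<sigma>L x) $ a" for a
    proof (rule adjoint_weak_limit[OF Ns h0s pL mL' \<eta> \<phi>, where a = a])
      have "(\<lambda>k. pair \<phi> (pix (N (s k)) (\<lambda>i j. ?G k i j $ a)))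
        \<longlonglongrightarrow> - pair (pderiv_dir a \<phi>) u'"
        using UNIV_2_cases[of a] d(1,2) by (auto simp: discrete_grad_def)
      moreover have "(\<lambda>k. pair \<phi> (pix (N (s k)) (\<lambda>i j. w (s k) i j $ a))) \<longlonglongrightarrow> pair \<phi> (\<lambda>x. W x $ a)"
        using ww[of a] \<phi> by (simp add: wconv_def)
      ultimately have "(\<lambda>k. (pair \<phi> (pix (N (s k)) (\<lambda>i j. ?G k i j $ a)))
           - pair \<phi> (pix (N (s k)) (\<lambda>i j. w (s k) i j $ a)))
         \<longlonglongrightarrow> - pair (pderiv_dir a \<phi>) u' - pair \<phi> (\<lambda>x. W x $ a)"
        by (rule tendsto_diff)
      moreover have "pair \<phi> (pix (N (s k)) (\<lambda>i j. ?G k i j $ a))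
           - pair \<phi> (pix (N (s k)) (\<lambda>i j. w (s k) i j $ a)) =
           (pair \<phi> (pix (N (s k)) (\<lambda>i j. adjoint_interp \<nu> nL \<eta> (vL (s k)) i j $ a)))" for k
      proof -
        have "pix (N (s k)) (\<lambda>i j. adjoint_interp \<nu> nL \<eta> (vL (s k)) i j $ a) x =
          pix (N (s k)) (\<lambda>i j. ?G k i j $ a) x - pix (N (s k)) (\<lambda>i j. w (s k) i j $ a) x" for x
          by (simp add: pix_def eL)
        then show ?thesis
          using integrable_ctest[OF R loc_int_pix[of "N (s k)" "\<lambda>i j. ?G k i j $ a"]]
            integrable_ctest[OF R loc_int_pix[of "N (s k)" "\<lambda>i j. w (s k) i j $ a"]]
          by (simp add: right_diff_distrib)
      qed
      moreover have "distr_grad u \<phi> $ a - distr_of_fun W \<phi> $ a = - pair (pderiv_dir a \<phi>) u' - pair \<phi> (\<lambda>x. W x $ a)"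
        using distr_grad_borel[OF u u' \<phi>] lebesgue_test_integral[OF loc_int_locally_integrable[OF lW] lW _ \<phi>] ctest_nth_integral[OF R lW]
        by (simp add: distr_of_fun_def)
      ultimately show "(\<lambda>k. pair \<phi> (pix (N (s k)) (\<lambda>i j. adjoint_interp \<nu> nL \<eta> (vL (s k)) i j $ a)))
        \<longlonglongrightarrow> distr_grad u \<phi> $ a - distr_of_fun W \<phi> $ a" by simp
      have "(\<lambda>k. (LINT x|torus. fold_sum \<phi> x *\<^sub>R FL (s k) x) $ a) \<longlonglongrightarrow> (LINT x|\<mu>L. fold_sum \<phi> x *\<^sub>R \<sigma>L x) $ a"
        by (intro tendsto_vec_nth limFLs test_function_cper \<phi>)
      moreover note fold_sum_pix_linear[OF N pgL(1) R bounded_linear_vec_nth[of a], folded FL_def]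
      ultimately show "(\<lambda>k. pair \<phi> (pix (N (s k)) (\<lambda>i j. (\<Sum>r=1..nL. vL (s k) r i j) $ a)))
        \<longlonglongrightarrow> (LINT x|\<mu>L. fold_sum \<phi> x *\<^sub>R \<sigma>L x) $ a" by simp
    qed
    show ?thesis using comp by (simp add: vec_eq_iff)
  qed
  have TB: "distr_sym_grad W \<phi> = (LINT x|\<mu>K. fold_sum \<phi> x *\<^sub>R \<sigma>K x)" if \<phi>: "test_function \<phi>" for \<phi>
  proof -
    obtain R where R: "ctest R \<phi>" using test_function_ctest[OF \<phi>] by metis
    note d1 = wconv_pix_difference[OF ww[of 1] Ns h0s \<phi>] and d2 = wconv_pix_difference[OF ww[of 2] Ns h0s \<phi>]
    define X where "X a b = - pair (pderiv_dir b \<phi>) (\<lambda>x. W x $ a)" for a b :: 2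
    \<comment> \<open>The hypothesis \<open>sy\<close> names the component \<open>c\<close> that
      occupies the entry (a, b); the middle component serves both off-diagonal entries.\<close>
    have lK: "(\<lambda>k. pair \<phi> (pix (N (s k)) (\<lambda>i j. (\<Sum>r=1..nK. vK (s k) r i j) $ c)))
        \<longlonglongrightarrow> (LINT x|\<mu>K. fold_sum \<phi> x *\<^sub>R \<sigma>K x) $ a $ b"
      if sy: "\<And>p. symm3 p $ a $ b = p $ c" for a b c
    proof -
      have "(\<lambda>k. (LINT x|torus. fold_sum \<phi> x *\<^sub>R FK (s k) x) $ a $ b) \<longlonglongrightarrow> (LINT x|\<mu>K. fold_sum \<phi> x *\<^sub>R \<sigma>K x) $ a $ b"
        by (intro tendsto_vec_nth limFKs test_function_cper \<phi>)
      moreover note fold_sum_pix_linear[OF N pgK(1) R bounded_linear_compose[OF bounded_linear_vec_nth[of b] bounded_linear_vec_nth[of a]], folded FK_def]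
      ultimately show ?thesis by (simp add: sy)
    qed
    have lK': "Y = (LINT x|\<mu>K. fold_sum \<phi> x *\<^sub>R \<sigma>K x) $ a $ b"
      if sy: "\<And>p. symm3 p $ a $ b = p $ c"
        and l: "(\<lambda>k. pair \<phi> (pix (N (s k)) (\<lambda>i j. ?E k i j $ c))) \<longlonglongrightarrow> Y"
      for a b c Y
      by (rule adjoint_weak_limit[OF Ns h0s pK mK' \<xi> \<phi>, where a = c]) (use l lK[OF sy] in \<open>auto simp: eK\<close>)
    have c1: "(\<lambda>k. pair \<phi> (pix (N (s k)) (\<lambda>i j. ?E k i j $ 1))) \<longlonglongrightarrow> X 1 1"
      using d1(3) by (simp add: discrete_sym_grad_def X_def)
    have c3: "(\<lambda>k. pair \<phi> (pix (N (s k)) (\<lambda>i j. ?E k i j $ 3))) \<longlonglongrightarrow> X 2 2"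
      using d2(4) by (simp add: discrete_sym_grad_def X_def)
    have c2: "(\<lambda>k. pair \<phi> (pix (N (s k)) (\<lambda>i j. ?E k i j $ 2))) \<longlonglongrightarrow> (X 1 2 + X 2 1) / 2"
    proof -
      define P where "P k = pix (N (s k)) (\<lambda>i j. (w (s k) i (j + 1) $ 1 - w (s k) i j $ 1) / (1 / N (s k)))" for k
      define Q where "Q k = pix (N (s k)) (\<lambda>i j. (w (s k) (i + 1) j $ 2 - w (s k) i j $ 2) / (1 / N (s k)))" for k
      have "(\<lambda>k. (pair \<phi> (P k) + pair \<phi> (Q k)) / 2) \<longlonglongrightarrow> (X 1 2 + X 2 1) / 2"
        unfolding P_def Q_def X_def by (intro tendsto_intros d1(2) d2(1)) simp
      moreover have "(pair \<phi> (P k) + pair \<phi> (Q k)) / 2 =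
         (pair \<phi> (pix (N (s k)) (\<lambda>i j. ?E k i j $ 2)))" for k
      proof -
        have lP: "loc_int (P k)" "loc_int (Q k)" unfolding P_def Q_def by (rule loc_int_pix)+
        have "(pair \<phi> (P k) + pair \<phi> (Q k)) / 2 = (LINT x|lborel. (\<phi> x * P k x + \<phi> x * Q k x) / 2)"
          using integrable_ctest[OF R lP(1)] integrable_ctest[OF R lP(2)] by simp
        also have "\<dots> = pair \<phi> (pix (N (s k)) (\<lambda>i j. ?E k i j $ 2))"
          by (intro Bochner_Integration.integral_cong) (auto simp: P_def Q_def pix_def discrete_sym_grad_def field_simps)
        finally show ?thesis .
      qed
      ultimately show ?thesis by simp
    qed
    have gX: "distr_grad (\<lambda>x. W x $ a) \<phi> $ b = X a b" for a b
      unfolding X_def by (rule distr_grad_borel[OF loc_int_locally_integrable[OF lWa] lWa _ \<phi>]) simp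
    have ent: "distr_sym_grad W \<phi> $ a $ b = (X a b + X b a) / 2" for a b
      by (simp add: distr_sym_grad_def gX)
    have "distr_sym_grad W \<phi> $ a $ b = (LINT x|\<mu>K. fold_sum \<phi> x *\<^sub>R \<sigma>K x) $ a $ b" for a b
      using UNIV_2_cases[of a] UNIV_2_cases[of b] lK'[OF _ c1, of 1 1] lK'[OF _ c3, of 2 2] lK'[OF _ c2, of 1 2] lK'[OF _ c2, of 2 1]
      by (auto simp: ent add.commute)
    then show ?thesis by (simp add: vec_eq_iff)
  qed
  \<comment> \<open>The limit distributions are now integrals of lattice sums against finite cell
    measures, so they are periodic locally finite measures with polar decompositions.\<close>
  obtain MA where MA: "is_measure_with_variation (\<lambda>\<phi>. distr_grad u \<phi> - distr_of_fun W \<phi>) MA"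
      "emeasure MA period_cell \<le> emeasure \<mu>L UNIV"
    using polar_periodize[OF \<mu>L \<sigma>L TA] by metis
  obtain MB where MB: "is_measure_with_variation (distr_sym_grad W) MB"
      "emeasure MB period_cell \<le> emeasure \<mu>K UNIV"
    using polar_periodize[OF \<mu>K \<sigma>K TB] by metis
  have "TGV \<alpha>0 \<alpha>1 u \<le> ennreal \<alpha>1 * emeasure MA period_cell + ennreal \<alpha>0 * emeasure MB period_cell"
    unfolding TGV_def using MA(1) MB(1) loc_int_locally_integrable[OF lW] periodic_imp_ae[OF W(1)]
    by (intro Inf_lower) blast
  also have "\<dots> \<le> ennreal \<alpha>1 * emeasure \<mu>L UNIV + ennreal \<alpha>0 * emeasure \<mu>K UNIV"
    using MA(2) MB(2) by (intro add_mono mult_left_mono) auto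
  also have "\<dots> = ennreal (\<alpha>1 * measure \<mu>L UNIV + \<alpha>0 * measure \<mu>K UNIV)"
    using \<alpha> cell_measureD(1)[OF \<mu>L] cell_measureD(1)[OF \<mu>K]
    by (simp add: finite_measure.emeasure_eq_measure ennreal_mult' ennreal_plus)
  \<comment> \<open>The constant 1 is a periodic test function, so total masses converge and the
    energy bound \<open>c\<close> is inherited without loss.\<close>
  also have "\<alpha>1 * measure \<mu>L UNIV + \<alpha>0 * measure \<mu>K UNIV \<le> c"
  proof -
    have one: "cper (\<lambda>x. 1)" by (simp add: cper_def periodic_def)
    have "(\<lambda>k. \<alpha>1 * mL (s k) + \<alpha>0 * mK (s k)) \<longlonglongrightarrow> \<alpha>1 * measure \<mu>L UNIV + \<alpha>0 * measure \<mu>K UNIV"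
      using limGLs[OF one] limGKs[OF one] cell_measureD(3)[OF \<mu>L] cell_measureD(3)[OF \<mu>K]
      by (intro tendsto_intros) (auto simp: bL bK)
    then show ?thesis by (rule LIMSEQ_le_const2) (use mval in auto)
  qed
  finally show ?thesis by (simp add: ennreal_leI)
qed

text \<open>Above the limit inferior, infinitely many discrete values lie strictly below
  \<open>c\<close>; strictness in the infimum provides feasible triples of energy at most
  \<open>c\<close>.\<close>

lemma lower_bound:
  fixes \<alpha>0 \<alpha>1 :: real
  assumes \<alpha>: "\<alpha>0 > 0" "\<alpha>1 > 0"
    and \<xi>: "normalized_kernels \<nu> nK \<xi>" and \<eta>: "normalized_kernels \<nu> nL \<eta>"
    and u: "locally_integrable u" and conv: "images_converge uh u"
    and app: "\<And>N. N \<ge> 1 \<Longrightarrow> discrete_affine_plus_periodic N (uh N)"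
  shows "TGV \<alpha>0 \<alpha>1 u \<le> liminf (\<lambda>N. discrete_TGV \<alpha>0 \<alpha>1 \<nu> nK \<xi> nL \<eta> N (uh N))"
proof (rule dense_ge)
  fix c :: ennreal
  let ?X = "\<lambda>N. discrete_TGV \<alpha>0 \<alpha>1 \<nu> nK \<xi> nL \<eta> N (uh N)"
  assume c: "liminf ?X < c"
  show "TGV \<alpha>0 \<alpha>1 u \<le> c"
  proof (cases c)
    case (real c')
    have "\<not> eventually (\<lambda>N. c \<le> ?X N) sequentially"
      using Liminf_bounded[of c ?X sequentially] c by auto
    then have fr: "\<exists>N\<ge>n. ?X N < c" for n
      unfolding eventually_sequentially by (meson not_le)
    have "infinite {N. N \<ge> 1 \<and> ?X N < c}"
      unfolding infinite_nat_iff_unbounded_le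
    proof
      fix m
      obtain N where "N \<ge> max m 1" "?X N < c" using fr by blast
      then show "\<exists>n\<ge>m. n \<in> {N. N \<ge> 1 \<and> ?X N < c}" by auto
    qed
    then obtain N :: "nat \<Rightarrow> nat" where N: "strict_mono N" "\<And>k. N k \<ge> 1" "\<And>k. ?X (N k) < c"
      using infinite_enumerate[of "{N. N \<ge> 1 \<and> ?X N < c}"] by auto
    have "\<exists>w vK vL. feasible \<nu> nK \<xi> nL \<eta> (N k) (uh (N k)) w vK vL \<and> energy \<alpha>0 \<alpha>1 (N k) nK nL vK vL \<le> c'" for k
    proof -
      from N(3)[of k] obtain w vK vL where "feasible \<nu> nK \<xi> nL \<eta> (N k) (uh (N k)) w vK vL"
        "ennreal (energy \<alpha>0 \<alpha>1 (N k) nK nL vK vL) < ennreal c'"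
        unfolding discrete_TGV_altdef Inf_less_iff real(2) by blast
      then show ?thesis using real(1) by (meson ennreal_leI linorder_not_le order_less_imp_le)
    qed
    then obtain w vK vL where k: "\<And>k. feasible \<nu> nK \<xi> nL \<eta> (N k) (uh (N k)) (w k) (vK k) (vL k)"
       "\<And>k. energy \<alpha>0 \<alpha>1 (N k) nK nL (vK k) (vL k) \<le> c'"
      by metis
    show ?thesis
      unfolding real(2) by (rule lower_bound_core[OF \<alpha> \<xi> \<eta> u conv N(1,2) app[OF N(2)] k])
  qed simp
qed

section \<open>Uniqueness and periodicity of the variation measure\<close>

text \<open>Exactly the regularity that \<open>is_measure_with_variation\<close> imposes: Borel and
  finite on compact sets.\<close>

definition radon :: "(real^2) measure \<Rightarrow> bool" where
  "radon M \<longleftrightarrow> sets M = sets borel \<and> (\<forall>K. compact K \<longrightarrow> emeasure M K < \<infinity>)"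

lemma radon_sets: "radon M \<Longrightarrow> sets M = sets borel"
  and radon_compact: "radon M \<Longrightarrow> compact K \<Longrightarrow> emeasure M K < \<infinity>"
  by (simp_all add: radon_def)

lemma radon_space: "radon M \<Longrightarrow> space M = UNIV"
  by (metis radon_def sets_eq_imp_space_eq space_borel)

lemma radon_sigma_finite:
  assumes "radon M" shows "sigma_finite_measure M"
proof
  have "(\<Union>n::nat. cball 0 (real n)) = (UNIV :: (real^2) set)"
    using real_arch_simple by auto
  then show "\<exists>A. countable A \<and> A \<subseteq> sets M \<and> \<Union> A = space M \<and> (\<forall>a\<in>A. emeasure M a \<noteq> \<infinity>)"
    using assms radon_compact[OF assms compact_cball]
    by (intro exI[of _ "range (\<lambda>n::nat. cball 0 (real n))"])
       (auto simp: radon_sets radon_space less_top)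
qed

text \<open>With a bump \<open>b\<close> that is positive exactly on an interval, 1 - exp(-n b) is
  smooth, lies between 0 and the indicator of the interval, and converges to it pointwise; products
  give boxes.\<close>

lemma box_bump_approx:
  fixes a b :: "real^2"
  obtains \<psi> :: "nat \<Rightarrow> real^2 \<Rightarrow> real" where "\<And>n. test_function (\<psi> n)" "\<And>n x. 0 \<le> \<psi> n x"
    "\<And>n x. \<psi> n x \<le> indicator (box a b) x" "\<And>x. (\<lambda>n. \<psi> n x) \<longlonglongrightarrow> indicator (box a b) x"
proof -
  define g where "g i n t = 1 - exp (- (real n * bump (a $ i) (b $ i) t))" for i n t
  have sm: "smooth1 (g i n)" for i n
  proof -
    have "smooth1 (\<lambda>t. 1 + (-1) * exp ((- real n) * bump (a $ i) (b $ i) t))"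
      by (intro smooth1_add smooth1_mult smooth1_const smooth1_exp smooth1_bump)
    then show ?thesis by (simp add: g_def[abs_def])
  qed
  have z: "g i n t = 0" if "\<not> (a $ i < t \<and> t < b $ i)" for i n t
    using that by (simp add: g_def bump_eq_0_iff)
  have b01: "0 \<le> g i n t" "g i n t \<le> 1" for i n t
    using bump_nonneg[of "a $ i" "b $ i" t] by (auto simp: g_def)
  have lim: "(\<lambda>n. g i n t) \<longlonglongrightarrow> (if a $ i < t \<and> t < b $ i then 1 else 0)" for i t
  proof (cases "a $ i < t \<and> t < b $ i")
    case True
    then have "0 < bump (a $ i) (b $ i) t" by (simp add: bump_pos_iff)
    then have "(\<lambda>n. exp (- bump (a $ i) (b $ i) t) ^ n) \<longlonglongrightarrow> 0"
      by (intro LIMSEQ_realpow_zero) auto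
    then have "(\<lambda>n. 1 - exp (- bump (a $ i) (b $ i) t) ^ n) \<longlonglongrightarrow> 1 - 0"
      by (rule tendsto_diff[OF tendsto_const])
    then show ?thesis using True by (simp add: g_def exp_of_nat_mult[symmetric])
  next
    case False
    then have "(\<lambda>n. g i n t) = (\<lambda>n. 0)" using z by blast
    then show ?thesis using False by (simp only: if_False tendsto_const)
  qed
  have box: "x \<in> box a b \<longleftrightarrow> a $ 1 < x $ 1 \<and> x $ 1 < b $ 1 \<and> a $ 2 < x $ 2 \<and> x $ 2 < b $ 2" for x
    by (auto simp: mem_box_cart forall_2)
  show thesis
  proof (rule that[of "\<lambda>n x. g 1 n (x $ 1) * g 2 n (x $ 2)"])
    show "test_function (\<lambda>x. g 1 n (x $ 1) * g 2 n (x $ 2))" for n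
      by (rule test_function_prod2[OF sm sm, where a = "a $ 1" and b = "b $ 1" and c = "a $ 2" and d = "b $ 2"])
         (use z less_imp_le in blast)+
    show "0 \<le> g 1 n (x $ 1) * g 2 n (x $ 2)" for n x using b01 by simp
    show "g 1 n (x $ 1) * g 2 n (x $ 2) \<le> indicator (box a b) x" for n x
      using b01 z[of 1 "x $ 1" n] z[of 2 "x $ 2" n] by (auto simp: indicator_def box mult_le_one)
    show "(\<lambda>n. g 1 n (x $ 1) * g 2 n (x $ 2)) \<longlonglongrightarrow> indicator (box a b) x" for x
    proof -
      have "(\<lambda>n. g 1 n (x $ 1) * g 2 n (x $ 2)) \<longlonglongrightarrow>
         (if a $ 1 < x $ 1 \<and> x $ 1 < b $ 1 then 1 else 0) * (if a $ 2 < x $ 2 \<and> x $ 2 < b $ 2 then 1 else 0)"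
        by (intro tendsto_mult lim)
      moreover have "(if a $ 1 < x $ 1 \<and> x $ 1 < b $ 1 then 1 else 0) * (if a $ 2 < x $ 2 \<and> x $ 2 < b $ 2 then 1 else 0)
        = (indicator (box a b) x :: real)" by (auto simp: indicator_def box)
      ultimately show ?thesis by simp
    qed
  qed
qed

text \<open>Test functions determine the measures of open boxes by dominated convergence, and open
  boxes are an intersection-stable generator with an exhaustion of finite measure.\<close>

lemma radon_eq_of_test:
  assumes M: "radon M" and M': "radon M'"
    and eq: "\<And>\<phi>. test_function \<phi> \<Longrightarrow> (\<And>x. 0 \<le> \<phi> x) \<Longrightarrow> (LINT x|M. \<phi> x) = (LINT x|M'. \<phi> x)"
  shows "M = M'"
proof -
  have fin: "emeasure M (box a b) < \<infinity>" if "radon M" for M a b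
  proof -
    have "emeasure M (box a b) \<le> emeasure M (cbox a b)"
      using that by (intro emeasure_mono box_subset_cbox) (auto simp: radon_sets)
    also have "\<dots> < \<infinity>" using that by (intro radon_compact compact_cbox)
    finally show ?thesis .
  qed
  have box: "emeasure M (box a b) = emeasure M' (box a b)" for a b :: "real^2"
  proof -
    obtain \<psi> :: "nat \<Rightarrow> real^2 \<Rightarrow> real" where \<psi>: "\<And>n. test_function (\<psi> n)" "\<And>n x. 0 \<le> \<psi> n x"
      "\<And>n x. \<psi> n x \<le> indicator (box a b) x" "\<And>x. (\<lambda>n. \<psi> n x) \<longlonglongrightarrow> indicator (box a b) x"
      by (rule box_bump_approx[of a b]) (rule that; assumption)
    have lim: "(\<lambda>n. LINT x|M. \<psi> n x) \<longlonglongrightarrow> measure M (box a b)" if M: "radon M" for M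
    proof -
      have m: "\<psi> n \<in> borel_measurable M" for n
        using test_function_continuous[OF \<psi>(1)] radon_sets[OF M]
        by (simp add: borel_measurable_continuous_onI cong: measurable_cong_sets)
      have i: "integrable M (indicator (box a b) :: _ \<Rightarrow> real)"
        using fin[OF M] radon_sets[OF M] by (intro integrable_real_indicator) auto
      have "(\<lambda>n. LINT x|M. \<psi> n x) \<longlonglongrightarrow> (LINT x|M. indicator (box a b) x)"
        by (rule integral_dominated_convergence[where w = "indicator (box a b)"])
           (use m i \<psi> in auto)
      then show ?thesis using radon_space[OF M] by simp
    qed
    have "measure M (box a b) = measure M' (box a b)"
      using lim[OF M] lim[OF M'] eq[OF \<psi>(1,2)] LIMSEQ_unique by fastforce
    then show ?thesis
      using fin[OF M] fin[OF M'] by (simp add: emeasure_eq_ennreal_measure less_top)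
  qed
  show ?thesis
  proof (rule measure_eqI_generator_eq)
    let ?E = "range (\<lambda>(a, b). box a b :: (real^2) set)"
    show "Int_stable ?E"
      by (auto simp: Int_stable_def box_Int_box image_iff split_paired_Ex) blast
    show "?E \<subseteq> Pow UNIV" "sets M = sigma_sets UNIV ?E" "sets M' = sigma_sets UNIV ?E"
      using radon_sets[OF M] radon_sets[OF M'] by (simp_all add: borel_eq_box)
    let ?A = "\<lambda>n::nat. box (- (real n *\<^sub>R One)) (real n *\<^sub>R One) :: (real^2) set"
    show "range ?A \<subseteq> ?E" "(\<Union>i. ?A i) = UNIV" unfolding UN_box_eq_UNIV by auto
    show "emeasure M (?A i) \<noteq> \<infinity>" for i using fin[OF M] by (simp add: less_top)
    show "emeasure M X = emeasure M' X" if "X \<in> ?E" for X using that box by auto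
  qed
qed

lemma radon_density:
  assumes P: "radon P" and f: "f \<in> borel_measurable borel" and nn: "\<And>x. 0 \<le> f x"
    and i: "\<And>R. integrable P (\<lambda>x. indicator (cball 0 R) x * f x)"
  shows "radon (density P (\<lambda>x. ennreal (f x)))"
  unfolding radon_def
proof (intro conjI allI impI)
  note [measurable_cong] = radon_sets[OF P]
  note [measurable] = f
  show "sets (density P (\<lambda>x. ennreal (f x))) = sets borel" by (simp add: radon_sets[OF P])
  fix K :: "(real^2) set" assume K: "compact K"
  then have [measurable]: "K \<in> sets borel" by (simp add: borel_compact)
  obtain R where R: "\<And>x. x \<in> K \<Longrightarrow> norm x \<le> R" using K compact_imp_bounded bounded_iff by metis
  have "emeasure (density P (\<lambda>x. ennreal (f x))) K = (\<integral>\<^sup>+x. ennreal (f x) * indicator K x \<partial>P)"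
    by (rule emeasure_density) auto
  also have "\<dots> \<le> (\<integral>\<^sup>+x. ennreal (norm (indicator (cball 0 R) x * f x)) \<partial>P)"
    using R nn by (intro nn_integral_mono) (auto simp: indicator_def)
  also have "\<dots> < \<infinity>" using i[of R] unfolding integrable_iff_bounded by blast
  finally show "emeasure (density P (\<lambda>x. ennreal (f x))) K < \<infinity>" .
qed

lemma radon_ctest_integrable:
  fixes f :: "real^2 \<Rightarrow> 'b::euclidean_space"
  assumes P: "radon P" and \<phi>: "ctest R \<phi>" and f: "f \<in> borel_measurable borel"
    and i: "integrable P (\<lambda>x. indicator (cball 0 R) x *\<^sub>R f x)"
  shows "integrable P (\<lambda>x. \<phi> x *\<^sub>R f x)"
proof -
  obtain B where B: "B > 0" "\<And>x. \<bar>\<phi> x\<bar> \<le> B" using ctest_bounded[OF \<phi>] by metis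
  note [measurable_cong] = radon_sets[OF P]
  note [measurable] = f ctest_measurable[OF \<phi>]
  show ?thesis
  proof (rule Bochner_Integration.integrable_bound[where f = "\<lambda>x. B *\<^sub>R (indicator (cball 0 R) x *\<^sub>R f x)"])
    show "integrable P (\<lambda>x. B *\<^sub>R (indicator (cball 0 R) x *\<^sub>R f x))" by (intro integrable_scaleR_right i)
    show "AE x in P. norm (\<phi> x *\<^sub>R f x) \<le> norm (B *\<^sub>R (indicator (cball 0 R) x *\<^sub>R f x))"
    proof (rule AE_I2)
      fix x
      show "norm (\<phi> x *\<^sub>R f x) \<le> norm (B *\<^sub>R (indicator (cball 0 R) x *\<^sub>R f x))"
        using B(1) B(2)[of x] \<phi> by (cases "norm x > R") (auto simp: ctest_def mult_right_mono)
    qed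
  qed measurable
qed

text \<open>The lemma of du Bois-Reymond for a general locally finite measure. The positive and
  negative parts of \<open>f\<close> define Radon measures that agree on test functions, so they
  coincide and their densities are equal almost everywhere.\<close>

lemma fundamental_lemma:
  fixes f :: "real^2 \<Rightarrow> real"
  assumes P: "radon P" and f[measurable]: "f \<in> borel_measurable borel"
    and i: "\<And>R. integrable P (\<lambda>x. indicator (cball 0 R) x * f x)"
    and z: "\<And>\<phi>. test_function \<phi> \<Longrightarrow> (LINT x|P. \<phi> x * f x) = 0"
  shows "AE x in P. f x = 0"
proof -
  note [measurable_cong] = radon_sets[OF P]
  interpret sigma_finite_measure P using P by (rule radon_sigma_finite)
  define fp where "fp x = max 0 (f x)" for x
  define fn where "fn x = max 0 (- f x)" for x
  have mp[measurable]: "fp \<in> borel_measurable borel" "fn \<in> borel_measurable borel"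
    unfolding fp_def[abs_def] fn_def[abs_def] by measurable
  have nn: "0 \<le> fp x" "0 \<le> fn x" for x by (auto simp: fp_def fn_def)
  have mI: "(\<lambda>x. indicator (cball 0 R) x * g x) \<in> borel_measurable P"
    if "g \<in> borel_measurable borel" for R and g :: "real^2 \<Rightarrow> real"
    using that radon_sets[OF P] by (intro borel_measurable_times borel_measurable_indicator) (auto cong: measurable_cong_sets)
  have ip: "integrable P (\<lambda>x. indicator (cball 0 R) x * fp x)" "integrable P (\<lambda>x. indicator (cball 0 R) x * fn x)" for R
    by (rule Bochner_Integration.integrable_bound[OF i[of R] mI]; auto simp: fp_def fn_def indicator_def)+
  have eq: "density P (\<lambda>x. ennreal (fp x)) = density P (\<lambda>x. ennreal (fn x))"
  proof (rule radon_eq_of_test)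
    show "radon (density P (\<lambda>x. ennreal (fp x)))" "radon (density P (\<lambda>x. ennreal (fn x)))"
      by (rule radon_density[OF P mp(1) nn(1) ip(1)], rule radon_density[OF P mp(2) nn(2) ip(2)])
    fix \<phi> assume \<phi>: "test_function \<phi>"
    obtain R where R: "ctest R \<phi>" using test_function_ctest[OF \<phi>] by metis
    note [measurable] = ctest_measurable[OF R]
    have ii: "integrable P (\<lambda>x. \<phi> x * fp x)" "integrable P (\<lambda>x. \<phi> x * fn x)"
      using radon_ctest_integrable[OF P R mp(1)] radon_ctest_integrable[OF P R mp(2)] ip by auto
    have "(LINT x|P. \<phi> x * fp x) - (LINT x|P. \<phi> x * fn x) = (LINT x|P. \<phi> x * fp x - \<phi> x * fn x)"
      using ii by simp
    also have "\<dots> = (LINT x|P. \<phi> x * f x)"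
      by (intro Bochner_Integration.integral_cong) (auto simp: fp_def fn_def max_def algebra_simps)
    also have "\<dots> = 0" by (rule z[OF \<phi>])
    finally have "(LINT x|P. \<phi> x * fp x) = (LINT x|P. \<phi> x * fn x)" by simp
    then show "(\<integral>x. \<phi> x \<partial>density P (\<lambda>x. ennreal (fp x))) = (\<integral>x. \<phi> x \<partial>density P (\<lambda>x. ennreal (fn x)))"
      using nn by (subst (1 2) integral_density) (auto simp: mult.commute)
  qed
  have "AE x in P. ennreal (fp x) = ennreal (fn x)"
    by (rule density_unique[OF _ _ eq]) auto
  then show ?thesis
  proof eventually_elim
    case (elim x)
    then have "fp x = fn x" using nn by simp
    then show ?case by (auto simp: fp_def fn_def max_def split: if_splits)
  qed
qed

text \<open>Used as a common reference measure: both summands have densities with respect to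
  it.\<close>

definition add_measure :: "'a measure \<Rightarrow> 'a measure \<Rightarrow> 'a measure" where
  "add_measure M N = measure_of (space M) (sets M) (\<lambda>A. emeasure M A + emeasure N A)"

lemma sets_add_measure [simp]: "sets (add_measure M N) = sets M"
  by (simp add: add_measure_def)

lemma emeasure_add_measure:
  assumes s: "sets N = sets M" and A: "A \<in> sets M"
  shows "emeasure (add_measure M N) A = emeasure M A + emeasure N A"
  unfolding add_measure_def
proof (rule emeasure_measure_of_sigma[OF sets.sigma_algebra_axioms _ _ A])
  show "positive (sets M) (\<lambda>A. emeasure M A + emeasure N A)" by (simp add: positive_def)
  show "countably_additive (sets M) (\<lambda>A. emeasure M A + emeasure N A)"
    unfolding countably_additive_def
  proof (intro allI impI)
    fix F :: "nat \<Rightarrow> 'a set" assume F: "range F \<subseteq> sets M" "disjoint_family F"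
    have "(\<Sum>i. emeasure M (F i) + emeasure N (F i)) = (\<Sum>i. emeasure M (F i)) + (\<Sum>i. emeasure N (F i))"
      by (rule suminf_add[symmetric]) auto
    then show "(\<Sum>i. emeasure M (F i) + emeasure N (F i)) = emeasure M (\<Union> (range F)) + emeasure N (\<Union> (range F))"
      using F s by (simp add: suminf_emeasure)
  qed
qed

lemma radon_dominated_density:
  assumes M: "radon M" and P: "radon P" and le: "\<And>A. A \<in> sets borel \<Longrightarrow> emeasure M A \<le> emeasure P A"
  obtains m where "m \<in> borel_measurable borel" "\<And>x. 0 \<le> (m x :: real)" "M = density P (\<lambda>x. ennreal (m x))"
    "\<And>R. integrable P (\<lambda>x. indicator (cball 0 R) x * m x)"
proof -
  have "emeasure M A = 0" if "A \<in> sets borel" "emeasure P A = 0" for A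
    using le[OF that(1)] that(2) by simp
  then obtain m where mb: "m \<in> borel_measurable borel" and nn: "\<And>x. 0 \<le> (m x :: real)" and eq: "M = density P (\<lambda>x. ennreal (m x))"
    using borel_RN_density[OF radon_sigma_finite[OF P] radon_sets[OF P] radon_sigma_finite[OF M] radon_sets[OF M]] by metis
  have mP: "m \<in> borel_measurable P" using mb radon_sets[OF P] by (simp cong: measurable_cong_sets)
  have "integrable P (\<lambda>x. indicator (cball 0 R) x * m x)" for R
  proof (rule integrableI_bounded)
    show "(\<lambda>x. indicator (cball 0 R) x * m x) \<in> borel_measurable P"
      using mP radon_sets[OF P] by (intro borel_measurable_times borel_measurable_indicator) auto
    have "(\<integral>\<^sup>+x. ennreal (norm (indicator (cball 0 R) x * m x)) \<partial>P) = (\<integral>\<^sup>+x. ennreal (m x) * indicator (cball 0 R) x \<partial>P)"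
      by (intro nn_integral_cong) (auto simp: indicator_def nn)
    also have "\<dots> = emeasure M (cball 0 R)"
      unfolding eq by (rule emeasure_density[symmetric]) (use mP radon_sets[OF P] in auto)
    also have "\<dots> < \<infinity>" using M compact_cball by (rule radon_compact)
    finally show "(\<integral>\<^sup>+x. ennreal (norm (indicator (cball 0 R) x * m x)) \<partial>P) < \<infinity>" .
  qed
  then show thesis using that mb nn eq by blast
qed

lemma variation_radon: "is_measure_with_variation T M \<Longrightarrow> radon M"
  by (auto simp: is_measure_with_variation_def radon_def)

text \<open>Let m and m' be the densities of both measures with respect to their sum. By the
  fundamental lemma m \<sigma> = m' \<sigma>' almost everywhere; taking norms gives m = m', because
  the directions are unit vectors wherever the densities are positive.\<close>

lemma variation_unique:
  fixes T :: "(real^2 \<Rightarrow> real) \<Rightarrow> 'b::euclidean_space"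
  assumes M: "is_measure_with_variation T M" and M': "is_measure_with_variation T M'"
  shows "M = M'"
proof -
  have r: "radon M" "radon M'" using M M' by (auto intro: variation_radon)
  obtain \<sigma> where \<sigma>[measurable]: "\<sigma> \<in> borel_measurable borel" and \<sigma>1: "AE x in M. norm (\<sigma> x) = 1"
    and \<sigma>T: "\<And>\<phi>. test_function \<phi> \<Longrightarrow> T \<phi> = (LINT x|M. \<phi> x *\<^sub>R \<sigma> x)"
    using M unfolding is_measure_with_variation_def by blast
  obtain \<sigma>' where \<sigma>'[measurable]: "\<sigma>' \<in> borel_measurable borel" and \<sigma>1': "AE x in M'. norm (\<sigma>' x) = 1"
    and \<sigma>T': "\<And>\<phi>. test_function \<phi> \<Longrightarrow> T \<phi> = (LINT x|M'. \<phi> x *\<^sub>R \<sigma>' x)"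
    using M' unfolding is_measure_with_variation_def by blast
  define P where "P = add_measure M M'"
  have eP: "emeasure P A = emeasure M A + emeasure M' A" if "A \<in> sets borel" for A
    unfolding P_def using that r by (intro emeasure_add_measure) (auto simp: radon_sets)
  have P: "radon P"
    unfolding radon_def
  proof (intro conjI allI impI)
    show "sets P = sets borel" by (simp add: P_def radon_sets[OF r(1)])
    fix K :: "(real^2) set" assume K: "compact K"
    then show "emeasure P K < \<infinity>"
      using r[THEN radon_compact, OF K] by (simp add: eP borel_compact)
  qed
  note [measurable_cong] = radon_sets[OF P]
  obtain m where m[measurable]: "m \<in> borel_measurable borel" "\<And>x. 0 \<le> (m x :: real)" "M = density P (\<lambda>x. ennreal (m x))"
    "\<And>R. integrable P (\<lambda>x. indicator (cball 0 R) x * m x)"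
    by (rule radon_dominated_density[OF r(1) P]) (auto simp: eP)
  obtain m' where m'[measurable]: "m' \<in> borel_measurable borel" "\<And>x. 0 \<le> (m' x :: real)" "M' = density P (\<lambda>x. ennreal (m' x))"
    "\<And>R. integrable P (\<lambda>x. indicator (cball 0 R) x * m' x)"
    by (rule radon_dominated_density[OF r(2) P]) (auto simp: eP)
  \<comment> \<open>The direction is normalised only almost everywhere for \<open>M\<close>; for
    \<open>P\<close> this is information only where \<open>m\<close> is positive, hence the
    multiplied form.\<close>
  have n1: "AE x in P. m x * norm (\<sigma> x) = m x"
  proof -
    have "AE x in P. 0 < ennreal (m x) \<longrightarrow> norm (\<sigma> x) = 1"
      using \<sigma>1 unfolding m(3) by (subst (asm) AE_density) auto
    then show ?thesis by eventually_elim (use m(2) in \<open>force simp: order_le_less\<close>)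
  qed
  have n1': "AE x in P. m' x * norm (\<sigma>' x) = m' x"
  proof -
    have "AE x in P. 0 < ennreal (m' x) \<longrightarrow> norm (\<sigma>' x) = 1"
      using \<sigma>1' unfolding m'(3) by (subst (asm) AE_density) auto
    then show ?thesis by eventually_elim (use m'(2) in \<open>force simp: order_le_less\<close>)
  qed
  have iv: "integrable P (\<lambda>x. indicator (cball 0 R) x *\<^sub>R (m x *\<^sub>R \<sigma> x))"
    if m: "m \<in> borel_measurable borel" "\<And>x. 0 \<le> (m x :: real)" "\<And>R. integrable P (\<lambda>x. indicator (cball 0 R) x * m x)"
     and n1: "AE x in P. m x * norm (\<sigma> x) = m x" and s: "\<sigma> \<in> borel_measurable borel" for m R and \<sigma> :: "real^2 \<Rightarrow> 'b"
  proof (rule Bochner_Integration.integrable_bound[OF m(3)[of R]])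
    show "(\<lambda>x. indicator (cball 0 R) x *\<^sub>R (m x *\<^sub>R \<sigma> x)) \<in> borel_measurable P"
      using m(1) s radon_sets[OF P] by (intro borel_measurable_scaleR borel_measurable_indicator) (auto cong: measurable_cong_sets)
    show "AE x in P. norm (indicator (cball 0 R) x *\<^sub>R (m x *\<^sub>R \<sigma> x)) \<le> norm (indicator (cball 0 R) x * m x)"
      using n1 by eventually_elim (use m(2) in \<open>auto simp: indicator_def\<close>)
  qed
  note i1 = iv[OF m(1,2,4) n1 \<sigma>] and i2 = iv[OF m'(1,2,4) n1' \<sigma>']
  have "AE x in P. (m x *\<^sub>R \<sigma> x - m' x *\<^sub>R \<sigma>' x) \<bullet> b = 0" for b
  proof (rule fundamental_lemma[OF P])
    show "(\<lambda>x. (m x *\<^sub>R \<sigma> x - m' x *\<^sub>R \<sigma>' x) \<bullet> b) \<in> borel_measurable borel" by measurable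
    show "integrable P (\<lambda>x. indicator (cball 0 R) x * ((m x *\<^sub>R \<sigma> x - m' x *\<^sub>R \<sigma>' x) \<bullet> b))" for R
    proof -
      have "integrable P (\<lambda>x. (indicator (cball 0 R) x *\<^sub>R (m x *\<^sub>R \<sigma> x) - indicator (cball 0 R) x *\<^sub>R (m' x *\<^sub>R \<sigma>' x)) \<bullet> b)"
        using i1[of R] i2[of R] by (intro integrable_inner_left Bochner_Integration.integrable_diff)
      then show ?thesis by (simp add: inner_diff_left right_diff_distrib mult.assoc)
    qed
    fix \<phi> assume \<phi>: "test_function \<phi>"
    obtain R where R: "ctest R \<phi>" using test_function_ctest[OF \<phi>] by metis
    note [measurable] = ctest_measurable[OF R]
    have j1: "integrable P (\<lambda>x. \<phi> x *\<^sub>R (m x *\<^sub>R \<sigma> x))" by (rule radon_ctest_integrable[OF P R _ i1]) measurable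
    have j2: "integrable P (\<lambda>x. \<phi> x *\<^sub>R (m' x *\<^sub>R \<sigma>' x))" by (rule radon_ctest_integrable[OF P R _ i2]) measurable
    have "T \<phi> = (LINT x|P. m x *\<^sub>R (\<phi> x *\<^sub>R \<sigma> x))"
      unfolding \<sigma>T[OF \<phi>] m(3) by (rule integral_density) (use m(2) in auto)
    then have t1: "T \<phi> = (LINT x|P. \<phi> x *\<^sub>R (m x *\<^sub>R \<sigma> x))" by (simp add: mult.commute)
    have "T \<phi> = (LINT x|P. m' x *\<^sub>R (\<phi> x *\<^sub>R \<sigma>' x))"
      unfolding \<sigma>T'[OF \<phi>] m'(3) by (rule integral_density) (use m'(2) in auto)
    then have t2: "T \<phi> = (LINT x|P. \<phi> x *\<^sub>R (m' x *\<^sub>R \<sigma>' x))" by (simp add: mult.commute)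
    have "(LINT x|P. \<phi> x * ((m x *\<^sub>R \<sigma> x - m' x *\<^sub>R \<sigma>' x) \<bullet> b)) =
       (LINT x|P. (\<phi> x *\<^sub>R (m x *\<^sub>R \<sigma> x) - \<phi> x *\<^sub>R (m' x *\<^sub>R \<sigma>' x)) \<bullet> b)"
      by (intro Bochner_Integration.integral_cong) (auto simp: inner_diff_left algebra_simps)
    also have "\<dots> = (LINT x|P. \<phi> x *\<^sub>R (m x *\<^sub>R \<sigma> x) - \<phi> x *\<^sub>R (m' x *\<^sub>R \<sigma>' x)) \<bullet> b"
      using j1 j2 by (intro integral_inner_left) auto
    also have "\<dots> = (T \<phi> - T \<phi>) \<bullet> b"
      using j1 j2 t1 t2 by (subst Bochner_Integration.integral_diff) auto
    finally show "(LINT x|P. \<phi> x * ((m x *\<^sub>R \<sigma> x - m' x *\<^sub>R \<sigma>' x) \<bullet> b)) = 0" by simp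
  qed
  then have "AE x in P. \<forall>b\<in>Basis. (m x *\<^sub>R \<sigma> x - m' x *\<^sub>R \<sigma>' x) \<bullet> b = 0"
    by (intro AE_finite_allI) auto
  then have "AE x in P. m x = m' x"
    using n1 n1'
  proof eventually_elim
    case (elim x)
    have "m x *\<^sub>R \<sigma> x - m' x *\<^sub>R \<sigma>' x = 0"
      by (rule euclidean_eqI) (use elim(1) in auto)
    then have "m x *\<^sub>R \<sigma> x = m' x *\<^sub>R \<sigma>' x" by simp
    then have "\<bar>m x\<bar> * norm (\<sigma> x) = \<bar>m' x\<bar> * norm (\<sigma>' x)" by (metis norm_scaleR)
    then show ?case using elim(2,3) m(2)[of x] m'(2)[of x] by simp
  qed
  then show ?thesis
    unfolding m(3) m'(3) by (intro density_cong) (auto elim: AE_mp)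
qed

section \<open>Translations of test functions and of variation measures\<close>

lemma pderiv_dir_shift:
  assumes "f differentiable (at (x + c))"
  shows "pderiv_dir i (\<lambda>x. f (x + c)) x = pderiv_dir i f (x + c)"
proof -
  have fd: "(f has_derivative frechet_derivative f (at (x + c))) (at (x + c))"
    using assms frechet_derivative_works by blast
  have "((\<lambda>x. x + c) has_derivative (\<lambda>v. v)) (at x)" by (auto intro!: derivative_eq_intros)
  from has_derivative_compose[OF this fd]
  have "((\<lambda>x. f (x + c)) has_derivative frechet_derivative f (at (x + c))) (at x)" .
  then show ?thesis by (simp add: pderiv_dir_eq) (simp add: pderiv_dir_def)
qed

lemma differentiable_shift:
  fixes f :: "real^2 \<Rightarrow> real"
  assumes "f differentiable (at (x + c))" shows "(\<lambda>x. f (x + c)) differentiable (at x)"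
proof -
  have fd: "(f has_derivative frechet_derivative f (at (x + c))) (at (x + c))"
    using assms frechet_derivative_works by blast
  have "((\<lambda>x. x + c) has_derivative (\<lambda>v. v)) (at x)" by (auto intro!: derivative_eq_intros)
  from has_derivative_compose[OF this fd] show ?thesis by (rule differentiableI)
qed

lemma smooth_shift:
  assumes "smooth f" shows "smooth (\<lambda>x. f (x + c))"
proof -
  have "fold pderiv_dir js (\<lambda>x. f (x + c)) = (\<lambda>x. fold pderiv_dir js f (x + c))" if "smooth f" for js f
    using that
  proof (induction js arbitrary: f)
    case (Cons j js)
    have "pderiv_dir j (\<lambda>x. f (x + c)) = (\<lambda>x. pderiv_dir j f (x + c))"
      by (rule ext) (rule pderiv_dir_shift[OF smooth_imp_differentiable[OF Cons.prems]])
    then show ?case using Cons.IH[OF smooth_pderiv[OF Cons.prems, of j]] by simp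
  qed simp
  from this[OF assms] show ?thesis
    using assms unfolding smooth_def by (simp add: differentiable_shift)
qed

lemma test_function_shift:
  assumes "test_function f" shows "test_function (\<lambda>x. f (x + c))"
proof -
  obtain R where R: "R > 0" "\<And>x. norm x > R \<Longrightarrow> f x = 0"
    using test_function_support[OF assms] by metis
  have "{x. f (x + c) \<noteq> 0} \<subseteq> cball 0 (R + norm c)"
  proof
    fix x assume "x \<in> {x. f (x + c) \<noteq> 0}"
    then have "norm (x + c) \<le> R" using R(2)[of "x + c"] by (auto simp: not_less[symmetric])
    then show "x \<in> cball 0 (R + norm c)" using norm_triangle_ineq4[of "x + c" c] by simp
  qed
  then have "bounded {x. f (x + c) \<noteq> 0}" using bounded_cball bounded_subset by blast
  then show ?thesis using assms by (auto simp: test_function_def smooth_shift)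
qed

text \<open>The translated measure with the translated direction field is another polar
  decomposition of \<open>T\<close>, so uniqueness applies.\<close>

lemma variation_lat_invariant:
  fixes T :: "(real^2 \<Rightarrow> real) \<Rightarrow> 'b::euclidean_space"
  assumes M: "is_measure_with_variation T M"
    and inv: "\<And>\<phi> k. test_function \<phi> \<Longrightarrow> T (\<lambda>x. \<phi> (x + lat k)) = T \<phi>"
  shows "lat_invariant M"
  unfolding lat_invariant_def
proof
  fix k
  have r: "radon M" using M by (rule variation_radon)
  note [measurable_cong] = radon_sets[OF r]
  obtain \<sigma> where \<sigma>[measurable]: "\<sigma> \<in> borel_measurable borel" and \<sigma>1: "AE x in M. norm (\<sigma> x) = 1"
    and \<sigma>T: "\<And>\<phi>. test_function \<phi> \<Longrightarrow> T \<phi> = (LINT x|M. \<phi> x *\<^sub>R \<sigma> x)"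
    using M unfolding is_measure_with_variation_def by blast
  define M' where "M' = distr M borel (\<lambda>x. x + lat k)"
  have "is_measure_with_variation T M'"
    unfolding is_measure_with_variation_def
  proof (intro conjI allI impI exI[of _ "\<lambda>x. \<sigma> (x - lat k)"])
    show "sets M' = sets borel" by (simp add: M'_def)
    show "(\<lambda>x. \<sigma> (x - lat k)) \<in> borel_measurable borel" by measurable
    show "AE x in M'. norm (\<sigma> (x - lat k)) = 1"
      unfolding M'_def by (subst AE_distr_iff) (use \<sigma>1 in auto)
    fix K :: "(real^2) set" assume K: "compact K"
    have "(\<lambda>x. x + lat k) -` K \<inter> space M = (\<lambda>x. x + (- lat k)) ` K"
      using radon_space[OF r] by (auto simp: image_iff) (metis add_diff_cancel)
    moreover have "compact ((\<lambda>x. x + (- lat k)) ` K)"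
      using K by (intro compact_continuous_image continuous_intros)
    ultimately show "emeasure M' K < \<infinity>"
      unfolding M'_def using K radon_compact[OF r, of "(\<lambda>x. x + (- lat k)) ` K"]
      by (subst emeasure_distr) (auto simp: borel_compact)
  next
    fix \<phi> :: "real^2 \<Rightarrow> real" assume \<phi>: "test_function \<phi>"
    have [measurable]: "\<phi> \<in> borel_measurable borel"
      using test_function_continuous[OF \<phi>] by (rule borel_measurable_continuous_onI)
    have "T \<phi> = T (\<lambda>x. \<phi> (x + lat k))" by (rule inv[OF \<phi>, symmetric])
    also have "\<dots> = (LINT x|M. \<phi> (x + lat k) *\<^sub>R \<sigma> x)" by (rule \<sigma>T[OF test_function_shift[OF \<phi>]])
    also have "\<dots> = (LINT x|M'. \<phi> x *\<^sub>R \<sigma> (x - lat k))"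
      unfolding M'_def by (subst integral_distr) auto
    finally show "T \<phi> = (LINT x|M'. \<phi> x *\<^sub>R \<sigma> (x - lat k))" .
  qed
  from variation_unique[OF M this] show "distr M borel (\<lambda>x. x + lat k) = M"
    unfolding M'_def by (rule sym)
qed

section \<open>Mollification\<close>

lemma AE_lborel_shift:
  fixes c :: "real^2"
  assumes "AE x in lborel. P x" shows "AE x in lborel. P (x + c)"
proof -
  have "AE x in distr lborel borel ((+) c). P x" using assms by (subst lborel_distr_plus)
  then have "AE x in lborel. P (c + x)" by (rule AE_distrD[rotated]) simp
  then show ?thesis by (simp add: add.commute)
qed

lemma AE_lebesgue_iff: "(AE x in lebesgue. P x) \<longleftrightarrow> (AE x in lborel. P x)"
  by (rule AE_completion_iff)

text \<open>The lattice is countable, so off one null set periodicity holds for all lattice vectors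
  at once. There \<open>f\<close> agrees with its values at fractional parts, which are periodic
  everywhere.\<close>

lemma periodic_representative:
  fixes f :: "real^2 \<Rightarrow> 'b::euclidean_space"
  assumes f: "loc_int f" and p: "\<And>k. AE x in lborel. f (x + lat k) = f x"
  shows "periodic (\<lambda>x. f (fracs x))" "(\<lambda>x. f (fracs x)) \<in> borel_measurable borel"
    "integrable torus (\<lambda>x. f (fracs x))" "AE x in lborel. f x = f (fracs x)"
proof -
  have m[measurable]: "f \<in> borel_measurable borel" using f by (rule loc_int_measurable)
  show "periodic (\<lambda>x. f (fracs x))" by (rule periodic_compose_fracs)
  show mf: "(\<lambda>x. f (fracs x)) \<in> borel_measurable borel" by measurable
  have "AE x in lborel. \<forall>k. f (x + lat k) = f x"
    using p by (simp add: AE_all_countable)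
  then show "AE x in lborel. f x = f (fracs x)"
    by eventually_elim (simp add: fracs_eq)
  have "integrable lborel (\<lambda>x. indicator period_cell x *\<^sub>R f (fracs x))"
  proof (rule Bochner_Integration.integrable_bound)
    show "integrable lborel (\<lambda>x. indicator (cball 0 2) x *\<^sub>R f x)" using f by (simp add: loc_int_def)
    show "(\<lambda>x. indicator period_cell x *\<^sub>R f (fracs x)) \<in> borel_measurable lborel"
      using mf by (intro borel_measurable_scaleR borel_measurable_indicator) auto
    show "AE x in lborel. norm (indicator period_cell x *\<^sub>R f (fracs x)) \<le> norm (indicator (cball 0 2) x *\<^sub>R f x)"
      using norm_cell by (auto simp: indicator_def fracs_cell)
  qed
  then show "integrable torus (\<lambda>x. f (fracs x))"
    unfolding torus_def
    using integrable_density[of "\<lambda>x. f (fracs x)" lborel "indicator period_cell :: _ \<Rightarrow> real"] mf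
    by (simp add: ennreal_indicator)
qed

lemma lat_Ints: "lat k $ i \<in> \<int>"
  using UNIV_2_cases[of i] by auto

lemma affine_plus_periodic_representative:
  assumes "affine_plus_periodic u"
  obtains q v where "periodic v" "v \<in> borel_measurable borel" "integrable torus v"
    "loc_int (\<lambda>x. q \<bullet> x + v x)" "AE x in lebesgue. u x = q \<bullet> x + v x"
proof -
  obtain q where u: "locally_integrable u" and q: "periodic_ae (\<lambda>x. u x - q \<bullet> x)"
    using assms by (auto simp: affine_plus_periodic_def)
  obtain u' where u': "loc_int u'" "AE x in lebesgue. u x = u' x"
    using borel_representative[OF u] by metis
  have lq: "loc_int (\<lambda>x. q \<bullet> x)"
    unfolding loc_int_def
  proof (intro conjI allI)
    fix R :: real
    have "integrable lborel (\<lambda>x::real^2. indicator (cball 0 R) x *\<^sub>R (q \<bullet> x))"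
      by (rule borel_integrable_compact) (auto intro!: continuous_intros)
    then show "integrable lborel (\<lambda>x. indicator (cball 0 R) x *\<^sub>R (q \<bullet> x))" .
  qed auto
  define f where "f x = u' x - q \<bullet> x" for x
  have lf: "loc_int f" unfolding f_def[abs_def] by (rule loc_int_diff[OF u'(1) lq])
  have pf: "AE x in lborel. f (x + lat k) = f x" for k
  proof -
    have "AE x in lborel. u (x + lat k) - q \<bullet> (x + lat k) = u x - q \<bullet> x"
      using q lat_Ints unfolding periodic_ae_def AE_lebesgue_iff by blast
    moreover have "AE x in lborel. u x = u' x" using u'(2) by (simp add: AE_lebesgue_iff)
    moreover from AE_lborel_shift[OF this, of "lat k"] have "AE x in lborel. u (x + lat k) = u' (x + lat k)" .
    ultimately show ?thesis by eventually_elim (simp add: f_def)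
  qed
  note r = periodic_representative[OF lf pf]
  have AE: "AE x in lborel. u' x = q \<bullet> x + f (fracs x)"
    using r(4) by eventually_elim (simp add: f_def)
  have "loc_int (\<lambda>x. q \<bullet> x + f (fracs x))"
  proof -
    have "loc_int (\<lambda>x. f (fracs x))" using r(1-3) by (rule loc_int_periodic)
    then show ?thesis using lq unfolding loc_int_def by (auto simp: distrib_left)
  qed
  moreover have "AE x in lebesgue. u x = q \<bullet> x + f (fracs x)"
    using u'(2) AE unfolding AE_lebesgue_iff by eventually_elim simp
  ultimately show thesis using that r(1-3) by blast
qed

lemma periodic_ae_representative:
  fixes w :: "real^2 \<Rightarrow> 'b::euclidean_space"
  assumes w: "locally_integrable w" and p: "periodic_ae w"
  obtains w' where "periodic w'" "w' \<in> borel_measurable borel" "integrable torus w'" "AE x in lebesgue. w x = w' x"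
proof -
  obtain f where f: "loc_int f" "AE x in lebesgue. w x = f x"
    using borel_representative[OF w] by metis
  have pf: "AE x in lborel. f (x + lat k) = f x" for k
  proof -
    have "AE x in lborel. w (x + lat k) = w x"
      using p lat_Ints unfolding periodic_ae_def AE_lebesgue_iff by blast
    moreover have "AE x in lborel. w x = f x" using f(2) by (simp add: AE_lebesgue_iff)
    moreover from AE_lborel_shift[OF this, of "lat k"] have "AE x in lborel. w (x + lat k) = f (x + lat k)" .
    ultimately show ?thesis by eventually_elim simp
  qed
  note r = periodic_representative[OF f(1) pf]
  have "AE x in lebesgue. w x = f (fracs x)"
    using f(2) r(4) unfolding AE_lebesgue_iff by eventually_elim simp
  then show thesis using that r(1-3) by blast
qed

section \<open>Density of continuous periodic functions in L1 of the torus\<close>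

lemma cper_dense_indicator:
  assumes A: "A \<in> sets borel" and e: "e > 0"
  shows "\<exists>\<phi>. cper \<phi> \<and> (LINT x|torus. \<bar>indicator A x - \<phi> x\<bar>) < e"
proof -
  interpret prob_space torus by (rule prob_space_torus)
  define B where "B = A \<inter> period_cell"
  have B: "B \<in> sets borel" using A cell_borel by (auto simp: B_def)
  have AEB: "AE x in torus. indicator A x = (indicator B x :: real)"
    using AE_torus by eventually_elim (simp add: B_def indicator_def)
  have sup: "emeasure torus B = (SUP K \<in> {K. K \<subseteq> B \<and> compact K}. emeasure torus K)"
    by (rule inner_regular) (use B in auto)
  \<comment> \<open>If the measure of \<open>B\<close> is zero, no nonnegative number lies strictly
    below it, so the supremum argument is replaced by the choice of the empty set.\<close>
  obtain K where K: "K \<subseteq> B" "compact K" "measure torus B < measure torus K + e / 2"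
  proof (cases "measure torus B = 0")
    case True
    then show thesis using that[of "{}"] e by simp
  next
    case False
    have "ennreal (measure torus B - e / 2) < emeasure torus B"
      using e False measure_nonneg[of torus B] unfolding emeasure_eq_measure
      by (intro ennreal_lessI) (auto simp: order_le_less)
    then obtain K where "K \<subseteq> B" "compact K" "ennreal (measure torus B - e / 2) < emeasure torus K"
      unfolding sup less_SUP_iff by blast
    then show thesis
      using that[of K] measure_nonneg[of torus K] by (cases "0 \<le> measure torus B - e / 2")
        (auto simp: emeasure_eq_measure ennreal_less_iff intro: order_less_le_trans[of _ "e / 2"])
  qed
  have Kb: "K \<in> sets borel" using K by (simp add: borel_compact)
  have "\<exists>\<phi>. cper \<phi> \<and> (LINT x|torus. \<bar>indicator K x - \<phi> x\<bar>) < e / 2"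
  proof (cases "K = {}")
    case True
    have "cper (\<lambda>x. 0)" by (simp add: cper_def periodic_def)
    then show ?thesis using True e by (intro exI[of _ "\<lambda>x. 0"]) simp
  next
    case False
    have Kc: "K \<subseteq> period_cell" using K by (auto simp: B_def)
    obtain \<Phi> :: "nat \<Rightarrow> real^2 \<Rightarrow> real" where \<Phi>: "\<And>n. cper (\<Phi> n)" "\<And>n x. 0 \<le> \<Phi> n x"
    "\<And>n x. x \<in> period_cell \<Longrightarrow> \<Phi> n x \<le> 169" "\<And>x. x \<in> period_cell \<Longrightarrow> (\<lambda>n. \<Phi> n x) \<longlonglongrightarrow> indicator K x"
      using compact_cper_approx[OF K(2) Kc False] by blast
    note [measurable] = cper_measurable[OF \<Phi>(1)] Kb
    have "(\<lambda>n. LINT x|torus. \<bar>indicator K x - \<Phi> n x\<bar>) \<longlonglongrightarrow> (LINT x|torus. 0)"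
    proof (rule integral_dominated_convergence[where w = "\<lambda>x. 170"])
      show "AE x in torus. (\<lambda>n. \<bar>indicator K x - \<Phi> n x\<bar>) \<longlonglongrightarrow> 0"
        using AE_torus
      proof eventually_elim
        case (elim x)
        have "(\<lambda>n. \<bar>indicator K x - \<Phi> n x\<bar>) \<longlonglongrightarrow> \<bar>indicator K x - indicator K x :: real\<bar>"
          by (intro tendsto_intros \<Phi>(4) elim)
        then show ?case by simp
      qed
      show "AE x in torus. norm \<bar>indicator K x - \<Phi> n x\<bar> \<le> 170" for n
        using AE_torus
      proof eventually_elim
        case (elim x)
        show ?case using \<Phi>(2)[of n x] \<Phi>(3)[OF elim, of n] by (auto simp: indicator_def)
      qed
    qed auto
    then have "(\<lambda>n. LINT x|torus. \<bar>indicator K x - \<Phi> n x\<bar>) \<longlonglongrightarrow> 0" by simp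
    then have "\<forall>\<^sub>F n in sequentially. (LINT x|torus. \<bar>indicator K x - \<Phi> n x\<bar>) < e / 2"
      using e by (intro order_tendstoD(2)) auto
    then obtain n where "(LINT x|torus. \<bar>indicator K x - \<Phi> n x\<bar>) < e / 2"
      by (auto simp: eventually_sequentially)
    then show ?thesis using \<Phi>(1) by blast
  qed
  then obtain \<phi> where \<phi>: "cper \<phi>" "(LINT x|torus. \<bar>indicator K x - \<phi> x\<bar>) < e / 2" by blast
  note [measurable] = cper_measurable[OF \<phi>(1)] Kb A B
  have i\<phi>: "integrable torus \<phi>" by (rule integrable_cper_const[OF \<phi>(1)]) (auto intro: finite_measure_axioms)
  have ind: "integrable torus (indicator C :: _ \<Rightarrow> real)" if "C \<in> sets borel" for C
    using that by (intro integrable_real_indicator) (auto simp: less_top[symmetric])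
  have "(LINT x|torus. \<bar>indicator A x - \<phi> x\<bar>) \<le> (LINT x|torus. (indicator B x - indicator K x) + \<bar>indicator K x - \<phi> x\<bar>)"
  proof (rule integral_mono_AE)
    show "integrable torus (\<lambda>x. \<bar>indicator A x - \<phi> x\<bar>)" using ind[OF A] i\<phi> by simp
    show "integrable torus (\<lambda>x. indicator B x - indicator K x + \<bar>indicator K x - \<phi> x\<bar>)"
      using ind[OF B] ind[OF Kb] i\<phi> by simp
    show "AE x in torus. \<bar>indicator A x - \<phi> x\<bar> \<le> indicator B x - indicator K x + \<bar>indicator K x - \<phi> x\<bar>"
      using AEB by eventually_elim (use K(1) in \<open>auto simp: indicator_def split: if_splits\<close>)
  qed
  also have "\<dots> = (measure torus B - measure torus K) + (LINT x|torus. \<bar>indicator K x - \<phi> x\<bar>)"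
    using ind[OF B] ind[OF Kb] i\<phi> by simp
  also have "\<dots> < e" using K(3) \<phi>(2) by simp
  finally show ?thesis using \<phi>(1) by blast
qed

lemma cper_add: "cper f \<Longrightarrow> cper g \<Longrightarrow> cper (\<lambda>x. f x + g x)"
  by (auto simp: cper_def periodic_def intro: continuous_intros)

lemma cper_cmult: "cper f \<Longrightarrow> cper (\<lambda>x. c * f x)"
  by (auto simp: cper_def periodic_def intro: continuous_intros)

lemma integrable_cper_torus: "cper \<phi> \<Longrightarrow> integrable torus \<phi>"
  using integrable_cper_const cell_measureD[OF cell_measure_torus] by blast

lemma cper_dense:
  fixes f :: "real^2 \<Rightarrow> real"
  assumes "integrable torus f" and "e > 0"
  shows "\<exists>\<phi>. cper \<phi> \<and> (LINT x|torus. \<bar>f x - \<phi> x\<bar>) < e"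
  using assms
proof (induction arbitrary: e rule: integrable_induct)
  case (base A c)
  have A: "A \<in> sets borel" using base by simp
  obtain \<phi> where \<phi>: "cper \<phi>" "(LINT x|torus. \<bar>indicator A x - \<phi> x\<bar>) < e / (\<bar>c\<bar> + 1)"
    using cper_dense_indicator[OF A, of "e / (\<bar>c\<bar> + 1)"] base by auto
  have "(LINT x|torus. \<bar>indicator A x *\<^sub>R c - c * \<phi> x\<bar>) = (LINT x|torus. \<bar>c\<bar> * \<bar>indicator A x - \<phi> x\<bar>)"
    by (intro Bochner_Integration.integral_cong) (auto simp: abs_mult[symmetric] algebra_simps)
  also have "\<dots> = \<bar>c\<bar> * (LINT x|torus. \<bar>indicator A x - \<phi> x\<bar>)" by simp
  also have "\<dots> \<le> \<bar>c\<bar> * (e / (\<bar>c\<bar> + 1))" using \<phi>(2) by (intro mult_left_mono) auto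
  also have "\<dots> < e" using base by (simp add: field_simps)
  finally show ?case using cper_cmult[OF \<phi>(1), of c] by blast
next
  case (add f g)
  obtain \<phi> where \<phi>: "cper \<phi>" "(LINT x|torus. \<bar>f x - \<phi> x\<bar>) < e / 2" using add.IH(1)[of "e / 2"] add.prems by auto
  obtain \<psi> where \<psi>: "cper \<psi>" "(LINT x|torus. \<bar>g x - \<psi> x\<bar>) < e / 2" using add.IH(2)[of "e / 2"] add.prems by auto
  have i: "integrable torus (\<lambda>x. \<bar>f x - \<phi> x\<bar>)" "integrable torus (\<lambda>x. \<bar>g x - \<psi> x\<bar>)"
    by (intro integrable_abs Bochner_Integration.integrable_diff add.hyps integrable_cper_torus[OF \<phi>(1)] integrable_cper_torus[OF \<psi>(1)])+
  have "(LINT x|torus. \<bar>f x + g x - (\<phi> x + \<psi> x)\<bar>) \<le> (LINT x|torus. \<bar>f x - \<phi> x\<bar> + \<bar>g x - \<psi> x\<bar>)"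
    by (intro integral_mono integrable_abs Bochner_Integration.integrable_diff Bochner_Integration.integrable_add add.hyps
        integrable_cper_torus[OF \<phi>(1)] integrable_cper_torus[OF \<psi>(1)]) auto
  also have "\<dots> = (LINT x|torus. \<bar>f x - \<phi> x\<bar>) + (LINT x|torus. \<bar>g x - \<psi> x\<bar>)" using i by simp
  also have "\<dots> < e" using \<phi>(2) \<psi>(2) by simp
  finally show ?case using cper_add[OF \<phi>(1) \<psi>(1)] by blast
next
  case (lim f s)
  have "(\<lambda>n. LINT x|torus. norm (s n x - f x)) \<longlonglongrightarrow> (LINT x|torus. 0)"
  \<comment> \<open>The approximating simple functions satisfy |s n| \<le> 2 |f|, so the difference
    is at most 3 |f|.\<close>
  proof (rule integral_dominated_convergence[where w = "\<lambda>x. 3 * norm (f x)"])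
    show "(\<lambda>x. norm (s n x - f x)) \<in> borel_measurable torus" for n
    proof -
      have [measurable]: "s n \<in> borel_measurable torus" "f \<in> borel_measurable torus"
        using lim.hyps(1)[of n] lim.hyps(4) by (auto intro: borel_measurable_integrable)
      show ?thesis by measurable
    qed
    show "AE x in torus. (\<lambda>n. norm (s n x - f x)) \<longlonglongrightarrow> 0"
    proof (rule AE_I2)
      fix x assume "x \<in> space torus"
      from tendsto_norm[OF tendsto_diff[OF lim.hyps(2)[OF this] tendsto_const[of "f x"]]]
      show "(\<lambda>n. norm (s n x - f x)) \<longlonglongrightarrow> 0" by simp
    qed
    show "AE x in torus. norm (norm (s n x - f x)) \<le> 3 * norm (f x)" for n
    proof (rule AE_I2)
      fix x assume "x \<in> space torus"
      from lim.hyps(3)[OF this, of n] show "norm (norm (s n x - f x)) \<le> 3 * norm (f x)"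
        using norm_triangle_ineq4[of "s n x" "f x"] by simp
    qed
  qed (use lim.hyps(4) in auto)
  then have l0: "(\<lambda>n. LINT x|torus. norm (s n x - f x)) \<longlonglongrightarrow> 0" by simp
  have "\<forall>\<^sub>F n in sequentially. (LINT x|torus. norm (s n x - f x)) < e / 2"
    by (rule order_tendstoD(2)[OF l0]) (use lim.prems in auto)
  then obtain n where n: "(LINT x|torus. norm (s n x - f x)) < e / 2"
    by (auto simp: eventually_sequentially)
  obtain \<phi> where \<phi>: "cper \<phi>" "(LINT x|torus. \<bar>s n x - \<phi> x\<bar>) < e / 2" using lim.IH[of "e / 2" n] lim.prems by auto
  have i: "integrable torus (\<lambda>x. norm (s n x - f x))" "integrable torus (\<lambda>x. \<bar>s n x - \<phi> x\<bar>)"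
    by (intro integrable_norm integrable_abs Bochner_Integration.integrable_diff lim.hyps(1,4) integrable_cper_torus[OF \<phi>(1)])+
  have "(LINT x|torus. \<bar>f x - \<phi> x\<bar>) \<le> (LINT x|torus. norm (s n x - f x) + \<bar>s n x - \<phi> x\<bar>)"
    by (intro integral_mono integrable_norm integrable_abs Bochner_Integration.integrable_diff Bochner_Integration.integrable_add
        lim.hyps(1,4) integrable_cper_torus[OF \<phi>(1)]) auto
  also have "\<dots> = (LINT x|torus. norm (s n x - f x)) + (LINT x|torus. \<bar>s n x - \<phi> x\<bar>)" using i by simp
  also have "\<dots> < e" using n \<phi>(2) by simp
  finally show ?case using \<phi>(1) by blast
qed

section \<open>Mollifiers and correlation\<close>

definition mollifier :: "real \<Rightarrow> (real^2 \<Rightarrow> real) \<Rightarrow> bool" where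
  "mollifier \<delta> \<rho> \<longleftrightarrow> test_function \<rho> \<and> (\<forall>x. 0 \<le> \<rho> x) \<and> ctest \<delta> \<rho> \<and> (LINT x|lborel. \<rho> x) = 1"

lemma loc_int_const: "loc_int (\<lambda>x. c :: real)"
  by (rule loc_int_periodic) (auto simp: periodic_def intro: finite_measure.integrable_const cell_measureD[OF cell_measure_torus])

lemma mollifier_exists:
  assumes "\<delta> > 0" obtains \<rho> where "mollifier \<delta> \<rho>"
proof -
  define b where "b = bump (- (\<delta> / 2)) (\<delta> / 2)"
  define \<rho>0 where "\<rho>0 x = b (x $ 1) * b (x $ 2)" for x :: "real^2"
  have sb: "smooth1 b" by (simp add: b_def smooth1_bump)
  have z: "b t \<noteq> 0 \<Longrightarrow> - (\<delta> / 2) \<le> t \<and> t \<le> \<delta> / 2" for t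
    by (simp add: b_def bump_eq_0_iff)
  have nn: "0 \<le> \<rho>0 x" for x by (simp add: \<rho>0_def b_def bump_nonneg)
  have t0: "test_function \<rho>0" unfolding \<rho>0_def[abs_def] by (rule test_function_prod2[OF sb sb z z])
  have supp: "\<rho>0 x = 0" if "norm x > \<delta>" for x
  proof (rule ccontr)
    assume "\<rho>0 x \<noteq> 0"
    then have "\<bar>x $ 1\<bar> \<le> \<delta> / 2" "\<bar>x $ 2\<bar> \<le> \<delta> / 2" using z[of "x $ 1"] z[of "x $ 2"] by (auto simp: \<rho>0_def)
    then have "norm x \<le> \<delta>" using norm_le_abs2[of x] by linarith
    then show False using that by simp
  qed
  have c0: "ctest \<delta> \<rho>0" using supp test_function_continuous[OF t0] by (simp add: ctest_def)
  note m0[measurable] = ctest_measurable[OF c0]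
  have i0: "integrable lborel \<rho>0" using integrable_ctest[OF c0 loc_int_const[of 1]] by simp
  define I where "I = (LINT x|lborel. \<rho>0 x)"
  have "I \<noteq> 0"
  proof
    assume "I = 0"
    then have "AE x in lborel. \<rho>0 x = 0"
      unfolding I_def using integral_nonneg_eq_0_iff_AE[OF i0] nn by simp
    then have "emeasure lborel {x. \<rho>0 x \<noteq> 0} = 0"
      by (subst (asm) AE_iff_measurable[where N = "{x. \<rho>0 x \<noteq> 0}"]) auto
    moreover have "box (vector [- (\<delta>/2), - (\<delta>/2)]) (vector [\<delta>/2, \<delta>/2]) \<subseteq> {x. \<rho>0 x \<noteq> 0}"
      by (auto simp: \<rho>0_def b_def bump_eq_0_iff mem_box_cart forall_2)
    moreover have "{x. \<rho>0 x \<noteq> 0} \<in> sets lborel" by simp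
    ultimately have "emeasure lborel (box (vector [- (\<delta>/2), - (\<delta>/2)]) (vector [\<delta>/2, \<delta>/2]) :: (real^2) set) = 0"
      by (metis emeasure_mono le_zero_eq)
    then show False using assms
      by (subst (asm) emeasure_lborel_box) (auto simp: Basis_vec_def UNIV_2 inner_axis axis_eq_axis)
  qed
  moreover have "0 \<le> I" unfolding I_def using nn by simp
  ultimately have I: "I > 0" by simp
  define \<rho> where "\<rho> x = (b (x $ 1) / I) * b (x $ 2)" for x :: "real^2"
  have \<rho>eq: "\<rho> x = \<rho>0 x / I" for x by (simp add: \<rho>_def \<rho>0_def)
  have "smooth1 (\<lambda>t. b t / I)"
    using smooth1_mult[OF smooth1_const[of "1 / I"] sb] by simp
  then have t\<rho>: "test_function \<rho>"
    unfolding \<rho>_def[abs_def] 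
    by (rule test_function_prod2[OF _ sb, where a = "- (\<delta> / 2)" and b = "\<delta> / 2" and c = "- (\<delta> / 2)" and d = "\<delta> / 2"])
       (use z in force)+
  have "ctest \<delta> \<rho>"
    unfolding ctest_def using test_function_continuous[OF t\<rho>] supp by (intro conjI) (simp_all add: \<rho>eq)
  moreover have "(LINT x|lborel. \<rho> x) = 1" using I by (simp add: \<rho>eq I_def)
  ultimately show thesis using t\<rho> that[of \<rho>] nn I by (auto simp: mollifier_def \<rho>eq)
qed

text \<open>Correlation instead of convolution: a distribution tested with the translate of \<psi>
  to \<open>x\<close> gives this expression without reflecting the kernel. Derivatives in
  \<open>x\<close> therefore fall on \<psi> with a minus sign.\<close>

definition corr :: "(real^2 \<Rightarrow> real) \<Rightarrow> (real^2 \<Rightarrow> real) \<Rightarrow> real^2 \<Rightarrow> real" where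
  "corr \<psi> f x = (LINT y|lborel. \<psi> (y - x) * f y)"

lemma corr_alt:
  assumes [measurable]: "\<psi> \<in> borel_measurable borel" "f \<in> borel_measurable borel"
  shows "corr \<psi> f x = pair \<psi> (\<lambda>y. f (y + x))"
  using lborel_shift[of "\<lambda>y. \<psi> (y - x) * f y" x] by (simp add: corr_def)

lemma corr_bound:
  assumes "ctest R \<psi>" "loc_int f" "\<And>x. \<bar>\<psi> x\<bar> \<le> e" "norm x \<le> r"
  shows "\<bar>corr \<psi> f x\<bar> \<le> e * lnorm (R + r) f"
  unfolding corr_def
  by (rule ctest_integral_bound[OF ctest_translate[OF assms(1,4)] assms(2)]) (rule assms(3))

lemma small_factor:
  fixes e C :: real assumes "e > 0" "C \<ge> 0"
  obtains d where "d > 0" "d * C \<le> e"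
proof
  show "e / (C + 1) > 0" using assms by simp
  show "e / (C + 1) * C \<le> e" using assms by (simp add: field_simps)
qed

lemma corr_continuous:
  assumes \<psi>: "test_function \<psi>" and f: "loc_int f"
  shows "continuous_on UNIV (corr \<psi> f)"
  unfolding continuous_on_iff
proof (intro ballI allI impI)
  fix x :: "real^2" and e :: real assume e: "e > 0"
  obtain R where R: "R > 0" "ctest R \<psi>" using test_function_ctest[OF \<psi>] by metis
  define r where "r = norm x + 1"
  define C where "C = lnorm (R + r) f"
  obtain d where d: "d > 0" "d * C \<le> e / 2" using small_factor[of "e / 2" C] e by (auto simp: C_def)
  obtain \<delta> where \<delta>: "\<delta> > 0" "\<And>a b. dist b a < \<delta> \<Longrightarrow> dist (\<psi> b) (\<psi> a) < d"
    using test_function_uc[OF \<psi>] d(1) unfolding uniformly_continuous_on_def by (metis UNIV_I)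
  show "\<exists>\<delta>>0. \<forall>x'\<in>UNIV. dist x' x < \<delta> \<longrightarrow> dist (corr \<psi> f x') (corr \<psi> f x) < e"
  proof (intro exI[of _ "min \<delta> 1"] conjI ballI impI)
    fix x' assume x': "dist x' x < min \<delta> 1"
    have n: "norm x \<le> r" "norm x' \<le> r"
      using x' norm_triangle_ineq2[of x' x] by (auto simp: r_def dist_norm)
    have c: "ctest (R + r) (\<lambda>y. \<psi> (y - x') - \<psi> (y - x))"
      using ctest_translate[OF R(2) n(1)] ctest_translate[OF R(2) n(2)]
      by (auto simp: ctest_def intro!: continuous_intros)
    have "corr \<psi> f x' - corr \<psi> f x = (LINT y|lborel. (\<psi> (y - x') - \<psi> (y - x)) * f y)"
      unfolding corr_def using ctest_shift_integrable[OF R(2) f] by (simp add: left_diff_distrib)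
    also have "\<bar>\<dots>\<bar> \<le> d * C"
      unfolding C_def
    proof (rule ctest_integral_bound[OF c f])
      fix y
      have "dist (y - x') (y - x) < \<delta>" using x' by (simp add: dist_norm norm_minus_commute)
      from \<delta>(2)[OF this] show "\<bar>\<psi> (y - x') - \<psi> (y - x)\<bar> \<le> d" by (simp add: dist_real_def)
    qed
    also have "\<dots> < e" using d e by simp
    finally show "dist (corr \<psi> f x') (corr \<psi> f x) < e" by (simp add: dist_real_def)
  qed (use \<delta> in auto)
qed

text \<open>Moving \<open>x\<close> by \<open>t\<close> moves the kernel by \<open>-t\<close>, so
  the quotient becomes a difference quotient of \<psi>, which converges uniformly; the local L1 norm
  of \<open>f\<close> makes the estimate uniform for \<open>x\<close> in a ball.\<close>

lemma corr_diff_quot: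
  assumes \<psi>: "test_function \<psi>" and f: "loc_int f" and e: "e > 0"
  obtains d where "d > 0" "\<And>t x. t \<noteq> 0 \<Longrightarrow> \<bar>t\<bar> < d \<Longrightarrow> norm x \<le> r \<Longrightarrow>
    \<bar>(corr \<psi> f (x + t *\<^sub>R axis a 1) - corr \<psi> f x) / t - (- corr (pderiv_dir a \<psi>) f x)\<bar> \<le> e"
proof -
  obtain R where R: "R > 0" "ctest R \<psi>" using test_function_ctest[OF \<psi>] by metis
  define C where "C = lnorm (R + 1 + r) f"
  obtain \<epsilon> where \<epsilon>: "\<epsilon> > 0" "\<epsilon> * C \<le> e" using small_factor[of e C] e by (auto simp: C_def)
  obtain d where d: "d > 0" "\<And>t x. t \<noteq> 0 \<Longrightarrow> \<bar>t\<bar> < d \<Longrightarrow> \<bar>(\<psi> (x + t *\<^sub>R axis a 1) - \<psi> x) / t - pderiv_dir a \<psi> x\<bar> \<le> \<epsilon>"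
    using diff_quotient_uniform[OF \<psi> \<epsilon>(1)] by metis
  have "\<bar>(corr \<psi> f (x + t *\<^sub>R axis a 1) - corr \<psi> f x) / t - (- corr (pderiv_dir a \<psi>) f x)\<bar> \<le> e"
    if t: "t \<noteq> 0" "\<bar>t\<bar> < min d 1" and x: "norm x \<le> r" for t x
  proof -
    define g where "g z = (\<psi> (z + (- t) *\<^sub>R axis a 1) - \<psi> z) / (- t) - pderiv_dir a \<psi> z" for z
    have cg: "ctest (R + 1) g" unfolding g_def[abs_def] by (rule ctest_diff_quotient(1)[OF \<psi> R(2)]) (use t in auto)
    have i: "integrable lborel (\<lambda>y. \<psi> (y - c) * f y)" "integrable lborel (\<lambda>y. pderiv_dir a \<psi> (y - c) * f y)" for c
      using ctest_shift_integrable[OF R(2) f] ctest_shift_integrable[OF pderiv_ctest[OF \<psi> R(2)] f] by auto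
    have "(corr \<psi> f (x + t *\<^sub>R axis a 1) - corr \<psi> f x) / t - (- corr (pderiv_dir a \<psi>) f x) =
       (LINT y|lborel. (\<psi> (y - (x + t *\<^sub>R axis a 1)) * f y - \<psi> (y - x) * f y) / t + pderiv_dir a \<psi> (y - x) * f y)"
      unfolding corr_def using i by simp
    also have "\<dots> = - corr g f x"
      unfolding corr_def by (subst Bochner_Integration.integral_minus[symmetric], intro Bochner_Integration.integral_cong)
        (auto simp: g_def field_simps t)
    finally have "\<bar>(corr \<psi> f (x + t *\<^sub>R axis a 1) - corr \<psi> f x) / t - (- corr (pderiv_dir a \<psi>) f x)\<bar> = \<bar>corr g f x\<bar>" by simp
    also have "\<dots> \<le> \<epsilon> * C"
      unfolding C_def using d(2)[of "- t"] t by (intro corr_bound[OF cg f _ x]) (simp add: g_def)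
    finally show ?thesis using \<epsilon> by simp
  qed
  then show thesis using that[of "min d 1"] d by simp
qed

lemma periodic_corr:
  assumes "periodic f" "f \<in> borel_measurable borel" "\<psi> \<in> borel_measurable borel"
  shows "periodic (corr \<psi> f)"
proof -
  have "corr \<psi> f (x + lat k) = corr \<psi> f x" for x k
    using periodicD[OF assms(1)] by (simp add: corr_alt[OF assms(3,2)] flip: add.assoc)
  then show ?thesis by (simp add: periodic_def)
qed

text \<open>Tonelli together with translation invariance of the torus: averaging translates with a
  probability density does not increase the L1 norm.\<close>

lemma torus_L1_corr:
  assumes \<rho>: "mollifier \<delta> \<rho>" and f: "periodic f" "f \<in> borel_measurable borel" "integrable torus f"
  shows "integrable torus (corr \<rho> f)" "(LINT x|torus. \<bar>corr \<rho> f x\<bar>) \<le> (LINT x|torus. \<bar>f x\<bar>)"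
proof -
  note [measurable] = f(2)
  have \<rho>': "ctest \<delta> \<rho>" "test_function \<rho>" "\<And>x. 0 \<le> \<rho> x" "(LINT x|lborel. \<rho> x) = 1"
    using \<rho> by (auto simp: mollifier_def)
  note m\<rho>[measurable] = ctest_measurable[OF \<rho>'(1)]
  have lf: "loc_int f" using f by (rule loc_int_periodic)
  have cp: "cper (corr \<rho> f)"
    unfolding cper_def using corr_continuous[OF \<rho>'(2) lf] periodic_corr[OF f(1,2) m\<rho>] by simp
  show ic: "integrable torus (corr \<rho> f)" using cp by (rule integrable_cper_torus)
  interpret T: prob_space torus by (rule prob_space_torus)
  interpret pair_sigma_finite torus lborel
    by (intro pair_sigma_finite.intro T.sigma_finite_measure_axioms lborel.sigma_finite_measure_axioms)
  have nt: "(\<integral>\<^sup>+x. ennreal \<bar>f (y + x)\<bar> \<partial>torus) = (\<integral>\<^sup>+x. ennreal \<bar>f x\<bar> \<partial>torus)" for y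
  proof -
    have "(\<integral>\<^sup>+x. ennreal \<bar>f x\<bar> \<partial>torus) = (\<integral>\<^sup>+x. ennreal \<bar>f x\<bar> \<partial>distr torus borel (\<lambda>x. fracs (x + y)))"
      by (simp add: torus_translate)
    also have "\<dots> = (\<integral>\<^sup>+x. ennreal \<bar>f (fracs (x + y))\<bar> \<partial>torus)" by (rule nn_integral_distr) auto
    finally show ?thesis using f(1) by (simp add: periodic_fracs add.commute)
  qed
  have "ennreal (LINT x|torus. \<bar>corr \<rho> f x\<bar>) = (\<integral>\<^sup>+x. ennreal \<bar>corr \<rho> f x\<bar> \<partial>torus)"
    using ic by (intro nn_integral_eq_integral[symmetric]) auto
  also have "\<dots> \<le> (\<integral>\<^sup>+x. (\<integral>\<^sup>+y. ennreal (\<rho> y) * ennreal \<bar>f (y + x)\<bar> \<partial>lborel) \<partial>torus)"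
  proof (rule nn_integral_mono)
    fix x
    have i: "integrable lborel (\<lambda>y. \<rho> y * f (y + x))"
      using integrable_shift[OF ctest_shift_integrable[OF \<rho>'(1) lf, of x], of x] by simp
    have "ennreal (norm (corr \<rho> f x)) \<le> (\<integral>\<^sup>+y. ennreal (norm (\<rho> y * f (y + x))) \<partial>lborel)"
      unfolding corr_alt[OF m\<rho> f(2)] using i by (rule integral_norm_bound_ennreal)
    also have "\<dots> = (\<integral>\<^sup>+y. ennreal (\<rho> y) * ennreal \<bar>f (y + x)\<bar> \<partial>lborel)"
      using \<rho>'(3) by (intro nn_integral_cong) (simp add: abs_mult ennreal_mult)
    finally show "ennreal \<bar>corr \<rho> f x\<bar> \<le> (\<integral>\<^sup>+y. ennreal (\<rho> y) * ennreal \<bar>f (y + x)\<bar> \<partial>lborel)" by simp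
  qed
  also have "\<dots> = (\<integral>\<^sup>+y. (\<integral>\<^sup>+x. ennreal (\<rho> y) * ennreal \<bar>f (y + x)\<bar> \<partial>torus) \<partial>lborel)"
    by (rule Fubini'[symmetric]) measurable
  also have "\<dots> = (\<integral>\<^sup>+y. ennreal (\<rho> y) * (\<integral>\<^sup>+x. ennreal \<bar>f x\<bar> \<partial>torus) \<partial>lborel)"
    by (intro nn_integral_cong, subst nn_integral_cmult) (auto simp: nt)
  also have "\<dots> = (\<integral>\<^sup>+y. ennreal (\<rho> y) \<partial>lborel) * (\<integral>\<^sup>+x. ennreal \<bar>f x\<bar> \<partial>torus)"
    by (rule nn_integral_multc) measurable
  also have "(\<integral>\<^sup>+y. ennreal (\<rho> y) \<partial>lborel) = 1"
    using integrable_ctest[OF \<rho>'(1) loc_int_const[of 1]] \<rho>'(3,4) by (subst nn_integral_eq_integral) auto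
  also have "1 * (\<integral>\<^sup>+x. ennreal \<bar>f x\<bar> \<partial>torus) = ennreal (LINT x|torus. \<bar>f x\<bar>)"
    using f(3) by (simp add: nn_integral_eq_integral)
  finally show "(LINT x|torus. \<bar>corr \<rho> f x\<bar>) \<le> (LINT x|torus. \<bar>f x\<bar>)" by simp
qed

lemma loc_int_continuous:
  fixes f :: "real^2 \<Rightarrow> real"
  assumes "continuous_on UNIV f" shows "loc_int f"
  unfolding loc_int_def
proof (intro conjI allI)
  show "f \<in> borel_measurable borel" using assms by (rule borel_measurable_continuous_onI)
  show "integrable lborel (\<lambda>x. indicator (cball 0 R) x *\<^sub>R f x)" for R
    by (rule borel_integrable_compact) (use assms in \<open>auto intro: continuous_on_subset\<close>)
qed

lemma mollifier_avg_bound: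
  assumes \<rho>: "mollifier \<delta> \<rho>" and f: "continuous_on UNIV f" and e: "\<And>y. norm y \<le> \<delta> \<Longrightarrow> \<bar>f (y + x) - f x\<bar> \<le> e"
  shows "\<bar>corr \<rho> f x - f x\<bar> \<le> e"
proof -
  have \<rho>': "ctest \<delta> \<rho>" "\<And>x. 0 \<le> \<rho> x" "(LINT x|lborel. \<rho> x) = 1"
    using \<rho> by (auto simp: mollifier_def)
  note [measurable] = ctest_measurable[OF \<rho>'(1)] borel_measurable_continuous_onI[OF f]
  have i\<rho>: "integrable lborel (\<lambda>y. \<rho> y * c)" for c
    using integrable_ctest[OF \<rho>'(1) loc_int_const[of c]] by simp
  have lf: "loc_int (\<lambda>y. f (y + x))"
    by (rule loc_int_continuous) (intro continuous_on_compose2[OF f] continuous_intros, auto)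
  have i: "integrable lborel (\<lambda>y. \<rho> y * f (y + x))"
    using integrable_ctest[OF \<rho>'(1) lf] by simp
  have "corr \<rho> f x - f x = (LINT y|lborel. \<rho> y * f (y + x)) - (LINT y|lborel. \<rho> y * f x)"
    using \<rho>'(3) by (simp add: corr_alt)
  also have "\<dots> = (LINT y|lborel. \<rho> y * (f (y + x) - f x))"
    using i i\<rho> by (simp add: right_diff_distrib)
  also have "\<bar>\<dots>\<bar> \<le> (LINT y|lborel. \<bar>\<rho> y * (f (y + x) - f x)\<bar>)" by (rule integral_abs_bound)
  also have "\<dots> \<le> (LINT y|lborel. \<rho> y * e)"
  proof (rule integral_mono[OF _ i\<rho>])
    have "integrable lborel (\<lambda>y. \<rho> y * f (y + x) - \<rho> y * f x)" using i i\<rho> by (rule Bochner_Integration.integrable_diff)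
    then show "integrable lborel (\<lambda>y. \<bar>\<rho> y * (f (y + x) - f x)\<bar>)" by (simp add: right_diff_distrib)
    fix y
    show "\<bar>\<rho> y * (f (y + x) - f x)\<bar> \<le> \<rho> y * e"
    proof (cases "norm y \<le> \<delta>")
      case True
      then show ?thesis using e[OF True] \<rho>'(2)[of y] by (simp add: abs_mult mult_left_mono)
    next
      case False
      then show ?thesis using \<rho>'(1) by (simp add: ctest_def)
    qed
  qed
  also have "\<dots> = e" using \<rho>'(3) by simp
  finally show ?thesis .
qed

lemma cper_uniform:
  assumes \<phi>: "cper \<phi>" and e: "e > 0"
  obtains \<delta> where "\<delta> > 0" "\<And>x y. norm y \<le> \<delta> \<Longrightarrow> \<bar>\<phi> (y + x) - \<phi> x\<bar> \<le> e"
proof -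
  have c: "continuous_on UNIV \<phi>" and p: "periodic \<phi>" using \<phi> by (auto simp: cper_def)
  have "uniformly_continuous_on (cball 0 3) \<phi>"
    by (intro compact_uniformly_continuous continuous_on_subset[OF c]) auto
  then obtain d where d: "d > 0" "\<And>x y. \<lbrakk>x \<in> cball 0 3; y \<in> cball 0 3; dist y x < d\<rbrakk> \<Longrightarrow> dist (\<phi> y) (\<phi> x) < e"
    unfolding uniformly_continuous_on_def using e by metis
  have "\<bar>\<phi> (y + x) - \<phi> x\<bar> \<le> e" if y: "norm y \<le> min (d / 2) 1" for x y
  proof -
    have n: "norm (fracs x) \<le> 2" by (rule norm_cell) simp
    have "dist (\<phi> (y + fracs x)) (\<phi> (fracs x)) < e"
    proof (rule d(2))
      show "fracs x \<in> cball 0 3" using n by simp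
      show "y + fracs x \<in> cball 0 3" using n y norm_triangle_ineq[of y "fracs x"] by simp
      show "dist (y + fracs x) (fracs x) < d" using y d by (simp add: dist_norm)
    qed
    moreover have "\<phi> (y + fracs x) = \<phi> (y + x)"
      using periodicD[OF p, of "y + fracs x" "floors x"] fracs_plus_floors[of x] by (simp add: add.assoc)
    moreover have "\<phi> (fracs x) = \<phi> x" using p by (rule periodic_fracs)
    ultimately show ?thesis by (simp add: dist_real_def)
  qed
  then show thesis using that[of "min (d / 2) 1"] d by simp
qed

text \<open>\<open>f\<close> is split into a continuous periodic function, on which mollification is
  uniformly close to the identity, and a small remainder, on which it is a contraction. The
  threshold for the radius does not depend on the mollifier chosen.\<close>

lemma mollify_torus_L1:
  assumes f: "periodic f" "f \<in> borel_measurable borel" "integrable torus f" and e: "e > 0"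
  obtains \<delta> where "\<delta> > 0" "\<And>\<rho> \<delta>'. mollifier \<delta>' \<rho> \<Longrightarrow> \<delta>' \<le> \<delta> \<Longrightarrow> (LINT x|torus. \<bar>corr \<rho> f x - f x\<bar>) \<le> e"
proof -
  interpret T: prob_space torus by (rule prob_space_torus)
  obtain \<phi> where \<phi>: "cper \<phi>" "(LINT x|torus. \<bar>f x - \<phi> x\<bar>) < e / 3"
    using cper_dense[OF f(3), of "e / 3"] e by auto
  obtain \<delta> where \<delta>: "\<delta> > 0" "\<And>x y. norm y \<le> \<delta> \<Longrightarrow> \<bar>\<phi> (y + x) - \<phi> x\<bar> \<le> e / 3"
    using cper_uniform[OF \<phi>(1), of "e / 3"] e by auto
  have \<phi>c: "continuous_on UNIV \<phi>" "periodic \<phi>" using \<phi>(1) by (auto simp: cper_def)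
  note m\<phi>[measurable] = cper_measurable[OF \<phi>(1)]
  note [measurable] = f(2)
  have "(LINT x|torus. \<bar>corr \<rho> f x - f x\<bar>) \<le> e" if \<rho>: "mollifier \<delta>' \<rho>" and le: "\<delta>' \<le> \<delta>" for \<rho> \<delta>'
  proof -
    have \<rho>': "ctest \<delta>' \<rho>" using \<rho> by (simp add: mollifier_def)
    define g where "g x = f x - \<phi> x" for x
    have g: "periodic g" "g \<in> borel_measurable borel" "integrable torus g"
      using f \<phi>c integrable_cper_torus[OF \<phi>(1)] by (auto simp: g_def[abs_def] periodic_def)
    have lf: "loc_int f" "loc_int \<phi>" using f \<phi>c by (auto intro: loc_int_periodic loc_int_continuous)
    have split: "corr \<rho> f x = corr \<rho> g x + corr \<rho> \<phi> x" for x
    proof -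
      have "corr \<rho> g x = corr \<rho> f x - corr \<rho> \<phi> x"
        unfolding corr_def g_def using ctest_shift_integrable[OF \<rho>' lf(1)] ctest_shift_integrable[OF \<rho>' lf(2)]
        by (simp add: right_diff_distrib)
      then show ?thesis by simp
    qed
    have "(LINT x|torus. \<bar>corr \<rho> f x - f x\<bar>) \<le> (LINT x|torus. \<bar>corr \<rho> g x\<bar> + (e / 3 + \<bar>g x\<bar>))"
    proof (rule integral_mono)
      show "integrable torus (\<lambda>x. \<bar>corr \<rho> f x - f x\<bar>)"
        using torus_L1_corr(1)[OF \<rho> f] f(3) by simp
      show "integrable torus (\<lambda>x. \<bar>corr \<rho> g x\<bar> + (e / 3 + \<bar>g x\<bar>))"
        using torus_L1_corr(1)[OF \<rho> g] g(3) by simp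
      fix x
      have "\<bar>corr \<rho> \<phi> x - \<phi> x\<bar> \<le> e / 3"
        by (rule mollifier_avg_bound[OF \<rho> \<phi>c(1)]) (use \<delta>(2) le in auto)
      then show "\<bar>corr \<rho> f x - f x\<bar> \<le> \<bar>corr \<rho> g x\<bar> + (e / 3 + \<bar>g x\<bar>)"
        unfolding split using g_def[of x] by linarith
    qed
    also have "\<dots> = (LINT x|torus. \<bar>corr \<rho> g x\<bar>) + (e / 3 + (LINT x|torus. \<bar>g x\<bar>))"
      using torus_L1_corr(1)[OF \<rho> g] g(3) T.prob_space by simp
    also have "\<dots> \<le> (LINT x|torus. \<bar>g x\<bar>) + (e / 3 + (LINT x|torus. \<bar>g x\<bar>))"
      using torus_L1_corr(2)[OF \<rho> g] by simp
    also have "\<dots> \<le> e" using \<phi>(2) by (simp add: g_def)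
    finally show ?thesis .
  qed
  then show thesis using that \<delta>(1) by blast
qed

section \<open>Sampling and discrete convolution\<close>

text \<open>Locally uniform closeness to \<open>G\<close> at the grid points. It survives fixed
  convolutions and Lipschitz functions, holds for the sampled difference quotients, and still yields
  convergence of means.\<close>

definition approx :: "(nat \<Rightarrow> real grid) \<Rightarrow> (real^2 \<Rightarrow> real) \<Rightarrow> bool" where
  "approx g G \<longleftrightarrow> (\<forall>R e. e > 0 \<longrightarrow> (\<forall>\<^sub>F N in sequentially. \<forall>i j. norm (hvec N i j) \<le> R \<longrightarrow> \<bar>g N i j - G (hvec N i j)\<bar> \<le> e))"

lemma approxD:
  "approx g G \<Longrightarrow> e > 0 \<Longrightarrow> \<forall>\<^sub>F N in sequentially. \<forall>i j. norm (hvec N i j) \<le> R \<longrightarrow> \<bar>g N i j - G (hvec N i j)\<bar> \<le> e"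
  by (simp add: approx_def)

lemma approx_sample: "approx (\<lambda>N i j. G (hvec N i j)) G"
  by (simp add: approx_def)

lemma approx_add:
  assumes "approx g G" "approx g' G'" shows "approx (\<lambda>N i j. g N i j + g' N i j) (\<lambda>x. G x + G' x)"
  unfolding approx_def
proof (intro allI impI)
  fix R e :: real assume e: "e > 0"
  show "\<forall>\<^sub>F N in sequentially. \<forall>i j. norm (hvec N i j) \<le> R \<longrightarrow> \<bar>g N i j + g' N i j - (G (hvec N i j) + G' (hvec N i j))\<bar> \<le> e"
    using approxD[OF assms(1) half_gt_zero[OF e], of R] approxD[OF assms(2) half_gt_zero[OF e], of R]
  proof eventually_elim
    case (elim N)
    show ?case
    proof (intro allI impI)
      fix i j assume "norm (hvec N i j) \<le> R"
      with elim have "\<bar>g N i j - G (hvec N i j)\<bar> \<le> e / 2" "\<bar>g' N i j - G' (hvec N i j)\<bar> \<le> e / 2" by blast+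
      then show "\<bar>g N i j + g' N i j - (G (hvec N i j) + G' (hvec N i j))\<bar> \<le> e" by linarith
    qed
  qed
qed

lemma approx_cmult:
  assumes "approx g G" shows "approx (\<lambda>N i j. c * g N i j) (\<lambda>x. c * G x)"
  unfolding approx_def
proof (intro allI impI)
  fix R e :: real assume e: "e > 0"
  obtain d where d: "d > 0" "d * \<bar>c\<bar> \<le> e" using small_factor[OF e, of "\<bar>c\<bar>"] by auto
  show "\<forall>\<^sub>F N in sequentially. \<forall>i j. norm (hvec N i j) \<le> R \<longrightarrow> \<bar>c * g N i j - c * G (hvec N i j)\<bar> \<le> e"
    using approxD[OF assms d(1), of R]
  proof eventually_elim
    case (elim N)
    show ?case
    proof (intro allI impI)
      fix i j assume "norm (hvec N i j) \<le> R"
      with elim have "\<bar>g N i j - G (hvec N i j)\<bar> \<le> d" by blast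
      then have "\<bar>g N i j - G (hvec N i j)\<bar> * \<bar>c\<bar> \<le> d * \<bar>c\<bar>" by (rule mult_right_mono) simp
      also have "\<bar>g N i j - G (hvec N i j)\<bar> * \<bar>c\<bar> = \<bar>c * g N i j - c * G (hvec N i j)\<bar>"
        by (simp add: abs_mult[symmetric] algebra_simps)
      finally show "\<bar>c * g N i j - c * G (hvec N i j)\<bar> \<le> e" using d by simp
    qed
  qed
qed

lemma approx_diff:
  assumes "approx g G" "approx g' G'" shows "approx (\<lambda>N i j. g N i j - g' N i j) (\<lambda>x. G x - G' x)"
  using approx_add[OF assms(1) approx_cmult[OF assms(2), of "-1"]] by simp

lemma approx_lipschitz:
  fixes G :: "real^2 \<Rightarrow> real^'n::finite" and nrm :: "real^'n \<Rightarrow> real"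
  assumes a: "\<And>a. approx (\<lambda>N i j. g N i j $ a) (\<lambda>x. G x $ a)"
    and lip: "\<And>p p'. \<bar>nrm p - nrm p'\<bar> \<le> L * (\<Sum>a\<in>UNIV. \<bar>p $ a - p' $ a\<bar>)" and L: "L \<ge> 0"
  shows "approx (\<lambda>N i j. nrm (g N i j)) (\<lambda>x. nrm (G x))"
  unfolding approx_def
proof (intro allI impI)
  fix R e :: real assume e: "e > 0"
  obtain d where d: "d > 0" "d * (L * CARD('n)) \<le> e" using small_factor[OF e, of "L * CARD('n)"] L by auto
  have "\<forall>\<^sub>F N in sequentially. \<forall>a\<in>UNIV. \<forall>i j. norm (hvec N i j) \<le> R \<longrightarrow> \<bar>g N i j $ a - G (hvec N i j) $ a\<bar> \<le> d"
    by (intro eventually_ball_finite ballI approxD[OF a d(1)]) simp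
  then show "\<forall>\<^sub>F N in sequentially. \<forall>i j. norm (hvec N i j) \<le> R \<longrightarrow> \<bar>nrm (g N i j) - nrm (G (hvec N i j))\<bar> \<le> e"
  proof eventually_elim
    case (elim N)
    show ?case
    proof (intro allI impI)
      fix i j assume "norm (hvec N i j) \<le> R"
      with elim have "\<bar>g N i j $ a - G (hvec N i j) $ a\<bar> \<le> d" for a by blast
      then have "(\<Sum>a\<in>UNIV. \<bar>g N i j $ a - G (hvec N i j) $ a\<bar>) \<le> of_nat (card (UNIV :: 'n set)) * d"
        by (rule sum_bounded_above)
      then have "L * (\<Sum>a\<in>UNIV. \<bar>g N i j $ a - G (hvec N i j) $ a\<bar>) \<le> L * (CARD('n) * d)"
        using L by (intro mult_left_mono) auto
      then show "\<bar>nrm (g N i j) - nrm (G (hvec N i j))\<bar> \<le> e"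
        using lip[of "g N i j" "G (hvec N i j)"] d(2) by (simp add: mult_ac)
    qed
  qed
qed

lemma approx_pix:
  assumes a: "approx g G" and c: "continuous_on UNIV G" and e: "e > 0"
  shows "\<forall>\<^sub>F N in sequentially. \<forall>x. norm x \<le> R \<longrightarrow> \<bar>pix N (g N) x - G x\<bar> \<le> e"
proof -
  have "uniformly_continuous_on (cball 0 (R + 1)) G"
    by (intro compact_uniformly_continuous continuous_on_subset[OF c]) auto
  then obtain d where d: "d > 0" "\<And>x y. \<lbrakk>x \<in> cball 0 (R + 1); y \<in> cball 0 (R + 1); dist y x < d\<rbrakk> \<Longrightarrow> dist (G y) (G x) < e / 2"
    unfolding uniformly_continuous_on_def using e by (metis half_gt_zero)
  have "\<forall>\<^sub>F N in sequentially. 1 / real N < min d 1"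
    using d(1) lim_1_over_n by (intro order_tendstoD(2)[where y = 0]) auto
  then show ?thesis
    using approxD[OF a half_gt_zero[OF e], of "R + 1"] eventually_ge_at_top[of 1]
  proof eventually_elim
    case (elim N)
    show ?case
    proof (intro allI impI)
      fix x :: "real^2" assume x: "norm x \<le> R"
      define i j where "i = round (N * x $ 1)" and "j = round (N * x $ 2)"
      have h: "\<bar>hvec N i j $ a - x $ a\<bar> \<le> 1 / 2 / N" for a
      proof -
        have "\<bar>of_int (round (N * x $ a)) - N * x $ a\<bar> \<le> 1 / 2" by (rule of_int_round_abs_le)
        then have "\<bar>of_int (round (N * x $ a)) - N * x $ a\<bar> / N \<le> 1 / 2 / N" by (rule divide_right_mono) simp
        also have "\<bar>of_int (round (N * x $ a)) - N * x $ a\<bar> / N = \<bar>of_int (round (N * x $ a)) / N - x $ a\<bar>"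
        proof -
          have "of_int (round (N * x $ a)) / N - x $ a = (of_int (round (N * x $ a)) - N * x $ a) / N"
            using elim(3) by (simp add: diff_divide_distrib)
          then show ?thesis by (simp add: abs_divide)
        qed
        finally show ?thesis using UNIV_2_cases[of a] by (auto simp: i_def j_def)
      qed
      have "norm (hvec N i j - x) \<le> 1 / N"
        using norm_le_abs2[of "hvec N i j - x"] h[of 1] h[of 2] by (simp add: field_simps)
      then have dist: "norm (hvec N i j - x) < d" "norm (hvec N i j - x) < 1" using elim(1) by auto
      then have nh: "norm (hvec N i j) \<le> R + 1" using x norm_triangle_ineq2[of "hvec N i j" x] by simp
      have "dist (G (hvec N i j)) (G x) < e / 2"
        by (rule d(2)) (use x nh dist in \<open>auto simp: dist_norm\<close>)
      moreover have "\<bar>g N i j - G (hvec N i j)\<bar> \<le> e / 2" using elim(2) nh by blast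
      ultimately have "\<bar>g N i j - G x\<bar> \<le> e" unfolding dist_real_def by linarith
      then show "\<bar>pix N (g N) x - G x\<bar> \<le> e" by (simp add: pix_def i_def j_def)
    qed
  qed
qed

text \<open>Convergence of Riemann sums: the mean over the grid is the torus integral of the pixel
  function, which is uniformly close to \<open>G\<close> on the cell.\<close>

lemma approx_av2:
  assumes a: "approx g G" and G: "cper G" and p: "\<And>N. N \<ge> 1 \<Longrightarrow> periodic_grid N (g N)"
  shows "(\<lambda>N. av2 N (g N)) \<longlonglongrightarrow> (LINT x|torus. G x)"
proof (rule tendstoI)
  fix e :: real assume e: "e > 0"
  interpret T: prob_space torus by (rule prob_space_torus)
  have c: "continuous_on UNIV G" using G by (simp add: cper_def)
  show "\<forall>\<^sub>F N in sequentially. dist (av2 N (g N)) (LINT x|torus. G x) < e"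
    using approx_pix[OF a c half_gt_zero[OF e], of 2] eventually_ge_at_top[of 1]
  proof eventually_elim
    case (elim N)
    note i = integral_pix(1)[OF elim(2) p[OF elim(2)]] integrable_cper_torus[OF G]
    have "av2 N (g N) - (LINT x|torus. G x) = (LINT x|torus. pix N (g N) x - G x)"
      using i by (simp add: integral_pix_av2[OF elim(2) p[OF elim(2)]])
    also have "\<bar>\<dots>\<bar> \<le> (LINT x|torus. \<bar>pix N (g N) x - G x\<bar>)" by (rule integral_abs_bound)
    also have "\<dots> \<le> (LINT x|torus. e / 2)"
    proof (rule integral_mono_AE)
      show "AE x in torus. \<bar>pix N (g N) x - G x\<bar> \<le> e / 2"
        using AE_torus by eventually_elim (use elim(1) norm_cell in blast)
    qed (use i in auto)
    also have "\<dots> < e" using e T.prob_space by simp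
    finally show ?case by (simp add: dist_real_def)
  qed
qed

section \<open>Convolution of grids with kernels of mass one\<close>

definition conv_grid :: "nat \<Rightarrow> (int \<Rightarrow> int \<Rightarrow> real) \<Rightarrow> real grid \<Rightarrow> real grid" where
  "conv_grid \<nu> k g i j = (\<Sum>m\<in>{- int \<nu>..int \<nu>}. \<Sum>n\<in>{- int \<nu>..int \<nu>}. k m n * g (i + m) (j + n))"

lemma conv_grid_diff: "conv_grid \<nu> k (\<lambda>i j. g i j - g' i j) i j = conv_grid \<nu> k g i j - conv_grid \<nu> k g' i j"
  by (simp add: conv_grid_def right_diff_distrib sum_subtractf)

lemma conv_grid_cmult: "conv_grid \<nu> k (\<lambda>i j. c * g i j) i j = c * conv_grid \<nu> k g i j"
  by (simp add: conv_grid_def sum_distrib_left mult_ac)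

lemma conv_grid_shift: "conv_grid \<nu> k (\<lambda>i j. g (i + a) (j + b)) i j = conv_grid \<nu> k g (i + a) (j + b)"
  by (simp add: conv_grid_def add_ac)

lemma conv_grid_commute: "conv_grid \<nu> k (conv_grid \<nu> k' g) = conv_grid \<nu> k' (conv_grid \<nu> k g)"
proof (intro ext)
  fix i j
  let ?V = "{- int \<nu>..int \<nu>}"
  have "conv_grid \<nu> k (conv_grid \<nu> k' g) i j =
      (\<Sum>m\<in>?V. \<Sum>n\<in>?V. \<Sum>m'\<in>?V. \<Sum>n'\<in>?V. k m n * k' m' n' * g (i + m + m') (j + n + n'))"
    by (simp add: conv_grid_def sum_distrib_left mult_ac)
  also have "\<dots> = (\<Sum>m\<in>?V. \<Sum>m'\<in>?V. \<Sum>n\<in>?V. \<Sum>n'\<in>?V. k m n * k' m' n' * g (i + m + m') (j + n + n'))"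
    by (intro sum.cong refl sum.swap)
  also have "\<dots> = (\<Sum>m'\<in>?V. \<Sum>m\<in>?V. \<Sum>n\<in>?V. \<Sum>n'\<in>?V. k m n * k' m' n' * g (i + m + m') (j + n + n'))"
    by (rule sum.swap)
  also have "\<dots> = (\<Sum>m'\<in>?V. \<Sum>m\<in>?V. \<Sum>n'\<in>?V. \<Sum>n\<in>?V. k m n * k' m' n' * g (i + m + m') (j + n + n'))"
    by (intro sum.cong refl sum.swap)
  also have "\<dots> = (\<Sum>m'\<in>?V. \<Sum>n'\<in>?V. \<Sum>m\<in>?V. \<Sum>n\<in>?V. k m n * k' m' n' * g (i + m + m') (j + n + n'))"
    by (intro sum.cong refl sum.swap)
  also have "\<dots> = conv_grid \<nu> k' (conv_grid \<nu> k g) i j"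
    by (simp add: conv_grid_def sum_distrib_left mult_ac add_ac)
  finally show "conv_grid \<nu> k (conv_grid \<nu> k' g) i j = conv_grid \<nu> k' (conv_grid \<nu> k g) i j" .
qed

definition unit_kernel :: "nat \<Rightarrow> (int \<Rightarrow> int \<Rightarrow> real) \<Rightarrow> bool" where
  "unit_kernel \<nu> k \<longleftrightarrow> (\<Sum>m\<in>{- int \<nu>..int \<nu>}. \<Sum>n\<in>{- int \<nu>..int \<nu>}. k m n) = 1"

lemma conv_grid_const: "unit_kernel \<nu> k \<Longrightarrow> conv_grid \<nu> k (\<lambda>i j. c) i j = c"
  by (simp add: conv_grid_def unit_kernel_def flip: sum_distrib_right)

text \<open>Mass one reduces the error to differences between nearby values and the central one.
  Each is at most \<open>2 * d\<close>, one part from the grid error and one from continuity of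
  \<open>G\<close>; as kernels may be signed, the sum of their absolute coefficients enters as a
  factor.\<close>

lemma approx_conv_grid:
  assumes a: "approx g G" and c: "continuous_on UNIV G" and k: "unit_kernel \<nu> k"
  shows "approx (\<lambda>N. conv_grid \<nu> k (g N)) G"
  unfolding approx_def
proof (intro allI impI)
  fix R e :: real assume e: "e > 0"
  let ?V = "{- int \<nu>..int \<nu>}"
  define R' where "R' = R + 2 * real \<nu>"
  define S where "S = (\<Sum>m\<in>?V. \<Sum>n\<in>?V. \<bar>k m n\<bar>)"
  have S0: "S \<ge> 0" by (simp add: S_def sum_nonneg)
  obtain d where d: "d > 0" "d * (2 * S) \<le> e" using small_factor[OF e, of "2 * S"] S0 by auto
  have "uniformly_continuous_on (cball 0 R') G"
    by (intro compact_uniformly_continuous continuous_on_subset[OF c]) auto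
  then obtain \<delta> where \<delta>: "\<delta> > 0" "\<And>x y. \<lbrakk>x \<in> cball 0 R'; y \<in> cball 0 R'; dist y x < \<delta>\<rbrakk> \<Longrightarrow> dist (G y) (G x) < d"
    unfolding uniformly_continuous_on_def using d(1) by metis
  have "(\<lambda>N. 2 * real \<nu> * (1 / real N)) \<longlonglongrightarrow> 2 * real \<nu> * 0"
    by (intro tendsto_mult tendsto_const lim_1_over_n)
  then have "\<forall>\<^sub>F N in sequentially. 2 * real \<nu> * (1 / real N) < \<delta>"
    using \<delta>(1) by (intro order_tendstoD(2)) auto
  then show "\<forall>\<^sub>F N in sequentially. \<forall>i j. norm (hvec N i j) \<le> R \<longrightarrow> \<bar>conv_grid \<nu> k (g N) i j - G (hvec N i j)\<bar> \<le> e"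
    using approxD[OF a d(1), of R'] eventually_ge_at_top[of 1]
  proof eventually_elim
    case (elim N)
    show ?case
    proof (intro allI impI)
      fix i j assume x: "norm (hvec N i j) \<le> R"
      have tb: "\<bar>g N (i + m) (j + n) - G (hvec N i j)\<bar> \<le> 2 * d" if "m \<in> ?V" "n \<in> ?V" for m n
      proof -
        have hv: "hvec N (i + m) (j + n) = hvec N i j + hvec N m n"
          by (simp add: vec2_eq_iff add_divide_distrib)
        have "norm (hvec N m n) \<le> (\<bar>of_int m\<bar> + \<bar>of_int n\<bar>) / N" by (rule norm_hvec)
        also have "\<dots> \<le> (2 * real \<nu>) / N"
          using that by (intro divide_right_mono) auto
        finally have n1: "norm (hvec N m n) \<le> 2 * real \<nu> * (1 / N)" by simp
        have n2: "2 * real \<nu> * (1 / N) \<le> 2 * real \<nu>"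
        proof -
          have "1 / real N \<le> 1" using elim(3) by simp
          then have "2 * real \<nu> * (1 / N) \<le> 2 * real \<nu> * 1" by (rule mult_left_mono) simp
          then show ?thesis by simp
        qed
        have n3: "norm (hvec N (i + m) (j + n)) \<le> R'"
          unfolding hv R'_def using n1 n2 x norm_triangle_ineq[of "hvec N i j" "hvec N m n"] by linarith
        have "dist (G (hvec N (i + m) (j + n))) (G (hvec N i j)) < d"
        proof (rule \<delta>(2))
          show "hvec N i j \<in> cball 0 R'" using x by (simp add: R'_def)
          show "hvec N (i + m) (j + n) \<in> cball 0 R'" using n3 by simp
          show "dist (hvec N (i + m) (j + n)) (hvec N i j) < \<delta>"
            unfolding hv using n1 elim(1) by (simp add: dist_norm)
        qed
        moreover have "\<bar>g N (i + m) (j + n) - G (hvec N (i + m) (j + n))\<bar> \<le> d" using elim(2) n3 by blast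
        ultimately show ?thesis by (simp add: dist_real_def)
      qed
      have eq: "conv_grid \<nu> k (g N) i j - G (hvec N i j) = (\<Sum>m\<in>?V. \<Sum>n\<in>?V. k m n * (g N (i + m) (j + n) - G (hvec N i j)))"
        using k by (simp add: conv_grid_def unit_kernel_def right_diff_distrib sum_subtractf flip: sum_distrib_right)
      have "\<bar>conv_grid \<nu> k (g N) i j - G (hvec N i j)\<bar> \<le> (\<Sum>m\<in>?V. \<Sum>n\<in>?V. \<bar>k m n * (g N (i + m) (j + n) - G (hvec N i j))\<bar>)"
        unfolding eq by (intro order_trans[OF sum_abs] sum_mono order_refl)
      also have "\<dots> \<le> (\<Sum>m\<in>?V. \<Sum>n\<in>?V. \<bar>k m n\<bar> * (2 * d))"
        using tb by (intro sum_mono) (auto simp: abs_mult intro!: mult_left_mono)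
      also have "\<dots> = S * (2 * d)" by (simp add: S_def sum_distrib_right)
      also have "\<dots> \<le> e" using d by (simp add: mult_ac)
      finally show "\<bar>conv_grid \<nu> k (g N) i j - G (hvec N i j)\<bar> \<le> e" .
    qed
  qed
qed

lemma periodic_conv_grid: "periodic_grid N g \<Longrightarrow> periodic_grid N (conv_grid \<nu> k g)"
  using periodic_grid_shift[of N g] unfolding periodic_grid_def conv_grid_def by simp

definition convs :: "nat \<Rightarrow> (int \<Rightarrow> int \<Rightarrow> real) list \<Rightarrow> real grid \<Rightarrow> real grid" where
  "convs \<nu> ks g = foldr (conv_grid \<nu>) ks g"

lemma convs_simps [simp]: "convs \<nu> [] g = g" "convs \<nu> (k # ks) g = conv_grid \<nu> k (convs \<nu> ks g)"
  by (simp_all add: convs_def)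

lemma convs_diff: "convs \<nu> ks (\<lambda>i j. g i j - g' i j) = (\<lambda>i j. convs \<nu> ks g i j - convs \<nu> ks g' i j)"
proof (induction ks)
  case (Cons k ks)
  show ?case unfolding convs_simps Cons.IH by (intro ext conv_grid_diff)
qed simp

lemma convs_cmult: "convs \<nu> ks (\<lambda>i j. c * g i j) = (\<lambda>i j. c * convs \<nu> ks g i j)"
proof (induction ks)
  case (Cons k ks)
  show ?case unfolding convs_simps Cons.IH by (intro ext conv_grid_cmult)
qed simp

lemma convs_shift: "convs \<nu> ks (\<lambda>i j. g (i + a) (j + b)) = (\<lambda>i j. convs \<nu> ks g (i + a) (j + b))"
proof (induction ks)
  case (Cons k ks)
  show ?case unfolding convs_simps Cons.IH by (intro ext conv_grid_shift)
qed simp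

lemma convs_const: "(\<And>k. k \<in> set ks \<Longrightarrow> unit_kernel \<nu> k) \<Longrightarrow> convs \<nu> ks (\<lambda>i j. c) = (\<lambda>i j. c)"
proof (induction ks)
  case (Cons k ks)
  then have IH: "convs \<nu> ks (\<lambda>i j. c) = (\<lambda>i j. c)" by simp
  show ?case unfolding convs_simps IH using Cons.prems by (intro ext conv_grid_const) simp
qed simp

lemma periodic_convs: "periodic_grid N g \<Longrightarrow> periodic_grid N (convs \<nu> ks g)"
  by (induction ks) (simp_all add: periodic_conv_grid)

lemma approx_convs:
  "approx g G \<Longrightarrow> continuous_on UNIV G \<Longrightarrow> (\<And>k. k \<in> set ks \<Longrightarrow> unit_kernel \<nu> k) \<Longrightarrow> approx (\<lambda>N. convs \<nu> ks (g N)) G"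
  by (induction ks) (auto intro: approx_conv_grid)

text \<open>By commutativity any factor of the product can be applied last; an equation whose
  operator is that factor is then solved by the product of the others.\<close>

lemma convs_remove1: "k \<in> set ks \<Longrightarrow> convs \<nu> ks g = conv_grid \<nu> k (convs \<nu> (remove1 k ks) g)"
  by (induction ks) (auto simp: conv_grid_commute)

section \<open>The recovery sequence\<close>

text \<open>Through \<open>symm3\<close> this is the reverse triangle inequality; 2 is a crude bound
  for the weight sqrt 2 of the middle component.\<close>

lemma sym_norm_lipschitz: "\<bar>sym_norm p - sym_norm p'\<bar> \<le> 2 * (\<Sum>a\<in>UNIV. \<bar>p $ a - p' $ a\<bar>)"
proof -
  have s: "symm3 p - symm3 p' = symm3 (p - p')" by (simp add: vec_eq_iff forall_2)
  have "\<bar>sym_norm p - sym_norm p'\<bar> \<le> norm (symm3 p - symm3 p')"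
    unfolding norm_symm3[symmetric] by (rule norm_triangle_ineq3)
  also have "\<dots> = sym_norm (p - p')" unfolding s norm_symm3 ..
  also have "\<dots> \<le> \<bar>(p - p') $ 1\<bar> + 2 * \<bar>(p - p') $ 2\<bar> + \<bar>(p - p') $ 3\<bar>"
    unfolding sym_norm_def
  proof (rule real_le_lsqrt)
    define a b c where "a = \<bar>(p - p') $ 1\<bar>" and "b = \<bar>(p - p') $ 2\<bar>" and "c = \<bar>(p - p') $ 3\<bar>"
    have nn: "0 \<le> a" "0 \<le> b" "0 \<le> c" by (auto simp: a_def b_def c_def)
    have "(a + 2 * b + c)\<^sup>2 = a\<^sup>2 + 4 * b\<^sup>2 + c\<^sup>2 + (4 * (a * b) + 2 * (a * c) + 4 * (b * c))"
      by (simp add: power2_eq_square algebra_simps)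
    moreover have "0 \<le> 4 * (a * b) + 2 * (a * c) + 4 * (b * c)" using nn by simp
    ultimately have "a\<^sup>2 + 2 * b\<^sup>2 + c\<^sup>2 \<le> (a + 2 * b + c)\<^sup>2" using zero_le_power2[of b] by linarith
    then show "((p - p') $ 1)\<^sup>2 + 2 * ((p - p') $ 2)\<^sup>2 + ((p - p') $ 3)\<^sup>2 \<le> (\<bar>(p - p') $ 1\<bar> + 2 * \<bar>(p - p') $ 2\<bar> + \<bar>(p - p') $ 3\<bar>)\<^sup>2"
      by (simp add: a_def b_def c_def)
  qed simp
  also have "\<dots> \<le> 2 * (\<Sum>a\<in>UNIV. \<bar>p $ a - p' $ a\<bar>)" by (simp add: sum_3)
  finally show ?thesis .
qed

lemma pderiv_dir_translate:
  assumes "test_function \<phi>"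
  shows "pderiv_dir a (\<lambda>y. \<phi> (y - x)) y = pderiv_dir a \<phi> (y - x)"
  using pderiv_dir_shift[of \<phi> y "- x" a] assms smooth_imp_differentiable by (simp add: test_function_def)

lemma test_function_translate: "test_function \<phi> \<Longrightarrow> test_function (\<lambda>y. \<phi> (y - x))"
  using test_function_shift[of \<phi> "- x"] by simp

text \<open>The correlation of \<phi> with the constant 1 does not depend on \<open>x\<close>, so
  its difference quotients vanish, while they approximate minus the integral in question.\<close>

lemma integral_pderiv_eq_0:
  assumes \<phi>: "test_function \<phi>" shows "(LINT y|lborel. pderiv_dir a \<phi> y) = 0"
proof -
  obtain R where R: "ctest R \<phi>" using test_function_ctest[OF \<phi>] by metis
  note [measurable] = ctest_measurable[OF R] ctest_measurable[OF pderiv_ctest[OF \<phi> R]]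
  have c: "corr \<phi> (\<lambda>y. 1) x = (LINT y|lborel. \<phi> y)" for x by (simp add: corr_alt)
  have "\<bar>corr (pderiv_dir a \<phi>) (\<lambda>y. 1) 0\<bar> \<le> e" if e: "e > 0" for e
  proof -
    obtain d where d: "d > 0" "\<And>t x. t \<noteq> 0 \<Longrightarrow> \<bar>t\<bar> < d \<Longrightarrow> norm x \<le> (0::real) \<Longrightarrow>
      \<bar>(corr \<phi> (\<lambda>y. 1) (x + t *\<^sub>R axis a 1) - corr \<phi> (\<lambda>y. 1) x) / t - (- corr (pderiv_dir a \<phi>) (\<lambda>y. 1) x)\<bar> \<le> e"
      using corr_diff_quot[OF \<phi> loc_int_const[of 1] e, of 0 a] by metis
    from d(2)[of "d / 2" 0] d(1) show ?thesis by (simp add: c)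
  qed
  then have "\<bar>corr (pderiv_dir a \<phi>) (\<lambda>y. 1) 0\<bar> \<le> 0" by (rule field_le_epsilon[where y = 0, simplified]) simp
  then show ?thesis by (simp add: corr_def)
qed

text \<open>Applied in two ways: a kernel of mass one preserves the slope, and a derivative of a
  kernel, which has mass zero, turns the affine plus periodic function into a periodic one.\<close>

lemma corr_affine_shift:
  assumes v: "periodic v" and l: "loc_int (\<lambda>x. q \<bullet> x + v x)" and \<psi>: "ctest R \<psi>"
  shows "corr \<psi> (\<lambda>x. q \<bullet> x + v x) (x + lat k) = corr \<psi> (\<lambda>x. q \<bullet> x + v x) x + (q \<bullet> lat k) * (LINT y|lborel. \<psi> y)"
proof -
  have i: "integrable lborel (\<lambda>y. \<psi> y * (q \<bullet> (y + x) + v (y + x)))"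
    using integrable_shift[OF ctest_shift_integrable[OF \<psi> l, of x], of x] by simp
  have i1: "integrable lborel \<psi>" using integrable_ctest[OF \<psi> loc_int_const[of 1]] by simp
  have "corr \<psi> (\<lambda>x. q \<bullet> x + v x) (x + lat k) = (LINT y|lborel. \<psi> y * (q \<bullet> (y + x) + v (y + x)) + \<psi> y * (q \<bullet> lat k))"
    unfolding corr_alt[OF ctest_measurable[OF \<psi>] loc_int_measurable[OF l]]
    using periodicD[OF v, of "_ + x" k] by (intro Bochner_Integration.integral_cong) (auto simp: algebra_simps inner_add_right)
  also have "\<dots> = corr \<psi> (\<lambda>x. q \<bullet> x + v x) x + (q \<bullet> lat k) * (LINT y|lborel. \<psi> y)"
    unfolding corr_alt[OF ctest_measurable[OF \<psi>] loc_int_measurable[OF l]]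
    using i i1 by simp
  finally show ?thesis .
qed

text \<open>The norm of the mollified distribution at \<open>x\<close> is at most the integral of
  the translated kernel against \<open>M\<close>. Unfolding over the lattice and exchanging the
  integrals leaves, for each point of the cell, the integral of \<rho> over the plane, which is
  1.\<close>

lemma variation_mollify:
  fixes T :: "(real^2 \<Rightarrow> real) \<Rightarrow> 'b::euclidean_space"
  assumes M: "is_measure_with_variation T M" and inv: "lat_invariant M" and \<rho>: "mollifier \<delta> \<rho>"
  shows "(\<integral>\<^sup>+x. ennreal (norm (T (\<lambda>y. \<rho> (y - x)))) \<partial>torus) \<le> emeasure M period_cell"
proof -
  have r: "radon M" using M by (rule variation_radon)
  note sM[measurable_cong] = radon_sets[OF r]
  have sf: "sigma_finite_measure M" using r by (rule radon_sigma_finite)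
  have \<rho>': "ctest \<delta> \<rho>" "test_function \<rho>" "\<And>x. 0 \<le> \<rho> x" "(LINT x|lborel. \<rho> x) = 1"
    using \<rho> by (auto simp: mollifier_def)
  note m\<rho>[measurable] = ctest_measurable[OF \<rho>'(1)]
  obtain \<sigma> where \<sigma>[measurable]: "\<sigma> \<in> borel_measurable borel" and \<sigma>1: "AE x in M. norm (\<sigma> x) = 1"
    and \<sigma>T: "\<And>\<phi>. test_function \<phi> \<Longrightarrow> T \<phi> = (LINT x|M. \<phi> x *\<^sub>R \<sigma> x)"
    using M unfolding is_measure_with_variation_def by blast
  interpret C: sigma_finite_measure "on_cell M" using sM sf by (rule sigma_finite_on_cell)
  interpret pair_sigma_finite torus "on_cell M"
    by (intro pair_sigma_finite.intro C.sigma_finite_measure_axioms prob_space_imp_sigma_finite prob_space_torus)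
  interpret Z: sigma_finite_measure Z2 by (rule sigma_finite_Z2)
  have mZ: "(\<lambda>z. \<integral>\<^sup>+k. ennreal (\<rho> (snd z + lat k - fst z)) \<partial>Z2) \<in> borel_measurable (borel \<Otimes>\<^sub>M borel)"
  proof -
    have "(\<lambda>(k, z). ennreal (\<rho> (snd z + lat k - fst z))) \<in> borel_measurable (Z2 \<Otimes>\<^sub>M (borel \<Otimes>\<^sub>M borel))"
      by (rule measurable_pair_measure_countable1) auto
    from measurable_pair_swap[OF this]
    have "(\<lambda>(z, k). ennreal (\<rho> (snd z + lat k - fst z))) \<in> borel_measurable ((borel \<Otimes>\<^sub>M borel) \<Otimes>\<^sub>M Z2)"
      by (simp add: split_beta')
    then show ?thesis by (rule Z.borel_measurable_nn_integral)
  qed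
  have "(\<integral>\<^sup>+x. ennreal (norm (T (\<lambda>y. \<rho> (y - x)))) \<partial>torus) \<le> (\<integral>\<^sup>+x. (\<integral>\<^sup>+y. (\<integral>\<^sup>+k. ennreal (\<rho> (y + lat k - x)) \<partial>Z2) \<partial>on_cell M) \<partial>torus)"
  proof (rule nn_integral_mono)
    fix x
    have c: "ctest (\<delta> + norm x) (\<lambda>y. \<rho> (y - x))" by (rule ctest_translate[OF \<rho>'(1) order_refl])
    have "integrable M (\<lambda>y. indicator (cball 0 (\<delta> + norm x)) y *\<^sub>R \<sigma> y)"
    proof (rule Bochner_Integration.integrable_bound[where f = "indicator (cball 0 (\<delta> + norm x)) :: _ \<Rightarrow> real"])
      show "integrable M (indicator (cball 0 (\<delta> + norm x)) :: _ \<Rightarrow> real)"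
        using radon_compact[OF r compact_cball] sM by (intro integrable_real_indicator) auto
      show "(\<lambda>y. indicator (cball 0 (\<delta> + norm x)) y *\<^sub>R \<sigma> y) \<in> borel_measurable M"
        using sM by (intro borel_measurable_scaleR borel_measurable_indicator) auto
      show "AE y in M. norm (indicator (cball 0 (\<delta> + norm x)) y *\<^sub>R \<sigma> y) \<le> norm (indicator (cball 0 (\<delta> + norm x)) y :: real)"
        using \<sigma>1 by eventually_elim simp
    qed
    then have i: "integrable M (\<lambda>y. \<rho> (y - x) *\<^sub>R \<sigma> y)"
      by (rule radon_ctest_integrable[OF r c \<sigma>])
    have "ennreal (norm (T (\<lambda>y. \<rho> (y - x)))) \<le> (\<integral>\<^sup>+y. ennreal (norm (\<rho> (y - x) *\<^sub>R \<sigma> y)) \<partial>M)"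
      unfolding \<sigma>T[OF test_function_translate[OF \<rho>'(2)]] using i by (rule integral_norm_bound_ennreal)
    also have "\<dots> = (\<integral>\<^sup>+y. ennreal (\<rho> (y - x)) \<partial>M)"
      using \<sigma>1 \<rho>'(3) by (intro nn_integral_cong_AE) (auto elim!: eventually_mono)
    also have "\<dots> = (\<integral>\<^sup>+y. (\<integral>\<^sup>+k. ennreal (\<rho> (y + lat k - x)) \<partial>Z2) \<partial>on_cell M)"
      by (rule nn_integral_unfold[OF sM sf inv]) measurable
    finally show "ennreal (norm (T (\<lambda>y. \<rho> (y - x)))) \<le> (\<integral>\<^sup>+y. (\<integral>\<^sup>+k. ennreal (\<rho> (y + lat k - x)) \<partial>Z2) \<partial>on_cell M)" .
  qed
  also have "\<dots> = (\<integral>\<^sup>+y. (\<integral>\<^sup>+x. (\<integral>\<^sup>+k. ennreal (\<rho> (y + lat k - x)) \<partial>Z2) \<partial>torus) \<partial>on_cell M)"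
    by (rule Fubini'[symmetric]) (use mZ sM in \<open>simp add: split_beta' cong: measurable_cong_sets sets_pair_measure_cong\<close>)
  also have "\<dots> = (\<integral>\<^sup>+y. 1 \<partial>on_cell M)"
  proof (rule nn_integral_cong)
    fix y
    have "(\<integral>\<^sup>+x. (\<integral>\<^sup>+k. ennreal (\<rho> (y + lat k - x)) \<partial>Z2) \<partial>torus) = (\<integral>\<^sup>+x. (\<integral>\<^sup>+k. ennreal (\<rho> (y - (x + lat k))) \<partial>Z2) \<partial>torus)"
      using nn_integral_Z2_uminus[of "\<lambda>k. ennreal (\<rho> (y + lat k - x))" for x] by (simp add: lat_uminus diff_diff_eq add.commute)
    also have "\<dots> = (\<integral>\<^sup>+x. ennreal (\<rho> (y - x)) \<partial>lborel)"
      unfolding torus_on_cell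
      by (rule nn_integral_unfold[symmetric]) (auto simp: lat_invariant_lborel lborel.sigma_finite_measure_axioms)
    also have "\<dots> = (\<integral>\<^sup>+x. ennreal (\<rho> x) \<partial>lborel)"
    \<comment> \<open>Reflection at a point preserves Lebesgue measure: the affine map has
      determinant of modulus 1.\<close>
    proof -
      have "(\<integral>\<^sup>+x. ennreal (\<rho> x) \<partial>lborel) = (\<integral>\<^sup>+x. ennreal (\<rho> x) \<partial>density (distr lborel borel (\<lambda>x. y + (-1) *\<^sub>R x)) (\<lambda>_. ennreal (\<bar>-1\<bar> ^ DIM(real^2))))"
        using lborel_affine[of "-1" y] by simp
      also have "\<dots> = (\<integral>\<^sup>+x. ennreal (\<rho> (y - x)) \<partial>lborel)"
        by (simp add: nn_integral_density nn_integral_distr)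
      finally show ?thesis by simp
    qed
    also have "\<dots> = 1"
      using integrable_ctest[OF \<rho>'(1) loc_int_const[of 1]] \<rho>'(3,4) by (subst nn_integral_eq_integral) auto
    finally show "(\<integral>\<^sup>+x. (\<integral>\<^sup>+k. ennreal (\<rho> (y + lat k - x)) \<partial>Z2) \<partial>torus) = 1" .
  qed
  also have "\<dots> = emeasure M period_cell"
    using sM radon_space[OF r] cell_borel by (simp add: on_cell_def emeasure_density cong: measurable_cong_sets)
  finally show ?thesis .
qed

lemma approx_diff_quot:
  assumes \<psi>: "test_function \<psi>" and f: "loc_int f"
    and s: "s \<longlonglongrightarrow> 0" "\<And>N. N \<ge> 1 \<Longrightarrow> s N \<noteq> 0"
  shows "approx (\<lambda>N i j. (corr \<psi> f (hvec N i j + s N *\<^sub>R axis a 1) - corr \<psi> f (hvec N i j)) / s N) (\<lambda>x. - corr (pderiv_dir a \<psi>) f x)"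
  unfolding approx_def
proof (intro allI impI)
  fix R e :: real assume e: "e > 0"
  obtain d where d: "d > 0" "\<And>t x. t \<noteq> 0 \<Longrightarrow> \<bar>t\<bar> < d \<Longrightarrow> norm x \<le> R \<Longrightarrow>
    \<bar>(corr \<psi> f (x + t *\<^sub>R axis a 1) - corr \<psi> f x) / t - (- corr (pderiv_dir a \<psi>) f x)\<bar> \<le> e"
    using corr_diff_quot[OF \<psi> f e] by metis
  show "\<forall>\<^sub>F N in sequentially. \<forall>i j. norm (hvec N i j) \<le> R \<longrightarrow>
    \<bar>(corr \<psi> f (hvec N i j + s N *\<^sub>R axis a 1) - corr \<psi> f (hvec N i j)) / s N - - corr (pderiv_dir a \<psi>) f (hvec N i j)\<bar> \<le> e"
    using tendstoD[OF s(1) d(1)] eventually_ge_at_top[of 1]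
    by eventually_elim (use d(2) s(2) in \<open>simp add: dist_real_def\<close>)
qed

lemma approx_eventually_cong:
  assumes "approx g G" "\<And>N i j. N \<ge> 1 \<Longrightarrow> g N i j = g' N i j" shows "approx g' G"
  unfolding approx_def
proof (intro allI impI)
  fix R e :: real assume "e > 0"
  from approxD[OF assms(1) this, of R] eventually_ge_at_top[of 1]
  show "\<forall>\<^sub>F N in sequentially. \<forall>i j. norm (hvec N i j) \<le> R \<longrightarrow> \<bar>g' N i j - G (hvec N i j)\<bar> \<le> e"
    by eventually_elim (use assms(2) in simp)
qed

lemma approx_grid_differences:
  assumes \<psi>: "test_function \<psi>" and f: "loc_int f"
  defines "g \<equiv> \<lambda>N i j. corr \<psi> f (hvec N i j)"
  shows "approx (\<lambda>N i j. (g N (i + 1) j - g N i j) / (1 / real N)) (\<lambda>x. - corr (pderiv_dir 1 \<psi>) f x)"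
    "approx (\<lambda>N i j. (g N i (j + 1) - g N i j) / (1 / real N)) (\<lambda>x. - corr (pderiv_dir 2 \<psi>) f x)"
    "approx (\<lambda>N i j. (g N i j - g N (i - 1) j) / (1 / real N)) (\<lambda>x. - corr (pderiv_dir 1 \<psi>) f x)"
    "approx (\<lambda>N i j. (g N i j - g N i (j - 1)) / (1 / real N)) (\<lambda>x. - corr (pderiv_dir 2 \<psi>) f x)"
proof -
  have s: "(\<lambda>N. 1 / real N) \<longlonglongrightarrow> 0" "(\<lambda>N. - (1 / real N)) \<longlonglongrightarrow> 0"
    using lim_1_over_n tendsto_minus[OF lim_1_over_n] by auto
  have h: "hvec N (i + m) (j + n) = hvec N i j + hvec N m n" for N i j m n
    by (simp add: vec2_eq_iff add_divide_distrib)
  have e: "hvec N (i + 1) j = hvec N i j + (1 / real N) *\<^sub>R axis 1 1" "hvec N i (j + 1) = hvec N i j + (1 / real N) *\<^sub>R axis 2 1"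
    "hvec N (i - 1) j = hvec N i j + (- (1 / real N)) *\<^sub>R axis 1 1" "hvec N i (j - 1) = hvec N i j + (- (1 / real N)) *\<^sub>R axis 2 1" for N i j
    using h[of N i 1 j 0] h[of N i 0 j 1] h[of N i "-1" j 0] h[of N i 0 j "-1"] by (simp_all add: hvec_axis)
  show "approx (\<lambda>N i j. (g N (i + 1) j - g N i j) / (1 / real N)) (\<lambda>x. - corr (pderiv_dir 1 \<psi>) f x)"
    unfolding g_def e by (rule approx_diff_quot[OF \<psi> f s(1)]) simp
  show "approx (\<lambda>N i j. (g N i (j + 1) - g N i j) / (1 / real N)) (\<lambda>x. - corr (pderiv_dir 2 \<psi>) f x)"
    unfolding g_def e by (rule approx_diff_quot[OF \<psi> f s(1)]) simp
  show "approx (\<lambda>N i j. (g N i j - g N (i - 1) j) / (1 / real N)) (\<lambda>x. - corr (pderiv_dir 1 \<psi>) f x)"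
    unfolding g_def e
    by (rule approx_eventually_cong[OF approx_diff_quot[OF \<psi> f s(2), of 1]]) (auto simp: field_simps)
  show "approx (\<lambda>N i j. (g N i j - g N i (j - 1)) / (1 / real N)) (\<lambda>x. - corr (pderiv_dir 2 \<psi>) f x)"
    unfolding g_def e
    by (rule approx_eventually_cong[OF approx_diff_quot[OF \<psi> f s(2), of 2]]) (auto simp: field_simps)
qed

text \<open>All filters except the first carry zero, and applying the first kernel of a component
  restores the factor missing from its product. Each component lacks a different factor, yet all end
  with the same full product.\<close>

lemma adjoint_interp_single:
  assumes "I \<ge> 1" and V: "\<And>a i j. V i j $ a = convs \<nu> (remove1 (\<kappa> a 1) ks) (g a) i j"
    and ks: "\<And>a. \<kappa> a 1 \<in> set ks"
  shows "adjoint_interp \<nu> I \<kappa> (\<lambda>r. if r = 1 then V else (\<lambda>i j. 0)) i j $ a = convs \<nu> ks (g a) i j"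
proof -
  have "adjoint_interp \<nu> I \<kappa> (\<lambda>r. if r = 1 then V else (\<lambda>i j. 0)) i j $ a =
     (\<Sum>r=1..I. if r = 1 then conv_grid \<nu> (\<kappa> a 1) (\<lambda>i j. V i j $ a) i j else 0)"
    unfolding adjoint_interp_def vec_lambda_beta by (intro sum.cong refl) (simp add: conv_grid_def)
  also have "\<dots> = conv_grid \<nu> (\<kappa> a 1) (\<lambda>i j. V i j $ a) i j" using assms(1) by simp
  also have "\<dots> = convs \<nu> ks (g a) i j" using convs_remove1[OF ks] by (simp add: V)
  finally show ?thesis .
qed

text \<open>The sampled fields are convolved with all five kernels of the first filter. Since convolutions commute, dropping
  one kernel from this product solves the constraints exactly, with only the first filter active.\<close>

lemma recovery_core:
  fixes \<alpha>0 \<alpha>1 :: real and \<xi> :: "3 kernels" and \<eta> :: "2 kernels" and w :: "real^2 \<Rightarrow> real^2"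
  assumes \<alpha>: "\<alpha>0 > 0" "\<alpha>1 > 0" and n: "nK \<ge> 1" "nL \<ge> 1"
    and \<xi>: "normalized_kernels \<nu> nK \<xi>" and \<eta>: "normalized_kernels \<nu> nL \<eta>"
    and v: "periodic v" and l: "loc_int (\<lambda>x. q \<bullet> x + v x)"
    and w: "periodic w" "w \<in> borel_measurable borel" "integrable torus w"
    and \<rho>: "mollifier \<delta> \<rho>"
  defines "uf \<equiv> \<lambda>x. q \<bullet> x + v x"
  defines "GA \<equiv> \<lambda>x. \<chi> a. - corr (pderiv_dir a \<rho>) uf x - corr \<rho> (\<lambda>x. w x $ a) x"
  defines "X \<equiv> \<lambda>a b x. - corr (pderiv_dir b \<rho>) (\<lambda>x. w x $ a) x"
  defines "GB \<equiv> \<lambda>x. vector [X 1 1 x, (X 1 2 x + X 2 1 x) / 2, X 2 2 x] :: real^3"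
  obtains U where "\<And>N. N \<ge> 1 \<Longrightarrow> discrete_affine_plus_periodic N (U N)" "approx U (corr \<rho> uf)"
    "continuous_on UNIV (corr \<rho> uf)"
    "integrable torus (\<lambda>x. norm (GA x))" "integrable torus (\<lambda>x. sym_norm (GB x))"
    "\<And>e. e > 0 \<Longrightarrow> \<forall>\<^sub>F N in sequentially. discrete_TGV \<alpha>0 \<alpha>1 \<nu> nK \<xi> nL \<eta> N (U N) \<le>
       ennreal (\<alpha>1 * (LINT x|torus. norm (GA x)) + \<alpha>0 * (LINT x|torus. sym_norm (GB x)) + e)"
proof -
  have \<rho>': "ctest \<delta> \<rho>" "test_function \<rho>" "(LINT x|lborel. \<rho> x) = 1"
    using \<rho> by (auto simp: mollifier_def)
  note m\<rho> = ctest_measurable[OF \<rho>'(1)]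
  have d\<rho>: "ctest \<delta> (pderiv_dir a \<rho>)" "test_function (pderiv_dir a \<rho>)" for a
    using pderiv_ctest[OF \<rho>'(2,1)] test_function_pderiv[OF \<rho>'(2)] by auto
  have luf: "loc_int uf" unfolding uf_def by (rule l)
  have lw: "loc_int w" using w by (rule loc_int_periodic)
  have lwa: "loc_int (\<lambda>x. w x $ a)" for a using lw by (rule loc_int_nth)
  have pwa: "periodic (\<lambda>x. w x $ a)" for a using w(1) by (simp add: periodic_def)
  define ks where "ks = [\<eta> 1 1, \<eta> 2 1, \<xi> 1 1, \<xi> 2 1, \<xi> 3 1]"
  have k\<eta>: "\<eta> a 1 \<in> set ks" for a using UNIV_2_cases[of a] by (auto simp: ks_def)
  have k\<xi>: "\<xi> a 1 \<in> set ks" for a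
  proof -
    have "a = 1 \<or> a = 2 \<or> a = 3" using UNIV_3 by blast
    then show ?thesis by (auto simp: ks_def)
  qed
  have unit: "unit_kernel \<nu> k" if "k \<in> set ks" for k
    using that \<xi> \<eta> n by (auto simp: ks_def normalized_kernels_def unit_kernel_def)
  have unit': "unit_kernel \<nu> k" if "k \<in> set (remove1 k' ks)" for k k'
    using that unit set_remove1_subset by fast
  define c0 where "c0 = corr \<rho> uf"
  define u0 where "u0 N i j = c0 (hvec N i j)" for N i j
  define w0 where "w0 N a i j = corr \<rho> (\<lambda>x. w x $ a) (hvec N i j)" for N a i j
  \<comment> \<open>The image and the field receive the same full product of kernels. The product
    commutes with the difference operators, so the right-hand sides of both constraints are this
    product applied to the sampled quantities \<open>g1\<close> and \<open>g2\<close>.\<close>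
  define U where "U N = convs \<nu> ks (u0 N)" for N
  define W where "W N i j = (\<chi> a. convs \<nu> ks (w0 N a) i j)" for N i j
  have cc0: "continuous_on UNIV c0" unfolding c0_def by (rule corr_continuous[OF \<rho>'(2) luf])
  have hN: "hvec N (i + int N) j = hvec N i j + lat (1, 0)" "hvec N i (j + int N) = hvec N i j + lat (0, 1)"
    if "N \<ge> 1" for N i j using that by (simp_all add: vec2_eq_iff add_divide_distrib)
  have c0s: "c0 (x + lat k) = c0 x + q \<bullet> lat k" for x k
    unfolding c0_def uf_def using corr_affine_shift[OF v l \<rho>'(1)] \<rho>'(3) by simp
  have u0s: "u0 N (i + int N) j = u0 N i j + q $ 1" "u0 N i (j + int N) = u0 N i j + q $ 2" if "N \<ge> 1" for N i j
    unfolding u0_def hN[OF that] c0s by (simp_all add: inner_vec_def sum_2)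
  \<comment> \<open>Kernels of mass one preserve constants, so the convolved image keeps the
    increments \<open>q\<close> over one period.\<close>
  have cadd: "convs \<nu> ks (\<lambda>i j. g i j + c) = (\<lambda>i j. convs \<nu> ks g i j + c)" for g c
    using convs_diff[of \<nu> ks g "\<lambda>i j. - c"] convs_const[OF unit, of ks "- c"] by simp
  have Us: "U N (i + int N) j = U N i j + q $ 1" "U N i (j + int N) = U N i j + q $ 2" if N: "N \<ge> 1" for N i j
  proof -
    have "(\<lambda>i j. convs \<nu> ks (u0 N) (i + int N) (j + 0)) = (\<lambda>i j. convs \<nu> ks (u0 N) i j + q $ 1)"
      unfolding convs_shift[symmetric] using u0s(1)[OF N] by (simp add: cadd)
    then show "U N (i + int N) j = U N i j + q $ 1" by (simp add: U_def fun_eq_iff)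
    have "(\<lambda>i j. convs \<nu> ks (u0 N) (i + 0) (j + int N)) = (\<lambda>i j. convs \<nu> ks (u0 N) i j + q $ 2)"
      unfolding convs_shift[symmetric] using u0s(2)[OF N] by (simp add: cadd)
    then show "U N i (j + int N) = U N i j + q $ 2" by (simp add: U_def fun_eq_iff)
  qed
  have app: "discrete_affine_plus_periodic N (U N)" if N: "N \<ge> 1" for N
    unfolding discrete_affine_plus_periodic_def periodic_grid_def
    using N by (intro exI[of _ q]) (auto simp: Us[OF N] inner_vec_def sum_2 add_divide_distrib distrib_left)
  have apU: "approx U c0"
    unfolding U_def[abs_def] u0_def[abs_def] by (rule approx_convs[OF approx_sample cc0 unit])
  define g1 where "g1 N a i j = discrete_grad (1 / real N) (u0 N) i j $ a - w0 N a i j" for N a i j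
  define VL where "VL N i j = (\<chi> a. convs \<nu> (remove1 (\<eta> a 1) ks) (g1 N a) i j)" for N i j
  define g2 where "g2 N c i j = discrete_sym_grad (1 / real N) (\<lambda>i j. \<chi> a. w0 N a i j) i j $ c" for N c i j
  define VK where "VK N i j = (\<chi> c. convs \<nu> (remove1 (\<xi> c 1) ks) (g2 N c) i j)" for N i j
  have pw0: "periodic_grid N (w0 N a)" if "N \<ge> 1" for N a
    unfolding periodic_grid_def w0_def hN[OF that]
    using periodicD[OF periodic_corr[OF pwa loc_int_measurable[OF lwa] m\<rho>]] by simp
  have pg1: "periodic_grid N (g1 N a)" if N: "N \<ge> 1" for N a
  proof -
    have "u0 N (i + int N + 1) j = u0 N (i + 1) j + q $ 1" "u0 N i (j + int N + 1) = u0 N i (j + 1) + q $ 2" for i j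
      using u0s(1)[OF N, of "i + 1" j] u0s(2)[OF N, of i "j + 1"] by (simp_all add: ac_simps)
    then show ?thesis
      using UNIV_2_cases[of a] periodic_grid_simps[OF pw0[OF N]]
      unfolding periodic_grid_def by (auto simp: g1_def discrete_grad_def u0s[OF N])
  qed
  have pg2: "periodic_grid N (g2 N c)" if N: "N \<ge> 1" for N c
    unfolding periodic_grid_def by (simp add: g2_def discrete_sym_grad_def periodic_grid_simps[OF pw0[OF N]])
  have pVL: "periodic_grid N (VL N)" if N: "N \<ge> 1" for N
    using periodic_convs[OF pg1[OF N]] by (simp add: periodic_grid_def VL_def)
  have pVK: "periodic_grid N (VK N)" if N: "N \<ge> 1" for N
    using periodic_convs[OF pg2[OF N]] by (simp add: periodic_grid_def VK_def)
  have pW: "periodic_grid N (W N)" if N: "N \<ge> 1" for N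
    using periodic_convs[OF pw0[OF N]] by (simp add: periodic_grid_def W_def)
  have sh: "convs \<nu> ks g (i + a) (j + b) = convs \<nu> ks (\<lambda>i j. g (i + a) (j + b)) i j" for g i j a b
    by (simp add: convs_shift)
  have cdiv: "convs \<nu> ks (\<lambda>i j. g i j / c) = (\<lambda>i j. convs \<nu> ks g i j / c)" for g c
    using convs_cmult[of \<nu> ks "1 / c" g] by simp
  have cplus: "convs \<nu> ks (\<lambda>i j. g i j + g' i j) = (\<lambda>i j. convs \<nu> ks g i j + convs \<nu> ks g' i j)" for g g'
    using convs_diff[of \<nu> ks g "\<lambda>i j. (-1) * g' i j"] convs_cmult[of \<nu> ks "-1" g'] by simp
  have DL: "convs \<nu> ks (g1 N a) i j = (discrete_grad (1 / real N) (U N) i j - W N i j) $ a" for N a i j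
  proof -
    have g1': "g1 N 1 = (\<lambda>i j. (u0 N (i + 1) j - u0 N i j) / (1 / real N) - w0 N 1 i j)"
      "g1 N 2 = (\<lambda>i j. (u0 N i (j + 1) - u0 N i j) / (1 / real N) - w0 N 2 i j)"
      by (simp_all add: g1_def fun_eq_iff discrete_grad_def)
    have "convs \<nu> ks (g1 N 1) i j = (discrete_grad (1 / real N) (U N) i j - W N i j) $ 1"
      unfolding g1' convs_diff cdiv using sh[of "u0 N" i 1 j 0] by (simp add: discrete_grad_def W_def U_def)
    moreover have "convs \<nu> ks (g1 N 2) i j = (discrete_grad (1 / real N) (U N) i j - W N i j) $ 2"
      unfolding g1' convs_diff cdiv using sh[of "u0 N" i 0 j 1] by (simp add: discrete_grad_def W_def U_def)
    ultimately show ?thesis using UNIV_2_cases[of a] by auto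
  qed
  have DK: "convs \<nu> ks (g2 N c) i j = discrete_sym_grad (1 / real N) (W N) i j $ c" for N c i j
  proof -
    have g2': "g2 N 1 = (\<lambda>i j. (w0 N 1 i j - w0 N 1 (i - 1) j) / (1 / real N))"
      "g2 N 2 = (\<lambda>i j. (w0 N 1 i (j + 1) - w0 N 1 i j + w0 N 2 (i + 1) j - w0 N 2 i j) / (2 * (1 / real N)))"
      "g2 N 3 = (\<lambda>i j. (w0 N 2 i j - w0 N 2 i (j - 1)) / (1 / real N))"
      by (simp_all add: g2_def fun_eq_iff discrete_sym_grad_def)
    have "convs \<nu> ks (g2 N 1) i j = discrete_sym_grad (1 / real N) (W N) i j $ 1"
      unfolding g2' convs_diff cdiv using sh[of "w0 N 1" i "-1" j 0] by (simp add: discrete_sym_grad_def W_def)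
    moreover have "convs \<nu> ks (g2 N 2) i j = discrete_sym_grad (1 / real N) (W N) i j $ 2"
      unfolding g2' convs_diff cplus cdiv using sh[of "w0 N 1" i 0 j 1] sh[of "w0 N 2" i 1 j 0]
      by (simp add: discrete_sym_grad_def W_def)
    moreover have "convs \<nu> ks (g2 N 3) i j = discrete_sym_grad (1 / real N) (W N) i j $ 3"
      unfolding g2' convs_diff cdiv using sh[of "w0 N 2" i 0 j "-1"] by (simp add: discrete_sym_grad_def W_def)
    moreover have "c = 1 \<or> c = 2 \<or> c = 3" using UNIV_3 by blast
    ultimately show ?thesis by auto
  qed
  have ag1: "approx (\<lambda>N. g1 N a) (\<lambda>x. GA x $ a)" for a
  proof -
    have "approx (\<lambda>N i j. discrete_grad (1 / real N) (u0 N) i j $ a) (\<lambda>x. - corr (pderiv_dir a \<rho>) uf x)"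
      using UNIV_2_cases[of a] approx_grid_differences(1,2)[OF \<rho>'(2) luf]
      by (auto simp: discrete_grad_def u0_def c0_def)
    from approx_diff[OF this approx_sample[of "corr \<rho> (\<lambda>x. w x $ a)"]] show ?thesis
      by (simp add: GA_def g1_def[abs_def] w0_def)
  qed
  have ag2: "approx (\<lambda>N. g2 N c) (\<lambda>x. GB x $ c)" for c
  proof -
    note d1 = approx_grid_differences[OF \<rho>'(2) lwa[of 1]] and d2 = approx_grid_differences[OF \<rho>'(2) lwa[of 2]]
    have "approx (\<lambda>N. g2 N 1) (\<lambda>x. GB x $ 1)"
      using d1(3) by (simp add: g2_def[abs_def] discrete_sym_grad_def GB_def X_def w0_def)
    moreover have "approx (\<lambda>N. g2 N 3) (\<lambda>x. GB x $ 3)"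
      using d2(4) by (simp add: g2_def[abs_def] discrete_sym_grad_def GB_def X_def w0_def)
    moreover have "approx (\<lambda>N. g2 N 2) (\<lambda>x. GB x $ 2)"
    proof -
      from approx_cmult[OF approx_add[OF d1(2) d2(1)], of "1 / 2"]
      have "approx (\<lambda>N i j. 1 / 2 * ((w0 N 1 i (j + 1) - w0 N 1 i j) / (1 / real N) + (w0 N 2 (i + 1) j - w0 N 2 i j) / (1 / real N)))
         (\<lambda>x. 1 / 2 * (X 1 2 x + X 2 1 x))" by (simp only: w0_def X_def)
      moreover have "(\<lambda>x. 1 / 2 * (X 1 2 x + X 2 1 x)) = (\<lambda>x. GB x $ 2)" by (simp add: GB_def)
      moreover have "(\<lambda>N i j. 1 / 2 * ((w0 N 1 i (j + 1) - w0 N 1 i j) / (1 / real N) + (w0 N 2 (i + 1) j - w0 N 2 i j) / (1 / real N))) = (\<lambda>N. g2 N 2)"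
        by (simp add: fun_eq_iff g2_def discrete_sym_grad_def field_simps)
      ultimately show ?thesis by simp
    qed
    moreover have "c = 1 \<or> c = 2 \<or> c = 3" using UNIV_3 by blast
    ultimately show ?thesis by auto
  qed
  have cGA: "continuous_on UNIV (\<lambda>x. GA x $ a)" for a
    unfolding GA_def vec_lambda_beta
    by (intro continuous_intros corr_continuous \<rho>'(2) d\<rho> luf lwa)
  have cX: "continuous_on UNIV (X a b)" for a b
    unfolding X_def by (intro continuous_intros corr_continuous d\<rho> lwa)
  have cGB: "continuous_on UNIV (\<lambda>x. GB x $ c)" for c
  proof -
    have "c = 1 \<or> c = 2 \<or> c = 3" using UNIV_3 by blast
    moreover have "continuous_on UNIV (\<lambda>x. (X 1 2 x + X 2 1 x) / 2)" by (intro continuous_intros cX) simp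
    ultimately show ?thesis using cX by (auto simp: GB_def)
  qed
  have pGA: "periodic GA"
  proof -
    \<comment> \<open>The derivative of the mollifier has integral zero, so the affine part of the
      image contributes no increment.\<close>
    have "corr (pderiv_dir a \<rho>) uf (x + lat k) = corr (pderiv_dir a \<rho>) uf x" for a x k
      unfolding uf_def using corr_affine_shift[OF v l d\<rho>(1)] integral_pderiv_eq_0[OF \<rho>'(2)] by simp
    moreover have "corr \<rho> (\<lambda>x. w x $ a) (x + lat k) = corr \<rho> (\<lambda>x. w x $ a) x" for a x k
      by (rule periodicD[OF periodic_corr[OF pwa loc_int_measurable[OF lwa] m\<rho>]])
    ultimately show ?thesis by (simp add: periodic_def GA_def)
  qed
  have pGB: "periodic GB"
  proof -
    have "X a b (x + lat k) = X a b x" for a b x k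
      unfolding X_def using periodicD[OF periodic_corr[OF pwa loc_int_measurable[OF lwa] ctest_measurable[OF d\<rho>(1)]]] by simp
    then show ?thesis by (simp add: periodic_def GB_def)
  qed
  have nGA: "cper (\<lambda>x. norm (GA x))"
  proof -
    have "continuous_on UNIV GA" using cGA continuous_on_vec_lambda[of UNIV "\<lambda>a x. GA x $ a"] by simp
    then show ?thesis using pGA by (auto simp: cper_def periodic_def intro!: continuous_intros)
  qed
  have nGB: "cper (\<lambda>x. sym_norm (GB x))"
    unfolding cper_def sym_norm_def using pGB
    by (intro conjI continuous_intros cGB) (auto simp: periodic_def)
  have aVL: "approx (\<lambda>N i j. norm (VL N i j)) (\<lambda>x. norm (GA x))"
  proof (rule approx_lipschitz[where L = 1])
    show "approx (\<lambda>N i j. VL N i j $ a) (\<lambda>x. GA x $ a)" for a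
      using approx_convs[OF ag1 cGA unit'] by (simp add: VL_def)
    show "\<bar>norm p - norm p'\<bar> \<le> 1 * (\<Sum>a\<in>UNIV. \<bar>p $ a - p' $ a\<bar>)" for p p' :: "real^2"
      using order_trans[OF norm_triangle_ineq3 norm_le_l1_cart] by simp
  qed simp
  have aVK: "approx (\<lambda>N i j. sym_norm (VK N i j)) (\<lambda>x. sym_norm (GB x))"
  proof (rule approx_lipschitz[where L = 2])
    show "approx (\<lambda>N i j. VK N i j $ a) (\<lambda>x. GB x $ a)" for a
      using approx_convs[OF ag2 cGB unit'] by (simp add: VK_def)
  qed (use sym_norm_lipschitz in auto)
  define E where "E N = \<alpha>1 * av2 N (\<lambda>i j. norm (VL N i j)) + \<alpha>0 * av2 N (\<lambda>i j. sym_norm (VK N i j))" for N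
  have limE: "E \<longlonglongrightarrow> \<alpha>1 * (LINT x|torus. norm (GA x)) + \<alpha>0 * (LINT x|torus. sym_norm (GB x))"
    unfolding E_def[abs_def]
  proof (intro tendsto_intros)
    show "(\<lambda>N. av2 N (\<lambda>i j. norm (VL N i j))) \<longlonglongrightarrow> (LINT x|torus. norm (GA x))"
      by (rule approx_av2[OF aVL nGA]) (use pVL in \<open>simp add: periodic_grid_def\<close>)
    show "(\<lambda>N. av2 N (\<lambda>i j. sym_norm (VK N i j))) \<longlonglongrightarrow> (LINT x|torus. sym_norm (GB x))"
      by (rule approx_av2[OF aVK nGB]) (use pVK in \<open>simp add: periodic_grid_def\<close>)
  qed
  have TE: "discrete_TGV \<alpha>0 \<alpha>1 \<nu> nK \<xi> nL \<eta> N (U N) \<le> ennreal (E N)" if N: "N \<ge> 1" for N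
  proof -
    define vL where "vL r = (if r = 1 then VL N else (\<lambda>i j. 0))" for r :: nat
    define vK where "vK r = (if r = 1 then VK N else (\<lambda>i j. 0))" for r :: nat
    have p: "periodic_grid N (vL r)" "periodic_grid N (vK r)" for r
      using pVL[OF N] pVK[OF N] by (auto simp: vL_def vK_def periodic_grid_def)
    have eL: "adjoint_interp \<nu> nL \<eta> vL i j = discrete_grad (1 / real N) (U N) i j - W N i j" for i j
      unfolding vec_eq_iff vL_def
      by (subst adjoint_interp_single[where \<kappa> = \<eta> and ks = ks and g = "g1 N", OF n(2) _ k\<eta>]) (simp_all only: VL_def vec_lambda_beta DL, simp)
    have eK: "adjoint_interp \<nu> nK \<xi> vK i j = discrete_sym_grad (1 / real N) (W N) i j" for i j
      unfolding vec_eq_iff vK_def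
      by (subst adjoint_interp_single[where \<kappa> = \<xi> and ks = ks and g = "g2 N", OF n(1) _ k\<xi>]) (simp_all only: VK_def vec_lambda_beta DK, simp)
    have z0: "sym_norm 0 = 0" by (simp add: sym_norm_def)
    have "(\<Sum>r=1..nL. norm (vL r i j)) = (\<Sum>r=1..nL. if r = 1 then norm (VL N i j) else 0)" for i j
      by (intro sum.cong refl) (auto simp: vL_def)
    then have sL: "(\<Sum>r=1..nL. norm (vL r i j)) = norm (VL N i j)" for i j using n(2) by simp
    have "(\<Sum>r=1..nK. sym_norm (vK r i j)) = (\<Sum>r=1..nK. if r = 1 then sym_norm (VK N i j) else 0)" for i j
      by (intro sum.cong refl) (auto simp: vK_def z0)
    then have sK: "(\<Sum>r=1..nK. sym_norm (vK r i j)) = sym_norm (VK N i j)" for i j using n(1) by simp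
    have "E N = energy \<alpha>0 \<alpha>1 N nK nL vK vL"
      using Z_norm_av2[of N norm nL vL] Z_norm_av2[of N sym_norm nK vK]
      unfolding E_def energy_def sL sK by (simp only: mult.assoc mult.left_commute[of _ \<alpha>1] mult.left_commute[of _ \<alpha>0])
    moreover have "feasible \<nu> nK \<xi> nL \<eta> N (U N) (W N) vK vL"
      using p pW[OF N] eL eK by (simp add: feasible_def)
    ultimately show ?thesis unfolding discrete_TGV_altdef by (intro Inf_lower) auto
  qed
  show thesis
  proof (rule that[of U])
    show "approx U (corr \<rho> uf)" "continuous_on UNIV (corr \<rho> uf)" using apU cc0 by (simp_all add: c0_def)
    show "integrable torus (\<lambda>x. norm (GA x))" "integrable torus (\<lambda>x. sym_norm (GB x))"
      using nGA nGB by (auto intro: integrable_cper_torus)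
    fix e :: real assume e: "e > 0"
    have "\<forall>\<^sub>F N in sequentially. E N < \<alpha>1 * (LINT x|torus. norm (GA x)) + \<alpha>0 * (LINT x|torus. sym_norm (GB x)) + e"
      by (rule order_tendstoD(2)[OF limE]) (use e in simp)
    then show "\<forall>\<^sub>F N in sequentially. discrete_TGV \<alpha>0 \<alpha>1 \<nu> nK \<xi> nL \<eta> N (U N) \<le>
       ennreal (\<alpha>1 * (LINT x|torus. norm (GA x)) + \<alpha>0 * (LINT x|torus. sym_norm (GB x)) + e)"
      using eventually_ge_at_top[of 1]
    proof eventually_elim
      case (elim N)
      show ?case by (rule order_trans[OF TE[OF elim(2)]]) (use elim(1) in \<open>intro ennreal_leI, simp\<close>)
    qed
  qed (rule app)
qed

text \<open>The limits \<open>GA\<close> and \<open>symm3 (GB x)\<close> of the discrete fields are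
  the values of the distributions Du - w and Ew on the translate of \<rho> to \<open>x\<close>.
  Hence their L1 norms are at most the masses of the two variation measures on the cell.\<close>

lemma mollified_recovery:
  fixes \<alpha>0 \<alpha>1 :: real and \<xi> :: "3 kernels" and \<eta> :: "2 kernels"
  assumes \<alpha>: "\<alpha>0 > 0" "\<alpha>1 > 0" and n: "nK \<ge> 1" "nL \<ge> 1"
    and \<xi>: "normalized_kernels \<nu> nK \<xi>" and \<eta>: "normalized_kernels \<nu> nL \<eta>"
    and u: "locally_integrable u"
    and v: "periodic v" and l: "loc_int (\<lambda>x. q \<bullet> x + v x)"
    and eq: "AE x in lebesgue. u x = q \<bullet> x + v x"
    and \<rho>: "mollifier \<delta> \<rho>" and e: "e > 0"
  obtains U where "\<And>N. N \<ge> 1 \<Longrightarrow> discrete_affine_plus_periodic N (U N)" "approx U (corr \<rho> (\<lambda>x. q \<bullet> x + v x))"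
    "\<forall>\<^sub>F N in sequentially. discrete_TGV \<alpha>0 \<alpha>1 \<nu> nK \<xi> nL \<eta> N (U N) \<le> TGV \<alpha>0 \<alpha>1 u + ennreal e"
proof (cases "TGV \<alpha>0 \<alpha>1 u < \<infinity>")
  case False
  then have "TGV \<alpha>0 \<alpha>1 u = \<top>" by (simp add: less_top[symmetric])
  \<comment> \<open>With an infinite right-hand side any convergent sequence serves; the
    construction is run with the zero field.\<close>
  then have top: "T \<le> TGV \<alpha>0 \<alpha>1 u + ennreal e" for T by simp
  have w: "periodic (\<lambda>x. 0 :: real^2)" by (simp add: periodic_def)
  show thesis
  proof (rule recovery_core[OF \<alpha> n \<xi> \<eta> v l w _ _ \<rho>])
    fix U assume "\<And>N. 1 \<le> N \<Longrightarrow> discrete_affine_plus_periodic N (U N)" "approx U (corr \<rho> (\<lambda>x. q \<bullet> x + v x))"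
    then show thesis by (rule that) (simp_all add: top)
  qed simp_all
next
  case True
  have \<rho>': "ctest \<delta> \<rho>" "test_function \<rho>" using \<rho> by (auto simp: mollifier_def)
  \<comment> \<open>Half of \<open>e\<close> pays for near-optimality of the chosen field, the other
    half for the discretisation. Strictness requires the finite value assumed in this case.\<close>
  from True e have "TGV \<alpha>0 \<alpha>1 u < TGV \<alpha>0 \<alpha>1 u + ennreal (e / 2)"
    by (cases "TGV \<alpha>0 \<alpha>1 u") (auto simp: ennreal_plus[symmetric] ennreal_less_iff simp del: ennreal_plus)
  then obtain A B W where W: "locally_integrable W" "periodic_ae W"
    and A: "is_measure_with_variation (\<lambda>\<phi>. distr_grad u \<phi> - distr_of_fun W \<phi>) A"
    and B: "is_measure_with_variation (distr_sym_grad W) B"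
    and AB: "ennreal \<alpha>1 * emeasure A period_cell + ennreal \<alpha>0 * emeasure B period_cell < TGV \<alpha>0 \<alpha>1 u + ennreal (e / 2)"
    unfolding TGV_def Inf_less_iff by blast
  obtain w where w: "periodic w" "w \<in> borel_measurable borel" "integrable torus w" and Ww: "AE x in lebesgue. W x = w x"
    using periodic_ae_representative[OF W] by metis
  define uf where "uf x = q \<bullet> x + v x" for x
  have luf: "loc_int uf" using l by (simp add: uf_def[abs_def])
  have lw: "loc_int w" using w by (rule loc_int_periodic)
  have lwa: "loc_int (\<lambda>x. w x $ a)" for a using lw by (rule loc_int_nth)
  have pwa: "periodic (\<lambda>x. w x $ a)" for a using w(1) by (simp add: periodic_def)
  have lWa: "locally_integrable (\<lambda>x. W x $ a)" for a
    unfolding locally_integrable_def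
  proof (intro allI impI)
    fix K :: "(real^2) set" assume "compact K"
    then have "W absolutely_integrable_on K" using W(1) by (simp add: locally_integrable_def)
    from absolutely_integrable_linear[OF this bounded_linear_vec_nth[of a]]
    show "(\<lambda>x. W x $ a) absolutely_integrable_on K" by (simp add: o_def)
  qed
  have Wwa: "AE x in lebesgue. W x $ a = w x $ a" for a using Ww by eventually_elim simp
  have comp: "(distr_grad u \<phi> - distr_of_fun W \<phi>) $ a = - pair (pderiv_dir a \<phi>) uf - pair \<phi> (\<lambda>y. w y $ a)"
    if \<phi>: "test_function \<phi>" for \<phi> a
  proof -
    obtain R where R: "ctest R \<phi>" using test_function_ctest[OF \<phi>] by metis
    show ?thesis
      using distr_grad_borel[OF u luf _ \<phi>] eq ctest_nth_integral[OF R lw]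
        lebesgue_test_integral[OF W(1) lw Ww \<phi>]
      by (simp add: distr_of_fun_def uf_def)
  qed
  have Ecomp: "distr_grad (\<lambda>x. W x $ a) \<phi> $ b = - pair (pderiv_dir b \<phi>) (\<lambda>y. w y $ a)"
    if \<phi>: "test_function \<phi>" for \<phi> a b
    by (rule distr_grad_borel[OF lWa lwa Wwa \<phi>])
  have sh: "(LINT y|lborel. \<psi> (y + lat k) * w y $ a) = pair \<psi> (\<lambda>y. w y $ a)"
    if "\<psi> \<in> borel_measurable borel" for \<psi> k a
    using periodicD[OF periodic_corr[OF pwa[of a] loc_int_measurable[OF lwa[of a]] that], of 0 "- k"]
    by (simp add: corr_def lat_uminus)
  have invA: "lat_invariant A"
  proof (rule variation_lat_invariant[OF A])
    fix \<phi> k assume \<phi>: "test_function \<phi>"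
    obtain R where R: "ctest R \<phi>" using test_function_ctest[OF \<phi>] by metis
    have \<phi>': "test_function (\<lambda>x. \<phi> (x + lat k))" using \<phi> by (rule test_function_shift)
    \<comment> \<open>Although \<open>u\<close> itself is not periodic, its gradient is: derivatives
      of test functions have integral zero and do not see the added constant.\<close>
    have "(LINT y|lborel. pderiv_dir a \<phi> (y + lat k) * uf y) = pair (pderiv_dir a \<phi>) uf" for a
      using corr_affine_shift[OF v l pderiv_ctest[OF \<phi> R, of a], of 0 "- k"] integral_pderiv_eq_0[OF \<phi>, of a]
      by (simp add: corr_def lat_uminus uf_def)
    moreover have "pderiv_dir a (\<lambda>x. \<phi> (x + lat k)) y = pderiv_dir a \<phi> (y + lat k)" for a y
      using pderiv_dir_translate[OF \<phi>, of a "- lat k" y] by simp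
    ultimately show "distr_grad u (\<lambda>x. \<phi> (x + lat k)) - distr_of_fun W (\<lambda>x. \<phi> (x + lat k)) = distr_grad u \<phi> - distr_of_fun W \<phi>"
      unfolding vec_eq_iff comp[OF \<phi>] comp[OF \<phi>'] using sh[OF ctest_measurable[OF R]] by simp
  qed
  have invB: "lat_invariant B"
  proof (rule variation_lat_invariant[OF B])
    fix \<phi> k assume \<phi>: "test_function \<phi>"
    obtain R where R: "ctest R \<phi>" using test_function_ctest[OF \<phi>] by metis
    have \<phi>': "test_function (\<lambda>x. \<phi> (x + lat k))" using \<phi> by (rule test_function_shift)
    have "pderiv_dir a (\<lambda>x. \<phi> (x + lat k)) y = pderiv_dir a \<phi> (y + lat k)" for a y
      using pderiv_dir_translate[OF \<phi>, of a "- lat k" y] by simp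
    then show "distr_sym_grad W (\<lambda>x. \<phi> (x + lat k)) = distr_sym_grad W \<phi>"
      unfolding distr_sym_grad_def Ecomp[OF \<phi>] Ecomp[OF \<phi>'] using sh[OF ctest_measurable[OF pderiv_ctest[OF \<phi> R]]] by simp
  qed
  define GA where "GA x = (\<chi> a. - corr (pderiv_dir a \<rho>) uf x - corr \<rho> (\<lambda>x. w x $ a) x)" for x
  define X where "X a b x = - corr (pderiv_dir b \<rho>) (\<lambda>x. w x $ a) x" for a b x
  define GB :: "real^2 \<Rightarrow> real^3" where "GB x = vector [X 1 1 x, (X 1 2 x + X 2 1 x) / 2, X 2 2 x]" for x
  note \<rho>t = test_function_translate[OF \<rho>'(2)]
  have GA: "distr_grad u (\<lambda>y. \<rho> (y - x)) - distr_of_fun W (\<lambda>y. \<rho> (y - x)) = GA x" for x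
    unfolding vec_eq_iff comp[OF \<rho>t] by (simp add: GA_def corr_def pderiv_dir_translate[OF \<rho>'(2)])
  have GB: "distr_sym_grad W (\<lambda>y. \<rho> (y - x)) = symm3 (GB x)" for x
    unfolding distr_sym_grad_def Ecomp[OF \<rho>t]
    by (simp add: vec_eq_iff forall_2 GB_def X_def corr_def pderiv_dir_translate[OF \<rho>'(2)])
  obtain U where U: "\<And>N. N \<ge> 1 \<Longrightarrow> discrete_affine_plus_periodic N (U N)" "approx U (corr \<rho> uf)"
    "integrable torus (\<lambda>x. norm (GA x))" "integrable torus (\<lambda>x. sym_norm (GB x))"
    "\<And>e. e > 0 \<Longrightarrow> \<forall>\<^sub>F N in sequentially. discrete_TGV \<alpha>0 \<alpha>1 \<nu> nK \<xi> nL \<eta> N (U N) \<le>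
       ennreal (\<alpha>1 * (LINT x|torus. norm (GA x)) + \<alpha>0 * (LINT x|torus. sym_norm (GB x)) + e)"
    by (rule recovery_core[OF \<alpha> n \<xi> \<eta> v l w \<rho>, folded uf_def[abs_def], folded GA_def, folded X_def, folded GB_def])
      (rule that; assumption)
  define IA IB where "IA = (LINT x|torus. norm (GA x))" and "IB = (LINT x|torus. sym_norm (GB x))"
  have snn: "0 \<le> sym_norm p" for p by (simp add: sym_norm_def)
  have nn: "0 \<le> IA" "0 \<le> IB" unfolding IA_def IB_def by (auto simp: snn)
  have "ennreal IA \<le> emeasure A period_cell"
    using variation_mollify[OF A invA \<rho>] nn_integral_eq_integral[OF U(3)] by (simp add: GA IA_def)
  moreover have "ennreal IB \<le> emeasure B period_cell"
    using variation_mollify[OF B invB \<rho>] nn_integral_eq_integral[OF U(4)] by (simp add: GB IB_def norm_symm3 snn)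
  ultimately have "ennreal \<alpha>1 * ennreal IA + ennreal \<alpha>0 * ennreal IB \<le>
      ennreal \<alpha>1 * emeasure A period_cell + ennreal \<alpha>0 * emeasure B period_cell"
    by (intro add_mono mult_left_mono) auto
  then have le: "ennreal (\<alpha>1 * IA + \<alpha>0 * IB) \<le> TGV \<alpha>0 \<alpha>1 u + ennreal (e / 2)"
    using AB \<alpha> nn by (simp add: ennreal_mult)
  have "ennreal (\<alpha>1 * IA + \<alpha>0 * IB + e / 2) = ennreal (\<alpha>1 * IA + \<alpha>0 * IB) + ennreal (e / 2)"
    using \<alpha> nn e by (intro ennreal_plus) auto
  also have "\<dots> \<le> TGV \<alpha>0 \<alpha>1 u + ennreal (e / 2) + ennreal (e / 2)" by (intro add_mono le) simp
  also have "\<dots> = TGV \<alpha>0 \<alpha>1 u + ennreal e" using e by (simp add: add.assoc ennreal_plus[symmetric] del: ennreal_plus)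
  finally have fin: "ennreal (\<alpha>1 * IA + \<alpha>0 * IB + e / 2) \<le> TGV \<alpha>0 \<alpha>1 u + ennreal e" .
  have "\<forall>\<^sub>F N in sequentially. discrete_TGV \<alpha>0 \<alpha>1 \<nu> nK \<xi> nL \<eta> N (U N) \<le> TGV \<alpha>0 \<alpha>1 u + ennreal e"
    using U(5)[of "e / 2"] e fin unfolding IA_def IB_def by (auto elim!: eventually_mono)
  then show thesis using that[of U] U(1,2) by (simp add: uf_def[abs_def])
qed

section \<open>Local L1 errors and the diagonal sequence\<close>

lemma mollify_local_L1:
  fixes v :: "real^2 \<Rightarrow> real"
  assumes v: "periodic v" "v \<in> borel_measurable borel" "integrable torus v"
    and l: "loc_int (\<lambda>x. q \<bullet> x + v x)" and e: "e > 0"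
  obtains \<delta> \<rho> where "mollifier \<delta> \<rho>"
    "lnorm R (\<lambda>x. corr \<rho> (\<lambda>x. q \<bullet> x + v x) x - (q \<bullet> x + v x)) \<le> e"
proof -
  define \<mu> where "\<mu> = measure lborel (cball 0 R :: (real^2) set)"
  obtain B where B: "B \<ge> 0" "\<And>V :: real^2 \<Rightarrow> real. periodic V \<Longrightarrow> V \<in> borel_measurable borel \<Longrightarrow> integrable torus V \<Longrightarrow>
     integrable lborel (\<lambda>x. indicator (cball 0 R) x *\<^sub>R V x) \<and>
     (LINT x|lborel. indicator (cball 0 R) x * norm (V x)) \<le> B * (LINT x|torus. norm (V x))"
    by (rule periodic_loc_bound[of R]) blast
  \<comment> \<open>The affine part moves by at most \<open>norm q\<close> times the radius, which
    \<open>d1\<close> controls on the ball. The periodic part is estimated on the torus within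
    \<open>d2\<close>, valid for radii up to \<open>d3\<close>, and carried to the ball by the
    factor \<open>B\<close>.\<close>
  obtain d1 where d1: "d1 > 0" "d1 * (norm q * \<mu>) \<le> e / 2"
    using small_factor[of "e / 2" "norm q * \<mu>"] e by (auto simp: \<mu>_def)
  obtain d2 where d2: "d2 > 0" "d2 * B \<le> e / 2" using small_factor[of "e / 2" B] e B(1) by auto
  obtain d3 where d3: "d3 > 0" "\<And>\<rho> \<delta>'. mollifier \<delta>' \<rho> \<Longrightarrow> \<delta>' \<le> d3 \<Longrightarrow> (LINT x|torus. \<bar>corr \<rho> v x - v x\<bar>) \<le> d2"
    using mollify_torus_L1[OF v d2(1)] by metis
  define \<delta> where "\<delta> = min d1 d3"
  have \<delta>: "\<delta> > 0" "\<delta> \<le> d1" "\<delta> \<le> d3" using d1 d3 by (auto simp: \<delta>_def)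
  obtain \<rho> where \<rho>: "mollifier \<delta> \<rho>" using mollifier_exists[OF \<delta>(1)] by metis
  have \<rho>': "ctest \<delta> \<rho>" "test_function \<rho>" using \<rho> by (auto simp: mollifier_def)
  have lv: "loc_int v" using v by (rule loc_int_periodic)
  have cq: "continuous_on UNIV (\<lambda>x::real^2. q \<bullet> x)" by (intro continuous_intros)
  have lq: "loc_int (\<lambda>x. q \<bullet> x)" using cq by (rule loc_int_continuous)
  have split: "corr \<rho> (\<lambda>x. q \<bullet> x + v x) x = corr \<rho> (\<lambda>x. q \<bullet> x) x + corr \<rho> v x" for x
    using ctest_shift_integrable[OF \<rho>'(1) lq] ctest_shift_integrable[OF \<rho>'(1) lv] by (simp add: corr_def distrib_left)
  have lin: "\<bar>corr \<rho> (\<lambda>x. q \<bullet> x) x - q \<bullet> x\<bar> \<le> norm q * d1" for x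
  proof (rule mollifier_avg_bound[OF \<rho> cq])
    fix y :: "real^2" assume y: "norm y \<le> \<delta>"
    have "\<bar>q \<bullet> y\<bar> \<le> norm q * norm y" by (rule Cauchy_Schwarz_ineq2)
    also have "\<dots> \<le> norm q * d1" using y \<delta>(2) by (intro mult_left_mono) auto
    finally show "\<bar>q \<bullet> (y + x) - q \<bullet> x\<bar> \<le> norm q * d1" by (simp add: inner_add_right)
  qed
  define D where "D x = corr \<rho> v x - v x" for x
  have cv: "continuous_on UNIV (corr \<rho> v)" by (rule corr_continuous[OF \<rho>'(2) lv])
  have D: "periodic D" "D \<in> borel_measurable borel" "integrable torus D"
  proof -
    show "periodic D"
      using periodicD[OF periodic_corr[OF v(1,2) ctest_measurable[OF \<rho>'(1)]]] periodicD[OF v(1)] by (simp add: periodic_def D_def)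
    show "D \<in> borel_measurable borel"
      unfolding D_def[abs_def] using borel_measurable_continuous_onI[OF cv] v(2) by measurable
    show "integrable torus D" unfolding D_def[abs_def] using torus_L1_corr(1)[OF \<rho> v] v(3) by simp
  qed
  have "integrable lborel (\<lambda>x. indicator (cball 0 R) x * \<bar>D x\<bar>)"
    by (rule integrable_cball_abs[OF loc_int_periodic[OF D]])
  moreover have ic: "integrable lborel (\<lambda>x::real^2. indicator (cball 0 R) x * (norm q * d1))"
    using emeasure_lborel_cball_finite by (intro integrable_mult_left integrable_real_indicator) auto
  ultimately have i: "integrable lborel (\<lambda>x. indicator (cball 0 R) x * (norm q * d1) + indicator (cball 0 R) x * \<bar>D x\<bar>)" by simp
  have "lnorm R (\<lambda>x. corr \<rho> (\<lambda>x. q \<bullet> x + v x) x - (q \<bullet> x + v x))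
      \<le> (LINT x|lborel. indicator (cball 0 R) x * (norm q * d1) + indicator (cball 0 R) x * \<bar>D x\<bar>)"
  proof (rule integral_mono'[OF i])
    fix x
    have "\<bar>corr \<rho> (\<lambda>x. q \<bullet> x + v x) x - (q \<bullet> x + v x)\<bar> \<le> norm q * d1 + \<bar>D x\<bar>"
      unfolding split D_def using lin[of x] by linarith
    then show "indicator (cball 0 R) x * \<bar>corr \<rho> (\<lambda>x. q \<bullet> x + v x) x - (q \<bullet> x + v x)\<bar>
       \<le> indicator (cball 0 R) x * (norm q * d1) + indicator (cball 0 R) x * \<bar>D x\<bar>"
      by (simp add: indicator_def)
  qed (use d1 in auto)
  also have "\<dots> = (LINT x|lborel. indicator (cball (0 :: real^2) R) x * (norm q * d1)) + lnorm R D"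
    using i ic by (intro Bochner_Integration.integral_add) (auto intro: integrable_cball_abs[OF loc_int_periodic[OF D]])
  also have "\<dots> \<le> e / 2 + e / 2"
  proof (rule add_mono)
    show "(LINT x|lborel. indicator (cball (0 :: real^2) R) x * (norm q * d1)) \<le> e / 2"
      using d1(2) by (simp add: \<mu>_def ac_simps)
    have "lnorm R D \<le> B * (LINT x|torus. \<bar>D x\<bar>)" using B(2)[OF D] by simp
    also have "\<dots> \<le> B * d2" using d3(2)[OF \<rho> \<delta>(3)] B(1) by (intro mult_left_mono) (auto simp: D_def)
    finally show "lnorm R D \<le> e / 2" using d2 by (simp add: mult.commute)
  qed
  finally show thesis using that[OF \<rho>] by simp
qed

lemma approx_pix_local_L1:
  assumes a: "approx g G" and c: "continuous_on UNIV G" and f: "loc_int f" and e: "e > 0"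
    and G: "lnorm R (\<lambda>x. G x - f x) \<le> e / 2"
  shows "\<forall>\<^sub>F N in sequentially. (lnorm R (\<lambda>x. pix N (g N) x - f x)) \<le> e"
proof -
  obtain d where d: "d > 0" "d * measure lborel (cball 0 R :: (real^2) set) \<le> e / 2"
    using small_factor[of "e / 2" "measure lborel (cball 0 R :: (real^2) set)"] e by auto
  have lG: "loc_int (\<lambda>x. G x - f x)" by (rule loc_int_diff[OF loc_int_continuous[OF c] f])
  have ic: "integrable lborel (\<lambda>x::real^2. indicator (cball 0 R) x * d)"
    using emeasure_lborel_cball_finite by (intro integrable_mult_left integrable_real_indicator) auto
  show ?thesis using approx_pix[OF a c d(1), of R]
  proof eventually_elim
    case (elim N)
    have "lnorm R (\<lambda>x. pix N (g N) x - f x)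
        \<le> (LINT x|lborel. indicator (cball 0 R) x * d + indicator (cball 0 R) x * \<bar>G x - f x\<bar>)"
    proof (rule integral_mono')
      show "integrable lborel (\<lambda>x. indicator (cball 0 R) x * d + indicator (cball 0 R) x * \<bar>G x - f x\<bar>)"
        using ic integrable_cball_abs[OF lG] by simp
      fix x
      show "indicator (cball 0 R) x * \<bar>pix N (g N) x - f x\<bar> \<le> indicator (cball 0 R) x * d + indicator (cball 0 R) x * \<bar>G x - f x\<bar>"
        using elim[rule_format, of x] by (auto simp: indicator_def)
    qed (use d in auto)
    also have "\<dots> = d * measure lborel (cball 0 R :: (real^2) set) + lnorm R (\<lambda>x. G x - f x)"
      using ic integrable_cball_abs[OF lG] by simp
    finally show ?case using d(2) G by simp
  qed
qed

text \<open>\<kappa> N is the largest k \<le> N whose threshold \<open>m k\<close> has been reached.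
  If there is none the value is 0, so the property is claimed only from \<open>m 0\<close> on; the
  restriction k \<le> N keeps the set finite.\<close>

lemma diagonal_selection:
  fixes P :: "nat \<Rightarrow> nat \<Rightarrow> bool"
  assumes "\<And>k. \<forall>\<^sub>F N in sequentially. P k N"
  obtains \<kappa> where "filterlim \<kappa> at_top sequentially" "\<forall>\<^sub>F N in sequentially. P (\<kappa> N) N"
proof -
  obtain m where m: "\<And>k N. m k \<le> N \<Longrightarrow> P k N" using assms unfolding eventually_sequentially by metis
  define S where "S N = {k. k \<le> N \<and> m k \<le> N}" for N
  define \<kappa> where "\<kappa> N = Max (insert 0 (S N))" for N
  have fin: "finite (insert 0 (S N))" for N by (simp add: S_def)
  have "filterlim \<kappa> at_top sequentially"
    unfolding filterlim_at_top
  proof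
    fix k
    show "\<forall>\<^sub>F N in sequentially. k \<le> \<kappa> N"
      using eventually_ge_at_top[of "max k (m k)"]
    proof eventually_elim
      case (elim N)
      then show ?case unfolding \<kappa>_def by (intro Max_ge fin) (simp add: S_def)
    qed
  qed
  moreover have "\<forall>\<^sub>F N in sequentially. P (\<kappa> N) N"
    using eventually_ge_at_top[of "m 0"]
  proof eventually_elim
    case (elim N)
    have "\<kappa> N \<in> insert 0 (S N)" unfolding \<kappa>_def by (intro Max_in fin) simp
    then show ?case using elim by (auto intro!: m simp: S_def)
  qed
  ultimately show thesis using that by blast
qed

lemma images_converge_intro:
  assumes u: "locally_integrable u" and f: "loc_int f" and eq: "AE x in lebesgue. u x = f x"
    and lim: "\<And>R. (\<lambda>N. lnorm R (\<lambda>x. pix N (uh N) x - f x)) \<longlonglongrightarrow> 0"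
  shows "images_converge uh u"
  unfolding images_converge_def pixel_fun_pix
proof (intro allI impI)
  fix K :: "(real^2) set" assume K: "compact K"
  obtain R where R: "K \<subseteq> cball 0 R" using bounded_subset_ballD[OF compact_imp_bounded[OF K], of 0] ball_subset_cball by blast
  have bound: "(LINT x:K|lebesgue. \<bar>pix N (uh N) x - u x\<bar>) \<le> lnorm R (\<lambda>x. pix N (uh N) x - f x)" for N
  proof -
    have "locally_integrable (\<lambda>x. pix N (uh N) x - u x)"
      using u loc_int_locally_integrable[OF loc_int_pix[of N "uh N"]] unfolding locally_integrable_def
      by (auto intro: set_integral_diff(1))
    then have "(\<lambda>x. \<bar>pix N (uh N) x - u x\<bar>) absolutely_integrable_on cball 0 R"
      unfolding locally_integrable_def by (intro set_integrable_abs) simp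
    then have "(LINT x:K|lebesgue. \<bar>pix N (uh N) x - u x\<bar>) \<le> (LINT x:cball 0 R|lebesgue. \<bar>pix N (uh N) x - u x\<bar>)"
      unfolding set_lebesgue_integral_def set_integrable_def
      by (rule integral_mono') (use R in \<open>auto simp: indicator_def\<close>)
    then show ?thesis by (simp add: set_integral_abs_diff[OF loc_int_pix u f eq])
  qed
  show "(\<lambda>N. LINT x:K|lebesgue. \<bar>pix N (uh N) x - u x\<bar>) \<longlonglongrightarrow> 0"
  proof (rule real_tendsto_sandwich[OF _ _ tendsto_const lim[of R]])
    show "\<forall>\<^sub>F N in sequentially. 0 \<le> (LINT x:K|lebesgue. \<bar>pix N (uh N) x - u x\<bar>)"
      unfolding set_lebesgue_integral_def by (intro always_eventually allI integral_nonneg_AE) auto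
  qed (use bound in simp)
qed

text \<open>For each \<open>k\<close> the error is measured on the ball of radius \<open>k\<close>
  with tolerance 1 / (k + 1), so one diagonal index enlarges the ball and tightens both estimates at
  the same time.\<close>

lemma recovery_sequence:
  fixes \<alpha>0 \<alpha>1 :: real and \<xi> :: "3 kernels" and \<eta> :: "2 kernels"
  assumes \<alpha>: "\<alpha>0 > 0" "\<alpha>1 > 0" and n: "nK \<ge> 1" "nL \<ge> 1"
    and \<xi>: "normalized_kernels \<nu> nK \<xi>" and \<eta>: "normalized_kernels \<nu> nL \<eta>"
    and u: "affine_plus_periodic u"
  obtains uh where "\<And>N. N \<ge> 1 \<Longrightarrow> discrete_affine_plus_periodic N (uh N)" "images_converge uh u"
    "limsup (\<lambda>N. discrete_TGV \<alpha>0 \<alpha>1 \<nu> nK \<xi> nL \<eta> N (uh N)) \<le> TGV \<alpha>0 \<alpha>1 u"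
proof -
  have lu: "locally_integrable u" using u by (simp add: affine_plus_periodic_def)
  obtain q v where v: "periodic v" "v \<in> borel_measurable borel" "integrable torus v"
    and l: "loc_int (\<lambda>x. q \<bullet> x + v x)" and eq: "AE x in lebesgue. u x = q \<bullet> x + v x"
    by (rule affine_plus_periodic_representative[OF u]) (rule that; assumption)
  define f where "f x = q \<bullet> x + v x" for x
  have lf: "loc_int f" using l by (simp add: f_def[abs_def])
  define Err where "Err R N g = lnorm R (\<lambda>x. pix N g x - f x)" for R :: real and N g
  define T where "T N g = discrete_TGV \<alpha>0 \<alpha>1 \<nu> nK \<xi> nL \<eta> N g" for N g
  define \<epsilon> where "\<epsilon> k = 1 / (real k + 1)" for k :: nat
  have \<epsilon>: "\<epsilon> k > 0" for k by (simp add: \<epsilon>_def)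
  have "\<exists>U. (\<forall>N\<ge>1. discrete_affine_plus_periodic N (U N)) \<and>
      (\<forall>\<^sub>F N in sequentially. Err (real k) N (U N) \<le> \<epsilon> k \<and> T N (U N) \<le> TGV \<alpha>0 \<alpha>1 u + ennreal (\<epsilon> k))" for k
  proof -
    obtain \<delta> \<rho> where \<rho>: "mollifier \<delta> \<rho>"
      "lnorm (real k) (\<lambda>x. corr \<rho> f x - f x) \<le> \<epsilon> k / 2"
      using mollify_local_L1[OF v l, of "\<epsilon> k / 2" "real k"] \<epsilon>[of k] unfolding f_def[abs_def] by auto
    obtain U where U: "\<And>N. N \<ge> 1 \<Longrightarrow> discrete_affine_plus_periodic N (U N)" "approx U (corr \<rho> f)"
      "\<forall>\<^sub>F N in sequentially. T N (U N) \<le> TGV \<alpha>0 \<alpha>1 u + ennreal (\<epsilon> k)"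
      by (rule mollified_recovery[OF \<alpha> n \<xi> \<eta> lu v(1) l eq \<rho>(1) \<epsilon>[of k], folded f_def[abs_def] T_def]) (rule that; assumption)
    have c: "continuous_on UNIV (corr \<rho> f)"
      using \<rho>(1) lf by (intro corr_continuous) (auto simp: mollifier_def)
    have "\<forall>\<^sub>F N in sequentially. Err (real k) N (U N) \<le> \<epsilon> k"
      unfolding Err_def by (rule approx_pix_local_L1[OF U(2) c lf \<epsilon> \<rho>(2)])
    with U(3) have "\<forall>\<^sub>F N in sequentially. Err (real k) N (U N) \<le> \<epsilon> k \<and> T N (U N) \<le> TGV \<alpha>0 \<alpha>1 u + ennreal (\<epsilon> k)"
      by eventually_elim simp
    then show ?thesis using U(1) by blast
  qed
  then have "\<exists>U. \<forall>k. (\<forall>N\<ge>1. discrete_affine_plus_periodic N (U k N)) \<and>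
      (\<forall>\<^sub>F N in sequentially. Err (real k) N (U k N) \<le> \<epsilon> k \<and> T N (U k N) \<le> TGV \<alpha>0 \<alpha>1 u + ennreal (\<epsilon> k))"
    by (rule choice[OF allI])
  then obtain U where U': "\<forall>k. (\<forall>N\<ge>1. discrete_affine_plus_periodic N (U k N)) \<and>
      (\<forall>\<^sub>F N in sequentially. Err (real k) N (U k N) \<le> \<epsilon> k \<and> T N (U k N) \<le> TGV \<alpha>0 \<alpha>1 u + ennreal (\<epsilon> k))"
    by (rule exE)
  have U: "\<And>k N. N \<ge> 1 \<Longrightarrow> discrete_affine_plus_periodic N (U k N)"
    "\<And>k. \<forall>\<^sub>F N in sequentially. Err (real k) N (U k N) \<le> \<epsilon> k \<and> T N (U k N) \<le> TGV \<alpha>0 \<alpha>1 u + ennreal (\<epsilon> k)"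
    using U' by simp_all
  obtain \<kappa> where \<kappa>: "filterlim \<kappa> at_top sequentially"
    and ev: "\<forall>\<^sub>F N in sequentially. Err (real (\<kappa> N)) N (U (\<kappa> N) N) \<le> \<epsilon> (\<kappa> N) \<and> T N (U (\<kappa> N) N) \<le> TGV \<alpha>0 \<alpha>1 u + ennreal (\<epsilon> (\<kappa> N))"
    by (rule diagonal_selection[OF U(2)]) (rule that; assumption)
  have "\<epsilon> \<longlonglongrightarrow> 0" unfolding \<epsilon>_def[abs_def] by real_asymp
  then have \<epsilon>\<kappa>: "(\<lambda>N. \<epsilon> (\<kappa> N)) \<longlonglongrightarrow> 0" using \<kappa> by (rule filterlim_compose)
  define uh where "uh N = U (\<kappa> N) N" for N
  have mono: "Err R N g \<le> Err R' N g" if "R \<le> R'" for R R' N g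
    unfolding Err_def
  proof (rule integral_mono')
    show "integrable lborel (\<lambda>x. indicator (cball 0 R') x * \<bar>pix N g x - f x\<bar>)"
      by (rule integrable_cball_abs[OF loc_int_diff[OF loc_int_pix lf]])
  qed (use that in \<open>auto simp: indicator_def\<close>)
  show thesis
  proof (rule that[of uh])
    show "discrete_affine_plus_periodic N (uh N)" if "N \<ge> 1" for N using U(1)[OF that] by (simp add: uh_def)
    show "images_converge uh u"
    proof (rule images_converge_intro[OF lu lf])
      show "AE x in lebesgue. u x = f x" using eq by (simp add: f_def)
      fix R
      have "(\<lambda>N. Err R N (uh N)) \<longlonglongrightarrow> 0"
      proof (rule real_tendsto_sandwich[OF _ _ tendsto_const \<epsilon>\<kappa>])
        show "\<forall>\<^sub>F N in sequentially. 0 \<le> Err R N (uh N)" by (simp add: Err_def)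
        have "\<forall>\<^sub>F N in sequentially. nat \<lceil>R\<rceil> \<le> \<kappa> N" using \<kappa> unfolding filterlim_at_top by blast
        then show "\<forall>\<^sub>F N in sequentially. Err R N (uh N) \<le> \<epsilon> (\<kappa> N)" using ev
        proof eventually_elim
          case (elim N)
          have "R \<le> real (\<kappa> N)" using elim(1) by linarith
          from mono[OF this, of N "uh N"] elim(2) show ?case by (simp add: uh_def)
        qed
      qed
      then show "(\<lambda>N. lnorm R (\<lambda>x. pix N (uh N) x - f x)) \<longlonglongrightarrow> 0" by (simp add: Err_def)
    qed
    show "limsup (\<lambda>N. discrete_TGV \<alpha>0 \<alpha>1 \<nu> nK \<xi> nL \<eta> N (uh N)) \<le> TGV \<alpha>0 \<alpha>1 u"
    proof (rule ennreal_le_epsilon)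
      fix e :: real assume e: "e > 0"
      have "\<forall>\<^sub>F N in sequentially. \<epsilon> (\<kappa> N) < e" by (rule order_tendstoD(2)[OF \<epsilon>\<kappa> e])
      with ev have "\<forall>\<^sub>F N in sequentially. discrete_TGV \<alpha>0 \<alpha>1 \<nu> nK \<xi> nL \<eta> N (uh N) \<le> TGV \<alpha>0 \<alpha>1 u + ennreal e"
      proof eventually_elim
        case (elim N)
        have "T N (U (\<kappa> N) N) \<le> TGV \<alpha>0 \<alpha>1 u + ennreal (\<epsilon> (\<kappa> N))" using elim by simp
        also have "\<dots> \<le> TGV \<alpha>0 \<alpha>1 u + ennreal e" using elim by (intro add_left_mono ennreal_leI) simp
        finally show ?case by (simp add: T_def uh_def)
      qed
      then show "limsup (\<lambda>N. discrete_TGV \<alpha>0 \<alpha>1 \<nu> nK \<xi> nL \<eta> N (uh N)) \<le> TGV \<alpha>0 \<alpha>1 u + ennreal e"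
        by (rule Limsup_bounded)
    qed
  qed
qed

theorem theorem1:
  fixes \<alpha>\<^sub>0 \<alpha>\<^sub>1 :: real and n\<^sub>K n\<^sub>L \<nu> :: nat
    and \<xi> :: "3 kernels" and \<eta> :: "2 kernels"
    and u :: "real^2 \<Rightarrow> real"
  assumes "\<alpha>\<^sub>0 > 0" "\<alpha>\<^sub>1 > 0" "n\<^sub>K \<ge> 1" "n\<^sub>L \<ge> 1"
    and "normalized_kernels \<nu> n\<^sub>K \<xi>" "normalized_kernels \<nu> n\<^sub>L \<eta>"
    and "affine_plus_periodic u"
  shows "(\<forall>uh. (\<forall>N\<ge>1. discrete_affine_plus_periodic N (uh N)) \<and> images_converge uh u \<longrightarrow>
            TGV \<alpha>\<^sub>0 \<alpha>\<^sub>1 u \<le> liminf (\<lambda>N. discrete_TGV \<alpha>\<^sub>0 \<alpha>\<^sub>1 \<nu> n\<^sub>K \<xi> n\<^sub>L \<eta> N (uh N))) \<and>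
         (\<exists>uh. (\<forall>N\<ge>1. discrete_affine_plus_periodic N (uh N)) \<and> images_converge uh u \<and>
            limsup (\<lambda>N. discrete_TGV \<alpha>\<^sub>0 \<alpha>\<^sub>1 \<nu> n\<^sub>K \<xi> n\<^sub>L \<eta> N (uh N)) \<le> TGV \<alpha>\<^sub>0 \<alpha>\<^sub>1 u)"
proof (intro conjI allI impI)
  fix uh assume "(\<forall>N\<ge>1. discrete_affine_plus_periodic N (uh N)) \<and> images_converge uh u"
  then show "TGV \<alpha>\<^sub>0 \<alpha>\<^sub>1 u \<le> liminf (\<lambda>N. discrete_TGV \<alpha>\<^sub>0 \<alpha>\<^sub>1 \<nu> n\<^sub>K \<xi> n\<^sub>L \<eta> N (uh N))"
    using assms(7) by (intro lower_bound[OF assms(1,2,5,6)]) (auto simp: affine_plus_periodic_def)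
next
  obtain uh where "\<And>N. N \<ge> 1 \<Longrightarrow> discrete_affine_plus_periodic N (uh N)" "images_converge uh u"
    "limsup (\<lambda>N. discrete_TGV \<alpha>\<^sub>0 \<alpha>\<^sub>1 \<nu> n\<^sub>K \<xi> n\<^sub>L \<eta> N (uh N)) \<le> TGV \<alpha>\<^sub>0 \<alpha>\<^sub>1 u"
    by (rule recovery_sequence[OF assms]) (rule that; assumption)
  then show "\<exists>uh. (\<forall>N\<ge>1. discrete_affine_plus_periodic N (uh N)) \<and> images_converge uh u \<and>
      limsup (\<lambda>N. discrete_TGV \<alpha>\<^sub>0 \<alpha>\<^sub>1 \<nu> n\<^sub>K \<xi> n\<^sub>L \<eta> N (uh N)) \<le> TGV \<alpha>\<^sub>0 \<alpha>\<^sub>1 u" by blast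
qed

end
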